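(* Let $d\ge 1$, let $A$ be a (possibly unbounded) self-adjoint operator on a Hilbert space $\mathcal H$, and let $\mathbf B$ be an injective operator from $\mathbb C^d$ to $\mathcal H$ (possibly unbounded, in the form-bounded sense that $(\mathbf I+|A|)^{-1/2}\mathbf B$ is bounded), such that $\operatorname{Ran}\mathbf B$ is cyclic for $A$. For each $\boldsymbol\alpha\in\mathbf H(d)$, the real vector space of $d\times d$ Hermitian matrices, let $A_{\boldsymbol\alpha}=A+\mathbf B\boldsymbol\alpha\mathbf B^*$, and let $\mu^{\boldsymbol\alpha}$ be a scalar spectral measure (of maximal type) of $A_{\boldsymbol\alpha}$. Let $\nu$ be a finite Borel measure on $\mathbb R$ that is singular with respect to Lebesgue measure. Then there is a set $E\subset\mathbf H(d)$ of Hausdorff dimension at most $\dim\mathbf H(d)-1=d^2-1$ such that $\mu^{\boldsymbol\alpha}$ and $\nu$ are mutually singular for all $\boldsymbol\alpha\in\mathbf H(d)\setminus E$.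
   Context: $\mathbf H(d)$ is identified with $\mathbb R^{d^2}$ (any Euclidean norm) for the purposes of Hausdorff dimension. Form-bounded convention: $\mathbf B$ maps $\mathbb C^d$ linearly and injectively into the completion of $\mathcal H$ in the norm $\|(\mathbf I+|A|)^{-1/2}x\|$, so that $(\mathbf I+|A|)^{-1/2}\mathbf B:\mathbb C^d\to\mathcal H$ is a bounded injective operator; this includes the case of bounded injective $\mathbf B:\mathbb C^d\to\mathcal H$. The expressions $(A-z\mathbf I)^{-1}\mathbf B:\mathbb C^d\to\mathcal H$, its counterpart $\mathbf B^*(A-z\mathbf I)^{-1}:\mathcal H\to\mathbb C^d$, and the matrix $\mathcal F(z):=\mathbf B^*(A-z\mathbf I)^{-1}\mathbf B$ are then well defined for $z\in\mathbb C\setminus\mathbb R$. The operator $A_{\boldsymbol\alpha}=A+\mathbf B\boldsymbol\alpha\mathbf B^*$ is the self-adjoint operator with resolvent $$(A_{\boldsymbol\alpha}-z\mathbf I)^{-1}=(A-z\mathbf I)^{-1}-(A-z\mathbf I)^{-1}\mathbf B(\mathbf I+\boldsymbol\alpha\mathcal F(z))^{-1}\boldsymbol\alpha\,\mathbf B^*(A-z\mathbf I)^{-1};$$ for bounded $\mathbf B$ this is the ordinary operator sum. $\operatorname{Ran}\mathbf B$ is cyclic for $A$ means that the linear span of $\{(A-z\mathbf I)^{-1}\mathbf B e: e\in\mathbb C^d,\ z\in\mathbb C\setminus\mathbb R\}$ is dense in $\mathcal H$. A scalar spectral measure (of maximal type) of a self-adjoint operator $T$ is a ($\sigma$-finite,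 non-negative) Borel measure on $\mathbb R$ having exactly the same null sets as the projection-valued spectral measure of $T$. It is unique up to mutual absolute continuity, so the choice of representative does not affect mutual singularity with $\nu$. *)

theory Defs
  imports "HOL-Analysis.Analysis"
begin

section \<open>Complex Hilbert spaces\<close>

class complex_normed_vector = real_normed_vector +
  fixes scaleC :: "complex \<Rightarrow> 'a \<Rightarrow> 'a"  (infixr \<open>*\<^sub>C\<close> 75)
  assumes scaleC_add_right: "c *\<^sub>C (x + y) = c *\<^sub>C x + c *\<^sub>C y"
    and scaleC_add_left: "(c + d) *\<^sub>C x = c *\<^sub>C x + d *\<^sub>C x"
    and scaleC_scaleC: "c *\<^sub>C d *\<^sub>C x = (c * d) *\<^sub>C x"
    and scaleC_of_real: "complex_of_real r *\<^sub>C x = r *\<^sub>R x"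
    and norm_scaleC: "norm (c *\<^sub>C x) = cmod c * norm x"

class complex_banach = complex_normed_vector + complete_space

text \<open>The inner product is antilinear in its first and linear in its second argument.\<close>

class complex_hilbert = complex_banach +
  fixes cinner :: "'a \<Rightarrow> 'a \<Rightarrow> complex"
  assumes cinner_commute: "cinner x y = cnj (cinner y x)"
    and cinner_add_right: "cinner x (y + z) = cinner x y + cinner x z"
    and cinner_scaleC_right: "cinner x (c *\<^sub>C y) = c * cinner x y"
    and cinner_self: "cinner x x = complex_of_real ((norm x)\<^sup>2)"

section \<open>Unbounded self-adjoint operators\<close>

text \<open>An unbounded operator \<open>T\<close> is represented by its graph \<open>{(x, T x) | x \<in> Dom T}\<close>.
  For a densely defined \<open>T\<close> the adjoint is single-valued, and it is always linear and closed, so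
  \<open>self_adjoint T\<close> makes \<open>T\<close> the graph of a linear operator.\<close>

definition adjoint_graph :: "('h::complex_hilbert \<times> 'h) set \<Rightarrow> ('h \<times> 'h) set" where
  "adjoint_graph T = {(y, w). \<forall>(x, v)\<in>T. cinner v y = cinner x w}"

definition self_adjoint :: "('h::complex_hilbert \<times> 'h) set \<Rightarrow> bool" where
  "self_adjoint T \<longleftrightarrow> closure (Domain T) = UNIV \<and> adjoint_graph T = T"

text \<open>\<open>resolvent T z x\<close> is the solution \<open>u\<close> of \<open>T u - z u = x\<close>.\<close>

definition resolvent :: "('h::complex_hilbert \<times> 'h) set \<Rightarrow> complex \<Rightarrow> 'h \<Rightarrow> 'h" where
  "resolvent T z x = (THE u. (u, x + z *\<^sub>C u) \<in> T)"

section \<open>Spectral measures\<close>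

definition orthogonal_projection :: "('h::complex_hilbert \<Rightarrow> 'h) \<Rightarrow> bool" where
  "orthogonal_projection Q \<longleftrightarrow> Vector_Spaces.linear scaleC scaleC Q \<and>
     (\<forall>x. Q (Q x) = Q x) \<and> (\<forall>x y. cinner (Q x) y = cinner x (Q y))"

text \<open>Countable additivity is in the strong operator topology. Values of \<open>P\<close> outside the Borel
  sets are irrelevant.\<close>

definition projection_valued_measure :: "(real set \<Rightarrow> 'h::complex_hilbert \<Rightarrow> 'h) \<Rightarrow> bool" where
  "projection_valued_measure P \<longleftrightarrow>
     (\<forall>S\<in>sets borel. orthogonal_projection (P S)) \<and>
     P UNIV = (\<lambda>x. x) \<and>
     (\<forall>S::nat \<Rightarrow> real set. range S \<subseteq> sets borel \<and> disjoint_family S \<longrightarrow>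
        (\<forall>x. (\<lambda>n. P (S n) x) sums P (\<Union>n. S n) x))"

definition pvm_vector_measure :: "(real set \<Rightarrow> 'h::complex_hilbert \<Rightarrow> 'h) \<Rightarrow> 'h \<Rightarrow> real measure" where
  "pvm_vector_measure P x = measure_of UNIV (sets borel) (\<lambda>S. ennreal (Re (cinner x (P S x))))"

text \<open>\<open>P\<close> is the spectral measure of the self-adjoint operator \<open>T\<close>, that is
  \<open>T = \<integral> t dP(t)\<close>: the domain of \<open>T\<close> is \<open>{x. \<integral> t\<^sup>2 d\<langle>x, P x\<rangle> < \<infinity>}\<close> and
  \<open>\<langle>x, T x\<rangle> = \<integral> t d\<langle>x, P x\<rangle>\<close> for all \<open>x\<close> in the domain; by polarization this determines \<open>T\<close>.\<close>

definition is_spectral_pvm ::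
  "('h::complex_hilbert \<times> 'h) set \<Rightarrow> (real set \<Rightarrow> 'h \<Rightarrow> 'h) \<Rightarrow> bool" where
  "is_spectral_pvm T P \<longleftrightarrow> projection_valued_measure P \<and>
     Domain T = {x. (\<integral>\<^sup>+t. ennreal (t\<^sup>2) \<partial>pvm_vector_measure P x) < \<infinity>} \<and>
     (\<forall>(x, y)\<in>T. cinner x y = complex_of_real (LINT t|pvm_vector_measure P x. t))"

text \<open>The spectral measure of a self-adjoint operator exists and is unique on the Borel sets by the
  spectral theorem, so the existential quantifiers over \<open>P\<close> below select it.\<close>

definition scalar_spectral_measure ::
  "('h::complex_hilbert \<times> 'h) set \<Rightarrow> real measure \<Rightarrow> bool" where
  "scalar_spectral_measure T \<mu> \<longleftrightarrow> sets \<mu> = sets borel \<and> sigma_finite_measure \<mu> \<and>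
     (\<exists>P. is_spectral_pvm T P \<and>
        (\<forall>S\<in>sets borel. emeasure \<mu> S = 0 \<longleftrightarrow> (\<forall>x. P S x = 0)))"

text \<open>The operator \<open>f(T) = \<integral> f dP\<close> for bounded Borel \<open>f\<close>.\<close>

definition bounded_borel_calculus ::
  "('h::complex_hilbert \<times> 'h) set \<Rightarrow> (real \<Rightarrow> complex) \<Rightarrow> 'h \<Rightarrow> 'h" where
  "bounded_borel_calculus T f = (THE R. Vector_Spaces.linear scaleC scaleC R \<and>
     (\<exists>P. is_spectral_pvm T P \<and>
        (\<forall>x. cinner x (R x) = (LINT t|pvm_vector_measure P x. f t))))"

section \<open>Form-bounded perturbations\<close>

text \<open>\<open>(I + |A|)\<^bsup>-1/2\<^esup>\<close>\<close>

definition inv_sqrt_I_plus_abs :: "('h::complex_hilbert \<times> 'h) set \<Rightarrow> 'h \<Rightarrow> 'h" where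
  "inv_sqrt_I_plus_abs A =
     bounded_borel_calculus A (\<lambda>t. complex_of_real ((1 + \<bar>t\<bar>) powr (-1/2)))"

text \<open>\<open>\<iota>\<close> embeds \<open>\<H>\<close> in the Banach space \<open>'k\<close> as its completion in the norm
  \<open>\<parallel>(I + |A|)\<^bsup>-1/2\<^esup> x\<parallel>\<close>. The completion is unique up to isometric isomorphism over \<open>\<H>\<close>.\<close>

definition form_completion ::
  "('h::complex_hilbert \<times> 'h) set \<Rightarrow> ('h \<Rightarrow> 'k::complex_banach) \<Rightarrow> bool" where
  "form_completion A \<iota> \<longleftrightarrow> Vector_Spaces.linear scaleC scaleC \<iota> \<and>
     (\<forall>x. norm (\<iota> x) = norm (inv_sqrt_I_plus_abs A x)) \<and>
     closure (range \<iota>) = UNIV"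

definition continuous_extension ::
  "('h \<Rightarrow> 'k::topological_space) \<Rightarrow> ('h \<Rightarrow> 'b::topological_space) \<Rightarrow> 'k \<Rightarrow> 'b" where
  "continuous_extension \<iota> f = (THE g. continuous_on UNIV g \<and> (\<forall>x. g (\<iota> x) = f x))"

text \<open>\<open>(A - z I)\<^bsup>-1\<^esup> B\<close>, where \<open>(A - z I)\<^bsup>-1\<^esup>\<close> is extended by continuity to the completion.\<close>

definition resolvent_B ::
  "('h::complex_hilbert \<times> 'h) set \<Rightarrow> ('h \<Rightarrow> 'k::complex_banach) \<Rightarrow> (complex^'d \<Rightarrow> 'k) \<Rightarrow>
   complex \<Rightarrow> complex^'d \<Rightarrow> 'h" where
  "resolvent_B A \<iota> B z e = continuous_extension \<iota> (resolvent A z) (B e)"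

text \<open>\<open>B\<^sup>* u\<close> for \<open>u\<close> in the form domain \<open>Dom |A|\<^bsup>1/2\<^esup>\<close>. Exactly for these \<open>u\<close> the functional
  \<open>x \<mapsto> \<langle>x, u\<rangle>\<close> extends continuously from \<open>\<H>\<close> to the completion, and the \<open>j\<close>-th
  coordinate of \<open>B\<^sup>* u\<close> is \<open>\<langle>e\<^sub>j, B\<^sup>* u\<rangle> = \<langle>B e\<^sub>j, u\<rangle>\<close>, understood in terms of this extension.
  The ranges of \<open>(A - z I)\<^bsup>-1\<^esup>\<close> and of \<open>(A - z I)\<^bsup>-1\<^esup> B\<close> lie in the form domain.\<close>

definition B_star ::
  "('h::complex_hilbert \<Rightarrow> 'k::complex_banach) \<Rightarrow> (complex^'d \<Rightarrow> 'k) \<Rightarrow> 'h \<Rightarrow> complex^'d" where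
  "B_star \<iota> B u = (\<chi> j. continuous_extension \<iota> (\<lambda>x. cinner x u) (B (axis j 1)))"

text \<open>\<open>F(z) = B\<^sup>* (A - z I)\<^bsup>-1\<^esup> B\<close>\<close>

definition F_matrix ::
  "('h::complex_hilbert \<times> 'h) set \<Rightarrow> ('h \<Rightarrow> 'k::complex_banach) \<Rightarrow> (complex^'d \<Rightarrow> 'k) \<Rightarrow>
   complex \<Rightarrow> complex^'d^'d" where
  "F_matrix A \<iota> B z = matrix (\<lambda>e. B_star \<iota> B (resolvent_B A \<iota> B z e))"

text \<open>\<open>A + B \<alpha> B\<^sup>*\<close>, defined through its resolvent.\<close>

definition perturbed_operator ::
  "('h::complex_hilbert \<times> 'h) set \<Rightarrow> ('h \<Rightarrow> 'k::complex_banach) \<Rightarrow> (complex^'d \<Rightarrow> 'k) \<Rightarrow>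
   complex^'d^'d \<Rightarrow> ('h \<times> 'h) set" where
  "perturbed_operator A \<iota> B \<alpha> = (THE T. self_adjoint T \<and>
     (\<forall>z. z \<notin> \<real> \<longrightarrow> (\<forall>x. resolvent T z x = resolvent A z x -
        resolvent_B A \<iota> B z (matrix_inv (mat 1 + \<alpha> ** F_matrix A \<iota> B z) *v
          (\<alpha> *v B_star \<iota> B (resolvent A z x))))))"

definition cyclic_range ::
  "('h::complex_hilbert \<times> 'h) set \<Rightarrow> ('h \<Rightarrow> 'k::complex_banach) \<Rightarrow> (complex^'d \<Rightarrow> 'k) \<Rightarrow> bool" where
  "cyclic_range A \<iota> B \<longleftrightarrow>
     closure (module.span scaleC {resolvent_B A \<iota> B z e | z e. z \<notin> \<real>}) = UNIV"

section \<open>Hermitian matrices, singular measures, Hausdorff dimension\<close>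

definition hermitian_matrices :: "(complex^'d^'d) set" where
  "hermitian_matrices = {\<alpha>. \<forall>i j. \<alpha> $ i $ j = cnj (\<alpha> $ j $ i)}"

definition mutually_singular :: "'a measure \<Rightarrow> 'a measure \<Rightarrow> bool" where
  "mutually_singular M N \<longleftrightarrow>
     (\<exists>S\<in>sets M \<inter> sets N. emeasure M S = 0 \<and> emeasure N (space N - S) = 0)"

text \<open>Only used for \<open>s > 0\<close>; the library's \<open>diameter\<close> is meaningful for bounded sets only.\<close>

definition hausdorff_outer_measure :: "real \<Rightarrow> 'a::metric_space set \<Rightarrow> ennreal" where
  "hausdorff_outer_measure s E =
     (SUP \<delta>\<in>{0<..}. INF U\<in>{U::nat \<Rightarrow> 'a set. E \<subseteq> (\<Union>n. U n) \<and>
        (\<forall>n. bounded (U n) \<and> diameter (U n) \<le> \<delta>)}.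
        (\<Sum>n. ennreal (diameter (U n) powr s)))"

definition hausdorff_dimension :: "'a::metric_space set \<Rightarrow> ereal" where
  "hausdorff_dimension E = (INF s\<in>{s. 0 < s \<and> hausdorff_outer_measure s E = 0}. ereal s)"

end

theory Submission
  imports Defs "HOL-Probability.Probability" "HOL-Complex_Analysis.Complex_Analysis"
begin

text \<open>If the spectral measure \<open>\<rho>\<close> of \<open>A\<^sub>\<alpha>\<close> at one of the vectors \<open>u\<^sub>j = (A\<^sub>\<alpha> - i)\<^sup>-\<^sup>1 B e\<^sub>j\<close> is not singular to \<open>\<nu>\<close>,
  then, since \<open>\<nu>\<close> lives on a Lebesgue null set, \<open>\<rho> (x - \<epsilon>, x + \<epsilon>) / \<epsilon>\<close> is large for small \<open>\<epsilon>\<close> and for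
  \<open>x\<close> in a set of \<open>\<nu>\<close>-measure at least some \<open>\<delta> > 0\<close>. The quotient is dominated by
  \<open>4 \<parallel>F\<^sub>\<alpha>(x + i \<epsilon>)\<parallel>\<close> with \<open>F\<^sub>\<alpha> = F (I + \<alpha> F)\<^sup>-\<^sup>1\<close>. Largeness above \<open>1 / \<eta>\<close> is inherited by
  \<open>F (I + (\<alpha>' - i \<eta>) F)\<^sup>-\<^sup>1\<close> for all \<open>\<alpha>'\<close> in the \<open>\<eta>\<close>-neighbourhood of \<open>\<alpha>\<close>, and it forces the trace of the
  imaginary part of this matrix to be at least of order \<open>1 / \<eta>\<close>. As a function of \<open>t\<close>,
  \<open>F (I + (\<alpha>' + t - i \<eta>) F)\<^sup>-\<^sup>1\<close> extends to a matrix-valued function on the lower half plane with diagonal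
  entries bounded by \<open>1 / |Im t|\<close>, and Cauchy's theorem bounds the integral of the imaginary parts over
  bounded \<open>t\<close> uniformly in \<open>\<eta>\<close>. By averaging over \<open>\<alpha>'\<close> and \<open>\<nu>\<close>, the \<open>\<eta>\<close>-neighbourhood of the bounded
  exceptional parameters for a fixed \<open>\<delta>\<close> has volume \<open>O(\<eta>)\<close>, so these parameters are covered by
  \<open>O(\<eta> ^ (1 - d\<^sup>2))\<close> balls of radius \<open>2 \<eta>\<close>.\<close>

text \<open>The vectors \<open>B e_j\<close> live only in a completion of the space; one resolvent
  turns them into the honest vectors \<open>u_j\<close>, and the spectral measures at these
  \<open>d\<close> vectors decide everything, because resolvents of the perturbed operator and
  linear combinations lead from them to the whole cyclic set. The obstacle is that boundary values
  of \<open>F\<close> have no regularity in the parameter. The shift by \<open>- \<i> \<eta>\<close>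
  buys stability: a lower bound at one parameter survives, up to a constant factor, on its whole
  \<open>\<eta>\<close>-neighbourhood. Averaging in the single direction of the identity matrix is
  then enough, since the resulting bound does not depend on the point of the line or on the
  remaining coordinates and can be integrated against any finite \<open>\<nu>\<close>. One averaged
  direction gains one power of \<open>\<eta>\<close>, hence one dimension. Exceptional means that
  for every threshold the large set has \<open>\<nu>\<close>-measure at least
  \<open>\<delta>\<close> at all late scales; its negation supplies good scales arbitrarily late,
  and singularity asks for no more. Existence and uniqueness of spectral measures are both read off
  from the moments of the Cayley transform.\<close>

lemma vector_space_scaleC: "vector_space (scaleC :: complex \<Rightarrow> 'a::complex_normed_vector \<Rightarrow> 'a)"
proof
  fix x :: 'a
  show "1 *\<^sub>C x = x" using scaleC_of_real[of 1 x] by simp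
qed (auto simp: scaleC_add_right scaleC_add_left scaleC_scaleC)

interpretation scaleC: vector_space "scaleC :: complex \<Rightarrow> 'a::complex_normed_vector \<Rightarrow> 'a"
  by (rule vector_space_scaleC)

lemma scaleC_one [simp]: "1 *\<^sub>C x = x"
  using scaleC_of_real[of 1 x] by simp

lemma scaleC_zero_left [simp]: "0 *\<^sub>C x = 0"
  using scaleC_of_real[of 0 x] by simp

lemma scaleC_minus_left [simp]: "(- c) *\<^sub>C x = - (c *\<^sub>C x)"
  using scaleC.scale_minus_left .

lemma scaleC_diff_left: "(c - d) *\<^sub>C x = c *\<^sub>C x - d *\<^sub>C x"
  using scaleC.scale_left_diff_distrib .

lemma scaleC_diff_right: "c *\<^sub>C (x - y) = c *\<^sub>C x - c *\<^sub>C (y::'a::complex_normed_vector)"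
  using scaleC.scale_right_diff_distrib .

lemma bounded_bilinear_scaleC:
  "bounded_bilinear (scaleC :: complex \<Rightarrow> 'a::complex_normed_vector \<Rightarrow> 'a)"
proof
  show "\<exists>K. \<forall>a b. norm (a *\<^sub>C (b::'a)) \<le> norm a * norm b * K"
    by (rule exI[of _ 1]) (simp add: norm_scaleC)
  fix r :: real and a :: complex and b :: 'a
  show "(r *\<^sub>R a) *\<^sub>C b = r *\<^sub>R (a *\<^sub>C b)"
    by (simp add: scaleC_of_real[symmetric] scaleC_scaleC scaleR_conv_of_real)
  show "a *\<^sub>C (r *\<^sub>R b) = r *\<^sub>R (a *\<^sub>C b)"
    by (simp add: scaleC_of_real[symmetric] scaleC_scaleC mult.commute)
qed (auto simp: scaleC_add_left scaleC_add_right)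

lemmas tendsto_scaleC [tendsto_intros] = bounded_bilinear.tendsto[OF bounded_bilinear_scaleC]

section \<open>Complex-linear maps between complex normed spaces\<close>

abbreviation clinear :: "('a::complex_normed_vector \<Rightarrow> 'b::complex_normed_vector) \<Rightarrow> bool" where
  "clinear \<equiv> Vector_Spaces.linear scaleC scaleC"

lemma clinear_iff:
  "clinear f \<longleftrightarrow> (\<forall>x y. f (x + y) = f x + f y) \<and> (\<forall>c x. f (c *\<^sub>C x) = c *\<^sub>C f x)"
  unfolding Vector_Spaces.linear_iff by (auto intro: vector_space_scaleC)

lemma clinearI:
  assumes "\<And>x y. f (x + y) = f x + f y" "\<And>c x. f (c *\<^sub>C x) = c *\<^sub>C f x"
  shows "clinear f"
  using assms by (simp add: clinear_iff)

lemma clinear_add: "clinear f \<Longrightarrow> f (x + y) = f x + f y"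
  and clinear_scale: "clinear f \<Longrightarrow> f (c *\<^sub>C x) = c *\<^sub>C f x"
  by (simp_all add: clinear_iff)

lemma clinear_zero: "clinear f \<Longrightarrow> f 0 = 0"
  by (metis clinear_scale scaleC_zero_left)

lemma clinear_minus: "clinear f \<Longrightarrow> f (- x) = - f x"
  by (metis clinear_scale scaleC_minus_left scaleC_one)

lemma clinear_diff: "clinear f \<Longrightarrow> f (x - y) = f x - f y"
  by (metis clinear_add clinear_minus diff_conv_add_uminus)

lemma clinear_sum: "clinear f \<Longrightarrow> f (\<Sum>i\<in>I. g i) = (\<Sum>i\<in>I. f (g i))"
  by (induction I rule: infinite_finite_induct) (auto simp: clinear_add clinear_zero)

lemma clinear_compose: "clinear f \<Longrightarrow> clinear g \<Longrightarrow> clinear (\<lambda>x. f (g x))"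
  by (simp add: clinear_iff)

lemma clinear_id: "clinear (\<lambda>x. x)"
  by (simp add: clinear_iff)

lemma clinear_funpow: "clinear f \<Longrightarrow> clinear (f ^^ n)" for f :: "'a::complex_normed_vector \<Rightarrow> 'a"
  by (induction n) (auto simp: clinear_iff)

lemma clinear_tendsto:
  assumes "clinear f" "\<And>x. norm (f x) \<le> C * norm x" "X \<longlonglongrightarrow> l"
  shows "(\<lambda>n. f (X n)) \<longlonglongrightarrow> f l"
proof (rule Lim_transform_bound[THEN LIM_zero_cancel])
  have "(\<lambda>n. norm (X n - l)) \<longlonglongrightarrow> 0"
    using assms(3) by (simp add: LIM_zero_iff tendsto_norm_zero_iff)
  from tendsto_mult_left[OF this, of C]
  show "(\<lambda>n. C * norm (X n - l)) \<longlonglongrightarrow> 0" by simp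
  show "\<forall>\<^sub>F n in sequentially. norm (f (X n) - f l) \<le> norm (C * norm (X n - l))"
  proof (rule always_eventually, rule allI)
    fix n
    have "norm (f (X n) - f l) \<le> C * norm (X n - l)"
      using assms(2)[of "X n - l"] clinear_diff[OF assms(1)] by simp
    then show "norm (f (X n) - f l) \<le> norm (C * norm (X n - l))"
      by (metis abs_ge_self order_trans real_norm_def)
  qed
qed

lemma clinear_eq_on_dense:
  assumes f: "clinear f" "\<And>x. norm (f x) \<le> C * norm x"
    and 0: "\<And>x. x \<in> X \<Longrightarrow> f x = 0"
    and X: "closure X = UNIV"
  shows "f x = 0"
proof -
  obtain s where s: "\<And>n. s n \<in> X" "s \<longlonglongrightarrow> x"
    using X closure_sequential[of x X] by auto
  have "(\<lambda>n. f (s n)) \<longlonglongrightarrow> f x"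
    using clinear_tendsto[OF f s(2)] .
  then show ?thesis
    using s(1) 0 by (simp add: LIMSEQ_const_iff)
qed

section \<open>Complex Hilbert spaces\<close>

lemma cinner_add_left: "cinner (x + y) z = cinner x z + cinner y (z::'a::complex_hilbert)"
  by (metis cinner_add_right cinner_commute complex_cnj_add)

lemma cinner_scaleC_left: "cinner (c *\<^sub>C x) y = cnj c * cinner x (y::'a::complex_hilbert)"
  by (metis cinner_scaleC_right cinner_commute complex_cnj_mult)

lemma cinner_zero_right [simp]: "cinner x (0::'a::complex_hilbert) = 0"
  using cinner_scaleC_right[of x 0 0] by simp

lemma cinner_zero_left [simp]: "cinner 0 (x::'a::complex_hilbert) = 0"
  using cinner_scaleC_left[of 0 0 x] by simp

lemma cinner_minus_right [simp]: "cinner x (- y) = - cinner x (y::'a::complex_hilbert)"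
  using cinner_scaleC_right[of x "-1" y] by simp

lemma cinner_minus_left [simp]: "cinner (- x) y = - cinner x (y::'a::complex_hilbert)"
  using cinner_scaleC_left[of "-1" x y] by simp

lemma cinner_diff_right: "cinner x (y - z) = cinner x y - cinner x (z::'a::complex_hilbert)"
  using cinner_add_right[of x y "- z"] by simp

lemma cinner_diff_left: "cinner (x - y) z = cinner x z - cinner y (z::'a::complex_hilbert)"
  using cinner_add_left[of x "- y" z] by simp

lemma cinner_sum_right: "cinner x (\<Sum>i\<in>I. f i) = (\<Sum>i\<in>I. cinner x (f i::'a::complex_hilbert))"
  by (induction I rule: infinite_finite_induct) (auto simp: cinner_add_right)

lemma cinner_sum_left: "cinner (\<Sum>i\<in>I. f i) x = (\<Sum>i\<in>I. cinner (f i) (x::'a::complex_hilbert))"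
  by (induction I rule: infinite_finite_induct) (auto simp: cinner_add_left)

lemmas cinner_simps = cinner_add_left cinner_add_right cinner_diff_left cinner_diff_right
  cinner_scaleC_left cinner_scaleC_right

lemma Re_cinner_self: "Re (cinner x x) = (norm (x::'a::complex_hilbert))\<^sup>2"
  and Im_cinner_self: "Im (cinner x x) = 0"
  by (simp_all add: cinner_self)

lemma Re_cinner_commute: "Re (cinner x y) = Re (cinner y (x::'a::complex_hilbert))"
  by (subst cinner_commute) simp

lemma norm_add_sq: "(norm (x + y))\<^sup>2 = (norm x)\<^sup>2 + (norm y)\<^sup>2 + 2 * Re (cinner x (y::'a::complex_hilbert))"
proof -
  have "(norm (x + y))\<^sup>2 = Re (cinner (x + y) (x + y))"
    by (simp only: Re_cinner_self)
  also have "\<dots> = (norm x)\<^sup>2 + (norm y)\<^sup>2 + 2 * Re (cinner x y)"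
    using Re_cinner_commute[of x y] by (simp add: cinner_add_left cinner_add_right Re_cinner_self)
  finally show ?thesis .
qed

lemma norm_diff_sq: "(norm (x - y))\<^sup>2 = (norm x)\<^sup>2 + (norm y)\<^sup>2 - 2 * Re (cinner x (y::'a::complex_hilbert))"
  using norm_add_sq[of x "- y"] by simp

lemma parallelogram_law:
  "(norm (x + y))\<^sup>2 + (norm (x - y))\<^sup>2 = 2 * (norm x)\<^sup>2 + 2 * (norm (y::'a::complex_hilbert))\<^sup>2"
  by (simp add: norm_add_sq norm_diff_sq)

lemma complex_Cauchy_Schwarz: "cmod (cinner x y) \<le> norm x * norm (y::'a::complex_hilbert)"
proof (cases "y = 0")
  case False
  let ?p = "cinner y x" and ?b = "complex_of_real ((norm y)\<^sup>2)"
  let ?v = "?b *\<^sub>C x - ?p *\<^sub>C y"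
  have "cinner ?v ?v = ?b * (?b * cinner x x - ?p * cinner x y) - cnj ?p * (?b * ?p - ?p * cinner y y)"
    by (simp add: cinner_simps algebra_simps)
  also have "\<dots> = ?b * (?b * complex_of_real ((norm x)\<^sup>2) - ?p * cnj ?p)"
    by (simp add: cinner_self cinner_commute[of x y])
  also have "?p * cnj ?p = complex_of_real ((cmod ?p)\<^sup>2)"
    by (metis complex_norm_square)
  finally have "(norm ?v)\<^sup>2 = (norm y)\<^sup>2 * ((norm y)\<^sup>2 * (norm x)\<^sup>2 - (cmod ?p)\<^sup>2)"
    unfolding cinner_self by (metis of_real_mult of_real_diff of_real_eq_iff)
  then have "(norm y)\<^sup>2 * ((norm y)\<^sup>2 * (norm x)\<^sup>2 - (cmod ?p)\<^sup>2) \<ge> 0"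
    by (metis zero_le_power2)
  then have "(cmod ?p)\<^sup>2 \<le> (norm y * norm x)\<^sup>2"
    using False by (simp add: zero_le_mult_iff power_mult_distrib)
  then have "cmod ?p \<le> norm y * norm x"
    by (rule power2_le_imp_le) simp
  then show ?thesis
    by (metis cinner_commute complex_mod_cnj mult.commute)
qed simp

lemma bounded_bilinear_cinner:
  "bounded_bilinear (cinner :: 'a::complex_hilbert \<Rightarrow> 'a \<Rightarrow> complex)"
proof
  show "\<exists>K. \<forall>a b. norm (cinner a (b::'a)) \<le> norm a * norm b * K"
    by (rule exI[of _ 1]) (simp add: complex_Cauchy_Schwarz)
  fix r :: real and a b :: 'a
  show "cinner (r *\<^sub>R a) b = r *\<^sub>R cinner a b"
    by (simp add: scaleC_of_real[symmetric] cinner_scaleC_left scaleR_conv_of_real)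
  show "cinner a (r *\<^sub>R b) = r *\<^sub>R cinner a b"
    by (simp add: scaleC_of_real[symmetric] cinner_scaleC_right scaleR_conv_of_real)
qed (auto simp: cinner_simps)

lemmas tendsto_cinner [tendsto_intros] = bounded_bilinear.tendsto[OF bounded_bilinear_cinner]

lemma cinner_ext: "(\<And>y. cinner y x = cinner y x') \<Longrightarrow> x = (x'::'a::complex_hilbert)"
proof -
  assume "\<And>y. cinner y x = cinner y x'"
  then have "cinner (x - x') (x - x') = 0" by (simp add: cinner_diff_right)
  then show ?thesis by (simp add: cinner_self)
qed

text \<open>A complex sesquilinear form is determined by its diagonal: inserting
  \<open>x + y\<close> kills the symmetric combination, inserting
  \<open>x + \<i> *\<^sub>C y\<close> the antisymmetric one.\<close>

lemma polarization_zero: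
  fixes F G :: "'a::complex_normed_vector \<Rightarrow> 'b::complex_hilbert"
  assumes F: "clinear F" and G: "clinear G" and 0: "\<And>x. cinner (F x) (G x) = 0"
  shows "cinner (F x) (G y) = 0"
proof -
  have 1: "cinner (F x) (G y) + cinner (F y) (G x) = 0"
    using 0[of "x + y"] 0[of x] 0[of y]
    by (simp add: clinear_add[OF F] clinear_add[OF G] cinner_simps add.commute)
  have "\<i> * cinner (F x) (G y) - \<i> * cinner (F y) (G x) = 0"
    using 0[of "x + \<i> *\<^sub>C y"] 0[of x] 0[of y]
    by (simp add: clinear_add[OF F] clinear_add[OF G] clinear_scale[OF F] clinear_scale[OF G] cinner_simps)
  then have "cinner (F x) (G y) = cinner (F y) (G x)" by simp
  with 1 show ?thesis by simp
qed

text \<open>Functions of an operator are specified only through \<open>cinner x (F x)\<close> being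
  an integral; this makes such specifications unique.\<close>

lemma quadratic_form_unique:
  fixes F G :: "'a::complex_hilbert \<Rightarrow> 'a"
  assumes "clinear F" "clinear G" "\<And>x. cinner x (F x) = cinner x (G x)"
  shows "F = G"
proof
  fix y
  have "clinear (\<lambda>x. F x - G x)"
    using assms(1,2) by (simp add: clinear_iff scaleC_diff_right)
  then have "cinner x (F y - G y) = 0" for x
    using polarization_zero[OF clinear_id, of "\<lambda>x. F x - G x" x y] assms(3) by (simp add: cinner_simps)
  then have "F y - G y = 0" using cinner_ext[of "F y - G y" 0] by simp
  then show "F y = G y" by simp
qed

text \<open>The projection theorem in disguise: a minimizing sequence for the distance from a point
  to \<open>M\<close> is Cauchy by the parallelogram law, and the point minus the limit is
  orthogonal to \<open>M\<close>, hence zero.\<close>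

lemma closure_eq_UNIV_if_orthogonal_complement_trivial:
  fixes M :: "'a::complex_hilbert set"
  assumes "0 \<in> M" and add: "\<And>x y. x \<in> M \<Longrightarrow> y \<in> M \<Longrightarrow> x + y \<in> M"
    and scale: "\<And>c x. x \<in> M \<Longrightarrow> c *\<^sub>C x \<in> M"
    and orth: "\<And>y. (\<And>x. x \<in> M \<Longrightarrow> cinner x y = 0) \<Longrightarrow> y = 0"
  shows "closure M = UNIV"
proof -
  have "x \<in> closure M" for x
  proof -
    define d where "d = infdist x M"
    have ne: "M \<noteq> {}" using assms(1) by auto
    have d: "d \<le> norm (x - m)" if "m \<in> M" for m
      unfolding d_def using infdist_le[OF that, of x] by (simp add: dist_norm)
    have d0: "d \<ge> 0" by (simp add: d_def infdist_nonneg)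
    have "\<exists>m\<in>M. norm (x - m) < d + e" if "e > 0" for e
    proof -
      have "(INF m\<in>M. dist x m) < d + e"
        using that ne by (simp add: d_def infdist_def)
      then show ?thesis
        using cINF_less_iff[OF ne, of "dist x" "d + e"] bdd_belowI2[of M 0 "dist x"]
        by (auto simp: dist_norm)
    qed
    then have "\<exists>m\<in>M. norm (x - m) < d + 1 / real (Suc n)" for n
      by simp
    then obtain m where m: "\<And>n. m n \<in> M" "\<And>n. norm (x - m n) < d + 1 / real (Suc n)"
      by metis
    \<comment> \<open>Excess over the minimal squared distance; it tends to 0 and controls the
      mutual distances of the \<open>m n\<close>.\<close>
    define q where "q n = (d + 1 / real (Suc n))\<^sup>2 - d\<^sup>2" for n
    have mq: "(norm (x - m n))\<^sup>2 \<le> d\<^sup>2 + q n" for n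
      using m(2)[of n] power_mono[of "norm (x - m n)" "d + 1 / real (Suc n)" 2]
      by (simp add: q_def less_imp_le)
    have "q \<longlonglongrightarrow> (d + 0)\<^sup>2 - d\<^sup>2"
      unfolding q_def by (intro tendsto_intros LIMSEQ_Suc[OF lim_1_over_n])
    then have q: "q \<longlonglongrightarrow> 0" by simp
    have par: "(norm (m k - m l))\<^sup>2 \<le> 2 * q k + 2 * q l" for k l
    proof -
      let ?c = "(1/2::real) *\<^sub>R (m k + m l)"
      have "?c \<in> M"
        using scale[OF add[OF m(1) m(1)], of "complex_of_real (1/2)" k l]
        by (simp only: scaleC_of_real)
      then have "d \<le> norm (x - ?c)" by (rule d)
      then have "d\<^sup>2 \<le> (norm (x - ?c))\<^sup>2" using d0 by (rule power_mono)
      moreover have "(x - m k) + (x - m l) = 2 *\<^sub>R (x - ?c)"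
        by (simp add: algebra_simps scaleR_2)
      then have "(norm ((x - m k) + (x - m l)))\<^sup>2 = 4 * (norm (x - ?c))\<^sup>2"
        by (simp add: power_mult_distrib)
      moreover have "norm ((x - m k) - (x - m l)) = norm (m k - m l)"
        by (simp add: norm_minus_commute)
      ultimately show ?thesis
        using parallelogram_law[of "x - m k" "x - m l"] mq[of k] mq[of l] by simp
    qed
    have "Cauchy m"
    proof (rule CauchyI)
      fix e :: real assume e: "e > 0"
      then have "eventually (\<lambda>n. q n < e\<^sup>2 / 4) sequentially"
        using q by (intro order_tendstoD) auto
      then obtain N where N: "\<And>n. n \<ge> N \<Longrightarrow> q n < e\<^sup>2 / 4"
        by (auto simp: eventually_sequentially)
      have "norm (m k - m l) < e" if "k \<ge> N" "l \<ge> N" for k l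
      proof -
        have "(norm (m k - m l))\<^sup>2 < e\<^sup>2"
          using par[of k l] N[OF that(1)] N[OF that(2)] by simp
        then show ?thesis using e by (simp add: power2_less_imp_less)
      qed
      then show "\<exists>N. \<forall>k\<ge>N. \<forall>l\<ge>N. norm (m k - m l) < e" by blast
    qed
    then obtain l where l: "m \<longlonglongrightarrow> l"
      using Cauchy_convergent convergent_def by blast
    have "(\<lambda>n. (norm (x - m n))\<^sup>2) \<longlonglongrightarrow> (norm (x - l))\<^sup>2"
      by (intro tendsto_intros l)
    moreover have "(\<lambda>n. d\<^sup>2 + q n) \<longlonglongrightarrow> d\<^sup>2 + 0"
      by (intro tendsto_intros q)
    ultimately have le: "(norm (x - l))\<^sup>2 \<le> d\<^sup>2"
      using mq LIMSEQ_le[of "\<lambda>n. (norm (x - m n))\<^sup>2" _ "\<lambda>n. d\<^sup>2 + q n" "d\<^sup>2 + 0"] by auto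
    have ge: "d\<^sup>2 \<le> (norm (x - l - u))\<^sup>2" if u: "u \<in> M" for u
    proof -
      have "(\<lambda>n. (norm (x - m n - u))\<^sup>2) \<longlonglongrightarrow> (norm (x - l - u))\<^sup>2"
        by (intro tendsto_intros l)
      moreover have "d\<^sup>2 \<le> (norm (x - m n - u))\<^sup>2" for n
        using d[OF add[OF m(1)[of n] u]] d0 by (intro power_mono) (auto simp: algebra_simps)
      ultimately show ?thesis
        using LIMSEQ_le_const by blast
    qed
    have "cinner u (x - l) = 0" if u: "u \<in> M" for u
    proof (rule ccontr)
      assume ne0: "cinner u (x - l) \<noteq> 0"
      define p where "p = cinner u (x - l)"
      have u0: "u \<noteq> 0" using ne0 by auto
      \<comment> \<open>\<open>?c\<close> is the coefficient of the projection of
        \<open>x - l\<close> onto \<open>u\<close>. Subtracting that projection would lower the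
        squared distance by \<open>?t * (cmod p)\<^sup>2\<close>, below the infimum.\<close>
      let ?t = "1 / (norm u)\<^sup>2"
      let ?c = "complex_of_real ?t * p"
      have "Re (cinner (x - l) (?c *\<^sub>C u)) = ?t * (cmod p)\<^sup>2"
      proof -
        have "cinner (x - l) (?c *\<^sub>C u) = complex_of_real ?t * (p * cnj p)"
          by (simp add: cinner_scaleC_right p_def cinner_commute[of "x - l" u])
        then show ?thesis
          by (metis Re_complex_of_real complex_norm_square of_real_mult of_real_power)
      qed
      moreover have "(norm (?c *\<^sub>C u))\<^sup>2 = ?t * (cmod p)\<^sup>2"
        using u0 by (simp add: norm_scaleC norm_mult norm_divide power_mult_distrib power2_eq_square field_simps)
      ultimately have "(norm (x - l - ?c *\<^sub>C u))\<^sup>2 = (norm (x - l))\<^sup>2 - ?t * (cmod p)\<^sup>2"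
        by (simp add: norm_diff_sq[of "x - l"])
      moreover have "?t * (cmod p)\<^sup>2 > 0"
        using u0 ne0 by (simp add: p_def)
      ultimately show False
        using ge[OF scale[OF u, of ?c]] le by linarith
    qed
    then have "x - l = 0" by (rule orth)
    then show ?thesis
      using m(1) l closure_sequential[of x M] by auto
  qed
  then show ?thesis by auto
qed

lemma mem_closed_subspace_if_dense: 
  fixes M :: "'a::complex_hilbert set"
  assumes "closure M = UNIV" "\<And>s l. (\<And>n. s n \<in> M) \<Longrightarrow> s \<longlonglongrightarrow> l \<Longrightarrow> l \<in> M"
  shows "x \<in> M"
  using assms(1) closure_sequential[of x M] assms(2)[of _ x] by auto

section \<open>Self-adjoint operators and their resolvents\<close>

lemma self_adjoint_symmetric:
  "self_adjoint T \<Longrightarrow> (x, v) \<in> T \<Longrightarrow> (y, w) \<in> T \<Longrightarrow> cinner v y = cinner x w"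
  unfolding self_adjoint_def adjoint_graph_def by fastforce

text \<open>The maximality half of self-adjointness. \<open>T\<close> is a bare relation, so its
  linearity and closedness are read off from this test.\<close>

lemma self_adjoint_memI:
  "self_adjoint T \<Longrightarrow> (\<And>x v. (x, v) \<in> T \<Longrightarrow> cinner v y = cinner x w) \<Longrightarrow> (y, w) \<in> T"
  unfolding self_adjoint_def adjoint_graph_def by fastforce

lemma self_adjoint_add:
  assumes "self_adjoint T" "(x, v) \<in> T" "(y, w) \<in> T"
  shows "(x + y, v + w) \<in> T"
  using self_adjoint_symmetric[OF assms(1) _ assms(2)] self_adjoint_symmetric[OF assms(1) _ assms(3)]
  by (intro self_adjoint_memI[OF assms(1)]) (simp add: cinner_simps)

lemma self_adjoint_scale:
  assumes "self_adjoint T" "(x, v) \<in> T"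
  shows "(c *\<^sub>C x, c *\<^sub>C v) \<in> T"
  using self_adjoint_symmetric[OF assms(1) _ assms(2)]
  by (intro self_adjoint_memI[OF assms(1)]) (simp add: cinner_simps)

lemma self_adjoint_diff:
  assumes "self_adjoint T" "(x, v) \<in> T" "(y, w) \<in> T"
  shows "(x - y, v - w) \<in> T"
  using self_adjoint_add[OF assms(1,2) self_adjoint_scale[OF assms(1,3), of "-1"]] by simp

lemma self_adjoint_closed:
  assumes T: "self_adjoint T" and "\<And>n. (s n, t n) \<in> T" "s \<longlonglongrightarrow> x" "t \<longlonglongrightarrow> v"
  shows "(x, v) \<in> T"
proof (rule self_adjoint_memI[OF T])
  fix y w assume yw: "(y, w) \<in> T"
  have "(\<lambda>n. cinner w (s n)) \<longlonglongrightarrow> cinner w x" "(\<lambda>n. cinner y (t n)) \<longlonglongrightarrow> cinner y v"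
    by (intro tendsto_intros assms)+
  moreover have "cinner w (s n) = cinner y (t n)" for n
    using self_adjoint_symmetric[OF T yw assms(2)] .
  ultimately show "cinner w x = cinner y v"
    using LIMSEQ_unique by auto
qed

text \<open>Symmetry makes \<open>cinner u (x + z *\<^sub>C u)\<close> real, so
  \<open>Im z * (norm u)\<^sup>2\<close> is balanced by \<open>Im (cinner u x)\<close>.\<close>

lemma symmetric_resolvent_bound:
  assumes "cinner (x + z *\<^sub>C u) u = cinner u (x + z *\<^sub>C (u::'a::complex_hilbert))"
  shows "\<bar>Im z\<bar> * norm u \<le> norm x"
proof (cases "u = 0")
  case False
  have "cinner (x + z *\<^sub>C u) u = cnj (cinner u (x + z *\<^sub>C u))"
    by (rule cinner_commute)
  then have "Im (cinner u (x + z *\<^sub>C u)) = 0"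
    using assms by (metis add.inverse_neutral complex_cnj_cancel_iff complex_cnj_cnj cnj.simps(2) equal_neg_zero)
  then have "Im (cinner u x) = - (Im z * (norm u)\<^sup>2)"
    by (simp add: cinner_simps cinner_self eq_neg_iff_add_eq_0 del: of_real_power)
  then have "\<bar>Im z\<bar> * (norm u)\<^sup>2 = \<bar>Im (cinner u x)\<bar>"
    by (simp add: abs_mult)
  also have "\<dots> \<le> norm u * norm x"
    using abs_Im_le_cmod complex_Cauchy_Schwarz order_trans by blast
  finally show ?thesis
    using False by (simp add: power2_eq_square)
qed simp

lemma self_adjoint_resolvent_bound:
  assumes "self_adjoint T" "(u, x + z *\<^sub>C u) \<in> T"
  shows "\<bar>Im z\<bar> * norm u \<le> norm x"
  by (rule symmetric_resolvent_bound) (rule self_adjoint_symmetric[OF assms(1,2,2)])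

lemma self_adjoint_resolvent_unique:
  assumes T: "self_adjoint T" and "Im z \<noteq> 0" "(u, x + z *\<^sub>C u) \<in> T" "(v, x + z *\<^sub>C v) \<in> T"
  shows "u = v"
proof -
  have "(u - v, 0 + z *\<^sub>C (u - v)) \<in> T"
    using self_adjoint_diff[OF T assms(3,4)] by (simp add: scaleC_diff_right)
  from self_adjoint_resolvent_bound[OF T this] assms(2) show ?thesis by (simp add: mult_le_0_iff)
qed

text \<open>The range of \<open>T - z\<close> is dense, because a vector orthogonal to it would be
  an eigenvector of the adjoint, that is of \<open>T\<close>, for the nonreal value
  \<open>cnj z\<close>. It is closed by the resolvent bound.\<close>

lemma self_adjoint_resolvent_exists:
  assumes T: "self_adjoint T" and z: "Im z \<noteq> 0"
  shows "\<exists>u. (u, x + z *\<^sub>C u) \<in> T"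
proof -
  define M where "M = {x. \<exists>u. (u, x + z *\<^sub>C u) \<in> T}"
  have "(0, 0) \<in> T" by (rule self_adjoint_memI[OF T]) simp
  then have 0: "0 \<in> M" unfolding M_def by (auto intro!: exI[of _ 0])
  have "closure M = UNIV"
  proof (rule closure_eq_UNIV_if_orthogonal_complement_trivial[OF 0])
    fix x y assume "x \<in> M" "y \<in> M"
    then obtain u v where "(u, x + z *\<^sub>C u) \<in> T" "(v, y + z *\<^sub>C v) \<in> T"
      unfolding M_def by auto
    from self_adjoint_add[OF T this] show "x + y \<in> M"
      unfolding M_def by (auto intro!: exI[of _ "u + v"] simp: scaleC_add_right algebra_simps)
  next
    fix c x assume "x \<in> M"
    then obtain u where "(u, x + z *\<^sub>C u) \<in> T"
      unfolding M_def by auto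
    from self_adjoint_scale[OF T this, of c] show "c *\<^sub>C x \<in> M"
      unfolding M_def by (auto intro!: exI[of _ "c *\<^sub>C u"] simp: scaleC_add_right scaleC_scaleC mult.commute)
  next
    fix y assume y: "\<And>x. x \<in> M \<Longrightarrow> cinner x y = 0"
    have "(y, 0 + cnj z *\<^sub>C y) \<in> T"
    proof (rule self_adjoint_memI[OF T])
      fix u v assume "(u, v) \<in> T"
      then have "v - z *\<^sub>C u \<in> M" unfolding M_def by (auto intro!: exI[of _ u])
      from y[OF this] show "cinner v y = cinner u (0 + cnj z *\<^sub>C y)"
        by (simp add: cinner_simps)
    qed
    from self_adjoint_resolvent_bound[OF T this] z show "y = 0" by (simp add: mult_le_0_iff)
  qed
  then have "x \<in> M"
  proof (rule mem_closed_subspace_if_dense)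
    fix s l assume s: "\<And>n. s n \<in> M" "s \<longlonglongrightarrow> l"
    then obtain u where u: "\<And>n. (u n, s n + z *\<^sub>C u n) \<in> T"
      unfolding M_def mem_Collect_eq by metis
    have diff: "\<bar>Im z\<bar> * norm (u k - u l) \<le> norm (s k - s l)" for k l
    proof -
      have "(u k - u l, (s k - s l) + z *\<^sub>C (u k - u l)) \<in> T"
        using self_adjoint_diff[OF T u[of k] u[of l]] by (simp add: scaleC_diff_right algebra_simps)
      from self_adjoint_resolvent_bound[OF T this] show ?thesis .
    qed
    have "Cauchy u"
    proof (rule CauchyI)
      fix e :: real assume "e > 0"
      then have "e * \<bar>Im z\<bar> > 0" using z by simp
      then obtain N where N: "\<And>k l. k \<ge> N \<Longrightarrow> l \<ge> N \<Longrightarrow> norm (s k - s l) < e * \<bar>Im z\<bar>"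
        using CauchyD[OF LIMSEQ_imp_Cauchy[OF s(2)]] by meson
      have "norm (u k - u l) < e" if "k \<ge> N" "l \<ge> N" for k l
      proof -
        have "\<bar>Im z\<bar> * norm (u k - u l) < \<bar>Im z\<bar> * e"
          using diff[of k l] N[OF that] by (simp add: mult.commute)
        then show ?thesis using z by simp
      qed
      then show "\<exists>N. \<forall>k\<ge>N. \<forall>l\<ge>N. norm (u k - u l) < e" by blast
    qed
    then obtain w where w: "u \<longlonglongrightarrow> w" using Cauchy_convergent convergent_def by blast
    have "(\<lambda>n. s n + z *\<^sub>C u n) \<longlonglongrightarrow> l + z *\<^sub>C w"
      by (intro tendsto_intros s w)
    from self_adjoint_closed[OF T u w this] show "l \<in> M" unfolding M_def by blast
  qed
  then show ?thesis unfolding M_def by simp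
qed

lemma resolvent_eqI:
  assumes "self_adjoint T" "Im z \<noteq> 0" "(u, x + z *\<^sub>C u) \<in> T"
  shows "resolvent T z x = u"
  unfolding resolvent_def using assms(3) self_adjoint_resolvent_unique[OF assms(1,2)] by blast

lemma resolvent_mem:
  assumes "self_adjoint T" "Im z \<noteq> 0"
  shows "(resolvent T z x, x + z *\<^sub>C resolvent T z x) \<in> T"
  using self_adjoint_resolvent_exists[OF assms, of x] resolvent_eqI[OF assms] by metis

lemma clinear_resolvent:
  assumes "self_adjoint T" "Im z \<noteq> 0"
  shows "clinear (resolvent T z)"
proof (rule clinearI; rule resolvent_eqI[OF assms])
  fix x y c
  show "(resolvent T z x + resolvent T z y, x + y + z *\<^sub>C (resolvent T z x + resolvent T z y)) \<in> T"
    using self_adjoint_add[OF assms(1) resolvent_mem[OF assms, of x] resolvent_mem[OF assms, of y]]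
    by (simp add: scaleC_add_right algebra_simps)
  show "(c *\<^sub>C resolvent T z x, c *\<^sub>C x + z *\<^sub>C c *\<^sub>C resolvent T z x) \<in> T"
    using self_adjoint_scale[OF assms(1) resolvent_mem[OF assms, of x], of c]
    by (simp add: scaleC_add_right scaleC_scaleC mult.commute)
qed

lemma resolvent_adjoint:
  assumes T: "self_adjoint T" and z: "Im z \<noteq> 0"
  shows "cinner (resolvent T z x) y = cinner x (resolvent T (cnj z) y)"
proof -
  have "Im (cnj z) \<noteq> 0" using z by simp
  from self_adjoint_symmetric[OF T resolvent_mem[OF T z, of x] resolvent_mem[OF T this, of y]]
  show ?thesis by (simp add: cinner_simps)
qed

lemma resolvent_identity:
  assumes T: "self_adjoint T" and z: "Im z \<noteq> 0" and w: "Im w \<noteq> 0"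
  shows "resolvent T z x = resolvent T w x + (z - w) *\<^sub>C resolvent T w (resolvent T z x)"
proof -
  have "resolvent T w (x + (z - w) *\<^sub>C resolvent T z x) = resolvent T z x"
    using resolvent_mem[OF T z, of x]
    by (intro resolvent_eqI[OF T w]) (simp add: scaleC_diff_left)
  then show ?thesis
    by (simp add: clinear_add[OF clinear_resolvent[OF T w]] clinear_scale[OF clinear_resolvent[OF T w]])
qed

lemma self_adjoint_eq_graph:
  assumes T: "self_adjoint T" and z: "Im z \<noteq> 0"
  shows "T = {(resolvent T z x, x + z *\<^sub>C resolvent T z x) | x. True}"
proof -
  have "(u, v) \<in> {(resolvent T z x, x + z *\<^sub>C resolvent T z x) | x. True}" if "(u, v) \<in> T" for u v
  proof -
    have "resolvent T z (v - z *\<^sub>C u) = u"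
      using that by (intro resolvent_eqI[OF T z]) simp
    then show ?thesis by (intro CollectI exI[of _ "v - z *\<^sub>C u"]) simp
  qed
  then show ?thesis using resolvent_mem[OF T z] by auto
qed

lemma self_adjoint_eq_if_resolvent_eq:
  assumes "self_adjoint T" "self_adjoint T'" "Im z \<noteq> 0" "\<And>x. resolvent T z x = resolvent T' z x"
  shows "T = T'"
  using self_adjoint_eq_graph[OF assms(1,3)] self_adjoint_eq_graph[OF assms(2,3)] assms(4) by simp

text \<open>A pseudo-resolvent with trivial kernel and the symmetry of a self-adjoint operator is a
  resolvent. Krein's formula supplies just such a family, and the perturbed operator is recovered
  from its value at \<open>\<i>\<close>.\<close>

lemma resolvent_family:
  fixes R :: "complex \<Rightarrow> 'h::complex_hilbert \<Rightarrow> 'h"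
  assumes lin: "\<And>z. Im z \<noteq> 0 \<Longrightarrow> clinear (R z)"
    and adj: "\<And>z x y. Im z \<noteq> 0 \<Longrightarrow> cinner (R z x) y = cinner x (R (cnj z) y)"
    and ident: "\<And>z w x. Im z \<noteq> 0 \<Longrightarrow> Im w \<noteq> 0 \<Longrightarrow> R z x = R w x + (z - w) *\<^sub>C R w (R z x)"
    and inj: "\<And>z x. Im z \<noteq> 0 \<Longrightarrow> R z x = 0 \<Longrightarrow> x = 0"
  defines "T \<equiv> {(R \<i> x, x + \<i> *\<^sub>C R \<i> x) | x. True}"
  shows "self_adjoint T" "\<And>z x. Im z \<noteq> 0 \<Longrightarrow> resolvent T z x = R z x"
proof -
  have i: "Im \<i> \<noteq> 0" "Im (- \<i>) \<noteq> 0" by simp_all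
  have mem: "(R z x, x + z *\<^sub>C R z x) \<in> T" if z: "Im z \<noteq> 0" for z x
  proof -
    \<comment> \<open>By the resolvent identity \<open>R \<i>\<close> maps this vector to
      \<open>R z x\<close>, so the graph built at \<open>\<i>\<close> contains the pairs belonging
      to every nonreal \<open>z\<close>.\<close>
    let ?y = "x + (z - \<i>) *\<^sub>C R z x"
    have *: "R \<i> ?y = R z x"
      using ident[OF z i(1), of x] by (simp add: clinear_add[OF lin[OF i(1)]] clinear_scale[OF lin[OF i(1)]])
    moreover have "?y + \<i> *\<^sub>C R z x = x + z *\<^sub>C R z x"
      by (simp add: scaleC_diff_left)
    ultimately show ?thesis unfolding T_def by (intro CollectI exI[of _ ?y]) simp
  qed
  have sym: "cinner v y = cinner x w" if xv: "(x, v) \<in> T" and yw: "(y, w) \<in> T" for x v y w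
  proof -
    obtain a b where a: "x = R \<i> a" "v = a + \<i> *\<^sub>C R \<i> a" and b: "y = R \<i> b" "w = b + \<i> *\<^sub>C R \<i> b"
      using xv yw unfolding T_def by auto
    have "cinner x w - cinner v y = cinner (R \<i> a) b + 2 * \<i> * cinner (R \<i> a) (R \<i> b) - cinner a (R \<i> b)"
      by (simp add: a b cinner_simps)
    also have "\<dots> = cinner a (R (- \<i>) b) + 2 * \<i> * cinner a (R (- \<i>) (R \<i> b)) - cinner a (R \<i> b)"
      using adj[OF i(1), of a] by simp
    also have "\<dots> = cinner a (R (- \<i>) b + (2 * \<i>) *\<^sub>C R (- \<i>) (R \<i> b) - R \<i> b)"
      by (simp add: cinner_simps)
    also have "\<dots> = 0"
      using ident[OF i(1) i(2), of b] by simp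
    finally show ?thesis by simp
  qed
  have dense: "closure (Domain T) = UNIV"
  proof (rule closure_eq_UNIV_if_orthogonal_complement_trivial)
    have D: "Domain T = range (R \<i>)" unfolding T_def by auto
    have "0 = R \<i> 0" by (simp add: clinear_zero[OF lin[OF i(1)]])
    then show "0 \<in> Domain T" unfolding D by (rule range_eqI)
    fix x y c assume "x \<in> Domain T"
    then obtain a where a: "x = R \<i> a" using D by auto
    have "c *\<^sub>C x = R \<i> (c *\<^sub>C a)"
      by (simp add: a clinear_scale[OF lin[OF i(1)]])
    then show "c *\<^sub>C x \<in> Domain T" using D by simp
    assume "y \<in> Domain T"
    then obtain b where b: "y = R \<i> b" using D by auto
    have "x + y = R \<i> (a + b)"
      by (simp add: a b clinear_add[OF lin[OF i(1)]])
    then show "x + y \<in> Domain T" using D by simp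
  next
    have D: "Domain T = range (R \<i>)" unfolding T_def by auto
    show "y = 0" if "\<And>x. x \<in> Domain T \<Longrightarrow> cinner x y = 0" for y
    proof -
      have "cinner x (R (- \<i>) y) = cinner x 0" for x
        using that[of "R \<i> x"] adj[OF i(1), of x y] D by simp
      then have "R (- \<i>) y = 0" by (rule cinner_ext)
      then show ?thesis by (rule inj[OF i(2)])
    qed
  qed
  have "(y, w) \<in> T" if "(y, w) \<in> adjoint_graph T" for y w
  proof -
    have yw: "cinner v y = cinner x w" if "(x, v) \<in> T" for x v
      using that \<open>(y, w) \<in> adjoint_graph T\<close> unfolding adjoint_graph_def by auto
    \<comment> \<open>\<open>y0\<close> solves \<open>T y0 + \<i> y0 = w + \<i> y\<close>. Testing
      \<open>y - y0\<close> against the range of \<open>T - \<i>\<close>, which is the whole space,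
      shows that \<open>y = y0\<close>.\<close>
    define y0 where "y0 = R (- \<i>) (w + \<i> *\<^sub>C y)"
    have m0: "(y0, w + \<i> *\<^sub>C y - \<i> *\<^sub>C y0) \<in> T"
      using mem[OF i(2), of "w + \<i> *\<^sub>C y"] unfolding y0_def by simp
    have "cinner a (y - y0) = cinner a 0" for a
    proof -
      have "cinner (a + \<i> *\<^sub>C R \<i> a) y = cinner (R \<i> a) w"
        by (rule yw[OF mem[OF i(1)]])
      moreover have "cinner (a + \<i> *\<^sub>C R \<i> a) y0 = cinner (R \<i> a) (w + \<i> *\<^sub>C y - \<i> *\<^sub>C y0)"
        by (rule sym[OF mem[OF i(1)] m0])
      ultimately show ?thesis by (simp add: cinner_simps algebra_simps diff_eq_eq)
    qed
    then have "y - y0 = 0" by (rule cinner_ext)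
    then show ?thesis using m0 by simp
  qed
  moreover have "T \<subseteq> adjoint_graph T"
    unfolding adjoint_graph_def using sym by auto
  ultimately show T: "self_adjoint T"
    unfolding self_adjoint_def using dense by auto
  show "resolvent T z x = R z x" if "Im z \<noteq> 0" for z x
    by (rule resolvent_eqI[OF T that mem[OF that]])
qed

section \<open>A bounded Borel functional calculus\<close>

definition bounded_borel :: "('a::topological_space \<Rightarrow> complex) \<Rightarrow> bool" where
  "bounded_borel f \<longleftrightarrow> f \<in> borel_measurable borel \<and> (\<exists>C. \<forall>t. cmod (f t) \<le> C)"

lemma bounded_borelI: "f \<in> borel_measurable borel \<Longrightarrow> (\<And>t. cmod (f t) \<le> C) \<Longrightarrow> bounded_borel f"
  unfolding bounded_borel_def by auto

lemma bounded_borel_measurable [measurable_dest]: "bounded_borel f \<Longrightarrow> f \<in> borel_measurable borel"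
  unfolding bounded_borel_def by auto

lemma bounded_borel_bound: "bounded_borel f \<Longrightarrow> (\<And>C. C > 0 \<Longrightarrow> (\<And>t. cmod (f t) \<le> C) \<Longrightarrow> thesis) \<Longrightarrow> thesis"
proof -
  assume "bounded_borel f" and *: "\<And>C. C > 0 \<Longrightarrow> (\<And>t. cmod (f t) \<le> C) \<Longrightarrow> thesis"
  then obtain C where C: "\<And>t. cmod (f t) \<le> C" unfolding bounded_borel_def by auto
  show thesis
  proof (rule *)
    show "max 1 C > 0" by simp
    show "cmod (f t) \<le> max 1 C" for t using C[of t] by simp
  qed
qed

lemma bounded_borel_const [intro, simp]: "bounded_borel (\<lambda>_. c)"
  by (rule bounded_borelI[of _ "cmod c"]) auto

lemma bounded_borel_add [intro]: "bounded_borel f \<Longrightarrow> bounded_borel g \<Longrightarrow> bounded_borel (\<lambda>t. f t + g t)"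
proof -
  assume f: "bounded_borel f" and g: "bounded_borel g"
  obtain C D where "\<And>t. cmod (f t) \<le> C" "\<And>t. cmod (g t) \<le> D"
    using bounded_borel_bound f g by metis
  then show ?thesis
    using f g by (intro bounded_borelI[of _ "C + D"]) (auto intro: norm_triangle_mono)
qed

lemma bounded_borel_mult [intro]: "bounded_borel f \<Longrightarrow> bounded_borel g \<Longrightarrow> bounded_borel (\<lambda>t. f t * g t)"
proof -
  assume f: "bounded_borel f" and g: "bounded_borel g"
  obtain C D where *: "\<And>t. cmod (f t) \<le> C" "\<And>t. cmod (g t) \<le> D" "C > 0"
    using bounded_borel_bound f g by metis
  show ?thesis
    using f g * by (intro bounded_borelI[of _ "C * D"]) (auto simp: norm_mult intro!: mult_mono intro: less_imp_le)
qed

lemma bounded_borel_cnj [intro]: "bounded_borel f \<Longrightarrow> bounded_borel (\<lambda>t. cnj (f t))"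
  unfolding bounded_borel_def
  using borel_measurable_continuous_onI[OF continuous_on_cnj[OF continuous_on_id]]
  by (auto intro: measurable_compose[of f borel borel cnj])

lemma bounded_borel_minus [intro]: "bounded_borel f \<Longrightarrow> bounded_borel (\<lambda>t. - f t)"
  unfolding bounded_borel_def by auto

lemma bounded_borel_diff [intro]: "bounded_borel f \<Longrightarrow> bounded_borel g \<Longrightarrow> bounded_borel (\<lambda>t. f t - g t)"
  using bounded_borel_add[of f "\<lambda>t. - g t"] bounded_borel_minus[of g] by simp

lemma bounded_borel_sum [intro]: "(\<And>i. i \<in> I \<Longrightarrow> bounded_borel (f i)) \<Longrightarrow> bounded_borel (\<lambda>t. \<Sum>i\<in>I. f i t)"
  by (induction I rule: infinite_finite_induct) auto

lemma bounded_borel_indicator [intro]: "S \<in> sets borel \<Longrightarrow> bounded_borel (indicator S)"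
  by (rule bounded_borelI[of _ 1]) (auto simp: indicator_def)

lemma LIMSEQ_zero_squeeze:
  fixes f h :: "nat \<Rightarrow> real"
  assumes "\<And>n. 0 \<le> f n" "\<And>n. f n \<le> h n" "h \<longlonglongrightarrow> 0"
  shows "f \<longlonglongrightarrow> 0"
  by (rule tendsto_sandwich[OF always_eventually always_eventually tendsto_const assms(3)])
     (use assms in auto)

lemma LIMSEQ_if_norm_sq_le:
  fixes X :: "nat \<Rightarrow> 'a::real_normed_vector"
  assumes le: "\<And>n. (norm (X n - l))\<^sup>2 \<le> c n" and c: "c \<longlonglongrightarrow> 0"
  shows "X \<longlonglongrightarrow> l"
proof -
  have "(\<lambda>n. sqrt (c n)) \<longlonglongrightarrow> 0" using tendsto_real_sqrt[OF c] by simp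
  moreover have "norm (X n - l) \<le> sqrt (c n)" for n using le by (rule real_le_rsqrt)
  ultimately have "(\<lambda>n. X n - l) \<longlonglongrightarrow> 0"
    by (intro Lim_null_comparison[of "\<lambda>n. X n - l" "\<lambda>n. sqrt (c n)"]) (auto intro: always_eventually)
  then show ?thesis by (rule LIM_zero_cancel)
qed

text \<open>Abstract input of a functional calculus: a multiplicative, conjugation-closed family of
  function-operator pairs whose quadratic forms are integrals against measures \<open>M x\<close>.
  It is instantiated by indicators and projections on the real line, and by trigonometric monomials
  and powers of a unitary operator on the circle.\<close>

locale vector_measures =
  fixes base :: "(('a::topological_space \<Rightarrow> complex) \<times> ('h::complex_hilbert \<Rightarrow> 'h)) set"
    and M :: "'h \<Rightarrow> 'a measure"
  assumes sets_M [measurable_cong]: "\<And>x. sets (M x) = sets borel"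
    and finite_M: "\<And>x. finite_measure (M x)"
    and base_bounded_borel: "\<And>f F. (f, F) \<in> base \<Longrightarrow> bounded_borel f"
    and base_linear: "\<And>f F. (f, F) \<in> base \<Longrightarrow> clinear F"
    and base_mult: "\<And>f F g G. (f, F) \<in> base \<Longrightarrow> (g, G) \<in> base \<Longrightarrow> (\<lambda>t. f t * g t, \<lambda>x. F (G x)) \<in> base"
    and base_adjoint: "\<And>f F. (f, F) \<in> base \<Longrightarrow>
      \<exists>F'. (\<lambda>t. cnj (f t), F') \<in> base \<and> (\<forall>x y. cinner (F x) y = cinner x (F' y))"
    and base_one: "(\<lambda>_. 1, \<lambda>x. x) \<in> base"
    and base_integral: "\<And>f F x. (f, F) \<in> base \<Longrightarrow> cinner x (F x) = (LINT t|M x. f t)"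
begin

text \<open>The linear span of \<open>base\<close>, kept as a relation, so that the operator
  belonging to a function never has to be shown independent of a representation.\<close>

inductive_set alg :: "(('a \<Rightarrow> complex) \<times> ('h \<Rightarrow> 'h)) set" where
  alg_base: "(f, F) \<in> base \<Longrightarrow> (f, F) \<in> alg"
| alg_add: "(f, F) \<in> alg \<Longrightarrow> (g, G) \<in> alg \<Longrightarrow> (\<lambda>t. f t + g t, \<lambda>x. F x + G x) \<in> alg"
| alg_scale: "(f, F) \<in> alg \<Longrightarrow> (\<lambda>t. c * f t, \<lambda>x. c *\<^sub>C F x) \<in> alg"

lemma space_M [simp]: "space (M x) = UNIV"
  using sets_eq_imp_space_eq[OF sets_M] by simp

lemma integrable_bounded_borel [intro]:
  assumes "bounded_borel f" shows "integrable (M x) f"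
proof -
  interpret finite_measure "M x" by (rule finite_M)
  obtain C where "C > 0" "\<And>t. cmod (f t) \<le> C" using bounded_borel_bound[OF assms] by blast
  then show ?thesis using assms by (intro integrable_const_bound[of _ C]) auto
qed

lemma integrable_bounded_borel_sq [intro]:
  assumes "bounded_borel f" shows "integrable (M x) (\<lambda>t. (cmod (f t))\<^sup>2)"
proof -
  have "bounded_borel (\<lambda>t. f t * cnj (f t))" using assms by auto
  from integrable_bounded_borel[OF this, of x]
  have "integrable (M x) (\<lambda>t. Re (f t * cnj (f t)))" by (rule integrable_Re)
  then show ?thesis by (simp only: cmod_power2 complex_mult_cnj Re_complex_of_real)
qed

lemma alg_bounded_borel: "(f, F) \<in> alg \<Longrightarrow> bounded_borel f"
  by (induction rule: alg.induct) (auto intro: base_bounded_borel)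

lemma alg_linear: "(f, F) \<in> alg \<Longrightarrow> clinear F"
proof (induction rule: alg.induct)
  case (alg_base f F) then show ?case by (rule base_linear)
next
  case (alg_add f F g G) then show ?case by (simp add: clinear_iff scaleC_add_right)
next
  case (alg_scale f F c) then show ?case by (simp add: clinear_iff scaleC_add_right scaleC_scaleC mult.commute)
qed

lemma alg_one: "(\<lambda>_. 1, \<lambda>x. x) \<in> alg"
  by (rule alg_base[OF base_one])

lemma alg_diff: "(f, F) \<in> alg \<Longrightarrow> (g, G) \<in> alg \<Longrightarrow> (\<lambda>t. f t - g t, \<lambda>x. F x - G x) \<in> alg"
  using alg_add[OF _ alg_scale[of g G "-1"], of f F] by simp

lemma alg_mult_base:
  "(f, F) \<in> alg \<Longrightarrow> (g, G) \<in> base \<Longrightarrow> (\<lambda>t. f t * g t, \<lambda>x. F (G x)) \<in> alg"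
proof (induction rule: alg.induct)
  case (alg_base f F) then show ?case by (intro alg.alg_base base_mult)
next
  case (alg_add f F f' F')
  from alg.alg_add[OF alg_add.IH(1)[OF alg_add.prems] alg_add.IH(2)[OF alg_add.prems]]
  show ?case by (simp add: distrib_right)
next
  case (alg_scale f F c)
  from alg.alg_scale[OF alg_scale.IH[OF alg_scale.prems], of c] show ?case by (simp add: mult.assoc)
qed

lemma alg_mult:
  "(g, G) \<in> alg \<Longrightarrow> (f, F) \<in> alg \<Longrightarrow> (\<lambda>t. f t * g t, \<lambda>x. F (G x)) \<in> alg"
proof (induction rule: alg.induct)
  case (alg_base g G) then show ?case by (intro alg_mult_base)
next
  case (alg_add g G g' G')
  from alg.alg_add[OF alg_add.IH(1)[OF alg_add.prems] alg_add.IH(2)[OF alg_add.prems]]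
  show ?case by (simp add: distrib_left clinear_add[OF alg_linear[OF alg_add.prems]])
next
  case (alg_scale g G c)
  from alg.alg_scale[OF alg_scale.IH[OF alg_scale.prems], of c]
  show ?case by (simp add: clinear_scale[OF alg_linear[OF alg_scale.prems]] ac_simps)
qed

lemma alg_adjoint:
  "(f, F) \<in> alg \<Longrightarrow> \<exists>F'. (\<lambda>t. cnj (f t), F') \<in> alg \<and> (\<forall>x y. cinner (F x) y = cinner x (F' y))"
proof (induction rule: alg.induct)
  case (alg_base f F) then show ?case using base_adjoint alg.alg_base by blast
next
  case (alg_add f F g G)
  then obtain F' G' where "(\<lambda>t. cnj (f t), F') \<in> alg" "\<forall>x y. cinner (F x) y = cinner x (F' y)"
    "(\<lambda>t. cnj (g t), G') \<in> alg" "\<forall>x y. cinner (G x) y = cinner x (G' y)" by blast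
  with alg.alg_add[of "\<lambda>t. cnj (f t)" F' "\<lambda>t. cnj (g t)" G'] show ?case
    by (intro exI[of _ "\<lambda>x. F' x + G' x"]) (simp add: cinner_simps)
next
  case (alg_scale f F c)
  then obtain F' where "(\<lambda>t. cnj (f t), F') \<in> alg" "\<forall>x y. cinner (F x) y = cinner x (F' y)" by blast
  with alg.alg_scale[of "\<lambda>t. cnj (f t)" F' "cnj c"] show ?case
    by (intro exI[of _ "\<lambda>x. cnj c *\<^sub>C F' x"]) (simp add: cinner_simps)
qed

lemma alg_integral: "(f, F) \<in> alg \<Longrightarrow> cinner x (F x) = (LINT t|M x. f t)"
proof (induction rule: alg.induct)
  case (alg_base f F) then show ?case by (rule base_integral)
next
  case (alg_add f F g G)
  then show ?case
    using integrable_bounded_borel[OF alg_bounded_borel[OF alg_add.hyps(1)], of x]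
      integrable_bounded_borel[OF alg_bounded_borel[OF alg_add.hyps(2)], of x]
    by (simp add: cinner_simps)
next
  case (alg_scale f F c) then show ?case by (simp add: cinner_simps)
qed

definition sqint :: "'h \<Rightarrow> ('a \<Rightarrow> complex) \<Rightarrow> real" where
  "sqint x f = (LINT t|M x. (cmod (f t))\<^sup>2)"

lemma sqint_eq: "complex_of_real (sqint x f) = (LINT t|M x. cnj (f t) * f t)"
proof -
  have "(LINT t|M x. cnj (f t) * f t) = (LINT t|M x. complex_of_real ((cmod (f t))\<^sup>2))"
    by (rule Bochner_Integration.integral_cong) (auto simp: complex_norm_square mult.commute simp del: of_real_power)
  then show ?thesis by (simp only: sqint_def integral_complex_of_real)
qed

lemma sqint_nonneg: "sqint x f \<ge> 0"
  unfolding sqint_def by simp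

text \<open>The isometry on which the calculus rests: \<open>(norm (F x))\<^sup>2\<close> is the
  quadratic form of the adjoint times \<open>F\<close>, an element of the algebra with function
  \<open>cnj f * f\<close>.\<close>

lemma alg_norm: assumes "(f, F) \<in> alg" shows "(norm (F x))\<^sup>2 = sqint x f"
proof -
  obtain F' where F': "(\<lambda>t. cnj (f t), F') \<in> alg" "\<And>x y. cinner (F x) y = cinner x (F' y)"
    using alg_adjoint[OF assms] by blast
  have "complex_of_real ((norm (F x))\<^sup>2) = cinner x (F' (F x))"
    by (simp only: F'(2)[symmetric] cinner_self)
  also have "\<dots> = complex_of_real (sqint x f)"
    unfolding sqint_eq using alg_integral[OF alg_mult[OF assms F'(1)]] by simp
  finally show ?thesis using of_real_eq_iff by blast
qed

lemma sqint_add_le: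
  assumes f: "bounded_borel f" and g: "bounded_borel g"
  shows "sqint x (\<lambda>t. f t + g t) \<le> 2 * sqint x f + 2 * sqint x g"
proof -
  have "sqint x (\<lambda>t. f t + g t) \<le> (LINT t|M x. 2 * (cmod (f t))\<^sup>2 + 2 * (cmod (g t))\<^sup>2)"
    unfolding sqint_def
  proof (rule integral_mono)
    show "integrable (M x) (\<lambda>t. (cmod (f t + g t))\<^sup>2)"
      using f g by (intro integrable_bounded_borel_sq bounded_borel_add)
    show "integrable (M x) (\<lambda>t. 2 * (cmod (f t))\<^sup>2 + 2 * (cmod (g t))\<^sup>2)"
      using integrable_bounded_borel_sq[OF f, of x] integrable_bounded_borel_sq[OF g, of x] by simp
    fix t
    have "(cmod (f t + g t))\<^sup>2 \<le> (cmod (f t) + cmod (g t))\<^sup>2"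
      by (intro power_mono norm_triangle_ineq) simp
    also have "\<dots> \<le> 2 * (cmod (f t))\<^sup>2 + 2 * (cmod (g t))\<^sup>2"
      using sum_squares_bound[of "cmod (f t)" "cmod (g t)"] by (simp add: power2_sum)
    finally show "(cmod (f t + g t))\<^sup>2 \<le> 2 * (cmod (f t))\<^sup>2 + 2 * (cmod (g t))\<^sup>2" .
  qed
  also have "\<dots> = 2 * sqint x f + 2 * sqint x g"
    using integrable_bounded_borel_sq[OF f, of x] integrable_bounded_borel_sq[OF g, of x]
    by (simp add: sqint_def)
  finally show ?thesis .
qed

lemma sqint_diff_triangle:
  assumes "bounded_borel f" "bounded_borel g" "bounded_borel h"
  shows "sqint x (\<lambda>t. f t - h t) \<le> 2 * sqint x (\<lambda>t. f t - g t) + 2 * sqint x (\<lambda>t. g t - h t)"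
  using sqint_add_le[of "\<lambda>t. f t - g t" "\<lambda>t. g t - h t" x] assms by auto

lemma sqint_scale: "sqint x (\<lambda>t. c * f t) = (cmod c)\<^sup>2 * sqint x f"
  by (simp add: sqint_def norm_mult power_mult_distrib)

lemma sqint_cnj: "sqint x (\<lambda>t. cnj (f t)) = sqint x f"
  by (simp add: sqint_def)

lemma sqint_mult_le:
  assumes f: "bounded_borel f" and g: "bounded_borel g" and C: "\<And>t. cmod (f t) \<le> C"
  shows "sqint x (\<lambda>t. f t * g t) \<le> C\<^sup>2 * sqint x g"
proof -
  have "sqint x (\<lambda>t. f t * g t) \<le> (LINT t|M x. C\<^sup>2 * (cmod (g t))\<^sup>2)"
    unfolding sqint_def
  proof (rule integral_mono)
    show "integrable (M x) (\<lambda>t. (cmod (f t * g t))\<^sup>2)"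
      using f g by (intro integrable_bounded_borel_sq bounded_borel_mult)
    show "integrable (M x) (\<lambda>t. C\<^sup>2 * (cmod (g t))\<^sup>2)"
      using integrable_bounded_borel_sq[OF g, of x] by simp
  qed (auto simp: norm_mult power_mult_distrib intro!: mult_right_mono power_mono C)
  then show ?thesis by (simp add: sqint_def)
qed

lemma sqint_limit:
  assumes f: "\<And>n. bounded_borel (f n)" and g: "bounded_borel g"
    and lim: "\<And>t. (\<lambda>n. f n t) \<longlonglongrightarrow> g t" and C: "\<And>n t. cmod (f n t) \<le> C"
  shows "(\<lambda>n. sqint x (\<lambda>t. f n t - g t)) \<longlonglongrightarrow> 0"
proof -
  interpret finite_measure "M x" by (rule finite_M)
  have Cg: "cmod (g t) \<le> C" for t
    using tendsto_norm[OF lim[of t]] C by (intro LIMSEQ_le_const2) auto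
  have *: "cmod (f n t - g t) \<le> 2 * C" for n t
    using C[of n t] Cg[of t] norm_triangle_ineq4[of "f n t" "g t"] by linarith
  have "(\<lambda>n. LINT t|M x. (cmod (f n t - g t))\<^sup>2) \<longlonglongrightarrow> (LINT t|M x. 0)"
  proof (rule integral_dominated_convergence)
    show "(\<lambda>t. 0) \<in> borel_measurable (M x)" by simp
    show "(\<lambda>t. (cmod (f n t - g t))\<^sup>2) \<in> borel_measurable (M x)" for n
      using f g by measurable
    show "integrable (M x) (\<lambda>t. (2 * C)\<^sup>2)" by simp
    show "AE t in M x. (\<lambda>n. (cmod (f n t - g t))\<^sup>2) \<longlonglongrightarrow> 0"
    proof (rule AE_I2)
      fix t
      have "(\<lambda>n. (cmod (f n t - g t))\<^sup>2) \<longlonglongrightarrow> (cmod (g t - g t))\<^sup>2"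
        by (intro tendsto_intros lim)
      then show "(\<lambda>n. (cmod (f n t - g t))\<^sup>2) \<longlonglongrightarrow> 0" by simp
    qed
    show "AE t in M x. norm ((cmod (f n t - g t))\<^sup>2) \<le> (2 * C)\<^sup>2" for n
    proof (rule AE_I2)
      fix t
      show "norm ((cmod (f n t - g t))\<^sup>2) \<le> (2 * C)\<^sup>2"
        using power_mono[OF *[of n t] norm_ge_zero, of 2] by simp
    qed
  qed
  then show ?thesis by (simp add: sqint_def)
qed

text \<open>Pointwise \<open>cmod (f t) \<le> e + (cmod (f t))\<^sup>2 / e\<close>. The free
  parameter \<open>e\<close> makes this as good as Cauchy-Schwarz for passing from L2 to L1
  convergence.\<close>

lemma integral_le_sqint:
  assumes f: "bounded_borel f" and e: "e > 0"
  shows "cmod (LINT t|M x. f t) \<le> e * measure (M x) UNIV + sqint x f / e"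
proof -
  interpret finite_measure "M x" by (rule finite_M)
  have "cmod (LINT t|M x. f t) \<le> (LINT t|M x. cmod (f t))" by simp
  also have "\<dots> \<le> (LINT t|M x. e + (cmod (f t))\<^sup>2 / e)"
  proof (rule integral_mono)
    show "integrable (M x) (\<lambda>t. cmod (f t))" using integrable_bounded_borel[OF f] by simp
    show "integrable (M x) (\<lambda>t. e + (cmod (f t))\<^sup>2 / e)"
      using integrable_bounded_borel_sq[OF f, of x] by simp
    fix t
    have "0 \<le> cmod (f t) * e" using e by simp
    then have "cmod (f t) * e \<le> e\<^sup>2 + (cmod (f t))\<^sup>2"
      using sum_squares_bound[of "cmod (f t)" e] by linarith
    then show "cmod (f t) \<le> e + (cmod (f t))\<^sup>2 / e"
      using e by (simp add: field_simps power2_eq_square)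
  qed
  also have "\<dots> = e * measure (M x) UNIV + sqint x f / e"
    using integrable_bounded_borel_sq[OF f, of x] by (simp add: sqint_def)
  finally show ?thesis .
qed

lemma integral_tendsto_if_sqint:
  assumes g: "\<And>n. bounded_borel (g n)" and f: "bounded_borel f"
    and lim: "(\<lambda>n. sqint x (\<lambda>t. g n t - f t)) \<longlonglongrightarrow> 0"
  shows "(\<lambda>n. LINT t|M x. g n t) \<longlonglongrightarrow> (LINT t|M x. f t)"
proof (rule LIMSEQ_I)
  fix r :: real assume r: "r > 0"
  define m where "m = measure (M x) UNIV + 1"
  have m: "m > 0" unfolding m_def using measure_nonneg[of "M x" UNIV] by linarith
  define e where "e = r / (2 * m)"
  have e: "e > 0" using r m by (simp add: e_def)
  have "eventually (\<lambda>n. sqint x (\<lambda>t. g n t - f t) < e * (r / 2)) sequentially"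
    using lim e r by (intro order_tendstoD) auto
  then obtain N where N: "\<And>n. n \<ge> N \<Longrightarrow> sqint x (\<lambda>t. g n t - f t) < e * (r / 2)"
    by (auto simp: eventually_sequentially)
  have "norm ((LINT t|M x. g n t) - (LINT t|M x. f t)) < r" if "n \<ge> N" for n
  proof -
    have "norm ((LINT t|M x. g n t) - (LINT t|M x. f t)) = cmod (LINT t|M x. g n t - f t)"
      using integrable_bounded_borel[OF g, of x n] integrable_bounded_borel[OF f, of x] by simp
    also have "\<dots> \<le> e * measure (M x) UNIV + sqint x (\<lambda>t. g n t - f t) / e"
      using g f e by (intro integral_le_sqint) auto
    also have "\<dots> < e * m + r / 2"
    proof -
      have "sqint x (\<lambda>t. g n t - f t) / e < r / 2" using N[OF that] e by (simp add: field_simps)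
      moreover have "e * measure (M x) UNIV \<le> e * m" using e by (simp add: m_def)
      ultimately show ?thesis by linarith
    qed
    also have "\<dots> = r" using m by (simp add: e_def)
    finally show ?thesis .
  qed
  then show "\<exists>N. \<forall>n\<ge>N. norm ((LINT t|M x. g n t) - (LINT t|M x. f t)) < r" by blast
qed

text \<open>L2 density of the algebra, at finitely many vectors simultaneously: linearity of the
  calculus compares the values at \<open>x\<close>, \<open>y\<close> and \<open>x + y\<close>, which
  see different measures but must share one approximating sequence.\<close>

definition approximable :: "('a \<Rightarrow> complex) \<Rightarrow> bool" where
  "approximable f \<longleftrightarrow> (\<forall>X e. finite X \<longrightarrow> e > 0 \<longrightarrow>
     (\<exists>g G. (g, G) \<in> alg \<and> (\<forall>x\<in>X. sqint x (\<lambda>t. g t - f t) < e)))"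

lemma approximableD:
  assumes "approximable f" "finite X" "e > 0"
  obtains g G where "(g, G) \<in> alg" "\<And>x. x \<in> X \<Longrightarrow> sqint x (\<lambda>t. g t - f t) < e"
  using assms unfolding approximable_def by metis

lemma approximable_alg: "(f, F) \<in> alg \<Longrightarrow> approximable f"
  unfolding approximable_def sqint_def by (intro allI impI exI[of _ f] exI[of _ F]) auto

lemma approximable_closed:
  assumes f: "bounded_borel f"
    and *: "\<And>X e. finite X \<Longrightarrow> e > 0 \<Longrightarrow>
      \<exists>g. bounded_borel g \<and> approximable g \<and> (\<forall>x\<in>X. sqint x (\<lambda>t. g t - f t) < e)"
  shows "approximable f"
  unfolding approximable_def
proof (intro allI impI)
  fix X :: "'h set" and e :: real assume X: "finite X" and e: "e > 0"
  then obtain g where g: "bounded_borel g" "approximable g" "\<And>x. x \<in> X \<Longrightarrow> sqint x (\<lambda>t. g t - f t) < e / 4"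
    using *[OF X, of "e / 4"] by auto
  obtain h H where h: "(h, H) \<in> alg" "\<And>x. x \<in> X \<Longrightarrow> sqint x (\<lambda>t. h t - g t) < e / 4"
    using approximableD[OF g(2) X, of "e / 4"] e by auto
  have "sqint x (\<lambda>t. h t - f t) < e" if "x \<in> X" for x
    using sqint_diff_triangle[OF alg_bounded_borel[OF h(1)] g(1) f, of x] g(3)[OF that] h(2)[OF that] by linarith
  then show "\<exists>g G. (g, G) \<in> alg \<and> (\<forall>x\<in>X. sqint x (\<lambda>t. g t - f t) < e)" using h(1) by blast
qed

lemma approximable_limit:
  assumes f: "\<And>n. bounded_borel (f n)" "\<And>n. approximable (f n)" and g: "bounded_borel g"
    and lim: "\<And>t. (\<lambda>n. f n t) \<longlonglongrightarrow> g t" and C: "\<And>n t. cmod (f n t) \<le> C"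
  shows "approximable g"
proof (rule approximable_closed[OF g])
  fix X :: "'h set" and e :: real assume X: "finite X" and e: "e > 0"
  have "eventually (\<lambda>n. \<forall>x\<in>X. sqint x (\<lambda>t. f n t - g t) < e) sequentially"
    using X e by (intro eventually_ball_finite ballI order_tendstoD(2)[OF sqint_limit[OF f(1) g lim C]])
  then obtain n where "\<forall>x\<in>X. sqint x (\<lambda>t. f n t - g t) < e"
    using eventually_happens'[OF sequentially_bot] by blast
  then show "\<exists>h. bounded_borel h \<and> approximable h \<and> (\<forall>x\<in>X. sqint x (\<lambda>t. h t - g t) < e)"
    using f by blast
qed

lemma approximable_add:
  assumes f: "bounded_borel f" "approximable f" and g: "bounded_borel g" "approximable g"
  shows "approximable (\<lambda>t. f t + g t)"
  unfolding approximable_def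
proof (intro allI impI)
  fix X :: "'h set" and e :: real assume X: "finite X" and e: "e > 0"
  obtain f' F' where f': "(f', F') \<in> alg" "\<And>x. x \<in> X \<Longrightarrow> sqint x (\<lambda>t. f' t - f t) < e / 4"
    using approximableD[OF f(2) X, of "e / 4"] e by auto
  obtain g' G' where g': "(g', G') \<in> alg" "\<And>x. x \<in> X \<Longrightarrow> sqint x (\<lambda>t. g' t - g t) < e / 4"
    using approximableD[OF g(2) X, of "e / 4"] e by auto
  have "sqint x (\<lambda>t. f' t + g' t - (f t + g t)) < e" if "x \<in> X" for x
  proof -
    have "sqint x (\<lambda>t. (f' t - f t) + (g' t - g t)) < e"
      using sqint_add_le[of "\<lambda>t. f' t - f t" "\<lambda>t. g' t - g t" x] f'(2)[OF that] g'(2)[OF that]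
        alg_bounded_borel[OF f'(1)] alg_bounded_borel[OF g'(1)] f(1) g(1)
        bounded_borel_diff by fastforce
    then show ?thesis by (simp add: algebra_simps)
  qed
  then show "\<exists>h H. (h, H) \<in> alg \<and> (\<forall>x\<in>X. sqint x (\<lambda>t. h t - (f t + g t)) < e)"
    using alg_add[OF f'(1) g'(1)] by blast
qed

lemma approximable_scale:
  assumes f: "approximable f"
  shows "approximable (\<lambda>t. c * f t)"
  unfolding approximable_def
proof (intro allI impI)
  fix X :: "'h set" and e :: real assume X: "finite X" and e: "e > 0"
  \<comment> \<open>The summand 1 keeps the tolerance \<open>e / ?d\<close> meaningful when
    \<open>c = 0\<close>.\<close>
  let ?d = "(cmod c)\<^sup>2 + 1"
  have d: "?d > 0" by (simp add: add_nonneg_pos)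
  obtain f' F' where f': "(f', F') \<in> alg" "\<And>x. x \<in> X \<Longrightarrow> sqint x (\<lambda>t. f' t - f t) < e / ?d"
    using approximableD[OF f X, of "e / ?d"] e d by auto
  have "sqint x (\<lambda>t. c * f' t - c * f t) < e" if "x \<in> X" for x
  proof -
    have "sqint x (\<lambda>t. c * f' t - c * f t) = (cmod c)\<^sup>2 * sqint x (\<lambda>t. f' t - f t)"
      using sqint_scale[of x c "\<lambda>t. f' t - f t"] by (simp add: right_diff_distrib)
    also have "\<dots> \<le> ?d * sqint x (\<lambda>t. f' t - f t)"
      by (intro mult_right_mono sqint_nonneg) simp
    also have "\<dots> < e" using f'(2)[OF that] d by (simp add: field_simps)
    finally show ?thesis .
  qed
  then show "\<exists>h H. (h, H) \<in> alg \<and> (\<forall>x\<in>X. sqint x (\<lambda>t. h t - c * f t) < e)"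
    using alg_scale[OF f'(1)] by blast
qed

lemma approximable_sum:
  assumes "\<And>i. i \<in> I \<Longrightarrow> bounded_borel (f i)" "\<And>i. i \<in> I \<Longrightarrow> approximable (f i)"
  shows "approximable (\<lambda>t. \<Sum>i\<in>I. f i t)"
  using assms
proof (induction I rule: infinite_finite_induct)
  case (insert i I)
  then show ?case by (auto intro!: approximable_add)
qed (use approximable_scale[OF approximable_alg[OF alg_one], of 0] in auto)

end

text \<open>\<open>gen\<close> collects the sets whose density is checked by hand: all Borel sets
  for a projection-valued measure, the closed sets for the circle. Dynkin's theorem extends it to
  the Borel sets.\<close>

locale l2_calculus = vector_measures base M
  for base :: "(('a::topological_space \<Rightarrow> complex) \<times> ('h::complex_hilbert \<Rightarrow> 'h)) set"
    and M :: "'h \<Rightarrow> 'a measure" +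
  fixes gen :: "'a set set"
  assumes gen_Int_stable: "Int_stable gen"
    and sigma_sets_gen: "sets borel = sigma_sets UNIV gen"
    and gen_approximable: "\<And>S. S \<in> gen \<Longrightarrow> approximable (indicator S)"
begin

lemma approximable_indicator:
  assumes "S \<in> sets borel"
  shows "approximable (indicator S)"
proof -
  have b: "S \<in> sets borel" if "S \<in> sigma_sets UNIV gen" for S
    using that sigma_sets_gen by blast
  from assms have "S \<in> sigma_sets UNIV gen" using sigma_sets_gen by blast
  then show ?thesis
  proof (induction rule: sigma_sets_induct_disjoint[OF gen_Int_stable subset_UNIV[of gen, folded Pow_UNIV], consumes 1], goal_cases)
    case (1 S) then show ?case by (rule gen_approximable)
  next
    case 2
    show ?case using approximable_scale[OF approximable_alg[OF alg_one], of 0] by (simp add: indicator_def[abs_def])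
  next
    case (3 A)
    have "approximable (\<lambda>t. 1 + (-1) * indicator A t)"
      using 3 b by (intro approximable_add approximable_scale approximable_alg[OF alg_one]) auto
    moreover have "(\<lambda>t. 1 + (-1) * indicator A t :: complex) = indicator (UNIV - A)"
      by (auto simp: indicator_def fun_eq_iff)
    ultimately show ?case by simp
  next
    case (4 A)
    have A: "A i \<in> sets borel" for i using 4 b by auto
    show ?case
    proof (rule approximable_limit[of "\<lambda>n. indicator (\<Union>i<n. A i)" _ 1])
      show "bounded_borel (indicator (\<Union>i<n. A i))" for n using A by auto
      show "bounded_borel (indicator (\<Union>i. A i))" using A by auto
      show "(\<lambda>n. indicator (\<Union>i<n. A i) t) \<longlonglongrightarrow> (indicator (\<Union>i. A i) t::complex)" for t
        by (rule LIMSEQ_indicator_UN)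
      show "cmod (indicator (\<Union>i<n. A i) t) \<le> 1" for n t by (auto simp: indicator_def)
      show "approximable (indicator (\<Union>i<n. A i))" for n
      proof -
        have "approximable (\<lambda>t. \<Sum>i<n. indicator (A i) t)"
          using 4 A by (intro approximable_sum) auto
        moreover have "(\<lambda>t. \<Sum>i<n. indicator (A i) t :: complex) = indicator (\<Union>i<n. A i)"
          using 4(1) by (intro ext indicator_UN_disjoint[symmetric]) (auto simp: disjoint_family_on_def)
        ultimately show ?thesis by simp
      qed
    qed
  qed
qed

lemma approximable_bounded_borel:
  assumes f: "bounded_borel f"
  shows "approximable f"
proof -
  obtain C where C: "C > 0" "\<And>t. cmod (f t) \<le> C" using bounded_borel_bound[OF f] by blast
  obtain s where s: "\<And>i. simple_function borel (s i)" "\<And>t. (\<lambda>i. s i t) \<longlonglongrightarrow> f t"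
    "\<And>i t. dist (s i t) 0 \<le> 2 * dist (f t) 0"
    using borel_measurable_implies_sequence_metric[OF bounded_borel_measurable[OF f], of 0] by auto
  show ?thesis
  proof (rule approximable_limit[OF _ _ f s(2)])
    show le: "cmod (s n t) \<le> 2 * C" for n t using s(3)[of n t] C(2)[of t] by simp
    show "bounded_borel (s n)" for n
      using borel_measurable_simple_function[OF s(1)] le by (rule bounded_borelI)
    show "approximable (s n)" for n
    proof -
      have fin: "finite (range (s n))" and m: "\<And>y. s n -` {y} \<in> sets borel"
        using s(1)[of n] simple_functionD[OF s(1)[of n]] by (auto simp: simple_function_def)
      have eq: "s n = (\<lambda>t. \<Sum>y\<in>range (s n). y * indicator (s n -` {y}) t)"
      proof
        fix t
        show "s n t = (\<Sum>y\<in>range (s n). y * indicator (s n -` {y}) t)"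
          using fin by (subst sum.remove[of _ "s n t"]) (auto intro!: sum.neutral simp: indicator_def)
      qed
      show ?thesis
        by (subst eq, rule approximable_sum)
           (rule bounded_borel_mult[OF bounded_borel_const bounded_borel_indicator[OF m]],
            rule approximable_scale[OF approximable_indicator[OF m]])
    qed
  qed
qed

text \<open>\<open>Phi f\<close> is \<open>\<integral> f dP\<close>. It is pinned down by its distance to the operators \<open>G\<close> of the algebra, since
  \<open>\<parallel>G x - Phi f x\<parallel>\<close> is the distance of \<open>g\<close> and \<open>f\<close> in \<open>L\<^sup>2\<close> of the vector measure of \<open>x\<close>; the factor 2
  leaves room for approximations.\<close>

definition Phi :: "('a \<Rightarrow> complex) \<Rightarrow> 'h \<Rightarrow> 'h" where
  "Phi f x = (THE y. \<forall>(g, G)\<in>alg. (norm (G x - y))\<^sup>2 \<le> 2 * sqint x (\<lambda>t. g t - f t))"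

lemma approximating_sequence:
  assumes "bounded_borel f" "finite X"
  obtains g G where "\<And>n::nat. (g n, G n) \<in> alg" "\<And>x. x \<in> X \<Longrightarrow> (\<lambda>n. sqint x (\<lambda>t. g n t - f t)) \<longlonglongrightarrow> 0"
proof -
  have "\<exists>g G. (g, G) \<in> alg \<and> (\<forall>x\<in>X. sqint x (\<lambda>t. g t - f t) < 1 / real (Suc n))" for n
    by (rule approximableD[OF approximable_bounded_borel[OF assms(1)] assms(2), of "1 / real (Suc n)"]) auto
  then obtain g G where *: "\<And>n. (g n, G n) \<in> alg" "\<And>n x. x \<in> X \<Longrightarrow> sqint x (\<lambda>t. g n t - f t) < 1 / real (Suc n)"
    by metis
  have "(\<lambda>n. sqint x (\<lambda>t. g n t - f t)) \<longlonglongrightarrow> 0" if "x \<in> X" for x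
    using *(2)[OF that]
    by (intro LIMSEQ_zero_squeeze[OF sqint_nonneg _ LIMSEQ_Suc[OF lim_1_over_n]] less_imp_le)
  with *(1) show thesis by (rule that)
qed

lemma norm_sum_sq_le: "(norm (x + y))\<^sup>2 \<le> 2 * (norm x)\<^sup>2 + 2 * (norm (y::'h))\<^sup>2"
  using parallelogram_law[of x y] by (metis le_add_same_cancel1 zero_le_power2)

text \<open>For approximants \<open>H n\<close> of \<open>f\<close>, the vectors
  \<open>H n x\<close> are Cauchy by the isometry. Their limit inherits the bound with factor 2
  because the error of \<open>h n\<close> disappears in the limit.\<close>

lemma Phi_approx:
  assumes f: "bounded_borel f" and g: "(g, G) \<in> alg"
  shows "(norm (G x - Phi f x))\<^sup>2 \<le> 2 * sqint x (\<lambda>t. g t - f t)"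
proof -
  obtain h H where h: "\<And>n::nat. (h n, H n) \<in> alg" and "\<And>z. z \<in> {x} \<Longrightarrow> (\<lambda>n. sqint z (\<lambda>t. h n t - f t)) \<longlonglongrightarrow> 0"
    using approximating_sequence[OF f, of "{x}"] by auto
  then have lim: "(\<lambda>n. sqint x (\<lambda>t. h n t - f t)) \<longlonglongrightarrow> 0" by simp
  have d: "(norm (G' x - H n x))\<^sup>2 \<le> 2 * sqint x (\<lambda>t. g' t - f t) + 2 * sqint x (\<lambda>t. h n t - f t)"
    if "(g', G') \<in> alg" for g' G' n
  proof -
    have "(norm (G' x - H n x))\<^sup>2 = sqint x (\<lambda>t. g' t - h n t)"
      by (rule alg_norm[OF alg_diff[OF that h]])
    also have "\<dots> \<le> 2 * sqint x (\<lambda>t. g' t - f t) + 2 * sqint x (\<lambda>t. f t - h n t)"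
      by (rule sqint_diff_triangle[OF alg_bounded_borel[OF that] f alg_bounded_borel[OF h]])
    finally show ?thesis by (simp add: sqint_def norm_minus_commute)
  qed
  have "Cauchy (\<lambda>n. H n x)"
  proof (rule CauchyI)
    fix e :: real assume e: "e > 0"
    then have "eventually (\<lambda>n. sqint x (\<lambda>t. h n t - f t) < e\<^sup>2 / 4) sequentially"
      using lim by (intro order_tendstoD) auto
    then obtain N where N: "\<And>n. n \<ge> N \<Longrightarrow> sqint x (\<lambda>t. h n t - f t) < e\<^sup>2 / 4"
      by (auto simp: eventually_sequentially)
    have "norm (H k x - H l x) < e" if "k \<ge> N" "l \<ge> N" for k l
    proof -
      have "(norm (H k x - H l x))\<^sup>2 < e\<^sup>2"
        using d[OF h, of k l] N[OF that(1)] N[OF that(2)] by linarith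
      then show ?thesis using e by (simp add: power2_less_imp_less)
    qed
    then show "\<exists>N. \<forall>k\<ge>N. \<forall>l\<ge>N. norm (H k x - H l x) < e" by blast
  qed
  then obtain y where y: "(\<lambda>n. H n x) \<longlonglongrightarrow> y" using Cauchy_convergent convergent_def by blast
  have ex: "(norm (G' x - y))\<^sup>2 \<le> 2 * sqint x (\<lambda>t. g' t - f t)" if "(g', G') \<in> alg" for g' G'
  proof -
    have "(\<lambda>n. (norm (G' x - H n x))\<^sup>2) \<longlonglongrightarrow> (norm (G' x - y))\<^sup>2"
      by (intro tendsto_intros y)
    moreover have "(\<lambda>n. 2 * sqint x (\<lambda>t. g' t - f t) + 2 * sqint x (\<lambda>t. h n t - f t)) \<longlonglongrightarrow> 2 * sqint x (\<lambda>t. g' t - f t) + 2 * 0"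
      by (intro tendsto_intros lim)
    ultimately show ?thesis using d[OF that] LIMSEQ_le by fastforce
  qed
  have un: "y' = y" if y': "\<forall>(g, G)\<in>alg. (norm (G x - y'))\<^sup>2 \<le> 2 * sqint x (\<lambda>t. g t - f t)" for y'
  proof -
    \<comment> \<open>8 = 2 * 2 + 2 * 2: the characterizing bound for \<open>y\<close> and for
      \<open>y'\<close>, each doubled by the squared triangle inequality.\<close>
    have "(norm (y - y'))\<^sup>2 \<le> 8 * sqint x (\<lambda>t. h n t - f t)" for n
    proof -
      have "(norm (y - y'))\<^sup>2 \<le> 2 * (norm (y - H n x))\<^sup>2 + 2 * (norm (H n x - y'))\<^sup>2"
        using norm_sum_sq_le[of "y - H n x" "H n x - y'"] by simp
      then show ?thesis
        using ex[OF h, of n] bspec[OF y' h, of n] by (simp add: norm_minus_commute)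
    qed
    moreover have "(\<lambda>n. 8 * sqint x (\<lambda>t. h n t - f t)) \<longlonglongrightarrow> 8 * 0"
      by (intro tendsto_intros lim)
    ultimately have "(norm (y - y'))\<^sup>2 \<le> 8 * 0" using LIMSEQ_le_const by blast
    then show ?thesis by simp
  qed
  have "Phi f x = y"
    unfolding Phi_def using ex un by (intro the_equality) auto
  then show ?thesis using ex[OF g] by simp
qed

lemma Phi_tendsto:
  assumes f: "bounded_borel f" and g: "\<And>n. (g n, G n) \<in> alg"
    and lim: "(\<lambda>n. sqint x (\<lambda>t. g n t - f t)) \<longlonglongrightarrow> 0"
  shows "(\<lambda>n. G n x) \<longlonglongrightarrow> Phi f x"
proof -
  have "(\<lambda>n. 2 * sqint x (\<lambda>t. g n t - f t)) \<longlonglongrightarrow> 2 * 0" by (intro tendsto_intros lim)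
  then show ?thesis using LIMSEQ_if_norm_sq_le[OF Phi_approx[OF f g]] by simp
qed

lemma Phi_alg: "(f, F) \<in> alg \<Longrightarrow> Phi f x = F x"
  using Phi_approx[OF alg_bounded_borel, of f F f F x] by (simp add: sqint_def)

lemma clinear_Phi:
  assumes f: "bounded_borel f"
  shows "clinear (Phi f)"
proof (rule clinearI)
  fix x y c
  obtain g G where g: "\<And>n::nat. (g n, G n) \<in> alg"
    "\<And>z. z \<in> {x, y, x + y, c *\<^sub>C x} \<Longrightarrow> (\<lambda>n. sqint z (\<lambda>t. g n t - f t)) \<longlonglongrightarrow> 0"
    using approximating_sequence[OF f, of "{x, y, x + y, c *\<^sub>C x}"] by auto
  have lim: "(\<lambda>n. G n z) \<longlonglongrightarrow> Phi f z" if "z \<in> {x, y, x + y, c *\<^sub>C x}" for z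
    using Phi_tendsto[OF f g(1) g(2)[OF that]] .
  have "(\<lambda>n. G n (x + y)) \<longlonglongrightarrow> Phi f x + Phi f y"
    unfolding clinear_add[OF alg_linear[OF g(1)]] by (intro tendsto_intros lim) auto
  with lim[of "x + y"] show "Phi f (x + y) = Phi f x + Phi f y" using LIMSEQ_unique by blast
  have "(\<lambda>n. G n (c *\<^sub>C x)) \<longlonglongrightarrow> c *\<^sub>C Phi f x"
    unfolding clinear_scale[OF alg_linear[OF g(1)]] by (intro tendsto_intros lim) auto
  with lim[of "c *\<^sub>C x"] show "Phi f (c *\<^sub>C x) = c *\<^sub>C Phi f x" using LIMSEQ_unique by blast
qed

lemma Phi_adjoint:
  assumes f: "bounded_borel f"
  shows "cinner (Phi f x) y = cinner x (Phi (\<lambda>t. cnj (f t)) y)"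
proof -
  obtain g G where g: "\<And>n::nat. (g n, G n) \<in> alg" 
    "\<And>z. z \<in> {x, y} \<Longrightarrow> (\<lambda>n. sqint z (\<lambda>t. g n t - f t)) \<longlonglongrightarrow> 0"
    using approximating_sequence[OF f, of "{x, y}"] by auto
  obtain G' where G': "\<And>n. (\<lambda>t. cnj (g n t), G' n) \<in> alg" "\<And>n x y. cinner (G n x) y = cinner x (G' n y)"
    using alg_adjoint[OF g(1)] by metis
  have "(\<lambda>n. sqint y (\<lambda>t. cnj (g n t) - cnj (f t))) \<longlonglongrightarrow> 0"
    using g(2)[of y] by (simp add: sqint_cnj complex_cnj_diff[symmetric] del: complex_cnj_diff)
  from Phi_tendsto[OF bounded_borel_cnj[OF f] G'(1) this]
  have "(\<lambda>n. cinner x (G' n y)) \<longlonglongrightarrow> cinner x (Phi (\<lambda>t. cnj (f t)) y)"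
    by (intro tendsto_intros)
  moreover have "(\<lambda>n. cinner (G n x) y) \<longlonglongrightarrow> cinner (Phi f x) y"
    using Phi_tendsto[OF f g(1) g(2)] by (intro tendsto_intros) auto
  ultimately show ?thesis using G'(2) LIMSEQ_unique by auto
qed

lemma Phi_integral:
  assumes f: "bounded_borel f"
  shows "cinner x (Phi f x) = (LINT t|M x. f t)"
proof -
  obtain g G where g: "\<And>n::nat. (g n, G n) \<in> alg" 
    "\<And>z. z \<in> {x} \<Longrightarrow> (\<lambda>n. sqint z (\<lambda>t. g n t - f t)) \<longlonglongrightarrow> 0"
    using approximating_sequence[OF f, of "{x}"] by auto
  have "(\<lambda>n. LINT t|M x. g n t) \<longlonglongrightarrow> (LINT t|M x. f t)"
    using g f by (intro integral_tendsto_if_sqint alg_bounded_borel[OF g(1)]) auto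
  moreover have "(\<lambda>n. cinner x (G n x)) \<longlonglongrightarrow> cinner x (Phi f x)"
    using Phi_tendsto[OF f g(1) g(2)] by (intro tendsto_intros) auto
  ultimately show ?thesis using alg_integral[OF g(1)] LIMSEQ_unique by auto
qed

lemma Phi_add:
  assumes f: "bounded_borel f" and g: "bounded_borel g"
  shows "Phi (\<lambda>t. f t + g t) x = Phi f x + Phi g x"
proof -
  have "Phi (\<lambda>t. f t + g t) = (\<lambda>x. Phi f x + Phi g x)"
  proof (rule quadratic_form_unique)
    show "clinear (Phi (\<lambda>t. f t + g t))" using f g by (intro clinear_Phi) auto
    show "clinear (\<lambda>x. Phi f x + Phi g x)"
      using clinear_Phi[OF f] clinear_Phi[OF g] by (simp add: clinear_iff scaleC_add_right)
    show "cinner x (Phi (\<lambda>t. f t + g t) x) = cinner x (Phi f x + Phi g x)" for x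
      using f g integrable_bounded_borel[OF f, of x] integrable_bounded_borel[OF g, of x]
      by (simp add: cinner_simps Phi_integral bounded_borel_add)
  qed
  then show ?thesis by simp
qed

lemma Phi_scale:
  assumes f: "bounded_borel f"
  shows "Phi (\<lambda>t. c * f t) x = c *\<^sub>C Phi f x"
proof -
  have "Phi (\<lambda>t. c * f t) = (\<lambda>x. c *\<^sub>C Phi f x)"
  proof (rule quadratic_form_unique)
    show "clinear (Phi (\<lambda>t. c * f t))" using f by (intro clinear_Phi) auto
    show "clinear (\<lambda>x. c *\<^sub>C Phi f x)"
      using clinear_Phi[OF f] by (simp add: clinear_iff scaleC_add_right scaleC_scaleC mult.commute)
    show "cinner x (Phi (\<lambda>t. c * f t) x) = cinner x (c *\<^sub>C Phi f x)" for x
      using f by (simp add: cinner_simps Phi_integral bounded_borel_mult)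
  qed
  then show ?thesis by simp
qed

lemma Phi_diff:
  assumes f: "bounded_borel f" and g: "bounded_borel g"
  shows "Phi (\<lambda>t. f t - g t) x = Phi f x - Phi g x"
  using Phi_add[OF f, of "\<lambda>t. (-1) * g t"] Phi_scale[OF g, of "-1"] g by auto

lemma Phi_one [simp]: "Phi (\<lambda>_. 1) x = x"
  by (rule Phi_alg[OF alg_one])

lemma Phi_zero [simp]: "Phi (\<lambda>_. 0) x = 0"
  using Phi_scale[of "\<lambda>_. 1" 0 x] by simp

text \<open>Two stages: the left factor first lies in the algebra, then is general. In the second
  stage the approximants of \<open>f\<close> have no common bound, so the product is controlled by
  the bound \<open>D\<close> of \<open>g\<close>, and \<open>f\<close> is approximated at
  \<open>x\<close> and at \<open>Phi g x\<close> together.\<close>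

lemma Phi_mult:
  assumes f: "bounded_borel f" and g: "bounded_borel g"
  shows "Phi (\<lambda>t. f t * g t) x = Phi f (Phi g x)"
proof -
  have 1: "Phi (\<lambda>t. h t * g t) x = H (Phi g x)" if h: "(h, H) \<in> alg" for h H x
  proof -
    obtain C where C: "C > 0" "\<And>t. cmod (h t) \<le> C" using bounded_borel_bound[OF alg_bounded_borel[OF h]] by blast
    obtain k K where k: "\<And>n::nat. (k n, K n) \<in> alg" and "\<And>z. z \<in> {x} \<Longrightarrow> (\<lambda>n. sqint z (\<lambda>t. k n t - g t)) \<longlonglongrightarrow> 0"
      using approximating_sequence[OF g, of "{x}"] by auto
    then have lim: "(\<lambda>n. sqint x (\<lambda>t. k n t - g t)) \<longlonglongrightarrow> 0" by simp
    have "(\<lambda>n. C\<^sup>2 * sqint x (\<lambda>t. k n t - g t)) \<longlonglongrightarrow> C\<^sup>2 * 0" by (intro tendsto_intros lim)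
    moreover have "sqint x (\<lambda>t. h t * k n t - h t * g t) \<le> C\<^sup>2 * sqint x (\<lambda>t. k n t - g t)" for n
      using sqint_mult_le[OF alg_bounded_borel[OF h] bounded_borel_diff[OF alg_bounded_borel[OF k] g] C(2), of x n]
      by (simp add: right_diff_distrib)
    ultimately have "(\<lambda>n. sqint x (\<lambda>t. h t * k n t - h t * g t)) \<longlonglongrightarrow> 0"
      using LIMSEQ_zero_squeeze[OF sqint_nonneg] by fastforce
    from Phi_tendsto[OF bounded_borel_mult[OF alg_bounded_borel[OF h] g] alg_mult[OF k h] this]
    have "(\<lambda>n. H (K n x)) \<longlonglongrightarrow> Phi (\<lambda>t. h t * g t) x" .
    moreover have "(\<lambda>n. H (K n x)) \<longlonglongrightarrow> H (Phi g x)"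
    proof (rule clinear_tendsto[OF alg_linear[OF h] _ Phi_tendsto[OF g k lim], of C])
      fix y
      have "(norm (H y))\<^sup>2 = sqint y (\<lambda>t. h t * 1)" using alg_norm[OF h] by simp
      also have "\<dots> \<le> C\<^sup>2 * sqint y (\<lambda>_. 1)"
        by (rule sqint_mult_le[OF alg_bounded_borel[OF h] bounded_borel_const C(2)])
      also have "\<dots> = (C * norm y)\<^sup>2" using alg_norm[OF alg_one, of y] by (simp add: power_mult_distrib)
      finally show "norm (H y) \<le> C * norm y"
        by (rule power2_le_imp_le) (use C in auto)
    qed
    ultimately show ?thesis using LIMSEQ_unique by blast
  qed
  obtain D where D: "D > 0" "\<And>t. cmod (g t) \<le> D" using bounded_borel_bound[OF g] by blast
  obtain k K where k: "\<And>n::nat. (k n, K n) \<in> alg"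
    and lim: "\<And>z. z \<in> {x, Phi g x} \<Longrightarrow> (\<lambda>n. sqint z (\<lambda>t. k n t - f t)) \<longlonglongrightarrow> 0"
    using approximating_sequence[OF f, of "{x, Phi g x}"] by auto
  have "(\<lambda>n. 2 * (D\<^sup>2 * sqint x (\<lambda>t. k n t - f t))) \<longlonglongrightarrow> 2 * (D\<^sup>2 * 0)"
    by (intro tendsto_intros lim) simp
  moreover have "(norm (K n (Phi g x) - Phi (\<lambda>t. f t * g t) x))\<^sup>2 \<le> 2 * (D\<^sup>2 * sqint x (\<lambda>t. k n t - f t))" for n
  proof -
    have kn: "bounded_borel (k n)" by (rule alg_bounded_borel[OF k])
    have "K n (Phi g x) - Phi (\<lambda>t. f t * g t) x = Phi (\<lambda>t. g t * (k n t - f t)) x"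
      unfolding 1[OF k, symmetric] using kn f g
      by (subst Phi_diff[symmetric]) (auto simp: algebra_simps)
    \<comment> \<open>Comparison with the zero operator of the algebra bounds the norm up to a
      factor 2; the exact \<open>Phi_norm\<close> is derived later from multiplicativity.\<close>
    then have "(norm (K n (Phi g x) - Phi (\<lambda>t. f t * g t) x))\<^sup>2 \<le> 2 * sqint x (\<lambda>t. g t * (k n t - f t))"
      using Phi_approx[OF bounded_borel_mult[OF g bounded_borel_diff[OF kn f]] alg_scale[OF alg_one, of 0], of x]
      by (simp add: sqint_def)
    also have "\<dots> \<le> 2 * (D\<^sup>2 * sqint x (\<lambda>t. k n t - f t))"
      using kn f g D(2) by (intro mult_left_mono sqint_mult_le) auto
    finally show ?thesis .
  qed
  ultimately have "(\<lambda>n. K n (Phi g x)) \<longlonglongrightarrow> Phi (\<lambda>t. f t * g t) x"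
    using LIMSEQ_if_norm_sq_le[of "\<lambda>n. K n (Phi g x)" _ "\<lambda>n. 2 * (D\<^sup>2 * sqint x (\<lambda>t. k n t - f t))"]
    by simp
  moreover have "(\<lambda>n. K n (Phi g x)) \<longlonglongrightarrow> Phi f (Phi g x)"
    by (rule Phi_tendsto[OF f k lim]) simp
  ultimately show ?thesis using LIMSEQ_unique by blast
qed

lemma Phi_norm:
  assumes f: "bounded_borel f"
  shows "(norm (Phi f x))\<^sup>2 = sqint x f"
proof -
  have "complex_of_real ((norm (Phi f x))\<^sup>2) = cinner x (Phi (\<lambda>t. cnj (f t)) (Phi f x))"
    using f by (simp only: Phi_adjoint[symmetric] cinner_self)
  also have "\<dots> = complex_of_real (sqint x f)"
    using f by (simp add: sqint_eq Phi_mult[symmetric] Phi_integral bounded_borel_mult bounded_borel_cnj)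
  finally show ?thesis using of_real_eq_iff by blast
qed

lemma Phi_bound:
  assumes f: "bounded_borel f" and C: "\<And>t. cmod (f t) \<le> C"
  shows "norm (Phi f x) \<le> C * norm x"
proof (rule power2_le_imp_le)
  have C0: "C \<ge> 0" using C norm_ge_zero order_trans by blast
  then show "0 \<le> C * norm x" by simp
  have "(norm (Phi f x))\<^sup>2 = sqint x (\<lambda>t. f t * 1)" using Phi_norm[OF f] by simp
  also have "\<dots> \<le> C\<^sup>2 * sqint x (\<lambda>_. 1)" by (rule sqint_mult_le[OF f bounded_borel_const C])
  also have "\<dots> = (C * norm x)\<^sup>2" using Phi_norm[of "\<lambda>_. 1" x] by (simp add: power_mult_distrib)
  finally show "(norm (Phi f x))\<^sup>2 \<le> (C * norm x)\<^sup>2" .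
qed

text \<open>Turns conditions on the measure of a transformed vector, such as a finite second moment,
  into bounds on the function \<open>f\<close>.\<close>

lemma Phi_vector_measure:
  assumes f: "bounded_borel f"
  shows "M (Phi f x) = density (M x) (\<lambda>t. ennreal ((cmod (f t))\<^sup>2))"
proof (rule measure_eqI)
  fix S assume "S \<in> sets (M (Phi f x))"
  then have S: "S \<in> sets borel" by (simp add: sets_M)
  interpret a: finite_measure "M (Phi f x)" by (rule finite_M)
  have i: "bounded_borel (indicator S)" using S by auto
  have "ennreal (measure (M (Phi f x)) S) = ennreal (sqint (Phi f x) (indicator S))"
  proof -
    have "(cmod (indicator S t))\<^sup>2 = indicator S t" for t by (simp add: indicator_def)
    then show ?thesis using S by (simp add: sqint_def sets_M)
  qed
  also have "\<dots> = ennreal (sqint x (\<lambda>t. indicator S t * f t))"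
    using f i by (simp add: Phi_norm[symmetric] Phi_mult bounded_borel_mult)
  also have "\<dots> = (\<integral>\<^sup>+t. ennreal ((cmod (f t))\<^sup>2) * indicator S t \<partial>M x)"
    unfolding sqint_def
    using f i by (subst nn_integral_eq_integral[symmetric])
      (auto intro!: nn_integral_cong split: split_indicator)
  finally show "emeasure (M (Phi f x)) S = emeasure (density (M x) (\<lambda>t. ennreal ((cmod (f t))\<^sup>2))) S"
    using S f by (simp add: emeasure_density sets_M a.emeasure_eq_measure)
qed (simp add: sets_M)

end

context l2_calculus
begin

lemma Phi_limit:
  assumes f: "\<And>n. bounded_borel (f n)" and g: "bounded_borel g"
    and lim: "\<And>t. (\<lambda>n. f n t) \<longlonglongrightarrow> g t" and C: "\<And>n t. cmod (f n t) \<le> C"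
  shows "(\<lambda>n. Phi (f n) x) \<longlonglongrightarrow> Phi g x"
proof (rule LIMSEQ_if_norm_sq_le)
  show "(norm (Phi (f n) x - Phi g x))\<^sup>2 \<le> sqint x (\<lambda>t. f n t - g t)" for n
    using Phi_norm[OF bounded_borel_diff[OF f[of n] g], of x] by (simp add: Phi_diff[OF f g])
  show "(\<lambda>n. sqint x (\<lambda>t. f n t - g t)) \<longlonglongrightarrow> 0"
    using f g lim C by (rule sqint_limit)
qed

lemma Phi_cong_if_sqint_zero:
  assumes f: "bounded_borel f" and g: "bounded_borel g" and 0: "sqint x (\<lambda>t. f t - g t) = 0"
  shows "Phi f x = Phi g x"
  using Phi_norm[OF bounded_borel_diff[OF f g], of x] 0 by (simp add: Phi_diff[OF f g])

end

section \<open>Projection-valued measures\<close>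

locale pvm =
  fixes P :: "real set \<Rightarrow> 'h::complex_hilbert \<Rightarrow> 'h"
  assumes pvm: "projection_valued_measure P"
begin

lemma proj_linear: "S \<in> sets borel \<Longrightarrow> clinear (P S)"
  and proj_idem: "S \<in> sets borel \<Longrightarrow> P S (P S x) = P S x"
  and proj_adj: "S \<in> sets borel \<Longrightarrow> cinner (P S x) y = cinner x (P S y)"
  and proj_UNIV: "P UNIV x = x"
  and proj_sums: "range A \<subseteq> sets borel \<Longrightarrow> disjoint_family A \<Longrightarrow> (\<lambda>n. P (A n) x) sums P (\<Union>n. A n) x"
  using pvm unfolding projection_valued_measure_def orthogonal_projection_def by auto

text \<open>A constant series converges only if its term is zero.\<close>

lemma proj_empty: "P {} x = 0"
proof -
  have "(\<lambda>n::nat. P {} x) sums P (\<Union>n::nat. {}) x"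
    by (rule proj_sums) (auto simp: disjoint_family_on_def)
  then show ?thesis using sums_summable summable_LIMSEQ_zero LIMSEQ_const_iff by blast
qed

lemma proj_Un:
  assumes A: "A \<in> sets borel" and B: "B \<in> sets borel" and "A \<inter> B = {}"
  shows "P (A \<union> B) x = P A x + P B x"
proof -
  have "(\<lambda>n. P (binaryset A B n) x) sums P (\<Union>n. binaryset A B n) x"
    using assms by (intro proj_sums) (auto simp: range_binaryset_eq disjoint_family_on_def binaryset_def)
  then have "(\<lambda>n. P (binaryset A B n) x) sums P (A \<union> B) x" by (simp add: UN_binaryset_eq)
  moreover have "(\<lambda>n. P (binaryset A B n) x) sums (\<Sum>n\<in>{0,1}. P (binaryset A B n) x)"
    by (rule sums_finite) (auto simp: binaryset_def proj_empty)
  ultimately have "P (A \<union> B) x = (\<Sum>n\<in>{0,1}. P (binaryset A B n) x)" using sums_unique2 by blast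
  then show ?thesis by (simp add: binaryset_def)
qed

lemma cinner_proj: "S \<in> sets borel \<Longrightarrow> cinner x (P S x) = complex_of_real ((norm (P S x))\<^sup>2)"
  by (metis proj_adj proj_idem cinner_self)

lemma norm_proj_le: 
  assumes "S \<in> sets borel" shows "norm (P S x) \<le> norm x"
proof (cases "P S x = 0")
  case False
  have "(norm (P S x))\<^sup>2 \<le> norm x * norm (P S x)"
    using complex_Cauchy_Schwarz[of x "P S x"] unfolding cinner_proj[OF assms] norm_of_real by simp
  then show ?thesis using False by (simp add: power2_eq_square)
qed simp

text \<open>Multiplicativity follows from additivity: \<open>P (A \<union> B)\<close> is a
  contraction that sends \<open>y = P B x\<close> to \<open>P A y + y\<close>, whose squared norm
  exceeds that of \<open>y\<close> by \<open>3 * (norm (P A y))\<^sup>2\<close>.\<close>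

lemma proj_disjoint:
  assumes A: "A \<in> sets borel" and B: "B \<in> sets borel" and AB: "A \<inter> B = {}"
  shows "P A (P B x) = 0"
proof -
  let ?y = "P B x"
  have "P (A \<union> B) ?y = P A ?y + ?y" using proj_Un[OF assms] proj_idem[OF B] by simp
  then have "(norm (P A ?y + ?y))\<^sup>2 \<le> (norm ?y)\<^sup>2"
    using norm_proj_le[of "A \<union> B" ?y] A B by (simp add: power_mono)
  moreover have "Re (cinner (P A ?y) ?y) = (norm (P A ?y))\<^sup>2"
    using cinner_proj[OF A, of ?y] proj_adj[OF A] by simp
  ultimately have "3 * (norm (P A ?y))\<^sup>2 \<le> 0" by (simp add: norm_add_sq)
  then show ?thesis by simp
qed

lemma proj_Int:
  assumes A: "A \<in> sets borel" and B: "B \<in> sets borel"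
  shows "P A (P B x) = P (A \<inter> B) x"
proof -
  have I: "A \<inter> B \<in> sets borel" "A - B \<in> sets borel" "B - A \<in> sets borel" using A B by auto
  have b: "P B x = P (A \<inter> B) x + P (B - A) x"
    using proj_Un[OF I(1,3), of x] by (metis Diff_disjoint Int_Diff Int_Diff_Un Int_commute inf_bot_right)
  have a: "P A y = P (A \<inter> B) y + P (A - B) y" for y
    using proj_Un[OF I(1,2), of y] by (metis Diff_disjoint Int_Diff Int_Diff_Un Int_commute inf_bot_right)
  have "P (A \<inter> B) (P (B - A) x) = 0" "P (A - B) (P (B - A) x) = 0" "P (A - B) (P (A \<inter> B) x) = 0"
    using I by (auto intro!: proj_disjoint)
  then show ?thesis
    by (simp add: b a clinear_add[OF proj_linear[OF I(1)]] clinear_add[OF proj_linear[OF I(2)]] proj_idem[OF I(1)])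
qed

abbreviation M :: "'h \<Rightarrow> real measure" where "M \<equiv> pvm_vector_measure P"

lemma sets_pvm_vector_measure: "sets (M x) = sets borel"
  using sets.sigma_sets_eq[of "borel :: real measure"] by (simp add: pvm_vector_measure_def)

lemma emeasure_M: 
  assumes S: "S \<in> sets borel"
  shows "emeasure (M x) S = ennreal ((norm (P S x))\<^sup>2)"
proof -
  have eq: "Re (cinner x (P S x)) = (norm (P S x))\<^sup>2" if "S \<in> sets borel" for S
    using cinner_proj[OF that, of x] by simp
  have "emeasure (M x) S = ennreal (Re (cinner x (P S x)))"
  proof (rule emeasure_measure_of[OF pvm_vector_measure_def])
    show "sets borel \<subseteq> Pow UNIV" by simp
    show "S \<in> sets (M x)" using S by (simp add: sets_pvm_vector_measure)
    show "positive (sets (M x)) (\<lambda>S. ennreal (Re (cinner x (P S x))))"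
      by (simp add: positive_def proj_empty)
    show "countably_additive (sets (M x)) (\<lambda>S. ennreal (Re (cinner x (P S x))))"
    proof (rule countably_additiveI)
      fix A :: "nat \<Rightarrow> real set"
      assume "range A \<subseteq> sets (M x)" and dis: "disjoint_family A"
      then have A: "range A \<subseteq> sets borel"
        by (simp add: sets_pvm_vector_measure)
      have "(\<lambda>n. P (A n) x) sums P (\<Union>n. A n) x" by (rule proj_sums[OF A dis])
      then have "(\<lambda>n. Re (cinner x (P (A n) x))) sums Re (cinner x (P (\<Union>n. A n) x))"
        by (intro sums_Re bounded_linear.sums[OF bounded_bilinear.bounded_linear_right[OF bounded_bilinear_cinner]])
      moreover have "Re (cinner x (P (A n) x)) \<ge> 0" for n
        using A by (subst eq) auto
      ultimately show "(\<Sum>i. ennreal (Re (cinner x (P (A i) x)))) = ennreal (Re (cinner x (P (\<Union>n. A n) x)))"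
        by (metis suminf_ennreal_eq)
    qed
  qed
  then show ?thesis using eq[OF S] by simp
qed

lemma measure_M: "S \<in> sets borel \<Longrightarrow> measure (M x) S = (norm (P S x))\<^sup>2"
  by (simp add: measure_def emeasure_M)

sublocale vector_measures "{(indicator S, P S) | S. S \<in> sets borel}" M
proof (rule vector_measures.intro)
  show "sets (M x) = sets borel" for x by (rule sets_pvm_vector_measure)
  show "finite_measure (M x)" for x
    using emeasure_M[of UNIV x] by (intro finite_measureI) (simp add: pvm_vector_measure_def)
  have "(\<lambda>_::real. 1::complex) = indicator UNIV" by (simp add: indicator_def[abs_def])
  moreover have "P UNIV = (\<lambda>x. x)" using proj_UNIV by auto
  ultimately show "(\<lambda>_. 1, \<lambda>x. x) \<in> {(indicator S, P S) | S. S \<in> sets borel}" by force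
next
  fix f F assume "(f, F) \<in> {(indicator S :: _ \<Rightarrow> complex, P S) | S. S \<in> sets borel}"
  then obtain S where S: "f = indicator S" "F = P S" "S \<in> sets borel" by auto
  show "bounded_borel f" using S by auto
  show "clinear F" using S proj_linear by auto
  have "(\<lambda>t. cnj (f t)) = f" by (auto simp: S indicator_def)
  then show "\<exists>F'. (\<lambda>t. cnj (f t), F') \<in> {(indicator S, P S) | S. S \<in> sets borel} \<and> (\<forall>x y. cinner (F x) y = cinner x (F' y))"
    using S proj_adj by auto
  show "cinner x (F x) = (LINT t|M x. f t)" for x
  proof -
    have "(LINT t|M x. f t) = (LINT t|M x. complex_of_real (indicator S t))"
      by (intro Bochner_Integration.integral_cong) (auto simp: S indicator_def)
    also have "\<dots> = complex_of_real (measure (M x) S)"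
      using S(3) by (simp add: sets_pvm_vector_measure)
    finally have "(LINT t|M x. f t) = complex_of_real (measure (M x) S)" .
    then show ?thesis using S cinner_proj measure_M by simp
  qed
  fix g G assume "(g, G) \<in> {(indicator S :: _ \<Rightarrow> complex, P S) | S. S \<in> sets borel}"
  then obtain R where R: "g = indicator R" "G = P R" "R \<in> sets borel" by auto
  have "(\<lambda>t. f t * g t) = indicator (S \<inter> R)" "(\<lambda>x. F (G x)) = P (S \<inter> R)"
    using proj_Int[OF S(3) R(3)] by (auto simp: S R indicator_def)
  then show "(\<lambda>t. f t * g t, \<lambda>x. F (G x)) \<in> {(indicator S, P S) | S. S \<in> sets borel}"
    using S(3) R(3) by auto
qed

sublocale l2_calculus "{(indicator S, P S) | S. S \<in> sets borel}" M "sets borel"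
proof
  show "Int_stable (sets (borel :: real measure))" by (auto simp: Int_stable_def)
  show "sets borel = sigma_sets UNIV (sets (borel::real measure))"
    using sets.sigma_sets_eq[of "borel :: real measure"] by simp
  show "approximable (indicator S)" if "S \<in> sets borel" for S
    using that by (intro approximable_alg[OF alg_base]) auto
qed

lemma Phi_indicator: "S \<in> sets borel \<Longrightarrow> Phi (indicator S) x = P S x"
  by (rule Phi_alg[OF alg_base]) auto

lemma indicator_limit: "(\<lambda>n. Phi (indicator {- real n..real n}) x) \<longlonglongrightarrow> x"
proof -
  have "(\<lambda>n. Phi (indicator {- real n..real n}) x) \<longlonglongrightarrow> Phi (\<lambda>_. 1) x"
  proof (rule Phi_limit)
    fix t :: real
    obtain N where N: "\<bar>t\<bar> \<le> real N" using real_arch_simple by blast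
    have "eventually (\<lambda>n. indicator {- real n..real n} t = (1::complex)) sequentially"
      using eventually_ge_at_top[of N] by eventually_elim (use N in \<open>auto simp: indicator_def\<close>)
    then show "(\<lambda>n. indicator {- real n..real n} t :: complex) \<longlonglongrightarrow> 1"
      by (rule tendsto_eventually)
  qed (auto simp: indicator_def)
  then show ?thesis by simp
qed

end

section \<open>Resolvents and spectral measures of self-adjoint operators\<close>

abbreviation rfun :: "complex \<Rightarrow> real \<Rightarrow> complex" where
  "rfun z t \<equiv> 1 / (complex_of_real t - z)"

lemma of_real_diff_neq_0: "Im z \<noteq> 0 \<Longrightarrow> complex_of_real t - z \<noteq> 0"
  by (auto simp: complex_eq_iff)

lemma cmod_of_real_diff: "cmod (complex_of_real t - z) \<ge> \<bar>Im z\<bar>"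
  using abs_Im_le_cmod[of "complex_of_real t - z"] by simp

lemma rfun_bound: "Im z \<noteq> 0 \<Longrightarrow> cmod (rfun z t) \<le> 1 / \<bar>Im z\<bar>"
  using cmod_of_real_diff[of z t] by (auto simp: norm_divide intro!: divide_left_mono mult_pos_pos of_real_diff_neq_0)

lemma bounded_borel_rfun: "Im z \<noteq> 0 \<Longrightarrow> bounded_borel (rfun z)"
  by (rule bounded_borelI[OF _ rfun_bound]) auto

lemma id_rfun_bound:
  assumes z: "Im z \<noteq> 0"
  shows "cmod (complex_of_real t * rfun z t) \<le> 1 + cmod z / \<bar>Im z\<bar>"
proof -
  have "complex_of_real t * rfun z t = 1 + z * rfun z t"
    using of_real_diff_neq_0[OF z, of t] by (simp add: field_simps)
  then have "cmod (complex_of_real t * rfun z t) \<le> 1 + cmod z * cmod (rfun z t)"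
    by (metis norm_mult norm_one norm_triangle_ineq)
  also have "\<dots> \<le> 1 + cmod z * (1 / \<bar>Im z\<bar>)"
    by (intro add_left_mono mult_left_mono rfun_bound z) auto
  finally show ?thesis by simp
qed

text \<open>\<open>t * rfun z t\<close> is bounded, so \<open>Phi (rfun z)\<close> maps into the
  domain prescribed by square integrability.\<close>

lemma (in pvm) nn_integral_sq_Phi_rfun:
  assumes z: "Im z \<noteq> 0"
  shows "(\<integral>\<^sup>+t. ennreal (t\<^sup>2) \<partial>M (Phi (rfun z) x)) < \<infinity>"
proof -
  interpret finite_measure "M x" by (rule finite_M)
  have r [measurable]: "rfun z \<in> borel_measurable borel" by measurable
  have eq: "ennreal ((cmod (rfun z t))\<^sup>2) * ennreal (t\<^sup>2) = ennreal ((cmod (complex_of_real t * rfun z t))\<^sup>2)" for t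
    by (simp only: ennreal_mult[symmetric] zero_le_power2 norm_mult norm_of_real power_mult_distrib power2_abs mult.commute)
  have "(\<integral>\<^sup>+t. ennreal (t\<^sup>2) \<partial>M (Phi (rfun z) x)) = (\<integral>\<^sup>+t. ennreal ((cmod (rfun z t))\<^sup>2) * ennreal (t\<^sup>2) \<partial>M x)"
    unfolding Phi_vector_measure[OF bounded_borel_rfun[OF z]] by (rule nn_integral_density) measurable
  also have "\<dots> = (\<integral>\<^sup>+t. ennreal ((cmod (complex_of_real t * rfun z t))\<^sup>2) \<partial>M x)"
    by (simp only: eq)
  also have "\<dots> \<le> (\<integral>\<^sup>+t. ennreal ((1 + cmod z / \<bar>Im z\<bar>)\<^sup>2) \<partial>M x)"
    by (intro nn_integral_mono ennreal_leI power_mono id_rfun_bound z) auto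
  also have "\<dots> < \<infinity>" by (simp add: emeasure_eq_measure ennreal_mult_less_top)
  finally show ?thesis .
qed

lemma self_adjoint_single_valued:
  assumes T: "self_adjoint T" and "(x, v) \<in> T" "(x, w) \<in> T"
  shows "v = w"
proof -
  have 0: "(0, v - w) \<in> T" using self_adjoint_diff[OF assms] by simp
  have "cinner (v - w) y = 0" if "y \<in> Domain T" for y
    using that self_adjoint_symmetric[OF T 0] by auto
  \<comment> \<open>Multiplying the functional by a fixed vector gives a linear map into the Hilbert
    space, to which the density argument applies.\<close>
  moreover have "clinear (\<lambda>y. cinner (v - w) y *\<^sub>C (v - w))"
    by (rule clinearI) (simp_all add: cinner_simps scaleC_add_left scaleC_scaleC)
  moreover have "norm (cinner (v - w) y *\<^sub>C (v - w)) \<le> (norm (v - w) * norm (v - w)) * norm y" for y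
    using mult_right_mono[OF complex_Cauchy_Schwarz[of "v - w" y] norm_ge_zero[of "v - w"]]
    by (simp add: norm_scaleC mult.commute mult.left_commute)
  moreover have "closure (Domain T) = UNIV" using T by (simp add: self_adjoint_def)
  ultimately have "cinner (v - w) (v - w) *\<^sub>C (v - w) = 0"
    using clinear_eq_on_dense[of "\<lambda>y. cinner (v - w) y *\<^sub>C (v - w)" "norm (v - w) * norm (v - w)"
        "Domain T" "v - w"] by simp
  then show ?thesis by (simp add: cinner_self)
qed

locale spectral_pvm = pvm P for P :: "real set \<Rightarrow> 'h::complex_hilbert \<Rightarrow> 'h" +
  fixes T :: "('h \<times> 'h) set"
  assumes self_adj: "self_adjoint T" and spectral: "is_spectral_pvm T P"
begin

text \<open>\<open>is_spectral_pvm\<close> describes \<open>T\<close> only by its domain and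
  quadratic form. The form shows that the defect \<open>G x\<close> of the resolvent equation is
  orthogonal to \<open>Phi (rfun z) x\<close>; polarization makes \<open>G x\<close> orthogonal to
  the whole range of \<open>Phi (rfun z)\<close>, which is dense.\<close>

lemma resolvent_eq_Phi:
  assumes z: "Im z \<noteq> 0"
  shows "resolvent T z x = Phi (rfun z) x"
proof -
  let ?r = "rfun z"
  have r: "bounded_borel ?r" by (rule bounded_borel_rfun[OF z])
  have Mr: "M (Phi ?r x) = density (M x) (\<lambda>t. ennreal ((cmod (?r t))\<^sup>2))" for x
    by (rule Phi_vector_measure[OF r])
  have D: "Phi ?r x \<in> Domain T" for x
    using spectral nn_integral_sq_Phi_rfun[OF z, of x] by (simp add: is_spectral_pvm_def)
  then have "\<forall>x. \<exists>v. (Phi ?r x, v) \<in> T" by (simp add: Domain_iff)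
  from choice[OF this] obtain y where "\<forall>x. (Phi ?r x, y x) \<in> T" ..
  then have y: "(Phi ?r x, y x) \<in> T" for x ..
  have lin: "clinear y"
  proof (rule clinearI; rule self_adjoint_single_valued[OF self_adj y])
    fix a b c
    show "(Phi ?r (a + b), y a + y b) \<in> T"
      using self_adjoint_add[OF self_adj y[of a] y[of b]] by (simp add: clinear_add[OF clinear_Phi[OF r]])
    show "(Phi ?r (c *\<^sub>C a), c *\<^sub>C y a) \<in> T"
      using self_adjoint_scale[OF self_adj y[of a]] by (simp add: clinear_scale[OF clinear_Phi[OF r]])
  qed
  define G where "G x = y x - z *\<^sub>C Phi ?r x - x" for x
  have G: "clinear G"
    using lin clinear_Phi[OF r] unfolding G_def clinear_iff
    by (simp add: scaleC_add_right scaleC_diff_right scaleC_scaleC algebra_simps)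
  have "cinner (Phi ?r x) (G x) = 0" for x
  proof -
    have rr: "bounded_borel (\<lambda>t. cnj (?r t) * ?r t)" by (rule bounded_borel_mult[OF bounded_borel_cnj[OF r] r])
    have trr: "bounded_borel (\<lambda>t. complex_of_real t * (cnj (?r t) * ?r t))"
    proof (rule bounded_borelI)
      show "(\<lambda>t. complex_of_real t * (cnj (?r t) * ?r t)) \<in> borel_measurable borel"
        using bounded_borel_measurable[OF rr] by measurable
      fix t
      have "cmod (complex_of_real t * (cnj (?r t) * ?r t)) = cmod (complex_of_real t * ?r t) * cmod (?r t)"
        by (simp only: norm_mult complex_mod_cnj mult.assoc)
      also have "\<dots> \<le> (1 + cmod z / \<bar>Im z\<bar>) * (1 / \<bar>Im z\<bar>)"
        by (intro mult_mono id_rfun_bound rfun_bound z) auto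
      finally show "cmod (complex_of_real t * (cnj (?r t) * ?r t)) \<le> (1 + cmod z / \<bar>Im z\<bar>) * (1 / \<bar>Im z\<bar>)" .
    qed
    have "cinner (Phi ?r x) (y x) = complex_of_real (LINT t|M (Phi ?r x). t)"
      using spectral y[of x] unfolding is_spectral_pvm_def by auto
    also have "(LINT t|M (Phi ?r x). t) = (LINT t|M x. (cmod (?r t))\<^sup>2 * t)"
      unfolding Mr using bounded_borel_measurable[OF r]
      by (subst integral_density) auto
    also have "complex_of_real \<dots> = (LINT t|M x. complex_of_real t * (cnj (?r t) * ?r t))"
    proof -
      have "complex_of_real ((cmod (?r t))\<^sup>2 * t) = complex_of_real t * (cnj (?r t) * ?r t)" for t
        by (simp only: of_real_mult complex_norm_square ac_simps)
      then show ?thesis by (simp only: integral_complex_of_real[symmetric])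
    qed
    finally have 1: "cinner (Phi ?r x) (y x) = (LINT t|M x. complex_of_real t * (cnj (?r t) * ?r t))" .
    have 2: "cinner (Phi ?r x) (z *\<^sub>C Phi ?r x) = (LINT t|M x. z * (cnj (?r t) * ?r t))"
      using rr r by (simp only: cinner_scaleC_right Phi_adjoint Phi_mult[symmetric] bounded_borel_cnj Phi_integral)
        (rule integral_mult_right_zero[symmetric])
    have 3: "cinner (Phi ?r x) x = (LINT t|M x. cnj (?r t))"
      using r by (simp only: Phi_adjoint Phi_integral bounded_borel_cnj)
    have "complex_of_real t * (cnj (?r t) * ?r t) - z * (cnj (?r t) * ?r t) - cnj (?r t) = 0" for t
    proof -
      have "a * (c * b) - z * (c * b) - c = ((a - z) * b - 1) * c" for a b c :: complex
        by (simp add: algebra_simps)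
      moreover have "(complex_of_real t - z) * ?r t - 1 = 0"
        using of_real_diff_neq_0[OF z, of t] by simp
      ultimately show ?thesis by (simp only: mult_zero_left)
    qed
    then have "0 = (LINT t|M x. complex_of_real t * (cnj (?r t) * ?r t) - z * (cnj (?r t) * ?r t) - cnj (?r t))"
      by simp
    also have "\<dots> = cinner (Phi ?r x) (G x)"
    proof -
      have "integrable (M x) (\<lambda>t. complex_of_real t * (cnj (?r t) * ?r t))"
        "integrable (M x) (\<lambda>t. z * (cnj (?r t) * ?r t))" "integrable (M x) (\<lambda>t. cnj (?r t))"
        by (rule integrable_bounded_borel[OF trr] integrable_mult_right[OF integrable_bounded_borel[OF rr]]
            integrable_bounded_borel[OF bounded_borel_cnj[OF r]])+
      then show ?thesis
        by (simp only: G_def cinner_diff_right 1 2 3 Bochner_Integration.integral_diff Bochner_Integration.integrable_diff)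
    qed
    finally show ?thesis by simp
  qed
  then have 0: "cinner (Phi ?r a) (G b) = 0" for a b
    by (rule polarization_zero[OF clinear_Phi[OF r] G])
  have "G b = 0" for b
  proof -
    have "cinner (Phi (indicator {- real n..real n}) (G b)) (G b) = 0" for n
    proof -
      let ?I = "{- real n..real n}"
      \<comment> \<open>The inverse of \<open>?r\<close>, cut off to a bounded interval: every
        spectrally truncated vector therefore lies in the range of \<open>Phi ?r\<close>.\<close>
      let ?h = "\<lambda>t. indicator ?I t * (complex_of_real t - z)"
      have h: "bounded_borel ?h"
        by (rule bounded_borelI[of _ "real n + cmod z"])
           (auto simp: indicator_def intro!: order_trans[OF norm_triangle_ineq4] add_mono)
      have e: "(\<lambda>t. ?r t * ?h t) = indicator ?I"
        using of_real_diff_neq_0[OF z] by (auto simp: indicator_def)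
      have "Phi (indicator ?I) (G b) = Phi ?r (Phi ?h (G b))"
        using Phi_mult[OF r h, of "G b"] unfolding e .
      then show ?thesis using 0 by simp
    qed
    moreover have "(\<lambda>n. cinner (Phi (indicator {- real n..real n}) (G b)) (G b)) \<longlonglongrightarrow> cinner (G b) (G b)"
      by (intro tendsto_intros indicator_limit)
    ultimately have "cinner (G b) (G b) = 0" by (simp add: LIMSEQ_const_iff)
    then show ?thesis by (simp add: cinner_self)
  qed
  then have "y x = x + z *\<^sub>C Phi ?r x" by (simp add: G_def algebra_simps)
  then show ?thesis using y[of x] by (intro resolvent_eqI[OF self_adj z]) simp
qed

end

text \<open>The converse, from the resolvent at a single point. The delicate half is that a finite
  second moment puts \<open>x\<close> into the domain: the truncations of \<open>x\<close> are
  resolvents of a Cauchy sequence, and \<open>T\<close> is closed.\<close>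

lemma (in pvm) is_spectral_pvm_if_resolvent:
  assumes T: "self_adjoint T" and R: "\<And>x. resolvent T \<i> x = Phi (rfun \<i>) x"
  shows "is_spectral_pvm T P"
proof -
  let ?r = "rfun \<i>"
  have i: "Im \<i> \<noteq> 0" by simp
  have r: "bounded_borel ?r" by (rule bounded_borel_rfun) simp
  have tr: "bounded_borel (\<lambda>t. complex_of_real t * ?r t)"
    by (rule bounded_borelI[OF _ id_rfun_bound]) auto
  have T_iff: "T = {(Phi ?r u, u + \<i> *\<^sub>C Phi ?r u) | u. True}"
    using self_adjoint_eq_graph[OF T i] unfolding R .
  have Mr: "M (Phi ?r u) = density (M u) (\<lambda>t. ennreal ((cmod (?r t))\<^sup>2))" for u
    by (rule Phi_vector_measure[OF r])
  have dom1: "(\<integral>\<^sup>+t. ennreal (t\<^sup>2) \<partial>M x) < \<infinity>" if "x \<in> Domain T" for x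
  proof -
    obtain u where u: "x = Phi ?r u" using \<open>x \<in> Domain T\<close> unfolding T_iff by auto
    show ?thesis unfolding u by (rule nn_integral_sq_Phi_rfun) simp
  qed
  have dom2: "x \<in> Domain T" if fin: "(\<integral>\<^sup>+t. ennreal (t\<^sup>2) \<partial>M x) < \<infinity>" for x
  proof -
    interpret finite_measure "M x" by (rule finite_M)
    let ?I = "\<lambda>n. {- real n..real n}"
    \<comment> \<open>\<open>h n\<close> is \<open>t - \<i>\<close> truncated, so \<open>y n\<close>
      is \<open>T - \<i>\<close> applied to the truncation of \<open>x\<close>.\<close>
    define h where "h n t = indicator (?I n) t * (complex_of_real t - \<i>)" for n t
    have h: "bounded_borel (h n)" for n
      unfolding h_def
      by (rule bounded_borelI[of _ "real n + 1"])
         (auto simp: indicator_def intro!: order_trans[OF norm_triangle_ineq4] add_mono)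
    define y where "y n = Phi (h n) x" for n
    define a where "a n = sqint x (h n)" for n
    have int2: "integrable (M x) (\<lambda>t. t\<^sup>2)"
      using fin by (intro integrableI_bounded) auto
    have hn: "(cmod (h n t))\<^sup>2 = indicator (?I n) t * (t\<^sup>2 + 1)" for n t
      by (simp add: h_def norm_mult power_mult_distrib cmod_power2 indicator_def)
    have inti: "integrable (M x) (\<lambda>t. indicator (?I n) t * (t\<^sup>2 + 1))" for n
      using integrable_bounded_borel_sq[OF h, of x n] unfolding hn .
    have "incseq a"
      unfolding a_def sqint_def hn
      by (intro incseq_SucI integral_mono inti) (auto simp: indicator_def)
    moreover have "a n \<le> (LINT t|M x. t\<^sup>2 + 1)" for n
      unfolding a_def sqint_def hn using int2
      by (intro integral_mono inti) (auto simp: indicator_def)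
    ultimately have "Cauchy a"
      using incseq_convergent[of a] LIMSEQ_imp_Cauchy by metis
    \<comment> \<open>The \<open>h n\<close> extend one another along nested intervals, so the
      squared distance is the integral of \<open>t\<^sup>2 + 1\<close> over the gap between two of
      them.\<close>
    have d: "(norm (y m - y n))\<^sup>2 \<le> \<bar>a m - a n\<bar>" for m n
    proof -
      have *: "(norm (y m - y n))\<^sup>2 = a n - a m" if "m \<le> n" for m n
      proof -
        have "(norm (y m - y n))\<^sup>2 = sqint x (\<lambda>t. h m t - h n t)"
          unfolding y_def by (simp only: Phi_diff[OF h h, symmetric] Phi_norm[OF bounded_borel_diff[OF h h]])
        also have "\<dots> = (LINT t|M x. indicator (?I n) t * (t\<^sup>2 + 1) - indicator (?I m) t * (t\<^sup>2 + 1))"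
          unfolding sqint_def using that
          by (intro Bochner_Integration.integral_cong)
             (auto simp: h_def indicator_def cmod_power2 norm_minus_commute)
        also have "\<dots> = a n - a m"
          unfolding a_def sqint_def hn using inti by simp
        finally show ?thesis .
      qed
      show ?thesis
        using *[of m n] *[of n m] by (cases "m \<le> n") (auto simp: norm_minus_commute)
    qed
    have "Cauchy y"
    proof (rule CauchyI)
      fix e :: real assume e: "e > 0"
      then obtain N where N: "\<And>m n. m \<ge> N \<Longrightarrow> n \<ge> N \<Longrightarrow> norm (a m - a n) < e\<^sup>2"
        using CauchyD[OF \<open>Cauchy a\<close>, of "e\<^sup>2"] by auto
      have "norm (y m - y n) < e" if "m \<ge> N" "n \<ge> N" for m n
      proof -
        have "(norm (y m - y n))\<^sup>2 < e\<^sup>2" using d[of m n] N[OF that] by simp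
        then show ?thesis using e by (simp add: power2_less_imp_less)
      qed
      then show "\<exists>N. \<forall>m\<ge>N. \<forall>n\<ge>N. norm (y m - y n) < e" by blast
    qed
    then obtain l where l: "y \<longlonglongrightarrow> l" using Cauchy_convergent convergent_def by blast
    have Ry: "resolvent T \<i> (y n) = Phi (indicator (?I n)) x" for n
    proof -
      have "(\<lambda>t. ?r t * h n t) = indicator (?I n)"
        using of_real_diff_neq_0[OF i] by (auto simp: indicator_def h_def)
      then show ?thesis using Phi_mult[OF r h, of n x] unfolding R y_def by simp
    qed
    have lim: "(\<lambda>n. resolvent T \<i> (y n)) \<longlonglongrightarrow> x"
      unfolding Ry by (rule indicator_limit)
    have "(x, l + \<i> *\<^sub>C x) \<in> T"
      by (rule self_adjoint_closed[OF T resolvent_mem[OF T i] lim]) (intro tendsto_intros l lim)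
    then show ?thesis by auto
  qed
  have "cinner x y = complex_of_real (LINT t|M x. t)" if "(x, y) \<in> T" for x y
  proof -
    obtain u where u: "x = Phi ?r u" "y = u + \<i> *\<^sub>C Phi ?r u" using \<open>(x, y) \<in> T\<close> unfolding T_iff by auto
    have "y = Phi (\<lambda>t. 1 + \<i> * ?r t) u"
      by (simp only: u Phi_add[OF bounded_borel_const bounded_borel_mult[OF bounded_borel_const r]] Phi_scale[OF r] Phi_one)
    also have "(\<lambda>t. 1 + \<i> * ?r t) = (\<lambda>t. complex_of_real t * ?r t)"
      using of_real_diff_neq_0[OF i] by (auto simp: field_simps)
    finally have "cinner x y = (LINT t|M u. cnj (?r t) * (complex_of_real t * ?r t))"
      using r tr by (simp only: u(1) Phi_adjoint Phi_mult[symmetric] bounded_borel_cnj Phi_integral bounded_borel_mult)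
    also have "\<dots> = (LINT t|M u. complex_of_real ((cmod (?r t))\<^sup>2 * t))"
      by (intro Bochner_Integration.integral_cong) (simp_all only: of_real_mult complex_norm_square ac_simps)
    also have "\<dots> = complex_of_real (LINT t|M x. t)"
      unfolding u(1) Mr using bounded_borel_measurable[OF r]
      by (subst integral_density) (auto simp only: integral_complex_of_real, simp_all)
    finally show ?thesis .
  qed
  with dom1 dom2 pvm show ?thesis unfolding is_spectral_pvm_def by auto
qed

section \<open>Trigonometric polynomials on the circle\<close>

text \<open>\<open>sgn w\<close> is \<open>w\<close> on the unit circle and keeps the monomials
  bounded on the whole plane, as \<open>bounded_borel\<close> demands.\<close>

inductive_set trig :: "(complex \<Rightarrow> complex) set" where
  trig_base: "(\<lambda>w. sgn w ^ n * cnj (sgn w) ^ m) \<in> trig"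
| trig_add: "f \<in> trig \<Longrightarrow> g \<in> trig \<Longrightarrow> (\<lambda>w. f w + g w) \<in> trig"
| trig_scale: "f \<in> trig \<Longrightarrow> (\<lambda>w. c * f w) \<in> trig"

lemma trig_mult: 
  assumes "f \<in> trig" "g \<in> trig"
  shows "(\<lambda>w. f w * g w) \<in> trig"
  using assms(1)
proof (induction rule: trig.induct)
  case (trig_base n m)
  show ?case using assms(2)
  proof (induction rule: trig.induct)
    case (trig_base n' m')
    show ?case using trig.trig_base[of "n + n'" "m + m'"] by (simp add: power_add ac_simps)
  next
    case (trig_add f g) from trig.trig_add[OF trig_add.IH] show ?case by (simp add: distrib_left)
  next
    case (trig_scale f c) from trig.trig_scale[OF trig_scale.IH, of c] show ?case by (simp add: ac_simps)
  qed
next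
  case (trig_add f g) from trig.trig_add[OF trig_add.IH] show ?case by (simp add: distrib_right)
next
  case (trig_scale f c) from trig.trig_scale[OF trig_scale.IH, of c] show ?case by (simp add: ac_simps)
qed

lemma trig_real_polynomial:
  assumes "real_polynomial_function (p :: complex \<Rightarrow> real)"
  shows "\<exists>g\<in>trig. \<forall>w. cmod w = 1 \<longrightarrow> g w = complex_of_real (p w)"
  using assms
proof (induction rule: real_polynomial_function.induct)
  case (linear p)
  let ?a = "p 1" and ?b = "p \<i>"
  \<comment> \<open>From \<open>Re w = (w + cnj w) / 2\<close> and
    \<open>Im w = (w - cnj w) / (2 * \<i>)\<close>.\<close>
  let ?g = "\<lambda>w. (complex_of_real ?a / 2 - \<i> * complex_of_real ?b / 2) * (sgn w ^ 1 * cnj (sgn w) ^ 0) +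
      (complex_of_real ?a / 2 + \<i> * complex_of_real ?b / 2) * (sgn w ^ 0 * cnj (sgn w) ^ 1)"
  have 1: "?g \<in> trig" by (intro trig_add trig_scale trig_base)
  have 2: "?g w = complex_of_real (p w)" if "cmod w = 1" for w
  proof -
    interpret bounded_linear p by fact
    have eq: "w = Re w *\<^sub>R 1 + Im w *\<^sub>R \<i>" by (simp add: complex_eq_iff)
    have "p w = p (Re w *\<^sub>R 1 + Im w *\<^sub>R \<i>)" by (rule arg_cong[OF eq])
    also have "\<dots> = Re w * ?a + Im w * ?b" by (simp only: add scaleR real_scaleR_def)
    finally have "p w = Re w * ?a + Im w * ?b" .
    moreover have "sgn w = w" using that by (simp add: sgn_eq)
    moreover have "(complex_of_real a / 2 - \<i> * complex_of_real b / 2) * (w ^ 1 * cnj w ^ 0) +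
      (complex_of_real a / 2 + \<i> * complex_of_real b / 2) * (w ^ 0 * cnj w ^ 1) =
      complex_of_real (Re w * a + Im w * b)" for a b :: real
    proof -
      have "w = Complex (Re w) (Im w)" "cnj w = Complex (Re w) (- Im w)" by (simp_all add: complex_eq_iff)
      then show ?thesis
        by (intro complex_eqI) (simp_all add: mult.commute)
    qed
    ultimately show ?thesis by (simp only:)
  qed
  show ?case by (rule bexI[OF _ 1]) (intro allI impI, rule 2)
next
  case (const c)
  have 1: "(\<lambda>w. complex_of_real c * (sgn w ^ 0 * cnj (sgn w) ^ 0)) \<in> trig" by (intro trig_scale trig_base)
  show ?case by (rule bexI[OF _ 1]) simp
next
  case (add f g)
  then obtain f' g' where "f' \<in> trig" "g' \<in> trig" "\<forall>w. cmod w = 1 \<longrightarrow> f' w = complex_of_real (f w)"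
    "\<forall>w. cmod w = 1 \<longrightarrow> g' w = complex_of_real (g w)" by blast
  then show ?case by (intro bexI[OF _ trig_add[of f' g']]) auto
next
  case (mult f g)
  then obtain f' g' where "f' \<in> trig" "g' \<in> trig" "\<forall>w. cmod w = 1 \<longrightarrow> f' w = complex_of_real (f w)"
    "\<forall>w. cmod w = 1 \<longrightarrow> g' w = complex_of_real (g w)" by blast
  then show ?case by (intro bexI[OF _ trig_mult[of f' g']]) auto
qed

lemma trig_dense:
  assumes f: "continuous_on UNIV (f :: complex \<Rightarrow> real)" and e: "e > 0"
  obtains g where "g \<in> trig" "\<And>w. cmod w = 1 \<Longrightarrow> cmod (g w - complex_of_real (f w)) < e"
proof -
  have "compact (sphere (0::complex) 1)" by simp
  moreover have "continuous_on (sphere 0 1) f" using f continuous_on_subset by blast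
  ultimately obtain p where p: "real_polynomial_function p" "\<And>w. w \<in> sphere 0 1 \<Longrightarrow> \<bar>f w - p w\<bar> < e"
    using Stone_Weierstrass_real_polynomial_function[of "sphere 0 1" f e] e by auto
  obtain g where g: "g \<in> trig" "\<And>w. cmod w = 1 \<Longrightarrow> g w = complex_of_real (p w)"
    using trig_real_polynomial[OF p(1)] by auto
  show thesis
  proof (rule that[OF g(1)])
    fix w :: complex assume w: "cmod w = 1"
    then show "cmod (g w - complex_of_real (f w)) < e"
      using p(2)[of w] by (simp add: g(2) of_real_diff[symmetric] abs_minus_commute del: of_real_diff)
  qed
qed

section \<open>The trigonometric moment problem\<close>

lemma borel_measurable_cnj [measurable (raw)]:
  "f \<in> borel_measurable M \<Longrightarrow> (\<lambda>x. cnj (f x)) \<in> borel_measurable M"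
  by (rule measurable_compose[OF _ borel_measurable_continuous_onI[OF continuous_on_cnj[OF continuous_on_id]]])

lemma borel_measurable_cis [measurable (raw)]:
  "f \<in> borel_measurable M \<Longrightarrow> (\<lambda>x. cis (f x)) \<in> borel_measurable M"
  by (rule measurable_compose[OF _ borel_measurable_continuous_onI[OF continuous_on_cis[OF continuous_on_id]]])

lemma integral_cis:
  "(LINT \<theta>|lborel. indicator {0..2 * pi} \<theta> *\<^sub>R cis (of_int j * \<theta>)) = (if j = 0 then 2 * pi else 0)"
proof (cases "j = 0")
  case False
  define F where "F \<theta> = cis (of_int j * \<theta>) / (\<i> * of_int j)" for \<theta> :: real
  have "(LINT \<theta>|lborel. indicator {0..2 * pi} \<theta> *\<^sub>R cis (of_int j * \<theta>)) = F (2 * pi) - F 0"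
  proof (rule integral_FTC_Icc)
    show "0 \<le> 2 * pi" by simp
    show "(F has_vector_derivative cis (of_int j * \<theta>)) (at \<theta> within {0..2 * pi})" for \<theta>
      unfolding F_def has_vector_derivative_complex_iff using False
      by (auto simp: has_real_derivative_iff_has_vector_derivative[symmetric] Re_divide Im_divide power2_eq_square
          intro!: derivative_eq_intros)
    show "continuous_on {0..2 * pi} (\<lambda>\<theta>. cis (of_int j * \<theta>))"
      by (intro continuous_intros)
  qed
  also have "F (2 * pi) = F 0"
  proof -
    have "cis (of_int j * (2 * pi)) = 1"
      using cis_multiple_2pi[of "of_int j"] by (simp add: mult.commute)
    then show ?thesis by (simp add: F_def)
  qed
  finally show ?thesis using False by simp
qed (simp add: scaleR_conv_of_real)

lemma integrable_cis: "integrable lborel (\<lambda>\<theta>. indicator {0..2 * pi} \<theta> *\<^sub>R cis (a * \<theta>))"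
proof -
  have "set_integrable lborel {0..2 * pi} (\<lambda>\<theta>. cis (a * \<theta>))"
    by (intro borel_integrable_atLeastAtMost' continuous_intros)
  then show ?thesis by (simp add: set_integrable_def)
qed

locale unitary_pair =
  fixes U Us :: "'h::complex_hilbert \<Rightarrow> 'h"
  assumes U_linear: "clinear U" and Us_linear: "clinear Us"
    and U_adj: "cinner (U x) y = cinner x (Us y)"
    and Us_U: "Us (U x) = x" and U_Us: "U (Us x) = x"
begin

lemma U_funpow_adj: "cinner ((U ^^ n) x) y = cinner x ((Us ^^ n) y)"
  by (induction n arbitrary: x y) (simp_all add: U_adj funpow_swap1)

lemma Us_U_funpow: "(Us ^^ n) ((U ^^ n) x) = x"
  by (induction n) (simp_all add: funpow_swap1[of Us] Us_U)

lemma U_Us_funpow: "(U ^^ n) ((Us ^^ n) x) = x"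
  by (induction n) (simp_all add: funpow_swap1[of U] U_Us)

lemma cinner_funpow_add: "cinner ((U ^^ k) x) ((U ^^ (k + j)) y) = cinner x ((U ^^ j) y)"
  by (simp add: funpow_add U_funpow_adj Us_U_funpow)

text \<open>The Fejer means \<open>c N * \<parallel>v N \<theta>\<parallel>\<^sup>2\<close> of the formal series \<open>\<Sum>n. \<langle>x, U^n x\<rangle> e\<^sup>-\<^sup>i\<^sup>n\<^sup>\<theta>\<close> are
  nonnegative densities; Helly's theorem yields a weak limit.\<close>

lemma moment_measure_circle_arc:
  assumes x: "x \<noteq> 0"
  shows "\<exists>\<mu>. real_distribution \<mu> \<and>
    (\<forall>n::nat. (LINT \<theta>|\<mu>. cis (of_int (int n) * \<theta>)) = cinner x ((U ^^ n) x) / complex_of_real ((norm x)\<^sup>2))"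
proof -
  \<comment> \<open>Normalization to mass 1: each of the \<open>N\<close> diagonal terms contributes
    \<open>2 * pi * (norm x)\<^sup>2\<close>.\<close>
  define c where "c N = 1 / (2 * pi * real N * (norm x)\<^sup>2)" for N :: nat
  define v where "v N \<theta> = (\<Sum>k<N. cis (- (of_nat k * \<theta>)) *\<^sub>C (U ^^ k) x)" for N \<theta>
  define p where "p N \<theta> = indicator {0..2 * pi} \<theta> * (c N * (norm (v N \<theta>))\<^sup>2)" for N and \<theta> :: real
  \<comment> \<open>\<open>Suc N\<close> excludes the empty sum, whose density could not have mass
    1.\<close>
  define \<mu> where "\<mu> N = density lborel (\<lambda>\<theta>. ennreal (p (Suc N) \<theta>))" for N
  have c0: "c N \<ge> 0" for N by (simp add: c_def)
  have p0: "p N \<theta> \<ge> 0" for N \<theta> using c0 by (simp add: p_def)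
  define \<gamma> where "\<gamma> k l = cinner ((U ^^ k) x) ((U ^^ l) x)" for k l
  have expand: "p N \<theta> *\<^sub>R cis (of_int (int n) * \<theta>) = (\<Sum>k<N. \<Sum>l<N. complex_of_real (c N) * \<gamma> k l *
      (indicator {0..2 * pi} \<theta> *\<^sub>R cis (of_int (int k - int l + int n) * \<theta>)))" for N n \<theta>
  proof -
    have "complex_of_real ((norm (v N \<theta>))\<^sup>2) = cinner (v N \<theta>) (v N \<theta>)" by (simp only: cinner_self)
    also have "\<dots> = (\<Sum>k<N. \<Sum>l<N. \<gamma> k l * (cis (of_nat k * \<theta>) * cis (- (of_nat l * \<theta>))))"
      unfolding v_def \<gamma>_def
      by (simp only: cinner_sum_left, simp only: cinner_sum_right)
        (simp add: cinner_scaleC_left cinner_scaleC_right cis_cnj sum_distrib_left ac_simps)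
    finally have *: "complex_of_real ((norm (v N \<theta>))\<^sup>2) = \<dots>" .
    have "p N \<theta> *\<^sub>R cis (of_int (int n) * \<theta>) =
      indicator {0..2 * pi} \<theta> *\<^sub>R (complex_of_real (c N) * complex_of_real ((norm (v N \<theta>))\<^sup>2) * cis (of_int (int n) * \<theta>))"
      by (simp add: p_def scaleR_conv_of_real)
    also have "\<dots> = (\<Sum>k<N. \<Sum>l<N. indicator {0..2 * pi} \<theta> *\<^sub>R (complex_of_real (c N) *
      (\<gamma> k l * (cis (of_nat k * \<theta>) * cis (- (of_nat l * \<theta>)))) * cis (of_int (int n) * \<theta>)))"
      unfolding * by (simp only: sum_distrib_left sum_distrib_right scaleR_right.sum)
    also have "\<dots> = (\<Sum>k<N. \<Sum>l<N. complex_of_real (c N) * \<gamma> k l *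
      (indicator {0..2 * pi} \<theta> *\<^sub>R cis (of_int (int k - int l + int n) * \<theta>)))"
      by (intro sum.cong refl) (simp add: cis_mult algebra_simps)
    finally show ?thesis .
  qed
  have p_meas [measurable]: "p N \<in> borel_measurable borel" for N
  proof -
    have "(\<lambda>\<theta>. Re (p N \<theta> *\<^sub>R cis (of_int (int 0) * \<theta>))) \<in> borel_measurable borel"
      unfolding expand by measurable
    then show ?thesis by simp
  qed
  \<comment> \<open>Orthogonality of the characters leaves the pairs with \<open>l = k + n\<close>.
    There are \<open>Suc N - n\<close> of them, and truncated subtraction correctly gives none for
    large \<open>n\<close>; the resulting Fejer factor tends to 1.\<close>
  have moment: "(LINT \<theta>|\<mu> N. cis (of_int (int n) * \<theta>)) =
      complex_of_real (real (Suc N - n) / real (Suc N)) * (cinner x ((U ^^ n) x) / complex_of_real ((norm x)\<^sup>2))" for N n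
  proof -
    let ?N = "Suc N"
    have "(LINT \<theta>|\<mu> N. cis (of_int (int n) * \<theta>)) = (LINT \<theta>|lborel. p ?N \<theta> *\<^sub>R cis (of_int (int n) * \<theta>))"
      unfolding \<mu>_def using p0 by (intro integral_density) auto
    also have "\<dots> = (\<Sum>k<?N. \<Sum>l<?N. complex_of_real (c ?N) * \<gamma> k l *
      (if int k - int l + int n = 0 then 2 * pi else 0))"
      unfolding expand
      by (subst Bochner_Integration.integral_sum | intro Bochner_Integration.integrable_sum
          integrable_mult_right integrable_cis sum.cong refl | subst integral_mult_right_zero | subst integral_cis)+
    also have "\<dots> = (\<Sum>k<?N. if k < ?N - n then complex_of_real (c ?N) * cinner x ((U ^^ n) x) * (2 * pi) else 0)"
    proof (intro sum.cong refl)
      fix k assume "k \<in> {..<?N}"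
      have "(\<Sum>l<?N. complex_of_real (c ?N) * \<gamma> k l * (if int k - int l + int n = 0 then 2 * pi else 0)) =
        (\<Sum>l<?N. if l = k + n then complex_of_real (c ?N) * cinner x ((U ^^ n) x) * (2 * pi) else 0)"
        by (intro sum.cong refl) (auto simp: \<gamma>_def cinner_funpow_add)
      also have "\<dots> = (if k < ?N - n then complex_of_real (c ?N) * cinner x ((U ^^ n) x) * (2 * pi) else 0)"
        by (subst sum.delta) auto
      finally show "(\<Sum>l<?N. complex_of_real (c ?N) * \<gamma> k l * (if int k - int l + int n = 0 then 2 * pi else 0)) = \<dots>" .
    qed
    also have "\<dots> = of_nat (?N - n) * (complex_of_real (c ?N) * cinner x ((U ^^ n) x) * (2 * pi))"
    proof -
      have "{..<?N} \<inter> {k. k < ?N - n} = {..<?N - n}" by auto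
      then show ?thesis by (simp add: sum.If_cases del: lessThan_Suc sum.lessThan_Suc of_nat_diff of_nat_Suc)
    qed
    also have "\<dots> = complex_of_real (real (?N - n) / real ?N) * (cinner x ((U ^^ n) x) / complex_of_real ((norm x)\<^sup>2))"
    proof -
      have r: "c ?N * (2 * pi) = 1 / real ?N * (1 / (norm x)\<^sup>2)"
        by (simp add: c_def del: of_nat_Suc)
      have "of_nat (?N - n) * (complex_of_real (c ?N) * cinner x ((U ^^ n) x) * (2 * complex_of_real pi)) =
        of_nat (?N - n) * cinner x ((U ^^ n) x) * complex_of_real (c ?N * (2 * pi))"
        by (simp del: of_nat_Suc of_nat_diff)
      also have "\<dots> = complex_of_real (real (?N - n) / real ?N) * (cinner x ((U ^^ n) x) / complex_of_real ((norm x)\<^sup>2))"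
        unfolding r by (simp add: divide_inverse ac_simps del: of_nat_Suc of_nat_diff of_real_power)
      finally show ?thesis by simp
    qed
    finally show ?thesis .
  qed
  have total: "emeasure (\<mu> N) UNIV = 1" for N
  proof -
    have int: "integrable lborel (p (Suc N))"
    proof -
      have "integrable lborel (\<lambda>\<theta>. Re (p (Suc N) \<theta> *\<^sub>R cis (of_int (int 0) * \<theta>)))"
        unfolding expand by (intro integrable_Re Bochner_Integration.integrable_sum integrable_mult_right integrable_cis)
      then show ?thesis by simp
    qed
    have "complex_of_real (LINT \<theta>|lborel. p (Suc N) \<theta>) = (LINT \<theta>|\<mu> N. cis (of_int (int 0) * \<theta>))"
      unfolding \<mu>_def using p0 by (subst integral_density) (auto simp: scaleR_conv_of_real)
    also have "\<dots> = 1" unfolding moment using x by (simp add: cinner_self)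
    finally have "(LINT \<theta>|lborel. p (Suc N) \<theta>) = 1" using of_real_eq_1_iff by blast
    moreover have "emeasure (\<mu> N) UNIV = (\<integral>\<^sup>+\<theta>. ennreal (p (Suc N) \<theta>) \<partial>lborel)"
      unfolding \<mu>_def by (subst emeasure_density) auto
    ultimately show ?thesis using nn_integral_eq_integral[OF int] p0 by simp
  qed
  have rd: "real_distribution (\<mu> N)" for N
  proof -
    have "prob_space (\<mu> N)" using total by (intro prob_spaceI) (simp add: \<mu>_def)
    then show ?thesis
      by (simp add: real_distribution_def real_distribution_axioms_def \<mu>_def)
  qed
  have "tight \<mu>"
    unfolding tight_def
  proof (intro conjI allI impI rd)
    fix e :: real assume e: "e > 0"
    \<comment> \<open>The interval contains \<open>{0..2 * pi}\<close>, where the density lives,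
      because \<open>pi < 4\<close>.\<close>
    have "measure (\<mu> N) {-1<..8} = 1" for N
    proof -
      have "emeasure (\<mu> N) {-1<..8} = emeasure (\<mu> N) UNIV"
      proof -
        have z: "p (Suc N) \<theta> = 0" if "\<theta> \<notin> {-1<..8}" for \<theta>
          using that pi_less_4 by (auto simp: p_def indicator_def)
        have "(\<lambda>\<theta>. ennreal (p (Suc N) \<theta>)) \<in> borel_measurable lborel" by measurable
        note d = emeasure_density[OF this]
        show ?thesis
          unfolding \<mu>_def by (simp add: d, rule nn_integral_cong) (use z in \<open>auto simp: indicator_def\<close>)
      qed
      then show ?thesis using total by (simp add: measure_def)
    qed
    then show "\<exists>a b. a < b \<and> (\<forall>n. 1 - e < measure (\<mu> n) {a<..b})"
      using e by (intro exI[of _ "-1"] exI[of _ 8]) simp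
  qed
  from tight_imp_convergent_subsubsequence[OF this strict_mono_id]
  obtain r M where r: "strict_mono r" and M: "real_distribution M" "weak_conv_m (\<mu> \<circ> r) M"
    by auto
  interpret M: real_distribution M by fact
  have "(LINT \<theta>|M. cis (of_int (int n) * \<theta>)) = cinner x ((U ^^ n) x) / complex_of_real ((norm x)\<^sup>2)" for n
  proof -
    let ?a = "cinner x ((U ^^ n) x) / complex_of_real ((norm x)\<^sup>2)"
    have "(\<lambda>k. LINT \<theta>|(\<mu> \<circ> r) k. cis (of_int (int n) * \<theta>)) \<longlonglongrightarrow> (LINT \<theta>|M. cis (of_int (int n) * \<theta>))"
      by (rule weak_conv_imp_integral_bdd_continuous_conv[OF _ M(1) M(2), of _ 1])
         (use rd in \<open>auto intro!: continuous_on_interior[of UNIV] continuous_intros\<close>)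
    moreover have "(\<lambda>k. LINT \<theta>|(\<mu> \<circ> r) k. cis (of_int (int n) * \<theta>)) \<longlonglongrightarrow> complex_of_real 1 * ?a"
    proof -
      have "(\<lambda>N. 1 - real n * (1 / real (Suc N))) \<longlonglongrightarrow> 1 - real n * 0"
        by (intro tendsto_intros LIMSEQ_Suc[OF lim_1_over_n])
      moreover have "\<forall>\<^sub>F N in sequentially. 1 - real n * (1 / real (Suc N)) = real (Suc N - n) / real (Suc N)"
        using eventually_ge_at_top[of n]
        by eventually_elim (simp add: of_nat_diff field_simps del: of_nat_Suc)
      ultimately have "(\<lambda>N. real (Suc N - n) / real (Suc N)) \<longlonglongrightarrow> 1"
        using Lim_transform_eventually by fastforce
      from LIMSEQ_subseq_LIMSEQ[OF this r] have "(\<lambda>k. real (Suc (r k) - n) / real (Suc (r k))) \<longlonglongrightarrow> 1"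
        by (simp add: o_def del: of_nat_Suc)
      then show ?thesis unfolding o_def moment by (intro tendsto_intros)
    qed
    ultimately show ?thesis using LIMSEQ_unique by fastforce
  qed
  with M(1) show ?thesis by blast
qed

text \<open>The distribution of angles is rescaled by \<open>(norm x)\<^sup>2\<close> and pushed to
  the circle by \<open>cis\<close>. The zero vector cannot be normalized and is treated
  apart.\<close>

lemma moment_measure:
  "\<exists>\<mu> :: complex measure. sets \<mu> = sets borel \<and> finite_measure \<mu> \<and> (AE w in \<mu>. cmod w = 1) \<and>
    (\<forall>n::nat. (LINT w|\<mu>. w ^ n) = cinner x ((U ^^ n) x))"
proof (cases "x = 0")
  case True
  have "(U ^^ n) 0 = 0" for n by (rule clinear_zero[OF clinear_funpow[OF U_linear]])
  then show ?thesis using True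
    by (intro exI[of _ "null_measure borel"]) (auto intro!: finite_measureI AE_I'[of UNIV] simp: integral_eq_zero_null_sets)
next
  case False
  then obtain \<mu> where \<mu>: "real_distribution \<mu>"
    "\<And>n::nat. (LINT \<theta>|\<mu>. cis (of_int (int n) * \<theta>)) = cinner x ((U ^^ n) x) / complex_of_real ((norm x)\<^sup>2)"
    using moment_measure_circle_arc by blast
  interpret \<mu>: real_distribution \<mu> by fact
  let ?D = "density \<mu> (\<lambda>_. ennreal ((norm x)\<^sup>2))"
  let ?M = "distr ?D borel cis"
  have "finite_measure ?M"
    by (intro finite_measure.finite_measure_distr finite_measureI)
       (auto simp: emeasure_density \<mu>.emeasure_eq_measure ennreal_mult_eq_top_iff)
  moreover have "(LINT w|?M. w ^ n) = cinner x ((U ^^ n) x)" for n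
  proof -
    have "(LINT w|?M. w ^ n) = (LINT \<theta>|?D. cis \<theta> ^ n)"
      by (rule integral_distr) measurable
    also have "\<dots> = (LINT \<theta>|\<mu>. (norm x)\<^sup>2 *\<^sub>R cis \<theta> ^ n)"
      by (rule integral_density) auto
    also have "\<dots> = (norm x)\<^sup>2 *\<^sub>R (LINT \<theta>|\<mu>. cis (of_int (int n) * \<theta>))"
    proof -
      have "cis \<theta> ^ n = cis (of_int (int n) * \<theta>)" for \<theta> by (simp add: Complex.DeMoivre)
      then show ?thesis by (simp only: integral_scaleR_right)
    qed
    also have "\<dots> = cinner x ((U ^^ n) x)"
      unfolding \<mu>(2) using False by (simp add: scaleR_conv_of_real)
    finally show ?thesis .
  qed
  moreover have "AE w in ?M. cmod w = 1"
    by (subst AE_distr_iff) auto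
  ultimately show ?thesis by (intro exI[of _ ?M]) auto
qed

end

lemma continuous_approximation_closed_indicator:
  fixes C :: "'a::metric_space set"
  assumes "closed C"
  obtains f :: "nat \<Rightarrow> 'a \<Rightarrow> real" where "\<And>n. continuous_on UNIV (f n)" "\<And>n w. 0 \<le> f n w" "\<And>n w. f n w \<le> 1"
    "\<And>w. (\<lambda>n. f n w) \<longlonglongrightarrow> indicator C w"
proof (cases "C = {}")
  \<comment> \<open>\<open>infdist\<close> to the empty set is 0, so the functions used in the other
    case would be constantly 1.\<close>
  case True
  then show ?thesis by (intro that[of "\<lambda>_ _. 0"]) auto
next
  case False
  show ?thesis
  proof (rule that[of "\<lambda>n w. max 0 (1 - real n * infdist w C)"])
    show "continuous_on UNIV (\<lambda>w. max 0 (1 - real n * infdist w C))" for n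
      by (intro continuous_intros)
    show "(\<lambda>n. max 0 (1 - real n * infdist w C)) \<longlonglongrightarrow> indicator C w" for w
    proof (cases "w \<in> C")
      case False
      then have d: "infdist w C > 0" by (simp add: \<open>C \<noteq> {}\<close> assms infdist_pos_not_in_closed)
      obtain N where N: "1 < real N * infdist w C" using reals_Archimedean3[OF d] by blast
      have "\<forall>\<^sub>F n in sequentially. max 0 (1 - real n * infdist w C) = 0"
        using eventually_ge_at_top[of N]
      proof eventually_elim
        case (elim n)
        then have "real N * infdist w C \<le> real n * infdist w C" using d by simp
        then show ?case using N by simp
      qed
      then show ?thesis using False by (simp add: tendsto_eventually)
    qed simp
  qed (auto simp: infdist_nonneg)
qed

lemma trig_bounded_borel: "g \<in> trig \<Longrightarrow> bounded_borel g"
proof (induction rule: trig.induct)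
  case (trig_base n m)
  have "(\<lambda>w. sgn w ^ n * cnj (sgn w) ^ m) \<in> borel_measurable borel"
    by measurable
  then show ?case
    by (rule bounded_borelI[of _ 1]) (auto simp: norm_mult norm_power norm_sgn power_0_left)
qed auto

text \<open>On the circle \<open>sgn w = w\<close> and \<open>w * cnj w = 1\<close>, so a mixed
  monomial collapses to a single power of \<open>w\<close> or of its conjugate.\<close>

lemma integral_trig_base:
  assumes M: "sets M = sets borel" "AE w in M. cmod w = 1"
  shows "(LINT w|M. sgn w ^ n * cnj (sgn w) ^ m) =
    (if m \<le> n then (LINT w|M. w ^ (n - m)) else cnj (LINT w|M. w ^ (m - n)))"
proof -
  note [measurable_cong] = M(1)
  have m1: "(\<lambda>w. sgn w ^ n * cnj (sgn w) ^ m) \<in> borel_measurable M"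
    using trig_bounded_borel[OF trig_base[of n m]] by measurable
  have e: "sgn w ^ n * cnj (sgn w) ^ m = (if m \<le> n then w ^ (n - m) else cnj (w ^ (m - n)))" if "cmod w = 1" for w :: complex
  proof -
    have sg: "sgn w = w" using that by (simp add: sgn_eq)
    have w: "w * cnj w = 1" using that by (simp add: complex_norm_square[symmetric])
    show ?thesis
    proof (cases "m \<le> n")
      case True
      have "w ^ n * cnj w ^ m = w ^ (n - m) * (w * cnj w) ^ m"
        using True by (simp add: power_mult_distrib mult.assoc[symmetric] power_add[symmetric])
      then show ?thesis using True by (simp add: sg w)
    next
      case False
      have "w ^ n * cnj w ^ m = cnj w ^ (m - n) * (w * cnj w) ^ n"
        using False by (simp add: power_mult_distrib power_add[symmetric] mult.left_commute)
      then show ?thesis using False by (simp add: sg w)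
    qed
  qed
  show ?thesis
  proof (cases "m \<le> n")
    case True
    have "(LINT w|M. sgn w ^ n * cnj (sgn w) ^ m) = (LINT w|M. w ^ (n - m))"
      using m1 M(2) by (intro integral_cong_AE) (auto simp: e True elim: AE_mp)
    then show ?thesis using True by simp
  next
    case False
    have "(LINT w|M. sgn w ^ n * cnj (sgn w) ^ m) = (LINT w|M. cnj (w ^ (m - n)))"
    proof (rule integral_cong_AE[OF m1])
      show "(\<lambda>w. cnj (w ^ (m - n))) \<in> borel_measurable M"
        using borel_measurable_continuous_onI[of "\<lambda>w. cnj (w ^ (m - n))"] by (auto intro!: continuous_intros)
      show "AE w in M. sgn w ^ n * cnj (sgn w) ^ m = cnj (w ^ (m - n))"
        using M(2) by eventually_elim (use e False in auto)
    qed
    then show ?thesis using False by (simp add: integral_cnj del: complex_cnj_power)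
  qed
qed

text \<open>Negative moments are conjugates of positive ones, so all trigonometric polynomials have
  equal integrals. Uniform approximation on the circle reaches continuous functions, dominated
  convergence reaches closed sets, and these form an intersection-stable generator.\<close>

lemma circle_measure_unique:
  fixes \<mu> \<mu>' :: "complex measure"
  assumes s: "sets \<mu> = sets borel" "sets \<mu>' = sets borel" and fin: "finite_measure \<mu>" "finite_measure \<mu>'"
    and supp: "AE w in \<mu>. cmod w = 1" "AE w in \<mu>'. cmod w = 1"
    and eq: "\<And>n::nat. (LINT w|\<mu>. w ^ n) = (LINT w|\<mu>'. w ^ n)"
  shows "\<mu> = \<mu>'"
proof -
  interpret a: finite_measure \<mu> by fact
  interpret b: finite_measure \<mu>' by fact
  note [measurable_cong] = s
  have int: "integrable \<mu> f" "integrable \<mu>' f" if "bounded_borel f" for f :: "complex \<Rightarrow> complex"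
  proof -
    obtain C where "C > 0" "\<And>w. cmod (f w) \<le> C" using bounded_borel_bound[OF \<open>bounded_borel f\<close>] by blast
    then show "integrable \<mu> f" "integrable \<mu>' f"
      using \<open>bounded_borel f\<close>
      by (auto intro!: a.integrable_const_bound[of _ C] b.integrable_const_bound[of _ C])
  qed
  have trig: "(LINT w|\<mu>. g w) = (LINT w|\<mu>'. g w)" if "g \<in> trig" for g
    using that
  proof (induction rule: trig.induct)
    case (trig_base n m)
    show ?case using integral_trig_base[OF s(1) supp(1)] integral_trig_base[OF s(2) supp(2)] eq by simp
  next
    case (trig_add f g)
    then show ?case using int[OF trig_bounded_borel[OF trig_add.hyps(1)]] int[OF trig_bounded_borel[OF trig_add.hyps(2)]] by simp
  next
    case (trig_scale f c) then show ?case by simp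
  qed
  have cont: "(LINT w|\<mu>. f w) = (LINT w|\<mu>'. f w)"
    if f: "continuous_on UNIV f" "\<And>w. 0 \<le> f w" "\<And>w. f w \<le> 1" for f :: "complex \<Rightarrow> real"
  proof -
    define K where "K = measure \<mu> (space \<mu>) + measure \<mu>' (space \<mu>') + 1"
    have K: "K > 0" unfolding K_def using measure_nonneg[of \<mu>] measure_nonneg[of \<mu>'] by (simp add: add_nonneg_pos)
    have bf: "bounded_borel (\<lambda>w. complex_of_real (f w))"
      by (rule bounded_borelI[of _ 1]) (use f in \<open>auto intro!: borel_measurable_continuous_onI continuous_intros\<close>)
    have "cmod (complex_of_real (LINT w|\<mu>. f w) - complex_of_real (LINT w|\<mu>'. f w)) \<le> e" if e: "e > 0" for e
    proof -
      have "e / K > 0" using e K by simp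
      then obtain g where g: "g \<in> trig" "\<And>w. cmod w = 1 \<Longrightarrow> cmod (g w - complex_of_real (f w)) < e / K"
        using trig_dense[OF f(1)] by blast
      have bg: "bounded_borel g" by (rule trig_bounded_borel[OF g(1)])
      have d: "cmod ((LINT w|M. g w) - complex_of_real (LINT w|M. f w)) \<le> e / K * measure M (space M)"
        if M: "finite_measure M" "sets M = sets borel" "AE w in M. cmod w = 1" "\<And>f::complex \<Rightarrow> complex. bounded_borel f \<Longrightarrow> integrable M f" for M
      proof -
        interpret finite_measure M by fact
        have "(LINT w|M. g w) - complex_of_real (LINT w|M. f w) = (LINT w|M. g w - complex_of_real (f w))"
          using M(4)[OF bg] M(4)[OF bf] by simp
        also have "cmod \<dots> \<le> (LINT w|M. cmod (g w - complex_of_real (f w)))" by simp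
        also have "\<dots> \<le> (LINT w|M. e / K)"
        proof (rule integral_mono_AE)
          show "integrable M (\<lambda>w. cmod (g w - complex_of_real (f w)))"
            using M(4)[OF bounded_borel_diff[OF bg bf]] by (rule integrable_norm)
          show "AE w in M. cmod (g w - complex_of_real (f w)) \<le> e / K"
            using M(3) by eventually_elim (use g(2) in \<open>auto intro: less_imp_le\<close>)
        qed simp
        also have "\<dots> = e / K * measure M (space M)" by simp
        finally show ?thesis .
      qed
      have "cmod (complex_of_real (LINT w|\<mu>. f w) - complex_of_real (LINT w|\<mu>'. f w)) \<le>
        cmod ((LINT w|\<mu>. g w) - complex_of_real (LINT w|\<mu>. f w)) + cmod ((LINT w|\<mu>'. g w) - complex_of_real (LINT w|\<mu>'. f w))"
        unfolding trig[OF g(1)]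
        using norm_triangle_ineq4[of "(LINT w|\<mu>'. g w) - complex_of_real (LINT w|\<mu>. f w)" "(LINT w|\<mu>'. g w) - complex_of_real (LINT w|\<mu>'. f w)"]
        by (simp add: norm_minus_commute)
      also have "\<dots> \<le> e / K * measure \<mu> (space \<mu>) + e / K * measure \<mu>' (space \<mu>')"
        by (intro add_mono d fin s supp int)
      also have "\<dots> \<le> e / K * K" unfolding distrib_left[symmetric] using e K by (intro mult_left_mono) (auto simp: K_def)
      also have "\<dots> = e" using K by simp
      finally show ?thesis .
    qed
    then have "cmod (complex_of_real (LINT w|\<mu>. f w) - complex_of_real (LINT w|\<mu>'. f w)) \<le> 0"
      by (rule field_le_epsilon[of _ 0, simplified])
    then show ?thesis by simp
  qed
  have closed: "emeasure \<mu> C = emeasure \<mu>' C" if C: "closed C" for C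
  proof -
    obtain f :: "nat \<Rightarrow> complex \<Rightarrow> real" where f: "\<And>n. continuous_on UNIV (f n)" "\<And>n w. 0 \<le> f n w" "\<And>n w. f n w \<le> 1"
      "\<And>w. (\<lambda>n. f n w) \<longlonglongrightarrow> indicator C w"
      using continuous_approximation_closed_indicator[OF C] by blast
    have lim: "(\<lambda>n. LINT w|M. f n w) \<longlonglongrightarrow> measure M C" if M: "finite_measure M" "sets M = sets borel" for M
    proof -
      interpret finite_measure M by fact
      note [measurable_cong] = M(2)
      have sp: "space M = UNIV" using sets_eq_imp_space_eq[OF M(2)] by simp
      have "(\<lambda>n. LINT w|M. f n w) \<longlonglongrightarrow> (LINT w|M. indicator C w)"
      proof (rule integral_dominated_convergence[where w="\<lambda>_. 1"])
        have "C \<in> sets M" using C M(2) by simp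
        then show "(indicator C :: complex \<Rightarrow> real) \<in> borel_measurable M" by simp
        show "f n \<in> borel_measurable M" for n
          using borel_measurable_continuous_onI[OF f(1)[of n]] M(2) by (simp add: measurable_def sp)
      qed (use f in auto)
      then show ?thesis using C M(2) by (simp add: sp)
    qed
    have "measure \<mu> C = measure \<mu>' C"
      using lim[OF fin(1) s(1)] lim[OF fin(2) s(2)] cont[OF f(1,2,3)] LIMSEQ_unique by auto
    then show ?thesis by (simp add: a.emeasure_eq_measure b.emeasure_eq_measure)
  qed
  show ?thesis
  proof (rule measure_eqI_generator_eq[where E="Collect closed" and \<Omega>=UNIV and A="\<lambda>_. UNIV"])
    show "Int_stable (Collect closed)" by (auto simp: Int_stable_def)
    show "sets \<mu> = sigma_sets UNIV (Collect closed)" "sets \<mu>' = sigma_sets UNIV (Collect closed)"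
      unfolding s borel_eq_closed by simp_all
  qed (auto simp: closed)
qed

section \<open>The spectral theorem\<close>

context unitary_pair
begin

lemma Us_funpow_adj: "cinner ((Us ^^ n) x) y = cinner x ((U ^^ n) y)"
  by (metis U_funpow_adj cinner_commute)

lemma Us_U_funpow_comm: "(Us ^^ m) ((U ^^ n) x) = (U ^^ n) ((Us ^^ m) x)"
proof -
  have 1: "Us ((U ^^ n) x) = (U ^^ n) (Us x)" for n x
    by (induction n arbitrary: x) (simp_all add: Us_U U_Us funpow_swap1[of U])
  show ?thesis by (induction m) (simp_all add: 1)
qed

end

definition circle_base ::
  "('h::complex_hilbert \<Rightarrow> 'h) \<Rightarrow> ('h \<Rightarrow> 'h) \<Rightarrow> ((complex \<Rightarrow> complex) \<times> ('h \<Rightarrow> 'h)) set" where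
  "circle_base U Us =
     range (\<lambda>(n, m). (\<lambda>w. sgn w ^ n * cnj (sgn w) ^ m, \<lambda>x. (U ^^ n) ((Us ^^ m) x)))"

lemma circle_base_mem: "(\<lambda>w. sgn w ^ n * cnj (sgn w) ^ m, \<lambda>x. (U ^^ n) ((Us ^^ m) x)) \<in> circle_base U Us"
  unfolding circle_base_def by (rule range_eqI[of _ _ "(n, m)"]) simp

lemma circle_baseE:
  assumes "(f, F) \<in> circle_base U Us"
  obtains n m where "f = (\<lambda>w. sgn w ^ n * cnj (sgn w) ^ m)" "F = (\<lambda>x. (U ^^ n) ((Us ^^ m) x))"
  using assms unfolding circle_base_def by auto

locale unitary_moments = unitary_pair U Us for U Us :: "'h::complex_hilbert \<Rightarrow> 'h" +
  fixes N :: "'h \<Rightarrow> complex measure"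
  assumes sets_N: "sets (N x) = sets borel" and finite_N: "finite_measure (N x)"
    and circle_N: "AE w in N x. cmod w = 1"
    and moment_N: "(LINT w|N x. w ^ n) = cinner x ((U ^^ n) x)"
begin

sublocale vector_measures
  "circle_base U Us" N
proof (rule vector_measures.intro)
  show "sets (N x) = sets borel" for x by (rule sets_N)
  show "finite_measure (N x)" for x by (rule finite_N)
  show "(\<lambda>_. 1, \<lambda>x. x) \<in> circle_base U Us"
    using circle_base_mem[of 0 0 U Us] by (simp only: power_0 mult_1_left funpow_0)
next
  fix f F assume "(f, F) \<in> circle_base U Us"
  then obtain n m where f: "f = (\<lambda>w. sgn w ^ n * cnj (sgn w) ^ m)" and F: "F = (\<lambda>x. (U ^^ n) ((Us ^^ m) x))"
    by (rule circle_baseE)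
  show "bounded_borel f" unfolding f by (rule trig_bounded_borel[OF trig_base])
  show "clinear F" unfolding F by (rule clinear_compose[OF clinear_funpow[OF U_linear] clinear_funpow[OF Us_linear]])
  have "cinner (F x) y = cinner x ((U ^^ m) ((Us ^^ n) y))" for x y
    by (simp add: F U_funpow_adj Us_funpow_adj)
  moreover have "(\<lambda>w. cnj (f w)) = (\<lambda>w. sgn w ^ m * cnj (sgn w) ^ n)" by (simp add: f mult.commute)
  ultimately show "\<exists>F'. (\<lambda>t. cnj (f t), F') \<in> circle_base U Us \<and>
      (\<forall>x y. cinner (F x) y = cinner x (F' y))"
    using circle_base_mem[of m n U Us] by (intro exI[of _ "\<lambda>x. (U ^^ m) ((Us ^^ n) x)"]) simp
  show "cinner x (F x) = (LINT w|N x. f w)" for x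
  proof (cases "m \<le> n")
    case True
    have "(U ^^ n) ((Us ^^ m) x) = (U ^^ (n - m)) ((U ^^ m) ((Us ^^ m) x))"
      using True funpow_add[of "n - m" m U] by simp
    then show ?thesis
      using True integral_trig_base[OF sets_N[of x] circle_N[of x], of n m] by (simp add: f F U_Us_funpow moment_N)
  next
    case False
    have "(Us ^^ m) x = (Us ^^ n) ((Us ^^ (m - n)) x)"
      using False funpow_add[of n "m - n" Us] by simp
    then have "cinner x (F x) = cinner x ((Us ^^ (m - n)) x)"
      by (simp add: F U_Us_funpow)
    also have "\<dots> = cnj (cinner x ((U ^^ (m - n)) x))"
      by (metis U_funpow_adj cinner_commute)
    finally show ?thesis
      using False integral_trig_base[OF sets_N[of x] circle_N[of x], of n m] by (simp add: f moment_N)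
  qed
  fix g G assume "(g, G) \<in> circle_base U Us"
  then obtain k l where g: "g = (\<lambda>w. sgn w ^ k * cnj (sgn w) ^ l)" and G: "G = (\<lambda>x. (U ^^ k) ((Us ^^ l) x))"
    by (rule circle_baseE)
  have "(\<lambda>w. f w * g w) = (\<lambda>w. sgn w ^ (n + k) * cnj (sgn w) ^ (m + l))"
    by (simp add: f g power_add ac_simps)
  moreover have "(\<lambda>x. F (G x)) = (\<lambda>x. (U ^^ (n + k)) ((Us ^^ (m + l)) x))"
    by (simp add: F G funpow_add Us_U_funpow_comm)
  ultimately show "(\<lambda>t. f t * g t, \<lambda>x. F (G x)) \<in> circle_base U Us"
    using circle_base_mem[of "n + k" "m + l" U Us] by simp
qed

lemma alg_trig: "g \<in> trig \<Longrightarrow> \<exists>G. (g, G) \<in> alg"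
proof (induction rule: trig.induct)
  case (trig_base n m)
  have "((\<lambda>w. sgn w ^ n * cnj (sgn w) ^ m), \<lambda>x. (U ^^ n) ((Us ^^ m) x)) \<in> alg"
    by (rule alg_base[OF circle_base_mem])
  then show ?case by (intro exI[of _ "\<lambda>x. (U ^^ n) ((Us ^^ m) x)"])
next
  case (trig_add f g)
  then obtain F G where "(f, F) \<in> alg" "(g, G) \<in> alg" by blast
  then show ?case by (intro exI[of _ "\<lambda>x. F x + G x"]) (rule alg_add)
next
  case (trig_scale f c)
  then obtain F where "(f, F) \<in> alg" by blast
  then show ?case by (intro exI[of _ "\<lambda>x. c *\<^sub>C F x"]) (rule alg_scale)
qed

lemma approximable_continuous:
  assumes f: "continuous_on UNIV f" and bf: "bounded_borel (\<lambda>w. complex_of_real (f w))"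
  shows "approximable (\<lambda>w. complex_of_real (f w))"
proof (rule approximable_closed[OF bf])
  fix X :: "'h set" and e :: real assume X: "finite X" and e: "e > 0"
  \<comment> \<open>\<open>K\<close> exceeds the mass of each measure involved, so the single
    uniform tolerance \<open>sqrt (e / K)\<close> serves all vectors of \<open>X\<close>.\<close>
  define K where "K = 1 + (\<Sum>x\<in>X. measure (N x) UNIV)"
  have K: "K > 0" unfolding K_def by (intro add_pos_nonneg sum_nonneg) auto
  have d: "sqrt (e / K) > 0" using e K by simp
  obtain g where g: "g \<in> trig" "\<And>w. cmod w = 1 \<Longrightarrow> cmod (g w - complex_of_real (f w)) < sqrt (e / K)"
    using trig_dense[OF f d] by blast
  have bg: "bounded_borel g" by (rule trig_bounded_borel[OF g(1)])
  obtain G where G: "(g, G) \<in> alg" using alg_trig[OF g(1)] by blast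
  have "sqint x (\<lambda>w. g w - complex_of_real (f w)) < e" if "x \<in> X" for x
  proof -
    interpret finite_measure "N x" by (rule finite_N)
    have "sqint x (\<lambda>w. g w - complex_of_real (f w)) \<le> (LINT w|N x. e / K)"
      unfolding sqint_def
    proof (rule integral_mono_AE)
      show "integrable (N x) (\<lambda>w. (cmod (g w - complex_of_real (f w)))\<^sup>2)"
        by (rule integrable_bounded_borel_sq[OF bounded_borel_diff[OF bg bf]])
      show "AE w in N x. (cmod (g w - complex_of_real (f w)))\<^sup>2 \<le> e / K"
        using circle_N[of x]
      proof eventually_elim
        case (elim w)
        have "(cmod (g w - complex_of_real (f w)))\<^sup>2 \<le> (sqrt (e / K))\<^sup>2"
          using g(2)[OF elim] by (intro power_mono) auto
        then show ?case using e K by simp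
      qed
    qed simp
    also have "\<dots> = e / K * measure (N x) UNIV" by simp
    also have "\<dots> < e / K * K"
    proof (rule mult_strict_left_mono)
      have "measure (N x) UNIV \<le> (\<Sum>x\<in>X. measure (N x) UNIV)"
        using X that by (intro member_le_sum) auto
      then show "measure (N x) UNIV < K" by (simp add: K_def)
    qed (use e K in simp)
    also have "\<dots> = e" using K by simp
    finally show ?thesis .
  qed
  then show "\<exists>h. bounded_borel h \<and> approximable h \<and> (\<forall>x\<in>X. sqint x (\<lambda>t. h t - complex_of_real (f t)) < e)"
    using bg approximable_alg[OF G] by blast
qed

sublocale l2_calculus
  "circle_base U Us" N "Collect closed"
proof
  show "Int_stable (Collect (closed :: complex set \<Rightarrow> bool))" by (auto simp: Int_stable_def)
  show "sets borel = sigma_sets UNIV (Collect (closed :: complex set \<Rightarrow> bool))"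
    unfolding borel_eq_closed by simp
  fix C :: "complex set" assume "C \<in> Collect closed"
  then have C: "closed C" by simp
  obtain f :: "nat \<Rightarrow> complex \<Rightarrow> real" where f: "\<And>n. continuous_on UNIV (f n)" "\<And>n w. 0 \<le> f n w" "\<And>n w. f n w \<le> 1"
    "\<And>w. (\<lambda>n. f n w) \<longlonglongrightarrow> indicator C w"
    using continuous_approximation_closed_indicator[OF C] by blast
  have bf: "bounded_borel (\<lambda>w. complex_of_real (f n w))" for n
  proof (rule bounded_borelI)
    show "(\<lambda>w. complex_of_real (f n w)) \<in> borel_measurable borel"
      using borel_measurable_continuous_onI[OF f(1)[of n]] by measurable
    show "cmod (complex_of_real (f n w)) \<le> 1" for w using f(2,3)[of n w] by simp
  qed
  have ind: "(\<lambda>w. complex_of_real (indicator C w)) = indicator C" by (auto simp: indicator_def)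
  have "approximable (\<lambda>w. complex_of_real (indicator C w))"
  proof (rule approximable_limit[where f="\<lambda>n w. complex_of_real (f n w)" and C=1])
    show "bounded_borel (\<lambda>w. complex_of_real (indicator C w))"
      unfolding ind using C by auto
    show "(\<lambda>n. complex_of_real (f n w)) \<longlonglongrightarrow> complex_of_real (indicator C w)" for w
      by (intro tendsto_intros f)
    show "cmod (complex_of_real (f n w)) \<le> 1" for n w using f(2,3)[of n w] by simp
  qed (intro bf approximable_continuous f)+
  then show "approximable (indicator C)" unfolding ind .
qed

lemma Phi_trig_base: "Phi (\<lambda>w. sgn w ^ n * cnj (sgn w) ^ m) x = (U ^^ n) ((Us ^^ m) x)"
  by (rule Phi_alg[OF alg_base[OF circle_base_mem]])

end

context l2_calculus
begin

lemma Phi_sum: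
  assumes "finite I" "\<And>i. i \<in> I \<Longrightarrow> bounded_borel (f i)"
  shows "Phi (\<lambda>t. \<Sum>i\<in>I. f i t) x = (\<Sum>i\<in>I. Phi (f i) x)"
  using assms
proof (induction I)
  case (insert i I)
  have "Phi (\<lambda>t. f i t + (\<Sum>i\<in>I. f i t)) x = Phi (f i) x + Phi (\<lambda>t. \<Sum>i\<in>I. f i t) x"
    using insert by (intro Phi_add bounded_borel_sum) auto
  then show ?case using insert by simp
qed simp

text \<open>Idempotence comes from multiplicativity of the calculus, symmetry from conjugation, and
  countable additivity from bounded pointwise limits.\<close>

lemma projection_valued_measure_pushforward:
  assumes h [measurable]: "h \<in> borel_measurable borel"
  shows "projection_valued_measure (\<lambda>S. Phi (indicator (h -` S)))"
  unfolding projection_valued_measure_def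
proof (intro conjI ballI allI impI)
  have vim: "h -` S \<in> sets borel" if "S \<in> sets borel" for S
    using measurable_sets[OF h that] by simp
  then have b: "bounded_borel (indicator (h -` S))" if "S \<in> sets borel" for S
    using that by auto
  show "orthogonal_projection (Phi (indicator (h -` S)))" if S: "S \<in> sets borel" for S
    unfolding orthogonal_projection_def
  proof (intro conjI allI)
    show "clinear (Phi (indicator (h -` S)))" by (rule clinear_Phi[OF b[OF S]])
    have "(\<lambda>t. indicator (h -` S) t * indicator (h -` S) t :: complex) = indicator (h -` S)"
      by (auto simp: indicator_def)
    then show "Phi (indicator (h -` S)) (Phi (indicator (h -` S)) x) = Phi (indicator (h -` S)) x" for x
      using Phi_mult[OF b[OF S] b[OF S], of x] by simp
    have "(\<lambda>t. cnj (indicator (h -` S) t) :: complex) = indicator (h -` S)"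
      by (auto simp: indicator_def)
    then show "cinner (Phi (indicator (h -` S)) x) y = cinner x (Phi (indicator (h -` S)) y)" for x y
      using Phi_adjoint[OF b[OF S], of x y] by simp
  qed
  have "(indicator (h -` UNIV) :: 'a \<Rightarrow> complex) = (\<lambda>_. 1)" by auto
  then show "Phi (indicator (h -` UNIV)) = (\<lambda>x. x)" by (simp add: fun_eq_iff)
  fix S :: "nat \<Rightarrow> real set" and x
  assume S: "range S \<subseteq> sets borel \<and> disjoint_family S"
  then have Sn: "S n \<in> sets borel" for n by auto
  have "(\<lambda>n. Phi (indicator (h -` (\<Union>k<n. S k))) x) \<longlonglongrightarrow> Phi (indicator (h -` (\<Union>n. S n))) x"
  proof (rule Phi_limit)
    show "bounded_borel (indicator (h -` (\<Union>k<n. S k)))" for n using Sn by (intro b) auto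
    show "bounded_borel (indicator (h -` (\<Union>n. S n)))" using Sn by (intro b) auto
    show "(\<lambda>n. indicator (h -` (\<Union>k<n. S k)) t) \<longlonglongrightarrow> (indicator (h -` (\<Union>n. S n)) t :: complex)" for t
      unfolding vimage_UN by (rule LIMSEQ_indicator_UN)
    show "cmod (indicator (h -` (\<Union>k<n. S k)) t) \<le> 1" for n t by (auto simp: indicator_def)
  qed
  moreover have "Phi (indicator (h -` (\<Union>k<n. S k))) x = (\<Sum>k<n. Phi (indicator (h -` S k)) x)" for n
  proof -
    have "indicator (h -` (\<Union>k<n. S k)) = (\<lambda>t. \<Sum>k<n. indicator (h -` S k) t :: complex)"
      unfolding vimage_UN using S
      by (intro ext indicator_UN_disjoint) (auto simp: disjoint_family_on_def)
    then show ?thesis using Phi_sum[of "{..<n}" "\<lambda>k. indicator (h -` S k)" x] b[OF Sn] by simp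
  qed
  ultimately show "(\<lambda>n. Phi (indicator (h -` S n)) x) sums Phi (indicator (h -` (\<Union>n. S n))) x"
    by (simp add: sums_def)
qed

lemma pushforward_vector_measure:
  assumes h [measurable]: "h \<in> borel_measurable borel"
  shows "pvm_vector_measure (\<lambda>S. Phi (indicator (h -` S))) x = distr (M x) borel h"
proof (rule measure_eqI)
  interpret p: pvm "\<lambda>S. Phi (indicator (h -` S))"
    by unfold_locales (rule projection_valued_measure_pushforward[OF h])
  show "sets (pvm_vector_measure (\<lambda>S. Phi (indicator (h -` S))) x) = sets (distr (M x) borel h)"
    by (simp add: p.sets_pvm_vector_measure)
  fix S assume "S \<in> sets (pvm_vector_measure (\<lambda>S. Phi (indicator (h -` S))) x)"
  then have S: "S \<in> sets borel" by (simp add: p.sets_pvm_vector_measure)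
  interpret finite_measure "M x" by (rule finite_M)
  have hS: "h -` S \<in> sets borel" using measurable_sets[OF h S] by simp
  have "(norm (Phi (indicator (h -` S)) x))\<^sup>2 = sqint x (indicator (h -` S))"
    using hS by (intro Phi_norm) auto
  also have "\<dots> = measure (M x) (h -` S)"
  proof -
    have "(cmod (indicator (h -` S) t))\<^sup>2 = indicator (h -` S) t" for t by (simp add: indicator_def)
    then show ?thesis using hS by (simp add: sqint_def sets_M)
  qed
  finally show "emeasure (pvm_vector_measure (\<lambda>S. Phi (indicator (h -` S))) x) S = emeasure (distr (M x) borel h) S"
    using S by (simp add: p.emeasure_M emeasure_distr emeasure_eq_measure)
qed

end

text \<open>This is \<open>(T - \<i>) (T + \<i>)\<^sup>-\<^sup>1\<close>, rewritten with a bounded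
  operator only.\<close>

definition cayley :: "('h::complex_hilbert \<times> 'h) set \<Rightarrow> 'h \<Rightarrow> 'h" where
  "cayley T x = x - (2 * \<i>) *\<^sub>C resolvent T (- \<i>) x"

definition inverse_cayley :: "('h::complex_hilbert \<times> 'h) set \<Rightarrow> 'h \<Rightarrow> 'h" where
  "inverse_cayley T x = x + (2 * \<i>) *\<^sub>C resolvent T \<i> x"

lemma unitary_pair_cayley:
  assumes T: "self_adjoint T"
  shows "unitary_pair (cayley T) (inverse_cayley T)"
proof (rule unitary_pair.intro)
  have i: "Im \<i> \<noteq> 0" "Im (- \<i>) \<noteq> 0" by simp_all
  note lin = clinear_resolvent[OF T i(1)] clinear_resolvent[OF T i(2)]
  note R = clinear_add[OF lin(1)] clinear_add[OF lin(2)] clinear_scale[OF lin(1)] clinear_scale[OF lin(2)]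
    clinear_diff[OF lin(1)] clinear_diff[OF lin(2)]
  show "clinear (cayley T)" "clinear (inverse_cayley T)"
    by (rule clinearI; simp add: cayley_def inverse_cayley_def R scaleC_add_right scaleC_diff_right scaleC_scaleC mult.commute)+
  fix x y
  show "cinner (cayley T x) y = cinner x (inverse_cayley T y)"
    using resolvent_adjoint[OF T i(2), of x y] by (simp add: cayley_def inverse_cayley_def cinner_simps)
  have 1: "(2 * \<i>) *\<^sub>C resolvent T (- \<i>) (resolvent T \<i> x) = resolvent T \<i> x - resolvent T (- \<i>) x"
    using resolvent_identity[OF T i(1) i(2), of x] by (simp add: eq_diff_eq add.commute)
  have 2: "(2 * \<i>) *\<^sub>C resolvent T \<i> (resolvent T (- \<i>) x) = resolvent T \<i> x - resolvent T (- \<i>) x"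
    using resolvent_identity[OF T i(2) i(1), of x] by (simp add: algebra_simps)
  show "cayley T (inverse_cayley T x) = x"
    by (simp add: cayley_def inverse_cayley_def R 1 scaleC_diff_right)
  show "inverse_cayley T (cayley T x) = x"
    by (simp add: cayley_def inverse_cayley_def R 2 scaleC_diff_right)
qed

definition cayley_fun :: "real \<Rightarrow> complex" where
  "cayley_fun t = 1 - 2 * \<i> * rfun (- \<i>) t"

text \<open>The inverse of \<open>cayley_fun\<close> on the circle without 1. At 1 division by zero
  makes the value 0; the measures that occur are shown to give that point no mass.\<close>

definition real_of_circle :: "complex \<Rightarrow> real" where
  "real_of_circle w = Re (\<i> * (1 + w) / (1 - w))"

lemma borel_measurable_real_of_circle [measurable]: "real_of_circle \<in> borel_measurable borel"
  unfolding real_of_circle_def by measurable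

lemma cmod_cayley_fun: "cmod (cayley_fun t) = 1"
proof -
  have nz: "complex_of_real t + \<i> \<noteq> 0" by (simp add: complex_eq_iff)
  then have "cayley_fun t = (complex_of_real t - \<i>) / (complex_of_real t + \<i>)"
    by (simp add: cayley_fun_def field_simps)
  moreover have "cmod (complex_of_real t - \<i>) = cmod (complex_of_real t + \<i>)"
    by (simp add: cmod_def)
  ultimately show ?thesis using nz by (simp add: norm_divide)
qed

lemma real_of_circle_cayley_fun: "real_of_circle (cayley_fun t) = t"
proof -
  have nz: "complex_of_real t + \<i> \<noteq> 0" by (simp add: complex_eq_iff)
  then have "1 + cayley_fun t = 2 * complex_of_real t / (complex_of_real t + \<i>)"
    "1 - cayley_fun t = 2 * \<i> / (complex_of_real t + \<i>)"
    by (simp_all add: cayley_fun_def field_simps)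
  then have "\<i> * (1 + cayley_fun t) / (1 - cayley_fun t) = complex_of_real t"
    using nz by simp
  then show ?thesis by (simp only: real_of_circle_def Re_complex_of_real)
qed

text \<open>In the circle variable the resolvent function at \<open>\<i>\<close> is a trigonometric
  polynomial of degree one, so its operator is known exactly from the Cayley transform.\<close>

lemma rfun_real_of_circle:
  assumes "cmod w = 1" "w \<noteq> 1"
  shows "rfun \<i> (real_of_circle w) = (cnj w - 1) / (2 * \<i>)"
proof -
  have w: "cnj w * w = 1" using assms(1) by (simp add: complex_norm_square[symmetric] mult.commute)
  have nz: "1 - w \<noteq> 0" "1 - cnj w \<noteq> 0" using assms(2) by (auto simp: complex_eq_iff)
  have real: "cnj c = c \<Longrightarrow> complex_of_real (Re c) = c" for c
    by (simp add: complex_eq_iff)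
  have "cnj (\<i> * (1 + w) / (1 - w)) = \<i> * (1 + w) / (1 - w)"
  proof -
    have "- \<i> * (1 + cnj w) * (1 - w) = \<i> * (1 + w) * (1 - cnj w)"
      using w by (simp add: algebra_simps)
    then have "(- \<i> * (1 + cnj w)) / (1 - cnj w) = (\<i> * (1 + w)) / (1 - w)"
      using nz by (subst frac_eq_eq) auto
    then show ?thesis by simp
  qed
  then have "complex_of_real (real_of_circle w) = \<i> * (1 + w) / (1 - w)"
    unfolding real_of_circle_def by (rule real)
  then have "complex_of_real (real_of_circle w) - \<i> = 2 * \<i> * w / (1 - w)"
    using nz by (simp add: field_simps)
  then have "rfun \<i> (real_of_circle w) = (1 - w) / (2 * \<i> * w)" by simp
  also have "\<dots> = (cnj w - 1) / (2 * \<i>)"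
  proof -
    have "w \<noteq> 0" using assms(1) by auto
    moreover have "(cnj w - 1) * (2 * \<i> * w) = 2 * \<i> * (cnj w * w - w)" by (simp add: algebra_simps)
    ultimately show ?thesis using w by (subst frac_eq_eq) (simp_all add: mult.commute)
  qed
  finally show ?thesis .
qed

context spectral_pvm
begin

lemma Phi_cayley_fun_power: "Phi (\<lambda>t. cayley_fun t ^ n) x = (cayley T ^^ n) x"
proof (induction n arbitrary: x)
  case (Suc n)
  have r: "bounded_borel (rfun (- \<i>))" by (rule bounded_borel_rfun) simp
  have c: "bounded_borel cayley_fun"
    unfolding cayley_fun_def by (intro bounded_borel_diff bounded_borel_mult bounded_borel_const r)
  have cn: "bounded_borel (\<lambda>t. cayley_fun t ^ n)"
    by (rule bounded_borelI[of _ 1]) (use bounded_borel_measurable[OF c] in \<open>auto simp: norm_power cmod_cayley_fun\<close>)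
  have "Phi cayley_fun x = cayley T x" for x
    unfolding cayley_fun_def cayley_def
    using Phi_diff[OF bounded_borel_const bounded_borel_mult[OF bounded_borel_const r], of 1 "2 * \<i>" x]
      Phi_scale[OF r, of "2 * \<i>" x] resolvent_eq_Phi[of "- \<i>" x] by simp
  then show ?case using Phi_mult[OF c cn, of x] Suc by simp
qed simp

text \<open>The moments of the image on the circle depend on \<open>T\<close> alone, and the
  original measure is recovered from the image: this is the source of uniqueness.\<close>

lemma vector_measure_circle:
  "M x = distr (distr (M x) borel cayley_fun) borel real_of_circle"
  and circle_measure: "finite_measure (distr (M x) borel cayley_fun)"
    "AE w in distr (M x) borel cayley_fun. cmod w = 1"
    "(LINT w|distr (M x) borel cayley_fun. w ^ n) = cinner x ((cayley T ^^ n) x)"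
proof -
  interpret finite_measure "M x" by (rule finite_M)
  have m [measurable]: "cayley_fun \<in> borel_measurable borel" unfolding cayley_fun_def by measurable
  have "distr (distr (M x) borel cayley_fun) borel real_of_circle = distr (M x) borel (\<lambda>t. t)"
    by (subst distr_distr) (auto simp: o_def real_of_circle_cayley_fun)
  also have "\<dots> = M x" by (rule distr_id2) (simp add: sets_M)
  finally show "M x = distr (distr (M x) borel cayley_fun) borel real_of_circle" by simp
  show "finite_measure (distr (M x) borel cayley_fun)" by (rule finite_measure_distr) simp
  show "AE w in distr (M x) borel cayley_fun. cmod w = 1"
    by (subst AE_distr_iff) (auto simp: cmod_cayley_fun)
  have cn: "bounded_borel (\<lambda>t. cayley_fun t ^ n)"
    by (rule bounded_borelI[of _ 1]) (auto simp: norm_power cmod_cayley_fun)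
  have "(LINT w|distr (M x) borel cayley_fun. w ^ n) = (LINT t|M x. cayley_fun t ^ n)"
    by (rule integral_distr) measurable
  also have "\<dots> = cinner x ((cayley T ^^ n) x)"
    using Phi_integral[OF cn] Phi_cayley_fun_power by simp
  finally show "(LINT w|distr (M x) borel cayley_fun. w ^ n) = cinner x ((cayley T ^^ n) x)" .
qed

end

lemma spectral_vector_measure_unique:
  assumes T: "self_adjoint T" and P: "is_spectral_pvm T P" and P': "is_spectral_pvm T P'"
  shows "pvm_vector_measure P x = pvm_vector_measure P' x"
proof -
  interpret a: spectral_pvm P T by unfold_locales (use T P in \<open>auto simp: is_spectral_pvm_def\<close>)
  interpret b: spectral_pvm P' T by unfold_locales (use T P' in \<open>auto simp: is_spectral_pvm_def\<close>)
  have "distr (pvm_vector_measure P x) borel cayley_fun = distr (pvm_vector_measure P' x) borel cayley_fun"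
    by (rule circle_measure_unique) (simp_all add: a.circle_measure b.circle_measure)
  then show ?thesis using a.vector_measure_circle[of x] b.vector_measure_circle[of x] by metis
qed

text \<open>The calculus of the Cayley transform is carried to the line by
  \<open>real_of_circle\<close>. The resulting measure is recognized as the one of \<open>T\<close>
  by comparing resolvents at \<open>\<i>\<close>.\<close>

theorem spectral_theorem:
  assumes T: "self_adjoint T"
  shows "\<exists>P. is_spectral_pvm T P"
proof -
  have i: "Im \<i> \<noteq> 0" "Im (- \<i>) \<noteq> 0" by simp_all
  interpret u: unitary_pair "cayley T" "inverse_cayley T" by (rule unitary_pair_cayley[OF T])
  obtain N :: "_ \<Rightarrow> complex measure" where N: "\<And>x. sets (N x) = sets borel" "\<And>x. finite_measure (N x)"
    "\<And>x. AE w in N x. cmod w = 1" "\<And>x n. (LINT w|N x. w ^ n) = cinner x ((cayley T ^^ n) x)"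
    using u.moment_measure by metis
  interpret m: unitary_moments "cayley T" "inverse_cayley T" N
    by (rule unitary_moments.intro[OF u.unitary_pair_axioms unitary_moments_axioms.intro]) (rule N)+
  let ?P = "\<lambda>S. m.Phi (indicator (real_of_circle -` S))"
  interpret p: pvm ?P
    by unfold_locales (rule m.projection_valued_measure_pushforward[OF borel_measurable_real_of_circle])
  have Phi_eq: "p.Phi f = m.Phi (\<lambda>w. f (real_of_circle w))" if f: "bounded_borel f" for f
  proof (rule quadratic_form_unique)
    obtain C where C: "\<And>t. cmod (f t) \<le> C" using f unfolding bounded_borel_def by auto
    have f': "bounded_borel (\<lambda>w. f (real_of_circle w))"
      by (rule bounded_borelI[of _ C]) (use bounded_borel_measurable[OF f] C in auto)
    show "clinear (p.Phi f)" "clinear (m.Phi (\<lambda>w. f (real_of_circle w)))"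
      by (rule p.clinear_Phi[OF f] m.clinear_Phi[OF f'])+
    have "(LINT t|distr (N x) borel real_of_circle. f t) = (LINT w|N x. f (real_of_circle w))" for x
    proof (rule integral_distr)
      show "real_of_circle \<in> measurable (N x) borel"
        unfolding measurable_cong_sets[OF N(1) refl] by (rule borel_measurable_real_of_circle)
    qed (rule bounded_borel_measurable[OF f])
    then show "cinner x (p.Phi f x) = cinner x (m.Phi (\<lambda>w. f (real_of_circle w)) x)" for x
      by (simp add: p.Phi_integral[OF f] m.Phi_integral[OF f'] m.pushforward_vector_measure)
  qed
  have b1: "bounded_borel (indicator {1::complex})" by auto
  \<comment> \<open>A vector concentrated at 1 is fixed by the Cayley transform, hence annihilated
    by the resolvent at \<open>- \<i>\<close>, which is injective.\<close>
  have point: "measure (N x) {1} = 0" for x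
  proof -
    define y where "y = m.Phi (indicator {1}) x"
    have "cayley T y = m.Phi (\<lambda>w. sgn w ^ 1 * cnj (sgn w) ^ 0) y"
      unfolding m.Phi_trig_base by simp
    also have "\<dots> = m.Phi (\<lambda>w. (sgn w ^ 1 * cnj (sgn w) ^ 0) * indicator {1} w) x"
      unfolding y_def by (rule m.Phi_mult[OF trig_bounded_borel[OF trig_base] b1, symmetric])
    also have "(\<lambda>w. (sgn w ^ 1 * cnj (sgn w) ^ 0) * indicator {1} w) = (indicator {1} :: complex \<Rightarrow> complex)"
      by (auto simp: indicator_def)
    finally have "cayley T y = y" by (simp add: y_def)
    then have "resolvent T (- \<i>) y = 0"
      by (simp add: cayley_def)
    then have "(0, y) \<in> T" using resolvent_mem[OF T i(2), of y] by simp
    moreover have "(0, 0) \<in> T" by (rule self_adjoint_memI[OF T]) simp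
    ultimately have "y = 0" by (rule self_adjoint_single_valued[OF T])
    then have "m.sqint x (indicator {1}) = 0" using m.Phi_norm[OF b1, of x] by (simp add: y_def)
    moreover have "(cmod (indicator {1} w))\<^sup>2 = indicator {1} w" for w :: complex by (simp add: indicator_def)
    ultimately show ?thesis by (simp add: m.sqint_def N(1))
  qed
  have "is_spectral_pvm T ?P"
  proof (rule p.is_spectral_pvm_if_resolvent[OF T])
    fix x
    interpret finite_measure "N x" by (rule N(2))
    have r: "bounded_borel (rfun \<i>)" by (rule bounded_borel_rfun) simp
    obtain C where C: "\<And>t. cmod (rfun \<i> t) \<le> C" using r unfolding bounded_borel_def by auto
    have r': "bounded_borel (\<lambda>w. rfun \<i> (real_of_circle w))"
      by (rule bounded_borelI[OF _ C]) measurable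
    let ?h = "\<lambda>w::complex. (sgn w ^ 0 * cnj (sgn w) ^ 1)"
    \<comment> \<open>The trigonometric form of \<open>rfun \<i> (real_of_circle w)\<close>, valid
      on the circle off the point 1 and therefore almost everywhere.\<close>
    let ?g = "\<lambda>w::complex. 1 / (2 * \<i>) * (?h w - 1)"
    have h: "bounded_borel ?h" by (rule trig_bounded_borel[OF trig_base])
    have g: "bounded_borel ?g" by (intro bounded_borel_mult bounded_borel_diff bounded_borel_const h)
    have "m.Phi ?g x = (1 / (2 * \<i>)) *\<^sub>C (m.Phi ?h x - x)"
      using m.Phi_scale[OF bounded_borel_diff[OF h bounded_borel_const], of "1 / (2 * \<i>)" 1 x]
        m.Phi_diff[OF h bounded_borel_const, of 1 x] by simp
    also have "m.Phi ?h x = inverse_cayley T x" unfolding m.Phi_trig_base by simp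
    also have "(1 / (2 * \<i>)) *\<^sub>C (inverse_cayley T x - x) = resolvent T \<i> x"
      by (simp add: inverse_cayley_def scaleC_scaleC)
    finally have *: "m.Phi ?g x = resolvent T \<i> x" .
    have ae: "AE w in N x. w \<noteq> 1"
    proof (rule AE_I')
      show "{1} \<in> null_sets (N x)" using point[of x] N(1) by (simp add: null_sets_def emeasure_eq_measure)
    qed auto
    have "m.sqint x (\<lambda>w. ?g w - rfun \<i> (real_of_circle w)) = (LINT w|N x. 0)"
      unfolding m.sqint_def
    proof (rule integral_cong_AE)
      show "(\<lambda>w. (cmod (?g w - rfun \<i> (real_of_circle w)))\<^sup>2) \<in> borel_measurable (N x)"
        using borel_measurable_integrable[OF m.integrable_bounded_borel_sq[OF bounded_borel_diff[OF g r']]] .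
      show "AE w in N x. (cmod (?g w - rfun \<i> (real_of_circle w)))\<^sup>2 = 0"
        using ae N(3)[of x] by eventually_elim (simp add: rfun_real_of_circle sgn_eq)
    qed simp
    then have "m.Phi ?g x = m.Phi (\<lambda>w. rfun \<i> (real_of_circle w)) x"
      by (intro m.Phi_cong_if_sqint_zero[OF g r']) simp
    then show "resolvent T \<i> x = p.Phi (rfun \<i>) x"
      unfolding Phi_eq[OF r] * .
  qed
  then show ?thesis by blast
qed

section \<open>Complex matrices\<close>

definition vinner :: "complex^'d \<Rightarrow> complex^'d \<Rightarrow> complex" where
  "vinner e f = (\<Sum>j\<in>UNIV. cnj (e $ j) * f $ j)"

lemma vinner_add_left: "vinner (e + e') f = vinner e f + vinner e' f"
  and vinner_add_right: "vinner e (f + f') = vinner e f + vinner e f'"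
  and vinner_diff_left: "vinner (e - e') f = vinner e f - vinner e' f"
  and vinner_diff_right: "vinner e (f - f') = vinner e f - vinner e f'"
  and vinner_scale_left: "vinner (c *s e) f = cnj c * vinner e f"
  and vinner_scale_right: "vinner e (c *s f) = c * vinner e f"
  by (simp_all add: vinner_def algebra_simps sum.distrib sum_subtractf sum_distrib_left)

lemmas vinner_simps = vinner_add_left vinner_add_right vinner_diff_left vinner_diff_right
  vinner_scale_left vinner_scale_right

lemma vinner_zero_left [simp]: "vinner 0 f = 0"
  and vinner_zero_right [simp]: "vinner f 0 = 0"
  by (simp_all add: vinner_def)

lemma vinner_commute: "vinner f e = cnj (vinner e f)"
  by (simp add: vinner_def mult.commute)

lemma vinner_axis: "vinner (axis j 1) f = f $ j"
proof -
  have "vinner (axis j 1) f = (\<Sum>i\<in>UNIV. if i = j then f $ i else 0)"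
    unfolding vinner_def by (intro sum.cong) (auto simp: axis_def)
  then show ?thesis by simp
qed

lemma matrix_vector_axis: "((M :: complex^'d^'d) *v axis j 1) $ i = M $ i $ j"
  by (simp add: matrix_vector_mult_def axis_def if_distrib cong: if_cong)

lemma vinner_self: "vinner e e = complex_of_real ((norm e)\<^sup>2)"
proof -
  have "vinner e e = (\<Sum>j\<in>UNIV. complex_of_real ((cmod (e $ j))\<^sup>2))"
    unfolding vinner_def by (intro sum.cong refl) (simp only: complex_norm_square mult.commute)
  also have "\<dots> = complex_of_real ((norm e)\<^sup>2)"
    by (simp only: norm_vec_def L2_set_def of_real_sum[symmetric]) (simp add: sum_nonneg del: of_real_sum)
  finally show ?thesis .
qed

lemma vinner_mult_hermitian:
  assumes "\<alpha> \<in> hermitian_matrices"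
  shows "vinner (\<alpha> *v e) f = vinner e (\<alpha> *v f)"
proof -
  have h: "cnj (\<alpha> $ i $ j) = \<alpha> $ j $ i" for i j
    using assms unfolding hermitian_matrices_def by (metis (mono_tags, lifting) complex_cnj_cnj mem_Collect_eq)
  have "vinner (\<alpha> *v e) f = (\<Sum>i\<in>UNIV. \<Sum>j\<in>UNIV. \<alpha> $ j $ i * cnj (e $ j) * f $ i)"
    by (simp add: vinner_def matrix_vector_mult_def sum_distrib_right h)
  also have "\<dots> = (\<Sum>j\<in>UNIV. \<Sum>i\<in>UNIV. \<alpha> $ j $ i * cnj (e $ j) * f $ i)"
    by (rule sum.swap)
  also have "\<dots> = vinner e (\<alpha> *v f)"
    by (simp add: vinner_def matrix_vector_mult_def sum_distrib_left ac_simps)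
  finally show ?thesis .
qed

lemma Im_vinner_hermitian:
  assumes "\<alpha> \<in> hermitian_matrices"
  shows "Im (vinner e (\<alpha> *v e)) = 0"
proof -
  have "vinner e (\<alpha> *v e) = cnj (vinner e (\<alpha> *v e))"
    using vinner_commute[of "\<alpha> *v e" e] vinner_mult_hermitian[OF assms, of e e] by simp
  then show ?thesis by (simp add: complex_eq_iff)
qed

lemma matrix_inv_cancel:
  fixes M :: "'a::field^'d^'d"
  assumes "\<And>v. M *v v = 0 \<Longrightarrow> v = 0"
  shows "M ** matrix_inv M = mat 1" "matrix_inv M ** M = mat 1"
    "M *v (matrix_inv M *v x) = x" "matrix_inv M *v (M *v x) = x"
proof -
  have "\<exists>M'. M' ** M = mat 1" using assms by (simp add: matrix_left_invertible_ker)
  then have inv: "M ** matrix_inv M = mat 1 \<and> matrix_inv M ** M = mat 1"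
    unfolding matrix_inv_def by (rule someI_ex[OF ex_forward]) (simp add: matrix_left_right_inverse)
  then show "M ** matrix_inv M = mat 1" "matrix_inv M ** M = mat 1" by auto
  with inv show "M *v (matrix_inv M *v x) = x" "matrix_inv M *v (M *v x) = x"
    by (simp_all add: matrix_vector_mul_assoc)
qed

text \<open>The second clause serves to make \<open>I + \<alpha> F\<close> injective for Hermitian
  \<open>\<alpha>\<close>: there the first clause can only be played out to
  \<open>Im = 0\<close>.\<close>

definition dissipative :: "complex^'d^'d \<Rightarrow> bool" where
  "dissipative F \<longleftrightarrow>
     (\<forall>v. Im (vinner v (F *v v)) \<ge> 0 \<and> (Im (vinner v (F *v v)) = 0 \<longrightarrow> F *v v = 0))"

section \<open>Krein's resolvent formula\<close>

text \<open>\<open>R\<close>, \<open>G\<close>, \<open>Gs\<close>, \<open>F\<close> play the roles of \<open>(A - z)\<^sup>-\<^sup>1\<close>, \<open>(A - z)\<^sup>-\<^sup>1 B\<close>, \<open>B\<^sup>* (A - z)\<^sup>-\<^sup>1\<close>,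
  \<open>B\<^sup>* (A - z)\<^sup>-\<^sup>1 B\<close>.\<close>

locale krein =
  fixes R :: "complex \<Rightarrow> 'h::complex_hilbert \<Rightarrow> 'h"
    and G :: "complex \<Rightarrow> complex^'d \<Rightarrow> 'h"
    and Gs :: "complex \<Rightarrow> 'h \<Rightarrow> complex^'d"
    and F :: "complex \<Rightarrow> complex^'d^'d"
  assumes R_linear: "\<And>z. Im z \<noteq> 0 \<Longrightarrow> clinear (R z)"
    and R_adj: "\<And>z x y. Im z \<noteq> 0 \<Longrightarrow> cinner (R z x) y = cinner x (R (cnj z) y)"
    and R_ident: "\<And>z w x. Im z \<noteq> 0 \<Longrightarrow> Im w \<noteq> 0 \<Longrightarrow> (z - w) *\<^sub>C R w (R z x) = R z x - R w x"
    and R_inj: "\<And>z x. Im z \<noteq> 0 \<Longrightarrow> R z x = 0 \<Longrightarrow> x = 0"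
    and G_add: "\<And>z e f. G z (e + f) = G z e + G z f"
    and G_scale: "\<And>z c e. G z (c *s e) = c *\<^sub>C G z e"
    and Gs_linear: "\<And>z x y. Gs z (x + y) = Gs z x + Gs z y" "\<And>z c x. Gs z (c *\<^sub>C x) = c *s Gs z x"
    and G_ident: "\<And>z w e. Im z \<noteq> 0 \<Longrightarrow> Im w \<noteq> 0 \<Longrightarrow> (z - w) *\<^sub>C R w (G z e) = G z e - G w e"
    and Gs_ident: "\<And>z w x. Im z \<noteq> 0 \<Longrightarrow> Im w \<noteq> 0 \<Longrightarrow> (z - w) *s Gs w (R z x) = Gs z x - Gs w x"
    and F_ident: "\<And>z w e. Im z \<noteq> 0 \<Longrightarrow> Im w \<noteq> 0 \<Longrightarrow> (z - w) *s Gs w (G z e) = F z *v e - F w *v e"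
    and G_adj: "\<And>z e x. Im z \<noteq> 0 \<Longrightarrow> cinner (G z e) x = vinner e (Gs (cnj z) x)"
    and F_adj: "\<And>z e f. Im z \<noteq> 0 \<Longrightarrow> vinner (F z *v e) f = vinner e (F (cnj z) *v f)"
    and R_G_consistent: "\<And>z x c. Im z \<noteq> 0 \<Longrightarrow> R z x = G z c \<Longrightarrow> Gs z x = F z *v c"
begin

lemma G_zero [simp]: "G z 0 = 0"
  using G_scale[of z 0 0] by simp

lemma G_diff: "G z (e - f) = G z e - G z f"
  using G_add[of z "e - f" f] by (simp add: algebra_simps)

lemma Gs_diff: "Gs z (x - y) = Gs z x - Gs z y"
  using Gs_linear(1)[of z "x - y" y] by (simp add: algebra_simps)

lemma Gs_zero [simp]: "Gs z 0 = 0"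
  using Gs_linear(2)[of z 0 0] by simp

text \<open>\<open>F z - F (cnj z)\<close> is \<open>z - cnj z\<close> times the composition of
  \<open>G z\<close> with \<open>Gs (cnj z)\<close>, and \<open>Gs (cnj z)\<close> is the adjoint of
  \<open>G z\<close>.\<close>

lemma Im_F:
  assumes z: "Im z \<noteq> 0"
  shows "Im (vinner e (F z *v e)) = Im z * (norm (G z e))\<^sup>2"
proof -
  have z': "Im (cnj z) \<noteq> 0" using z by simp
  have "(z - cnj z) * vinner e (Gs (cnj z) (G z e)) = vinner e (F z *v e) - vinner e (F (cnj z) *v e)"
    by (simp only: vinner_scale_right[symmetric] F_ident[OF z z'] vinner_diff_right)
  moreover have "vinner e (Gs (cnj z) (G z e)) = complex_of_real ((norm (G z e))\<^sup>2)"
    using G_adj[OF z, of e "G z e"] by (simp add: cinner_self)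
  moreover have "vinner e (F (cnj z) *v e) = cnj (vinner e (F z *v e))"
    using F_adj[OF z, of e e] vinner_commute[of "F z *v e" e] by simp
  ultimately have "(z - cnj z) * complex_of_real ((norm (G z e))\<^sup>2) = vinner e (F z *v e) - cnj (vinner e (F z *v e))"
    by simp
  then have "Im ((z - cnj z) * complex_of_real ((norm (G z e))\<^sup>2)) = Im (vinner e (F z *v e) - cnj (vinner e (F z *v e)))"
    by simp
  then show ?thesis by simp
qed

lemma F_zero_if_G_zero:
  assumes z: "Im z \<noteq> 0" and "G z e = 0"
  shows "F z *v e = 0"
proof -
  have "R z 0 = G z e" using assms clinear_zero[OF R_linear[OF z]] by simp
  from R_G_consistent[OF z this] show ?thesis by simp
qed

lemma dissipative_F:
  assumes z: "Im z > 0"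
  shows "dissipative (F z)"
proof -
  have "Im z \<noteq> 0" using z by simp
  from Im_F[OF this] F_zero_if_G_zero[OF this] show ?thesis
    using z unfolding dissipative_def by auto
qed

end

locale krein_perturbation = krein R G Gs F
  for R :: "complex \<Rightarrow> 'h::complex_hilbert \<Rightarrow> 'h"
    and G :: "complex \<Rightarrow> complex^'d \<Rightarrow> 'h"
    and Gs :: "complex \<Rightarrow> 'h \<Rightarrow> complex^'d"
    and F :: "complex \<Rightarrow> complex^'d^'d" +
  fixes \<alpha> :: "complex^'d^'d"
  assumes hermitian: "\<alpha> \<in> hermitian_matrices"
begin

definition N :: "complex \<Rightarrow> complex^'d^'d" where
  "N z = matrix_inv (mat 1 + \<alpha> ** F z)"

definition R\<alpha> :: "complex \<Rightarrow> 'h \<Rightarrow> 'h" where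
  "R\<alpha> z x = R z x - G z (N z *v (\<alpha> *v Gs z x))"

text \<open>Krein's formula applied to \<open>B\<close>: this plays the role of
  \<open>(A\<^sub>\<alpha> - z)\<^sup>-\<^sup>1 B\<close>.\<close>

definition G\<alpha> :: "complex \<Rightarrow> complex^'d \<Rightarrow> 'h" where
  "G\<alpha> z e = G z (N z *v e)"

text \<open>A kernel vector satisfies \<open>v = - \<alpha> F v\<close>, so its form
  \<open>vinner v (F z *v v)\<close> is real. By \<open>Im_F\<close> then \<open>G z v = 0\<close>,
  hence \<open>F z *v v = 0\<close> and finally \<open>v = 0\<close>.\<close>

lemma kernel_trivial:
  assumes z: "Im z \<noteq> 0" and v: "(mat 1 + \<alpha> ** F z) *v v = 0"
  shows "v = 0"
proof -
  let ?q = "F z *v v"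
  have eq: "v = - (\<alpha> *v ?q)"
    using v by (simp add: matrix_vector_mult_add_rdistrib matrix_vector_mul_assoc eq_neg_iff_add_eq_0)
  have "vinner v ?q = - vinner (\<alpha> *v ?q) ?q"
    by (subst eq) (metis diff_0 vinner_diff_left vinner_zero_left)
  then have "Im (vinner v ?q) = 0"
    using Im_vinner_hermitian[OF hermitian, of ?q] vinner_mult_hermitian[OF hermitian, of ?q ?q] by simp
  then have "G z v = 0" using Im_F[OF z, of v] z by simp
  then have "?q = 0" by (rule F_zero_if_G_zero[OF z])
  then show ?thesis using eq by (simp add: matrix_vector_mult_0_right)
qed

lemma N_cancel:
  assumes z: "Im z \<noteq> 0"
  shows "N z *v e + \<alpha> *v (F z *v (N z *v e)) = e"
proof -
  have "(mat 1 + \<alpha> ** F z) *v (N z *v e) = e"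
    unfolding N_def by (rule matrix_inv_cancel(3)[OF kernel_trivial[OF z]])
  then show ?thesis by (simp only: matrix_vector_mult_add_rdistrib matrix_vector_mul_lid matrix_vector_mul_assoc[symmetric])
qed

lemma N_eqI:
  assumes z: "Im z \<noteq> 0" and e: "v + \<alpha> *v (F z *v v) = e"
  shows "N z *v e = v"
proof -
  have "(mat 1 + \<alpha> ** F z) *v v = e"
    using e by (simp only: matrix_vector_mult_add_rdistrib matrix_vector_mul_lid matrix_vector_mul_assoc[symmetric])
  then have "N z *v e = N z *v ((mat 1 + \<alpha> ** F z) *v v)" by simp
  also have "\<dots> = v" unfolding N_def by (rule matrix_inv_cancel(4)[OF kernel_trivial[OF z]])
  finally show ?thesis .
qed

lemma R\<alpha>_linear: 
  assumes z: "Im z \<noteq> 0" shows "clinear (R\<alpha> z)"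
  by (rule clinearI)
    (simp_all add: R\<alpha>_def clinear_add[OF R_linear[OF z]] clinear_scale[OF R_linear[OF z]] Gs_linear
      matrix_vector_right_distrib vector_scalar_commute G_add G_scale scaleC_diff_right)

text \<open>For \<open>g = Gs z x\<close> the bracket is \<open>B\<^sup>*\<close> of the perturbed
  resolvent of \<open>x\<close>. The fixed-point form lets symmetry of \<open>\<alpha>\<close> be
  used although \<open>\<alpha>\<close> may be singular.\<close>

lemma coefficient:
  assumes z: "Im z \<noteq> 0"
  shows "N z *v (\<alpha> *v g) = \<alpha> *v (g - F z *v (N z *v (\<alpha> *v g)))"
  using N_cancel[OF z, of "\<alpha> *v g"]
  by (simp add: matrix_vector_mult_diff_distrib algebra_simps)

lemma R\<alpha>_adj:
  assumes z: "Im z \<noteq> 0"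
  shows "cinner (R\<alpha> z x) y = cinner x (R\<alpha> (cnj z) y)"
proof -
  have z': "Im (cnj z) \<noteq> 0" using z by simp
  define g g' where "g = Gs z x" and "g' = Gs (cnj z) y"
  define c c' where "c = N z *v (\<alpha> *v g)" and "c' = N (cnj z) *v (\<alpha> *v g')"
  have c: "c = \<alpha> *v (g - F z *v c)" and c': "c' = \<alpha> *v (g' - F (cnj z) *v c')"
    unfolding c_def c'_def by (rule coefficient[OF z] coefficient[OF z'])+
  have "vinner c (g' - F (cnj z) *v c') = vinner (g - F z *v c) c'"
    using vinner_mult_hermitian[OF hermitian, of "g - F z *v c" "g' - F (cnj z) *v c'"]
    unfolding c[symmetric] c'[symmetric] .
  then have "vinner c g' = vinner g c'"
    by (simp add: vinner_diff_left vinner_diff_right F_adj[OF z])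
  moreover have "cinner (G z c) y = vinner c g'" unfolding g'_def by (rule G_adj[OF z])
  moreover have "cinner x (G (cnj z) c') = vinner g c'"
    using G_adj[OF z', of c' x] cinner_commute[of x "G (cnj z) c'"] vinner_commute[of g c']
    by (simp add: g_def)
  ultimately show ?thesis
    using R_adj[OF z, of x y] by (simp add: R\<alpha>_def c_def c'_def g_def g'_def cinner_simps)
qed

text \<open>The coefficient of the iterated resolvent solves a linear system with matrix
  \<open>I + \<alpha> F w\<close>. The difference of the coefficients at \<open>z\<close> and
  \<open>w\<close> solves the same system, so the two agree by uniqueness.\<close>

lemma R\<alpha>_ident:
  assumes z: "Im z \<noteq> 0" and w: "Im w \<noteq> 0"
  shows "R\<alpha> z x = R\<alpha> w x + (z - w) *\<^sub>C R\<alpha> w (R\<alpha> z x)"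
proof -
  define c where "c = N z *v (\<alpha> *v Gs z x)"
  define c' where "c' = N w *v (\<alpha> *v Gs w x)"
  define y where "y = R\<alpha> z x"
  define d where "d = N w *v (\<alpha> *v Gs w y)"
  have y: "y = R z x - G z c" by (simp add: y_def R\<alpha>_def c_def)
  have c: "c = \<alpha> *v (Gs z x - F z *v c)" and c': "c' = \<alpha> *v (Gs w x - F w *v c')"
    and d: "d = \<alpha> *v (Gs w y - F w *v d)"
    unfolding c_def c'_def d_def by (rule coefficient[OF z] coefficient[OF w])+
  have gy: "(z - w) *s Gs w y = Gs z x - Gs w x - (F z *v c - F w *v c)"
    by (simp only: y Gs_diff vector_ssub_ldistrib Gs_ident[OF z w] F_ident[OF z w])
  have "(z - w) *s d = N w *v (\<alpha> *v ((z - w) *s Gs w y))"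
    by (simp only: d_def vector_scalar_commute)
  also have "\<dots> = c - c'"
  proof (rule N_eqI[OF w])
    have "c - c' = \<alpha> *v (Gs z x - F z *v c) - \<alpha> *v (Gs w x - F w *v c')"
      using c c' by simp
    then show "c - c' + \<alpha> *v (F w *v (c - c')) = \<alpha> *v ((z - w) *s Gs w y)"
      unfolding gy by (simp add: matrix_vector_mult_diff_distrib algebra_simps)
  qed
  finally have dd: "(z - w) *s d = c - c'" .
  have "(z - w) *\<^sub>C R\<alpha> w y = (z - w) *\<^sub>C R w y - G w ((z - w) *s d)"
    by (simp only: R\<alpha>_def d_def scaleC_diff_right G_scale)
  also have "\<dots> = R z x - R w x - (G z c - G w c) - (G w c - G w c')"
    unfolding y clinear_diff[OF R_linear[OF w]] scaleC_diff_right R_ident[OF z w] G_ident[OF z w] dd G_diff ..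
  finally show ?thesis
    by (simp add: y_def[symmetric] y) (simp add: R\<alpha>_def c'_def[symmetric])
qed

text \<open>\<open>R z x = G z c\<close> is one vector written in two ways. Evaluating
  \<open>B\<^sup>*\<close> on it both ways gives \<open>Gs z x = F z *v c\<close>, which forces
  \<open>c = 0\<close>.\<close>

lemma R\<alpha>_inj:
  assumes z: "Im z \<noteq> 0" and "R\<alpha> z x = 0"
  shows "x = 0"
proof -
  define c where "c = N z *v (\<alpha> *v Gs z x)"
  have Rx: "R z x = G z c" using assms(2) by (simp add: R\<alpha>_def c_def)
  have "c = \<alpha> *v (Gs z x - F z *v c)" unfolding c_def by (rule coefficient[OF z])
  also have "\<dots> = 0" using R_G_consistent[OF z Rx] by (simp add: matrix_vector_mult_0_right)
  finally have "R z x = 0" using Rx by simp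
  then show ?thesis by (rule R_inj[OF z])
qed

lemma G\<alpha>_ident:
  assumes z: "Im z \<noteq> 0" and w: "Im w \<noteq> 0"
  shows "G\<alpha> z e = G\<alpha> w e + (z - w) *\<^sub>C R\<alpha> w (G\<alpha> z e)"
proof -
  define c where "c = N z *v e"
  define y where "y = G z c"
  define d where "d = N w *v (\<alpha> *v Gs w y)"
  have c: "c + \<alpha> *v (F z *v c) = e" unfolding c_def by (rule N_cancel[OF z])
  have "(z - w) *s d = N w *v (\<alpha> *v ((z - w) *s Gs w y))"
    by (simp only: d_def vector_scalar_commute)
  also have "\<dots> = N w *v e - c"
  proof (rule N_eqI[OF w])
    have "N w *v e - c + \<alpha> *v (F w *v (N w *v e - c)) =
      (N w *v e + \<alpha> *v (F w *v (N w *v e))) - (c + \<alpha> *v (F w *v c))"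
      by (simp add: matrix_vector_mult_diff_distrib)
    also have "\<dots> = (c + \<alpha> *v (F z *v c)) - (c + \<alpha> *v (F w *v c))"
      by (simp only: N_cancel[OF w] c)
    also have "\<dots> = \<alpha> *v ((z - w) *s Gs w y)"
      unfolding y_def F_ident[OF z w] by (simp add: matrix_vector_mult_diff_distrib)
    finally show "N w *v e - c + \<alpha> *v (F w *v (N w *v e - c)) = \<alpha> *v ((z - w) *s Gs w y)" .
  qed
  finally have dd: "(z - w) *s d = N w *v e - c" .
  have "(z - w) *\<^sub>C R\<alpha> w y = (z - w) *\<^sub>C R w y - G w ((z - w) *s d)"
    by (simp only: R\<alpha>_def d_def scaleC_diff_right G_scale)
  also have "\<dots> = G z c - G w c - (G w (N w *v e) - G w c)"
    unfolding y_def G_ident[OF z w] dd G_diff ..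
  finally show ?thesis by (simp add: G\<alpha>_def y_def c_def)
qed

text \<open>The left side is the imaginary part of the \<open>j\<close>-th diagonal entry of
  \<open>F z ** N z\<close>; the term with the Hermitian \<open>\<alpha>\<close> is real and drops
  out.\<close>

lemma norm_G\<alpha>_le:
  assumes z: "Im z > 0"
  shows "Im z * (norm (G\<alpha> z (axis j 1)))\<^sup>2 \<le> norm (F z ** N z)"
proof -
  have z0: "Im z \<noteq> 0" using z by simp
  let ?e = "axis j 1 :: complex^'d"
  define c where "c = N z *v ?e"
  have c: "c + \<alpha> *v (F z *v c) = ?e" unfolding c_def by (rule N_cancel[OF z0])
  have "vinner ?e (F z *v c) = vinner c (F z *v c) + vinner (\<alpha> *v (F z *v c)) (F z *v c)"
    by (subst c[symmetric]) (simp add: vinner_add_left)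
  then have "Im (vinner ?e (F z *v c)) = Im z * (norm (G z c))\<^sup>2"
    using Im_F[OF z0, of c] Im_vinner_hermitian[OF hermitian, of "F z *v c"]
      vinner_mult_hermitian[OF hermitian, of "F z *v c" "F z *v c"] by simp
  then have "Im z * (norm (G\<alpha> z ?e))\<^sup>2 = Im ((F z ** N z) $ j $ j)"
    by (simp add: G\<alpha>_def c_def vinner_axis matrix_vector_mul_assoc matrix_vector_axis)
  also have "\<dots> \<le> cmod ((F z ** N z) $ j $ j)"
    using abs_Im_le_cmod abs_le_D1 by blast
  also have "\<dots> \<le> norm ((F z ** N z) $ j)" by (rule Finite_Cartesian_Product.norm_nth_le)
  also have "\<dots> \<le> norm (F z ** N z)" by (rule Finite_Cartesian_Product.norm_nth_le)
  finally show ?thesis .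
qed

definition T\<alpha> :: "('h \<times> 'h) set" where
  "T\<alpha> = {(R\<alpha> \<i> x, x + \<i> *\<^sub>C R\<alpha> \<i> x) | x. True}"

lemma self_adjoint_T\<alpha>: "self_adjoint T\<alpha>"
  and resolvent_T\<alpha>: "Im z \<noteq> 0 \<Longrightarrow> resolvent T\<alpha> z x = R\<alpha> z x"
  unfolding T\<alpha>_def using resolvent_family[of R\<alpha>, OF R\<alpha>_linear R\<alpha>_adj R\<alpha>_ident R\<alpha>_inj] by auto

end

section \<open>Form-bounded perturbations\<close>

text \<open>A competing operator may refer to another spectral measure of \<open>T\<close>, but the
  vector measures coincide, so both have the same quadratic form.\<close>

lemma (in spectral_pvm) bounded_borel_calculus_eq_Phi:
  assumes f: "bounded_borel f"
  shows "bounded_borel_calculus T f = Phi f"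
  unfolding bounded_borel_calculus_def
proof (rule the_equality)
  show "clinear (Phi f) \<and> (\<exists>P. is_spectral_pvm T P \<and> (\<forall>x. cinner x (Phi f x) = (LINT t|pvm_vector_measure P x. f t)))"
    using clinear_Phi[OF f] spectral Phi_integral[OF f] by blast
  fix Q assume Q: "clinear Q \<and> (\<exists>P. is_spectral_pvm T P \<and> (\<forall>x. cinner x (Q x) = (LINT t|pvm_vector_measure P x. f t)))"
  then obtain P' where P': "is_spectral_pvm T P'" "\<And>x. cinner x (Q x) = (LINT t|pvm_vector_measure P' x. f t)" by blast
  have "cinner x (Q x) = cinner x (Phi f x)" for x
    using P'(2)[of x] spectral_vector_measure_unique[OF self_adj P'(1) spectral, of x] Phi_integral[OF f, of x] by simp
  then show "Q = Phi f" using Q clinear_Phi[OF f] by (intro quadratic_form_unique) auto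
qed

text \<open>Equality of norms makes the passage from \<open>\<iota> x\<close> to \<open>S x\<close>
  well defined and isometric, so it extends along Cauchy sequences. It realizes the abstract
  completion inside a concrete space.\<close>

lemma isometric_extension:
  fixes \<iota> :: "'h::complex_normed_vector \<Rightarrow> 'k::complex_normed_vector" and S :: "'h \<Rightarrow> 'b::complex_banach"
  assumes \<iota>: "clinear \<iota>" and S: "clinear S" and iso: "\<And>x. norm (\<iota> x) = norm (S x)"
    and dense: "closure (range \<iota>) = UNIV"
  obtains J where "clinear J" "\<And>k. norm (J k) = norm k" "\<And>x. J (\<iota> x) = S x"
proof -
  have seq: "\<exists>s. (\<lambda>n. \<iota> (s n)) \<longlonglongrightarrow> k" for k
  proof -
    obtain q where q: "\<And>n. q n \<in> range \<iota>" "q \<longlonglongrightarrow> k"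
      using dense closure_sequential[of k "range \<iota>"] by auto
    from q(1) have "\<forall>n. \<exists>x. q n = \<iota> x" by blast
    from choice[OF this] obtain s where "\<forall>n. q n = \<iota> (s n)" ..
    then have "q = (\<lambda>n. \<iota> (s n))" by auto
    then show ?thesis using q(2) by auto
  qed
  have "\<exists>l. \<forall>s. (\<lambda>n. \<iota> (s n)) \<longlonglongrightarrow> k \<longrightarrow> (\<lambda>n. S (s n)) \<longlonglongrightarrow> l" for k
  proof -
    obtain s where s: "(\<lambda>n. \<iota> (s n)) \<longlonglongrightarrow> k" using seq by blast
    have diff: "norm (S (a - b)) = norm (\<iota> a - \<iota> b)" for a b
      using iso[of "a - b"] clinear_diff[OF \<iota>] by simp
    have "Cauchy (\<lambda>n. S (s n))"
    proof (rule CauchyI)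
      fix e :: real assume "e > 0"
      then obtain M where "\<forall>m\<ge>M. \<forall>n\<ge>M. norm (\<iota> (s m) - \<iota> (s n)) < e"
        using CauchyD[OF LIMSEQ_imp_Cauchy[OF s]] by blast
      then show "\<exists>M. \<forall>m\<ge>M. \<forall>n\<ge>M. norm (S (s m) - S (s n)) < e"
        by (simp only: clinear_diff[OF S, symmetric] diff) blast
    qed
    then obtain l where l: "(\<lambda>n. S (s n)) \<longlonglongrightarrow> l" using Cauchy_convergent convergent_def by blast
    have "(\<lambda>n. S (q n)) \<longlonglongrightarrow> l" if q: "(\<lambda>n. \<iota> (q n)) \<longlonglongrightarrow> k" for q
    proof -
      have "(\<lambda>n. \<iota> (q n) - \<iota> (s n)) \<longlonglongrightarrow> 0" using tendsto_diff[OF q s] by simp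
      then have "(\<lambda>n. norm (\<iota> (q n) - \<iota> (s n))) \<longlonglongrightarrow> 0" by (simp add: tendsto_norm_zero_iff)
      then have "(\<lambda>n. norm (S (q n) - S (s n))) \<longlonglongrightarrow> 0" by (simp only: clinear_diff[OF S, symmetric] diff)
      then have "(\<lambda>n. S (q n) - S (s n)) \<longlonglongrightarrow> 0" by (simp only: tendsto_norm_zero_iff)
      from tendsto_add[OF this l] show ?thesis by simp
    qed
    then show ?thesis by blast
  qed
  then have "\<forall>k. \<exists>l. \<forall>s. (\<lambda>n. \<iota> (s n)) \<longlonglongrightarrow> k \<longrightarrow> (\<lambda>n. S (s n)) \<longlonglongrightarrow> l" by simp
  from choice[OF this] obtain J where "\<forall>k. \<forall>s. (\<lambda>n. \<iota> (s n)) \<longlonglongrightarrow> k \<longrightarrow> (\<lambda>n. S (s n)) \<longlonglongrightarrow> J k" ..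
  then have J: "(\<lambda>n. \<iota> (s n)) \<longlonglongrightarrow> k \<Longrightarrow> (\<lambda>n. S (s n)) \<longlonglongrightarrow> J k" for s k by blast
  show thesis
  proof (rule that)
    show "clinear J"
    proof (rule clinearI)
      fix k l c
      obtain s where s: "(\<lambda>n. \<iota> (s n)) \<longlonglongrightarrow> k" using seq by blast
      obtain q where q: "(\<lambda>n. \<iota> (q n)) \<longlonglongrightarrow> l" using seq by blast
      have "(\<lambda>n. \<iota> (s n + q n)) \<longlonglongrightarrow> k + l"
        unfolding clinear_add[OF \<iota>] by (intro tendsto_intros s q)
      from J[OF this] have "(\<lambda>n. S (s n) + S (q n)) \<longlonglongrightarrow> J (k + l)" unfolding clinear_add[OF S] .
      moreover have "(\<lambda>n. S (s n) + S (q n)) \<longlonglongrightarrow> J k + J l" by (intro tendsto_intros J s q)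
      ultimately show "J (k + l) = J k + J l" using LIMSEQ_unique by blast
      have "(\<lambda>n. \<iota> (c *\<^sub>C s n)) \<longlonglongrightarrow> c *\<^sub>C k"
        unfolding clinear_scale[OF \<iota>] by (intro tendsto_intros s)
      from J[OF this] have "(\<lambda>n. c *\<^sub>C S (s n)) \<longlonglongrightarrow> J (c *\<^sub>C k)" unfolding clinear_scale[OF S] .
      moreover have "(\<lambda>n. c *\<^sub>C S (s n)) \<longlonglongrightarrow> c *\<^sub>C J k" by (intro tendsto_intros J s)
      ultimately show "J (c *\<^sub>C k) = c *\<^sub>C J k" using LIMSEQ_unique by blast
    qed
    show "norm (J k) = norm k" for k
    proof -
      obtain s where s: "(\<lambda>n. \<iota> (s n)) \<longlonglongrightarrow> k" using seq by blast
      from tendsto_norm[OF J[OF this]] have "(\<lambda>n. norm (\<iota> (s n))) \<longlonglongrightarrow> norm (J k)" by (simp only: iso)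
      with tendsto_norm[OF s] show ?thesis using LIMSEQ_unique by blast
    qed
    show "J (\<iota> x) = S x" for x
      using J[of "\<lambda>_. x" "\<iota> x"] by (simp add: LIMSEQ_const_iff)
  qed
qed

lemma continuous_extension_eqI:
  fixes g :: "'k::metric_space \<Rightarrow> 'b::t2_space"
  assumes g: "continuous_on UNIV g" "\<And>x. g (\<iota> x) = f x" and dense: "closure (range \<iota>) = UNIV"
  shows "continuous_extension \<iota> f = g"
  unfolding continuous_extension_def
proof (rule the_equality)
  show "continuous_on UNIV g \<and> (\<forall>x. g (\<iota> x) = f x)" using g by blast
  fix h assume h: "continuous_on UNIV h \<and> (\<forall>x. h (\<iota> x) = f x)"
  show "h = g"
  proof
    fix k
    obtain q where q: "\<And>n. q n \<in> range \<iota>" "q \<longlonglongrightarrow> k"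
      using dense closure_sequential[of k "range \<iota>"] by auto
    have "(\<lambda>n. h (q n)) \<longlonglongrightarrow> h k" "(\<lambda>n. g (q n)) \<longlonglongrightarrow> g k"
      using h g(1) q(2) by (auto intro: continuous_on_tendsto_compose)
    moreover have "h (q n) = g (q n)" for n using q(1)[of n] h g(2) by auto
    ultimately show "h k = g k" using LIMSEQ_unique by auto
  qed
qed

lemma clinear_bounded_continuous_on:
  assumes "clinear f" "\<And>x. norm (f x) \<le> C * norm x"
  shows "continuous_on UNIV f"
  unfolding continuous_on_sequentially o_def using clinear_tendsto[OF assms] by blast

section \<open>The weight functions of the form-bounded calculus\<close>

definition sfun :: "real \<Rightarrow> complex" where
  "sfun t = complex_of_real ((1 + \<bar>t\<bar>) powr (-1/2))"

text \<open>The resolvent function with both weights stripped off: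
  \<open>rfun z t = sfun t * vfun z t * sfun t\<close>, and \<open>vfun z\<close> is still bounded.
  In \<open>svfun\<close> only one weight is stripped off.\<close>

definition vfun :: "complex \<Rightarrow> real \<Rightarrow> complex" where
  "vfun z t = complex_of_real (1 + \<bar>t\<bar>) * rfun z t"

definition svfun :: "complex \<Rightarrow> real \<Rightarrow> complex" where
  "svfun z t = sfun t * vfun z t"

lemma bounded_borel_sfun: "bounded_borel sfun"
proof (rule bounded_borelI)
  show "sfun \<in> borel_measurable borel" unfolding sfun_def by measurable
  fix t :: real
  have "(1 + \<bar>t\<bar>) powr (-1/2) \<le> (1 + \<bar>t\<bar>) powr 0" by (rule powr_mono) auto
  moreover have "1 + \<bar>t\<bar> \<noteq> 0" using abs_ge_zero[of t] by linarith
  ultimately show "cmod (sfun t) \<le> 1" by (simp add: sfun_def)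
qed

lemma vfun_bound:
  assumes z: "Im z \<noteq> 0"
  shows "cmod (vfun z t) \<le> 1 / \<bar>Im z\<bar> + (1 + cmod z / \<bar>Im z\<bar>)"
proof -
  have "cmod (vfun z t) = cmod (rfun z t) + cmod (complex_of_real t * rfun z t)"
  proof -
    have "cmod (complex_of_real (1 + \<bar>t\<bar>)) = 1 + \<bar>t\<bar>" by (simp only: norm_of_real)
    then have "cmod (vfun z t) = (1 + \<bar>t\<bar>) * cmod (rfun z t)" by (simp only: vfun_def norm_mult)
    moreover have "cmod (complex_of_real t * rfun z t) = \<bar>t\<bar> * cmod (rfun z t)"
      by (simp only: norm_mult norm_of_real)
    ultimately show ?thesis by (simp only: distrib_right mult_1_left)
  qed
  then show ?thesis using rfun_bound[OF z, of t] id_rfun_bound[OF z, of t] by linarith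
qed

lemma bounded_borel_vfun: "Im z \<noteq> 0 \<Longrightarrow> bounded_borel (vfun z)"
proof (rule bounded_borelI[OF _ vfun_bound])
  show "vfun z \<in> borel_measurable borel" unfolding vfun_def by measurable
qed

lemma bounded_borel_svfun: "Im z \<noteq> 0 \<Longrightarrow> bounded_borel (svfun z)"
  unfolding svfun_def by (rule bounded_borel_mult[OF bounded_borel_sfun bounded_borel_vfun])

lemma sfun_sq: "sfun t * sfun t * complex_of_real (1 + \<bar>t\<bar>) = 1"
proof -
  have "(1 + \<bar>t\<bar>) powr (-1/2) * (1 + \<bar>t\<bar>) powr (-1/2) * (1 + \<bar>t\<bar>) = 1"
    by (simp add: powr_add[symmetric] powr_minus_divide)
  then show ?thesis unfolding sfun_def of_real_mult[symmetric] by simp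
qed

lemma sfun_svfun: "sfun t * svfun z t = rfun z t"
proof -
  have "sfun t * svfun z t = (sfun t * sfun t * complex_of_real (1 + \<bar>t\<bar>)) * rfun z t"
    by (simp only: svfun_def vfun_def mult.assoc)
  then show ?thesis by (simp only: sfun_sq mult_1_left)
qed

lemma rfun_diff:
  assumes z: "Im z \<noteq> 0" and w: "Im w \<noteq> 0"
  shows "(z - w) * (rfun w t * rfun z t) = rfun z t - rfun w t"
  using of_real_diff_neq_0[OF z, of t] of_real_diff_neq_0[OF w, of t] by (simp add: divide_simps)

lemma cnj_sfun: "cnj (sfun t) = sfun t" and cnj_vfun: "cnj (vfun z t) = vfun (cnj z) t"
  by (simp_all add: sfun_def vfun_def)

locale form_perturbation = spectral_pvm P A
  for P :: "real set \<Rightarrow> 'h::complex_hilbert \<Rightarrow> 'h" and A :: "('h \<times> 'h) set" +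
  fixes \<iota> :: "'h \<Rightarrow> 'k::complex_banach" and B :: "complex^'d \<Rightarrow> 'k"
  assumes form: "form_completion A \<iota>" and B_linear: "Vector_Spaces.linear (*s) scaleC B"
begin

lemma norm_\<iota>: "norm (\<iota> x) = norm (Phi sfun x)"
  using form bounded_borel_calculus_eq_Phi[OF bounded_borel_sfun]
  unfolding form_completion_def inv_sqrt_I_plus_abs_def sfun_def by simp

lemma dense_\<iota>: "closure (range \<iota>) = UNIV"
  using form unfolding form_completion_def by blast

definition J :: "'k \<Rightarrow> 'h" where
  "J = (SOME J. clinear J \<and> (\<forall>k. norm (J k) = norm k) \<and> (\<forall>x. J (\<iota> x) = Phi sfun x))"

lemma J: "clinear J" "norm (J k) = norm k" "J (\<iota> x) = Phi sfun x"
proof -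
  have "clinear \<iota>" using form unfolding form_completion_def by blast
  then have "\<exists>J. clinear J \<and> (\<forall>k. norm (J k) = norm k) \<and> (\<forall>x. J (\<iota> x) = Phi sfun x)"
    by (rule isometric_extension[OF _ clinear_Phi[OF bounded_borel_sfun] norm_\<iota> dense_\<iota>]) (intro exI conjI allI)
  from someI_ex[OF this] show "clinear J" "norm (J k) = norm k" "J (\<iota> x) = Phi sfun x"
    unfolding J_def by auto
qed

lemma continuous_J: "continuous_on UNIV J"
  using J(1,2) by (intro clinear_bounded_continuous_on[of _ 1]) auto

text \<open>\<open>J\<close> extends \<open>(I + |A|)\<^sup>-\<^sup>1\<^sup>/\<^sup>2\<close> to the completion, so \<open>b\<close> is \<open>(I + |A|)\<^sup>-\<^sup>1\<^sup>/\<^sup>2 B\<close>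
  and \<open>bs\<close> its adjoint.\<close>

definition b :: "complex^'d \<Rightarrow> 'h" where "b e = J (B e)"

lemma b_add: "b (e + f) = b e + b f" and b_scale: "b (c *s e) = c *\<^sub>C b e"
  using B_linear by (simp_all add: b_def Vector_Spaces.linear_iff clinear_add[OF J(1)] clinear_scale[OF J(1)])

lemma b_eq_sum: "b e = (\<Sum>j\<in>UNIV. (e $ j) *\<^sub>C b (axis j 1))"
proof -
  have sum: "b (\<Sum>j\<in>I. f j) = (\<Sum>j\<in>I. b (f j))" for f :: "'d \<Rightarrow> complex^'d" and I
    using b_scale[of 0 0] by (induction I rule: infinite_finite_induct) (auto simp: b_add)
  have "e = (\<Sum>j\<in>UNIV. (e $ j) *s axis j 1)" by (simp add: basis_expansion)
  then have "b e = b (\<Sum>j\<in>UNIV. (e $ j) *s axis j 1)" by (rule arg_cong)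
  then show ?thesis by (simp only: sum b_scale)
qed

definition bs :: "'h \<Rightarrow> complex^'d" where "bs h = (\<chi> j. cinner (b (axis j 1)) h)"

lemma bs_add: "bs (x + y) = bs x + bs y" and bs_scale: "bs (c *\<^sub>C x) = c *s bs x"
  and bs_diff: "bs (x - y) = bs x - bs y"
  by (simp_all add: bs_def vec_eq_iff cinner_simps)

lemma vinner_bs: "vinner e (bs h) = cinner (b e) h"
  by (subst b_eq_sum) (simp add: vinner_def bs_def cinner_sum_left cinner_scaleC_left)

text \<open>The default 0 at real \<open>z\<close> makes additivity and homogeneity hold for every
  \<open>z\<close>, as the locale \<open>krein\<close> states them.\<close>

definition G :: "complex \<Rightarrow> complex^'d \<Rightarrow> 'h" where
  "G z e = (if Im z = 0 then 0 else Phi (svfun z) (b e))"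

definition Gs :: "complex \<Rightarrow> 'h \<Rightarrow> complex^'d" where
  "Gs z x = bs (if Im z = 0 then 0 else Phi (svfun z) x)"

lemma G_eq: "Im z \<noteq> 0 \<Longrightarrow> G z e = Phi (svfun z) (b e)"
  and Gs_eq: "Im z \<noteq> 0 \<Longrightarrow> Gs z x = bs (Phi (svfun z) x)"
  by (simp_all add: G_def Gs_def)

definition F :: "complex \<Rightarrow> complex^'d^'d" where
  "F z = (\<chi> i j. cinner (b (axis i 1)) (Phi (vfun z) (b (axis j 1))))"

lemma F_mult: 
  assumes z: "Im z \<noteq> 0"
  shows "F z *v e = bs (Phi (vfun z) (b e))"
proof -
  note lin = clinear_Phi[OF bounded_borel_vfun[OF z]]
  have "Phi (vfun z) (b e) = (\<Sum>j\<in>UNIV. (e $ j) *\<^sub>C Phi (vfun z) (b (axis j 1)))"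
    by (subst b_eq_sum) (simp only: clinear_sum[OF lin] clinear_scale[OF lin])
  then show ?thesis
    by (simp add: vec_eq_iff bs_def F_def matrix_vector_mult_def cinner_sum_right cinner_scaleC_right mult.commute)
qed

text \<open>\<open>J\<close> extends \<open>Phi sfun\<close>, and
  \<open>svfun z t * sfun t = rfun z t\<close>; so \<open>Phi (svfun z)\<close> after
  \<open>J\<close> is continuous and restricts to the resolvent.\<close>

lemma resolvent_B_eq:
  assumes z: "Im z \<noteq> 0"
  shows "resolvent_B A \<iota> B z e = Phi (svfun z) (b e)"
proof -
  have sv: "bounded_borel (svfun z)" by (rule bounded_borel_svfun[OF z])
  obtain C where C: "\<And>t. cmod (svfun z t) \<le> C" using sv unfolding bounded_borel_def by auto
  have "continuous_extension \<iota> (resolvent A z) = (\<lambda>k. Phi (svfun z) (J k))"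
  proof (rule continuous_extension_eqI[OF _ _ dense_\<iota>])
    show "continuous_on UNIV (\<lambda>k. Phi (svfun z) (J k))"
    proof (rule clinear_bounded_continuous_on[OF clinear_compose[OF clinear_Phi[OF sv] J(1)]])
      show "norm (Phi (svfun z) (J k)) \<le> C * norm k" for k
        using Phi_bound[OF sv C, of "J k"] J(2) by simp
    qed
    have "(\<lambda>t. svfun z t * sfun t) = rfun z"
      using sfun_svfun[of _ z] by (simp only: mult.commute)
    then show "Phi (svfun z) (J (\<iota> x)) = resolvent A z x" for x
      using Phi_mult[OF sv bounded_borel_sfun, of x] by (simp only: J(3) resolvent_eq_Phi[OF z])
  qed
  then show ?thesis by (simp add: resolvent_B_def b_def)
qed

text \<open>On vectors \<open>Phi sfun h\<close> the weight can be shifted to the other factor of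
  the inner product, where \<open>J\<close> absorbs it.\<close>

lemma B_star_eq: "B_star \<iota> B (Phi sfun h) = bs h"
proof -
  have "continuous_extension \<iota> (\<lambda>x. cinner x (Phi sfun h)) = (\<lambda>k. cinner (J k) h)"
  proof (rule continuous_extension_eqI[OF _ _ dense_\<iota>])
    show "continuous_on UNIV (\<lambda>k. cinner (J k) h)"
      by (intro bounded_bilinear.continuous_on[OF bounded_bilinear_cinner] continuous_J continuous_intros)
    show "cinner (J (\<iota> x)) h = cinner x (Phi sfun h)" for x
      using Phi_adjoint[OF bounded_borel_sfun, of x h] by (simp add: J(3) cnj_sfun)
  qed
  then show ?thesis by (simp add: B_star_def bs_def b_def)
qed

lemma Phi_ident:
  assumes "bounded_borel f" "bounded_borel g" "bounded_borel h" "bounded_borel k"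
    and eq: "\<And>t. c * (f t * g t) = h t - k t"
  shows "c *\<^sub>C Phi f (Phi g x) = Phi h x - Phi k x"
  using Phi_scale[OF bounded_borel_mult[OF assms(1,2)], of c x] Phi_mult[OF assms(1,2), of x]
    Phi_diff[OF assms(3,4), of x] by (simp only: eq)

lemma resolvent_eq_sfun:
  assumes z: "Im z \<noteq> 0"
  shows "resolvent A z x = Phi sfun (Phi (svfun z) x)"
  using Phi_mult[OF bounded_borel_sfun bounded_borel_svfun[OF z], of x]
  by (simp only: sfun_svfun resolvent_eq_Phi[OF z])

lemma G_eq_sfun:
  assumes z: "Im z \<noteq> 0"
  shows "G z e = Phi sfun (Phi (vfun z) (b e))"
  using Phi_mult[OF bounded_borel_sfun bounded_borel_vfun[OF z], of "b e"]
  by (simp only: G_eq[OF z] svfun_def[abs_def])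

lemma F_matrix_eq: "Im z \<noteq> 0 \<Longrightarrow> F_matrix A \<iota> B z = F z"
  using G_eq_sfun[of z]
  by (simp add: F_matrix_def matrix_def resolvent_B_eq G_eq[symmetric] B_star_eq F_def bs_def)

text \<open>The identities for \<open>G\<close>, \<open>Gs\<close> and \<open>F\<close> reduce
  through \<open>Phi_ident\<close> to the scalar identity \<open>rfun_diff\<close> multiplied by
  weights, and the adjoint relations to conjugation of functions.\<close>

sublocale krein "resolvent A" G Gs F
proof (rule krein.intro)
  note s = bounded_borel_sfun and v = bounded_borel_vfun and sv = bounded_borel_svfun and r = bounded_borel_rfun
  show "clinear (resolvent A z)" if "Im z \<noteq> 0" for z by (rule clinear_resolvent[OF self_adj that])
  show "cinner (resolvent A z x) y = cinner x (resolvent A (cnj z) y)" if "Im z \<noteq> 0" for z x y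
    by (rule resolvent_adjoint[OF self_adj that])
  show "(z - w) *\<^sub>C resolvent A w (resolvent A z x) = resolvent A z x - resolvent A w x" if "Im z \<noteq> 0" "Im w \<noteq> 0" for z w x
    using resolvent_identity[OF self_adj that, of x] by (simp add: eq_diff_eq add.commute)
  show "x = 0" if z: "Im z \<noteq> 0" and 0: "resolvent A z x = 0" for z x
  proof -
    have "(0, x) \<in> A" using resolvent_mem[OF self_adj z, of x] 0 by simp
    moreover have "(0, 0) \<in> A" by (rule self_adjoint_memI[OF self_adj]) simp
    ultimately show ?thesis by (rule self_adjoint_single_valued[OF self_adj])
  qed
  show "G z (e + f) = G z e + G z f" for z e f
    by (cases "Im z = 0") (simp_all add: G_def b_add clinear_add[OF clinear_Phi[OF sv]])
  show "G z (c *s e) = c *\<^sub>C G z e" for z c e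
    by (cases "Im z = 0") (simp_all add: G_def b_scale clinear_scale[OF clinear_Phi[OF sv]])
  show "Gs z (x + y) = Gs z x + Gs z y" for z x y
    by (cases "Im z = 0") (simp_all add: Gs_def bs_add[symmetric] clinear_add[OF clinear_Phi[OF sv]])
  show "Gs z (c *\<^sub>C x) = c *s Gs z x" for z c x
    by (cases "Im z = 0") (simp_all add: Gs_def bs_scale[symmetric] clinear_scale[OF clinear_Phi[OF sv]])
  fix z w :: complex and x :: 'h and e :: "complex^'d" assume z: "Im z \<noteq> 0" and w: "Im w \<noteq> 0"
  have eq: "(z - w) * (p * rfun w t * (q * rfun z t)) = p * q * rfun z t - p * q * rfun w t" for p q t
  proof -
    have "(z - w) * (p * rfun w t * (q * rfun z t)) = p * q * ((z - w) * (rfun w t * rfun z t))" by (simp only: ac_simps)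
    then show ?thesis by (simp only: rfun_diff[OF z w] right_diff_distrib)
  qed
  show "(z - w) *\<^sub>C resolvent A w (G z e) = G z e - G w e"
    unfolding G_eq[OF z] G_eq[OF w] resolvent_eq_Phi[OF w]
  proof (rule Phi_ident[OF r[OF w] sv[OF z] sv[OF z] sv[OF w]])
    show "(z - w) * (rfun w t * svfun z t) = svfun z t - svfun w t" for t
      using eq[of 1 t "sfun t * complex_of_real (1 + \<bar>t\<bar>)"] by (simp only: svfun_def vfun_def mult_1_left mult.assoc)
  qed
  show "(z - w) *s Gs w (resolvent A z x) = Gs z x - Gs w x"
  proof -
    have "(z - w) *\<^sub>C Phi (svfun w) (Phi (rfun z) x) = Phi (svfun z) x - Phi (svfun w) x"
    proof (rule Phi_ident[OF sv[OF w] r[OF z] sv[OF z] sv[OF w]])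
      show "(z - w) * (svfun w t * rfun z t) = svfun z t - svfun w t" for t
        using eq[of "sfun t * complex_of_real (1 + \<bar>t\<bar>)" t 1] by (simp only: svfun_def vfun_def mult_1_left mult_1_right mult.assoc)
    qed
    then show ?thesis by (simp only: Gs_eq[OF z] Gs_eq[OF w] bs_scale[symmetric] bs_diff[symmetric] resolvent_eq_Phi[OF z])
  qed
  show "(z - w) *s Gs w (G z e) = F z *v e - F w *v e"
  proof -
    have "(z - w) *\<^sub>C Phi (svfun w) (Phi (svfun z) (b e)) = Phi (vfun z) (b e) - Phi (vfun w) (b e)"
    proof (rule Phi_ident[OF sv[OF w] sv[OF z] v[OF z] v[OF w]])
      fix t
      let ?a = "complex_of_real (1 + \<bar>t\<bar>)"
      have pq: "(sfun t * ?a) * (sfun t * ?a) = ?a"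
      proof -
        have "(sfun t * ?a) * (sfun t * ?a) = (sfun t * sfun t * ?a) * ?a" by (simp only: ac_simps)
        then show ?thesis by (simp only: sfun_sq mult_1_left)
      qed
      show "(z - w) * (svfun w t * svfun z t) = vfun z t - vfun w t"
        using eq[of "sfun t * ?a" t "sfun t * ?a"] unfolding pq by (simp only: svfun_def vfun_def mult.assoc)
    qed
    then show ?thesis by (simp only: Gs_eq[OF w] G_eq[OF z] bs_scale[symmetric] bs_diff[symmetric] F_mult[OF z] F_mult[OF w])
  qed
  show "cinner (G z e) x = vinner e (Gs (cnj z) x)"
  proof -
    have "(\<lambda>t. cnj (svfun z t)) = svfun (cnj z)" by (simp add: fun_eq_iff svfun_def cnj_sfun cnj_vfun)
    then show ?thesis using Phi_adjoint[OF sv[OF z], of "b e" x] z by (simp add: G_eq Gs_eq vinner_bs)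
  qed
  show "vinner (F z *v e) f = vinner e (F (cnj z) *v f)" for f
  proof -
    have z': "Im (cnj z) \<noteq> 0" using z by simp
    have "vinner (F z *v e) f = cnj (vinner f (F z *v e))" by (rule vinner_commute)
    also have "\<dots> = cinner (Phi (vfun z) (b e)) (b f)"
      by (simp only: F_mult[OF z] vinner_bs cinner_commute[symmetric])
    also have "\<dots> = cinner (b e) (Phi (vfun (cnj z)) (b f))"
      using Phi_adjoint[OF v[OF z], of "b e" "b f"] by (simp only: cnj_vfun)
    finally show ?thesis by (simp only: F_mult[OF z'] vinner_bs)
  qed
  show "Gs z x = F z *v c" if eq: "resolvent A z x = G z c" for c
  proof -
    \<comment> \<open>Both sides of the assumed equation are values of \<open>Phi sfun\<close>,
      where \<open>B_star\<close> is known.\<close>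
    have "bs (Phi (svfun z) x) = bs (Phi (vfun z) (b c))"
      using arg_cong[OF eq, of "B_star \<iota> B"] unfolding resolvent_eq_sfun[OF z] G_eq_sfun[OF z] B_star_eq .
    then show ?thesis using z by (simp add: Gs_eq F_mult[OF z])
  qed
qed

text \<open>Existence is the theorem on resolvent families; uniqueness holds because the resolvent
  at \<open>\<i>\<close> already determines a self-adjoint operator.\<close>

lemma perturbed_operator_eq:
  assumes \<alpha>: "\<alpha> \<in> hermitian_matrices"
  shows "perturbed_operator A \<iota> B \<alpha> = krein_perturbation.T\<alpha> (resolvent A) G Gs F \<alpha>"
proof -
  interpret kp: krein_perturbation "resolvent A" G Gs F \<alpha> by unfold_locales (rule \<alpha>)
  have R\<alpha>: "kp.R\<alpha> z x = resolvent A z x -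
        resolvent_B A \<iota> B z (matrix_inv (mat 1 + \<alpha> ** F_matrix A \<iota> B z) *v
          (\<alpha> *v B_star \<iota> B (resolvent A z x)))" if z: "Im z \<noteq> 0" for z x
    using z by (simp add: kp.R\<alpha>_def kp.N_def resolvent_B_eq F_matrix_eq G_eq[symmetric] Gs_eq resolvent_eq_sfun B_star_eq)
  show ?thesis
    unfolding perturbed_operator_def
  proof (rule the_equality)
    show "self_adjoint kp.T\<alpha> \<and> (\<forall>z. z \<notin> \<real> \<longrightarrow> (\<forall>x. resolvent kp.T\<alpha> z x = resolvent A z x -
        resolvent_B A \<iota> B z (matrix_inv (mat 1 + \<alpha> ** F_matrix A \<iota> B z) *v
          (\<alpha> *v B_star \<iota> B (resolvent A z x)))))"
      using kp.self_adjoint_T\<alpha> kp.resolvent_T\<alpha> R\<alpha> by (simp add: complex_is_Real_iff)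
    fix T assume T: "self_adjoint T \<and> (\<forall>z. z \<notin> \<real> \<longrightarrow> (\<forall>x. resolvent T z x = resolvent A z x -
        resolvent_B A \<iota> B z (matrix_inv (mat 1 + \<alpha> ** F_matrix A \<iota> B z) *v
          (\<alpha> *v B_star \<iota> B (resolvent A z x)))))"
    have i: "Im \<i> \<noteq> 0" "\<i> \<notin> \<real>" by (simp_all add: complex_is_Real_iff)
    show "T = kp.T\<alpha>"
    proof (rule self_adjoint_eq_if_resolvent_eq[OF _ kp.self_adjoint_T\<alpha> i(1)])
      show "self_adjoint T" using T by blast
      show "resolvent T \<i> x = resolvent kp.T\<alpha> \<i> x" for x
        using T i(2) kp.resolvent_T\<alpha>[OF i(1), of x] R\<alpha>[OF i(1), of x] by simp
    qed
  qed
qed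

text \<open>Source of measurability in \<open>x\<close> for everything built from \<open>F\<close>
  along a horizontal line. A convergent sequence of points stays bounded, which gives the uniform
  bound on \<open>vfun\<close>.\<close>

lemma continuous_F:
  assumes "y \<noteq> 0"
  shows "continuous_on UNIV (\<lambda>x. F (Complex x y) $ i $ j)"
  unfolding continuous_on_sequentially o_def
proof (intro ballI allI impI)
  fix q :: "nat \<Rightarrow> real" and x assume "(\<forall>n. q n \<in> UNIV) \<and> q \<longlonglongrightarrow> x"
  then have q: "q \<longlonglongrightarrow> x" by simp
  have Im: "Im (Complex a y) \<noteq> 0" for a using assms by simp
  have lim: "(\<lambda>n. Complex (q n) y) \<longlonglongrightarrow> Complex x y"
    by (intro tendsto_intros q)
  have "Bseq (\<lambda>n. Complex (q n) y)" using lim by (intro convergent_imp_Bseq) (auto simp: convergent_def)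
  then obtain K where K: "\<And>n. cmod (Complex (q n) y) \<le> K" by (auto simp: Bseq_def)
  have "(\<lambda>n. Phi (vfun (Complex (q n) y)) (b (axis j 1))) \<longlonglongrightarrow> Phi (vfun (Complex x y)) (b (axis j 1))"
  proof (rule Phi_limit[OF bounded_borel_vfun[OF Im] bounded_borel_vfun[OF Im]])
    show "(\<lambda>n. vfun (Complex (q n) y) t) \<longlonglongrightarrow> vfun (Complex x y) t" for t
      unfolding vfun_def by (intro tendsto_intros lim of_real_diff_neq_0 Im)
    show "cmod (vfun (Complex (q n) y) t) \<le> 1 / \<bar>y\<bar> + (1 + K / \<bar>y\<bar>)" for n t
    proof -
      have "cmod (vfun (Complex (q n) y) t) \<le> 1 / \<bar>y\<bar> + (1 + cmod (Complex (q n) y) / \<bar>y\<bar>)"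
        using vfun_bound[OF Im, of "q n" t] by simp
      also have "\<dots> \<le> 1 / \<bar>y\<bar> + (1 + K / \<bar>y\<bar>)"
        using K[of n] by (intro add_left_mono divide_right_mono) auto
      finally show ?thesis .
    qed
  qed
  then show "(\<lambda>n. F (Complex (q n) y) $ i $ j) \<longlonglongrightarrow> F (Complex x y) $ i $ j"
    unfolding F_def by (simp, intro tendsto_intros)
qed

end

section \<open>Resolvents of dissipative matrices\<close>

lemma norm_vector_smult: "norm (c *s (v :: complex^'n)) = cmod c * norm v"
  by (simp add: norm_vec_def norm_mult L2_set_right_distrib)

text \<open>The norm of a matrix is its Frobenius norm; row by row the estimate is
  Cauchy-Schwarz.\<close>

lemma norm_matrix_mult_le:
  fixes A :: "complex^'n^'m" and B :: "complex^'k^'n"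
  shows "norm (A ** B) \<le> norm A * norm B"
proof -
  have row: "norm ((A ** B) $ i) \<le> norm (A $ i) * norm B" for i
  proof -
    have "(A ** B) $ i = (\<Sum>k\<in>UNIV. (A $ i $ k) *s (B $ k))"
      by (simp add: vec_eq_iff matrix_matrix_mult_def)
    then have "norm ((A ** B) $ i) \<le> (\<Sum>k\<in>UNIV. cmod (A $ i $ k) * norm (B $ k))"
      using sum_norm_le[of UNIV "\<lambda>k. (A $ i $ k) *s (B $ k)" "\<lambda>k. cmod (A $ i $ k) * norm (B $ k)"]
      by (simp add: norm_vector_smult)
    also have "\<dots> \<le> norm (A $ i) * norm B"
      using L2_set_mult_ineq[of "\<lambda>k. cmod (A $ i $ k)" "\<lambda>k. norm (B $ k)" UNIV]
      by (simp add: norm_vec_def)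
    finally show ?thesis .
  qed
  have "norm (A ** B) = L2_set (\<lambda>i. norm ((A ** B) $ i)) UNIV" by (simp add: norm_vec_def)
  also have "\<dots> \<le> L2_set (\<lambda>i. norm (A $ i) * norm B) UNIV"
    by (intro L2_set_mono row) auto
  also have "\<dots> = norm A * norm B"
    by (subst L2_set_left_distrib[symmetric]) (simp_all add: norm_vec_def)
  finally show ?thesis .
qed

lemma norm_sq_matrix_columns:
  fixes M :: "complex^'d^'d"
  shows "(norm M)\<^sup>2 = (\<Sum>j\<in>UNIV. (norm (M *v axis j 1))\<^sup>2)"
proof -
  have sq: "(norm (v :: complex^'d))\<^sup>2 = (\<Sum>i\<in>UNIV. (cmod (v $ i))\<^sup>2)" for v
    by (simp add: norm_vec_def L2_set_def sum_nonneg)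
  have "(norm M)\<^sup>2 = (\<Sum>i\<in>UNIV. (norm (M $ i))\<^sup>2)"
    by (simp add: norm_vec_def[of M] L2_set_def sum_nonneg)
  also have "\<dots> = (\<Sum>i\<in>UNIV. \<Sum>j\<in>UNIV. (cmod (M $ i $ j))\<^sup>2)" by (simp add: sq)
  also have "\<dots> = (\<Sum>j\<in>UNIV. \<Sum>i\<in>UNIV. (cmod (M $ i $ j))\<^sup>2)" by (rule sum.swap)
  also have "\<dots> = (\<Sum>j\<in>UNIV. (norm (M *v axis j 1))\<^sup>2)" by (simp add: sq matrix_vector_axis)
  finally show ?thesis .
qed

lemma mat_mult_vec: "mat c *v v = c *s (v :: 'a::comm_semiring_1^'n)"
  by (vector matrix_vector_mult_def mat_def) (simp add: if_distrib if_distribR cong: if_cong)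

lemma mat_eq_mult: "mat c ** (M :: complex^'n^'n) = (\<chi> i. c *s (M $ i))"
  by (vector matrix_matrix_mult_def mat_def) (simp add: if_distrib if_distribR cong: if_cong)

lemma matrix_add_rdistrib: "((A :: complex^'n^'m) + B) ** (C :: complex^'k^'n) = A ** C + B ** C"
  by (simp add: matrix_matrix_mult_def vec_eq_iff distrib_right sum.distrib)

lemma norm_mat: "norm (mat c :: complex^'d^'d) = cmod c * norm (mat 1 :: complex^'d^'d)"
proof -
  have "(mat c :: complex^'d^'d) $ i = c *s (mat 1 $ i)" for i
    by (simp add: vec_eq_iff mat_def)
  then have "norm (mat c :: complex^'d^'d) = L2_set (\<lambda>i. cmod c * norm ((mat 1 :: complex^'d^'d) $ i)) UNIV"
    by (simp add: norm_vec_def[of "mat c"] norm_vector_smult)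
  then show ?thesis by (simp add: L2_set_right_distrib norm_vec_def[of "mat 1"])
qed

lemma norm_mat_one_ge: "norm (mat 1 :: complex^'d^'d) \<ge> 1"
proof -
  define i where "i = (undefined :: 'd)"
  have "1 = cmod ((mat 1 :: complex^'d^'d) $ i $ i)" by (simp add: mat_def)
  also have "\<dots> \<le> norm (mat 1 :: complex^'d^'d)"
    by (rule order_trans[OF Finite_Cartesian_Product.norm_nth_le Finite_Cartesian_Product.norm_nth_le])
  finally show ?thesis .
qed

text \<open>For \<open>F = F(z)\<close> this is \<open>B\<^sup>* (A + B \<beta> B\<^sup>* - z)\<^sup>-\<^sup>1 B\<close>.\<close>

definition kres :: "complex^'d^'d \<Rightarrow> complex^'d^'d \<Rightarrow> complex^'d^'d" where
  "kres F \<beta> = F ** matrix_inv (mat 1 + \<beta> ** F)"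

text \<open>From \<open>v = - (\<alpha> + \<zeta>) F v\<close> the imaginary part of
  \<open>vinner v (F *v v)\<close> equals \<open>Im \<zeta> * (norm (F *v v))\<^sup>2\<close>, which
  is at most 0. Dissipativity then gives first equality and then \<open>F *v v = 0\<close>.\<close>

lemma dissipative_kernel:
  assumes F: "dissipative F" and \<alpha>: "\<alpha> \<in> hermitian_matrices" and \<zeta>: "Im \<zeta> \<le> 0"
    and v: "(mat 1 + (\<alpha> + mat \<zeta>) ** F) *v v = 0"
  shows "v = 0"
proof -
  let ?q = "F *v v"
  have "v + (\<alpha> *v ?q + \<zeta> *s ?q) = 0"
    using v by (simp only: matrix_vector_mult_add_rdistrib matrix_vector_mul_lid matrix_vector_mul_assoc[symmetric] mat_mult_vec[of \<zeta>])
  then have eq: "v = - (\<alpha> *v ?q + \<zeta> *s ?q)" by (simp only: eq_neg_iff_add_eq_0)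
  have "vinner v ?q = vinner (0 - (\<alpha> *v ?q + \<zeta> *s ?q)) ?q" using eq by simp
  also have "\<dots> = - vinner ?q (\<alpha> *v ?q) - cnj \<zeta> * complex_of_real ((norm ?q)\<^sup>2)"
    by (simp only: vinner_simps vinner_zero_left vinner_mult_hermitian[OF \<alpha>] vinner_self) simp
  finally have "Im (vinner v ?q) = Im \<zeta> * (norm ?q)\<^sup>2"
    using Im_vinner_hermitian[OF \<alpha>, of ?q] by simp
  also have "\<dots> \<le> 0" using \<zeta> by (simp add: mult_nonpos_nonneg)
  finally have "Im (vinner v ?q) = 0" using F unfolding dissipative_def by (meson order_antisym)
  then have "?q = 0" using F unfolding dissipative_def by blast
  then show ?thesis using eq by (simp add: matrix_vector_mult_0_right)
qed

text \<open>Let \<open>w\<close> solve \<open>(I + (\<alpha> + \<zeta>) F) w = e_i\<close>. The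
  entry is \<open>vinner e_i (F w)\<close>, and expanding \<open>e_i\<close> leaves a term with
  nonnegative imaginary part, a real Hermitian form, and \<open>cnj \<zeta>\<close> times
  \<open>(norm (F w))\<^sup>2\<close>.\<close>

lemma Im_kres_ge:
  fixes F \<alpha> :: "complex^'d^'d"
  assumes F: "dissipative F" and \<alpha>: "\<alpha> \<in> hermitian_matrices" and \<zeta>: "Im \<zeta> \<le> 0"
  shows "- Im \<zeta> * (norm (kres F (\<alpha> + mat \<zeta>) *v axis i 1))\<^sup>2 \<le> Im (kres F (\<alpha> + mat \<zeta>) $ i $ i)"
proof -
  let ?M = "mat 1 + (\<alpha> + mat \<zeta>) ** F"
  let ?e = "axis i 1 :: complex^'d"
  define w where "w = matrix_inv ?M *v ?e"
  have "?M *v w = ?e"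
    unfolding w_def by (rule matrix_inv_cancel(3)) (rule dissipative_kernel[OF F \<alpha> \<zeta>])
  then have e: "?e = w + (\<alpha> *v (F *v w) + \<zeta> *s (F *v w))"
    by (simp only: matrix_vector_mult_add_rdistrib matrix_vector_mul_lid matrix_vector_mul_assoc[symmetric] mat_mult_vec[of \<zeta>])
  have K: "kres F (\<alpha> + mat \<zeta>) *v ?e = F *v w"
    by (simp only: kres_def w_def matrix_vector_mul_assoc)
  have "kres F (\<alpha> + mat \<zeta>) $ i $ i = vinner ?e (F *v w)"
    by (simp only: vinner_axis K[symmetric] matrix_vector_axis)
  also have "\<dots> = vinner w (F *v w) + vinner (F *v w) (\<alpha> *v (F *v w)) + cnj \<zeta> * complex_of_real ((norm (F *v w))\<^sup>2)"
    by (subst e) (simp only: vinner_simps vinner_mult_hermitian[OF \<alpha>] vinner_self add.assoc)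
  finally have "Im (kres F (\<alpha> + mat \<zeta>) $ i $ i) = Im (vinner w (F *v w)) - Im \<zeta> * (norm (F *v w))\<^sup>2"
    using Im_vinner_hermitian[OF \<alpha>, of "F *v w"] by simp
  moreover have "Im (vinner w (F *v w)) \<ge> 0" using F unfolding dissipative_def by blast
  ultimately show ?thesis unfolding K by simp
qed

text \<open>For the norm \<open>r\<close> of the column, the lower bound on the imaginary part reads
  \<open>- Im \<zeta> * r\<^sup>2 \<le> r\<close>, so it turns into an upper bound for
  \<open>r\<close> itself.\<close>

lemma cmod_kres_le:
  fixes F \<alpha> :: "complex^'d^'d"
  assumes F: "dissipative F" and \<alpha>: "\<alpha> \<in> hermitian_matrices" and \<zeta>: "Im \<zeta> < 0"
  shows "cmod (kres F (\<alpha> + mat \<zeta>) $ i $ i) \<le> 1 / (- Im \<zeta>)"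
proof -
  let ?K = "kres F (\<alpha> + mat \<zeta>)"
  define r where "r = norm (?K *v axis i 1)"
  have le: "cmod (?K $ i $ i) \<le> r"
    using Finite_Cartesian_Product.norm_nth_le[of "?K *v axis i 1" i] by (simp add: r_def matrix_vector_axis)
  have "- Im \<zeta> * r\<^sup>2 \<le> Im (?K $ i $ i)"
    using Im_kres_ge[OF F \<alpha>, of \<zeta> i] \<zeta> by (simp add: r_def)
  also have "\<dots> \<le> r" using le abs_Im_le_cmod[of "?K $ i $ i"] by linarith
  finally have *: "- Im \<zeta> * r\<^sup>2 \<le> r" .
  have "r \<le> 1 / (- Im \<zeta>)"
  proof (cases "r = 0")
    case False
    then have "r > 0" by (simp add: r_def)
    moreover have "r * (- Im \<zeta> * r) \<le> r * 1" using * by (simp add: power2_eq_square ac_simps)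
    ultimately have "- Im \<zeta> * r \<le> 1" by (simp only: mult_le_cancel_left_pos)
    then show ?thesis using \<zeta> by (subst pos_le_divide_eq) (simp_all add: mult.commute)
  qed (use \<zeta> in simp)
  with le show ?thesis by linarith
qed

lemma trace_Im_kres_ge:
  fixes F \<alpha> :: "complex^'d^'d"
  assumes F: "dissipative F" and \<alpha>: "\<alpha> \<in> hermitian_matrices" and \<eta>: "\<eta> \<ge> 0"
  shows "\<eta> * (norm (kres F (\<alpha> + mat (- \<i> * complex_of_real \<eta>))))\<^sup>2 \<le>
    (\<Sum>i\<in>UNIV. Im (kres F (\<alpha> + mat (- \<i> * complex_of_real \<eta>)) $ i $ i))"
  unfolding norm_sq_matrix_columns sum_distrib_left
  using Im_kres_ge[OF F \<alpha>, of "- \<i> * complex_of_real \<eta>"] \<eta> by (intro sum_mono) simp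

text \<open>Second resolvent identity: \<open>kres F \<alpha>\<close> is the shifted matrix times
  \<open>I + D * kres F \<alpha>\<close>, where \<open>D\<close> is of order \<open>\<eta>\<close>.
  Largeness lets the norm of \<open>I\<close> be absorbed into a multiple of
  \<open>\<eta> * norm (kres F \<alpha>)\<close>, and \<open>norm (kres F \<alpha>)\<close>
  cancels.\<close>

lemma norm_kres_shift_ge:
  fixes F \<alpha> \<alpha>' :: "complex^'d^'d"
  assumes F: "dissipative F" and \<alpha>: "\<alpha> \<in> hermitian_matrices" and \<alpha>': "\<alpha>' \<in> hermitian_matrices"
    and \<eta>: "\<eta> > 0" and d: "norm (\<alpha>' - \<alpha>) \<le> \<eta>" and large: "norm (kres F \<alpha>) > 1 / \<eta>"
  shows "norm (kres F (\<alpha>' + mat (- \<i> * complex_of_real \<eta>))) \<ge> 1 / ((1 + 2 * norm (mat 1 :: complex^'d^'d)) * \<eta>)"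
proof -
  let ?\<zeta> = "- \<i> * complex_of_real \<eta>"
  let ?Kz = "kres F \<alpha>" and ?K = "kres F (\<alpha>' + mat ?\<zeta>)"
  let ?c = "norm (mat 1 :: complex^'d^'d)"
  let ?Mz = "mat 1 + \<alpha> ** F" and ?M = "mat 1 + (\<alpha>' + mat ?\<zeta>) ** F"
  let ?D = "\<alpha>' - \<alpha> + mat ?\<zeta>"
  have "v = 0" if "?Mz *v v = 0" for v
  proof (rule dissipative_kernel[OF F \<alpha>])
    show "(mat 1 + (\<alpha> + mat 0) ** F) *v v = 0" using that by simp
  qed simp
  then have 0: "?Mz ** matrix_inv ?Mz = mat 1" by (rule matrix_inv_cancel(1))
  have "v = 0" if "?M *v v = 0" for v
    by (rule dissipative_kernel[OF F \<alpha>' _ that]) (use \<eta> in simp)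
  then have 1: "matrix_inv ?M ** ?M = mat 1" by (rule matrix_inv_cancel(2))
  have e: "\<alpha>' + mat ?\<zeta> = \<alpha> + ?D" by simp
  have M: "?M = ?Mz + ?D ** F"
    by (subst e) (simp only: matrix_add_rdistrib[of \<alpha> ?D] add.assoc)
  have "mat 1 + ?D ** ?Kz = ?M ** matrix_inv ?Mz"
    unfolding M by (simp only: matrix_add_rdistrib[of ?Mz "?D ** F"] 0 kres_def matrix_mul_assoc)
  then have "?K ** (mat 1 + ?D ** ?Kz) = F ** (matrix_inv ?M ** ?M) ** matrix_inv ?Mz"
    by (simp add: kres_def matrix_mul_assoc)
  also have "\<dots> = ?Kz" by (simp only: 1 kres_def matrix_mul_rid)
  finally have eq: "?Kz = ?K ** (mat 1 + ?D ** ?Kz)" by simp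
  have c: "?c \<ge> 1" by (rule norm_mat_one_ge)
  have nD: "norm ?D \<le> (1 + ?c) * \<eta>"
  proof -
    have "norm ?D \<le> norm (\<alpha>' - \<alpha>) + norm (mat ?\<zeta> :: complex^'d^'d)" by (rule norm_triangle_ineq)
    also have "norm (mat ?\<zeta> :: complex^'d^'d) = \<eta> * ?c" using \<eta> by (subst norm_mat) (simp add: norm_mult)
    finally show ?thesis using d by (simp add: algebra_simps)
  qed
  have c_le: "?c \<le> ?c * \<eta> * norm ?Kz"
  proof -
    have "1 \<le> \<eta> * norm ?Kz" using large \<eta> by (simp add: field_simps)
    then have "?c * 1 \<le> ?c * (\<eta> * norm ?Kz)" by (intro mult_left_mono) auto
    then show ?thesis by (simp add: mult.assoc)
  qed
  have "norm ?Kz \<le> norm ?K * norm (mat 1 + ?D ** ?Kz)"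
    by (subst eq) (rule norm_matrix_mult_le)
  also have "norm (mat 1 + ?D ** ?Kz) \<le> ?c + norm ?D * norm ?Kz"
    using norm_triangle_ineq[of "mat 1" "?D ** ?Kz"] norm_matrix_mult_le[of ?D ?Kz] by linarith
  also have "\<dots> \<le> ?c * \<eta> * norm ?Kz + (1 + ?c) * \<eta> * norm ?Kz"
    using c_le nD by (intro add_mono mult_right_mono) auto
  also have "\<dots> = (1 + 2 * ?c) * \<eta> * norm ?Kz" by (simp add: algebra_simps)
  finally have "norm ?Kz \<le> norm ?K * ((1 + 2 * ?c) * \<eta> * norm ?Kz)"
    by (simp add: mult_left_mono)
  moreover have "norm ?Kz > 0" using large \<eta> by (smt (verit) zero_less_divide_1_iff)
  moreover have "norm ?K * ((1 + 2 * ?c) * \<eta> * norm ?Kz) = norm ?Kz * (norm ?K * ((1 + 2 * ?c) * \<eta>))"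
    by (simp only: ac_simps)
  ultimately have "1 \<le> norm ?K * ((1 + 2 * ?c) * \<eta>)"
    by (metis mult_le_cancel_left_pos mult.right_neutral)
  moreover have "(1 + 2 * ?c) * \<eta> > 0" using \<eta> c by (intro mult_pos_pos) auto
  ultimately show ?thesis by (simp add: divide_le_eq)
qed

subsection \<open>Dependence on parameters\<close>

text \<open>Cramer's rule writes the entries as quotients of polynomials in the entries of
  \<open>M\<close>, which serves continuity and holomorphy in parameters alike.\<close>

lemma matrix_inv_entry:
  fixes M :: "complex^'d^'d"
  assumes M: "\<And>v. M *v v = 0 \<Longrightarrow> v = 0"
  shows "matrix_inv M $ k $ l = det (\<chi> i j. if j = k then axis l 1 $ i else M $ i $ j) / det M"
    and "det M \<noteq> 0"
proof -
  have "invertible M"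
    unfolding invertible_def using matrix_inv_cancel(1,2)[OF M] by blast
  then show nz: "det M \<noteq> 0" by (simp add: invertible_det_nz)
  have "M *v (matrix_inv M *v axis l 1) = axis l 1" by (rule matrix_inv_cancel(3)[OF M])
  then have "matrix_inv M *v axis l 1 = (\<chi> k. det (\<chi> i j. if j = k then axis l 1 $ i else M $ i $ j) / det M)"
    using cramer[OF nz] by blast
  then have "(matrix_inv M *v axis l 1) $ k = det (\<chi> i j. if j = k then axis l 1 $ i else M $ i $ j) / det M"
    by simp
  then show "matrix_inv M $ k $ l = det (\<chi> i j. if j = k then axis l 1 $ i else M $ i $ j) / det M"
    by (simp only: matrix_vector_axis)
qed

lemma continuous_on_det:
  fixes M :: "'x::topological_space \<Rightarrow> complex^'d^'d"
  assumes "\<And>i j. continuous_on S (\<lambda>p. M p $ i $ j)"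
  shows "continuous_on S (\<lambda>p. det (M p))"
  unfolding det_def by (intro continuous_intros assms)

lemma continuous_on_matrix_inv:
  fixes M :: "'x::topological_space \<Rightarrow> complex^'d^'d"
  assumes M: "\<And>i j. continuous_on S (\<lambda>p. M p $ i $ j)" and ker: "\<And>p v. p \<in> S \<Longrightarrow> M p *v v = 0 \<Longrightarrow> v = 0"
  shows "continuous_on S (\<lambda>p. matrix_inv (M p) $ k $ l)"
proof -
  have "continuous_on S (\<lambda>p. det (\<chi> i j. if j = k then axis l 1 $ i else M p $ i $ j) / det (M p))"
  proof (rule continuous_on_divide)
    have "continuous_on S (\<lambda>p. (\<chi> i j. if j = k then axis l 1 $ i else M p $ i $ j) $ i $ j)" for i j
      using M by (cases "j = k") simp_all
    then show "continuous_on S (\<lambda>p. det (\<chi> i j. if j = k then axis l 1 $ i else M p $ i $ j))"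
      by (rule continuous_on_det)
    show "continuous_on S (\<lambda>p. det (M p))" by (rule continuous_on_det[OF M])
    show "\<forall>p\<in>S. det (M p) \<noteq> 0" by (rule ballI, rule matrix_inv_entry(2)[OF ker])
  qed
  then show ?thesis
    by (rule continuous_on_eq) (simp add: matrix_inv_entry(1)[OF ker])
qed

lemma continuous_on_matrix_mult_entry:
  fixes A B :: "'x::topological_space \<Rightarrow> complex^'d^'d"
  assumes "\<And>i j. continuous_on S (\<lambda>p. A p $ i $ j)" "\<And>i j. continuous_on S (\<lambda>p. B p $ i $ j)"
  shows "continuous_on S (\<lambda>p. (A p ** B p) $ i $ j)"
  unfolding matrix_matrix_mult_def by (simp, intro continuous_intros assms)

lemma continuous_on_kres:
  fixes F \<beta> :: "'x::topological_space \<Rightarrow> complex^'d^'d"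
  assumes F: "\<And>i j. continuous_on S (\<lambda>p. F p $ i $ j)" and \<beta>: "\<And>i j. continuous_on S (\<lambda>p. \<beta> p $ i $ j)"
    and ker: "\<And>p v. p \<in> S \<Longrightarrow> (mat 1 + \<beta> p ** F p) *v v = 0 \<Longrightarrow> v = 0"
  shows "continuous_on S (\<lambda>p. kres (F p) (\<beta> p) $ i $ j)"
  unfolding kres_def
proof (rule continuous_on_matrix_mult_entry[OF F continuous_on_matrix_inv])
  show "continuous_on S (\<lambda>p. (mat 1 + \<beta> p ** F p) $ i $ j)" for i j
    using continuous_on_add[OF continuous_on_const continuous_on_matrix_mult_entry[OF \<beta> F]] by simp
  show "v = 0" if "p \<in> S" "(mat 1 + \<beta> p ** F p) *v v = 0" for p v by (rule ker[OF that])
qed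

lemma holomorphic_on_matrix_inv:
  fixes M :: "complex \<Rightarrow> complex^'d^'d"
  assumes M: "\<And>i j. (\<lambda>p. M p $ i $ j) holomorphic_on S" and ker: "\<And>p v. p \<in> S \<Longrightarrow> M p *v v = 0 \<Longrightarrow> v = 0"
  shows "(\<lambda>p. matrix_inv (M p) $ k $ l) holomorphic_on S"
proof -
  have "(\<lambda>p. det (\<chi> i j. if j = k then axis l 1 $ i else M p $ i $ j) / det (M p)) holomorphic_on S"
  proof (intro holomorphic_on_divide)
    show "(\<lambda>p. det (M p)) holomorphic_on S"
      unfolding det_def by (intro holomorphic_intros M)
    have "(\<lambda>p. (\<chi> i j. if j = k then axis l 1 $ i else M p $ i $ j) $ i $ j) holomorphic_on S" for i j
      using M by (cases "j = k") simp_all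
    then show "(\<lambda>p. det (\<chi> i j. if j = k then axis l 1 $ i else M p $ i $ j)) holomorphic_on S"
      unfolding det_def by (intro holomorphic_intros)
    show "det (M p) \<noteq> 0" if "p \<in> S" for p by (rule matrix_inv_entry(2)[OF ker[OF that]])
  qed
  then show ?thesis
    by (rule holomorphic_transform) (simp add: matrix_inv_entry(1)[OF ker])
qed

lemma holomorphic_on_kres:
  fixes F \<alpha> :: "complex^'d^'d"
  assumes F: "dissipative F" and \<alpha>: "\<alpha> \<in> hermitian_matrices"
  shows "(\<lambda>\<zeta>. kres F (\<alpha> + mat (\<zeta> - \<i> * complex_of_real \<eta>)) $ i $ j) holomorphic_on {\<zeta>. Im \<zeta> \<le> \<eta>}"
proof -
  let ?M = "\<lambda>\<zeta>. mat 1 + (\<alpha> + mat (\<zeta> - \<i> * complex_of_real \<eta>)) ** F"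
  have entry: "(\<lambda>\<zeta>. ?M \<zeta> $ i $ j) holomorphic_on {\<zeta>. Im \<zeta> \<le> \<eta>}" for i j
  proof -
    have "?M \<zeta> $ i $ j = mat 1 $ i $ j + (\<alpha> ** F) $ i $ j + (\<zeta> - \<i> * complex_of_real \<eta>) * F $ i $ j" for \<zeta>
      by (simp add: matrix_add_rdistrib mat_eq_mult left_diff_distrib)
    then show ?thesis by (simp only:) (intro holomorphic_intros)
  qed
  have inv: "(\<lambda>\<zeta>. matrix_inv (?M \<zeta>) $ k $ l) holomorphic_on {\<zeta>. Im \<zeta> \<le> \<eta>}" for k l
    by (rule holomorphic_on_matrix_inv[OF entry]) (rule dissipative_kernel[OF F \<alpha>], auto)
  have "kres F (\<alpha> + mat (\<zeta> - \<i> * complex_of_real \<eta>)) $ i $ j = (\<Sum>k\<in>UNIV. F $ i $ k * matrix_inv (?M \<zeta>) $ k $ j)" for \<zeta>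
    by (simp add: kres_def matrix_matrix_mult_def)
  then show ?thesis by (simp only:) (intro holomorphic_intros inv)
qed

section \<open>Averaging along the identity direction\<close>

text \<open>The weight \<open>1 - \<zeta>\<^sup>2\<close> vanishes at the endpoints \<open>\<plusminus>1\<close>, so the integral over \<open>[-1, 1]\<close> can be moved
  to the two lower sides of the triangle \<open>-1, 1, -i\<close> without a logarithmic loss in \<open>\<eta>\<close>.\<close>

lemma nevanlinna_window:
  assumes holo: "f holomorphic_on {\<zeta>. Im \<zeta> \<le> 0}"
    and bound: "\<And>\<zeta>. Im \<zeta> < 0 \<Longrightarrow> cmod (f \<zeta>) \<le> 1 / (- Im \<zeta>)"
    and pos: "\<And>t. Im (f (complex_of_real t)) \<ge> 0"
  shows "(\<integral>\<^sup>+t. ennreal (Im (f (complex_of_real t))) * indicator {-1/2..1/2} t \<partial>lborel) \<le> 32"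
proof -
  define h where "h \<zeta> = f \<zeta> * (1 - \<zeta>\<^sup>2)" for \<zeta>
  have sub: "convex hull {-1, 1, - \<i>} \<subseteq> {\<zeta>. Im \<zeta> \<le> 0}"
    by (rule hull_minimal) (auto simp: convex_halfspace_Im_le)
  have h_holo: "h holomorphic_on {\<zeta>. Im \<zeta> \<le> 0}"
    unfolding h_def by (intro holomorphic_intros holo)
  have seg: "closed_segment a b \<subseteq> {\<zeta>. Im \<zeta> \<le> 0}" if "Im a \<le> 0" "Im b \<le> 0" for a b
    using that by (intro closed_segment_subset convex_halfspace_Im_le) auto
  have ci: "h contour_integrable_on linepath a b" if "Im a \<le> 0" "Im b \<le> 0" for a b
    using holomorphic_on_imp_continuous_on[OF h_holo] seg[OF that] continuous_on_subset
    by (intro contour_integrable_continuous_linepath) blast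
  have "(h has_contour_integral 0) (linepath (-1) 1 +++ linepath 1 (- \<i>) +++ linepath (- \<i>) (-1))"
    by (rule Cauchy_theorem_triangle[OF holomorphic_on_subset[OF h_holo sub]])
  from contour_integral_unique[OF this]
  have "contour_integral (linepath (-1) 1) h + (contour_integral (linepath 1 (- \<i>)) h + contour_integral (linepath (- \<i>) (-1)) h) = 0"
    using ci[of "-1" 1] ci[of 1 "-\<i>"] ci[of "-\<i>" "-1"]
    by (simp add: contour_integrable_joinI)
  then have sum: "cmod (contour_integral (linepath (-1) 1) h) \<le>
    cmod (contour_integral (linepath 1 (- \<i>)) h) + cmod (contour_integral (linepath (- \<i>) (-1)) h)"
    by (metis add_eq_0_iff norm_minus_cancel norm_triangle_ineq)
  \<comment> \<open>\<open>e\<close> is the real endpoint of the side in question. The factor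
    \<open>e - \<zeta>\<close> of the weight cancels the growth \<open>1 / (- Im \<zeta>)\<close> up
    to 2, and \<open>e + \<zeta>\<close> contributes another 2.\<close>
  have hb: "cmod (h \<zeta>) \<le> 4" if n: "cmod \<zeta> \<le> 1" and e: "e = 1 \<or> e = -1" and le: "cmod (e - \<zeta>) \<le> 2 * \<bar>Im \<zeta>\<bar>" and im: "Im \<zeta> \<le> 0" for \<zeta> e
  proof (cases "Im \<zeta> = 0")
    case True
    then have "\<zeta> = e" using le by simp
    then show ?thesis using e by (auto simp: h_def)
  next
    case False
    then have im: "Im \<zeta> < 0" using im by simp
    have fac: "1 - \<zeta>\<^sup>2 = (e - \<zeta>) * (e + \<zeta>)" using e by (auto simp: power2_eq_square algebra_simps)
    have "cmod (e + \<zeta>) \<le> 2" using norm_triangle_ineq[of e \<zeta>] n e by auto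
    then have "cmod (1 - \<zeta>\<^sup>2) \<le> (2 * \<bar>Im \<zeta>\<bar>) * 2"
      unfolding fac norm_mult using le by (intro mult_mono) auto
    then have "cmod (h \<zeta>) \<le> (1 / (- Im \<zeta>)) * ((2 * \<bar>Im \<zeta>\<bar>) * 2)"
      unfolding h_def norm_mult using bound[OF im] im by (intro mult_mono) auto
    also have "\<dots> = 4" using im by simp
    finally show ?thesis .
  qed
  have n2: "cmod (Complex a b) \<le> 2 * s" if "\<bar>a\<bar> = s" "\<bar>b\<bar> = s" for a b s
    using cmod_le[of "Complex a b"] that by simp
  have b1: "cmod (contour_integral (linepath 1 (- \<i>)) h) \<le> 4 * cmod (- \<i> - 1)"
  proof (rule contour_integral_bound_linepath[OF ci])
    fix \<zeta> assume "\<zeta> \<in> closed_segment 1 (- \<i>)"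
    then obtain s where s: "0 \<le> s" "s \<le> 1" "\<zeta> = (1 - s) *\<^sub>R 1 + s *\<^sub>R (- \<i>)" unfolding in_segment by auto
    have \<zeta>: "\<zeta> = Complex (1 - s) (- s)" using s(3) by (simp add: complex_eq_iff)
    show "cmod (h \<zeta>) \<le> 4"
    proof (rule hb[of _ 1])
      have "(cmod \<zeta>)\<^sup>2 = (1 - s)\<^sup>2 + s\<^sup>2" by (simp add: \<zeta> cmod_power2)
      also have "\<dots> \<le> 1" using s mult_left_le[of s s] by (simp add: power2_eq_square algebra_simps)
      finally show "cmod \<zeta> \<le> 1" by (simp add: power_le_one_iff)
      have "1 - \<zeta> = Complex s s" by (simp add: \<zeta> complex_eq_iff)
      then show "cmod (1 - \<zeta>) \<le> 2 * \<bar>Im \<zeta>\<bar>" using n2[of s s s] s by (simp add: \<zeta>)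
    qed (use s in \<open>auto simp: \<zeta>\<close>)
  qed auto
  have b2: "cmod (contour_integral (linepath (- \<i>) (-1)) h) \<le> 4 * cmod (-1 - (- \<i>))"
  proof (rule contour_integral_bound_linepath[OF ci])
    fix \<zeta> assume "\<zeta> \<in> closed_segment (- \<i>) (-1)"
    then obtain s where s: "0 \<le> s" "s \<le> 1" "\<zeta> = (1 - s) *\<^sub>R (- \<i>) + s *\<^sub>R (-1)" unfolding in_segment by auto
    have \<zeta>: "\<zeta> = Complex (- s) (s - 1)" using s(3) by (simp add: complex_eq_iff)
    show "cmod (h \<zeta>) \<le> 4"
    proof (rule hb[of _ "-1"])
      have "(cmod \<zeta>)\<^sup>2 = s\<^sup>2 + (s - 1)\<^sup>2" by (simp add: \<zeta> cmod_power2)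
      also have "\<dots> \<le> 1" using s mult_left_le[of s s] by (simp add: power2_eq_square algebra_simps)
      finally show "cmod \<zeta> \<le> 1" by (simp add: power_le_one_iff)
      have "-1 - \<zeta> = Complex (s - 1) (1 - s)" by (simp add: \<zeta> complex_eq_iff)
      then show "cmod (-1 - \<zeta>) \<le> 2 * \<bar>Im \<zeta>\<bar>" using n2[of "s - 1" "1 - s" "1 - s"] s by (simp add: \<zeta>)
    qed (use s in \<open>auto simp: \<zeta>\<close>)
  qed auto
  have "cmod (- \<i> - 1) \<le> 2" "cmod (-1 - (- \<i>)) \<le> 2"
    using norm_triangle_ineq4[of "- \<i>" 1] norm_triangle_ineq4[of "-1" "-\<i>"] by auto
  \<comment> \<open>Two sides of length at most 2, integrand at most 4.\<close>
  then have 16: "cmod (contour_integral (linepath (-1) 1) h) \<le> 16" using sum b1 b2 by linarith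
  have cont: "continuous_on {-1..1} (\<lambda>t. h (complex_of_real t))"
  proof (rule continuous_on_compose2[OF holomorphic_on_imp_continuous_on[OF h_holo]])
    show "continuous_on {-1..1} complex_of_real" by (intro continuous_intros)
  qed auto
  define g where "g t = Im (h (complex_of_real t))" for t
  have ge: "g t = Im (f (complex_of_real t)) * (1 - t\<^sup>2)" for t
  proof -
    have "h (complex_of_real t) = f (complex_of_real t) * complex_of_real (1 - t\<^sup>2)" by (simp add: h_def)
    then show ?thesis by (simp add: g_def)
  qed
  have g0: "g t \<ge> 0" if "t \<in> {-1..1}" for t
    using pos[of t] that by (auto simp: ge abs_square_le_1[of t] abs_le_iff)
  have "((\<lambda>t. h (complex_of_real t)) has_integral contour_integral (linepath (-1) 1) h) {-1..1}"
    using has_contour_integral_linepath_Reals_iff[of "-1" 1 h "contour_integral (linepath (-1) 1) h"]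
      has_contour_integral_integral[OF ci[of "-1" 1]] by simp
  then have gi: "(g has_integral Im (contour_integral (linepath (-1) 1) h)) {-1..1}"
    unfolding g_def by (rule has_integral_Im)
  \<comment> \<open>For \<open>t\<close> in \<open>{-1/2..1/2}\<close> the weight is at least
    \<open>1/2\<close>; undoing it doubles 16 to 32.\<close>
  have "(\<integral>\<^sup>+t. ennreal (Im (f (complex_of_real t))) * indicator {-1/2..1/2} t \<partial>lborel) \<le>
    (\<integral>\<^sup>+t. ennreal (2 * g t) * indicator {-1..1} t \<partial>lborel)"
  proof (rule nn_integral_mono)
    fix t :: real
    show "ennreal (Im (f (complex_of_real t))) * indicator {-1/2..1/2} t \<le> ennreal (2 * g t) * indicator {-1..1} t"
    proof (cases "t \<in> {-1/2..1/2}")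
      case True
      then have "\<bar>t\<bar> \<le> 1/2" by (auto simp: abs_le_iff)
      then have "t\<^sup>2 \<le> (1/2)\<^sup>2" by (metis abs_ge_zero power2_abs power_mono)
      then have "1/2 \<le> 1 - t\<^sup>2" by (simp add: power2_eq_square)
      then have "Im (f (complex_of_real t)) * (1/2) \<le> g t"
        unfolding ge using pos[of t] by (intro mult_left_mono)
      then show ?thesis using True by (auto simp: indicator_def intro!: ennreal_leI)
    qed simp
  qed
  also have "\<dots> = ennreal (2 * Im (contour_integral (linepath (-1) 1) h))"
    by (rule nn_integral_has_integral_lebesgue'[OF _ has_integral_mult_right[OF gi]]) (use g0 in auto)
  also have "\<dots> \<le> ennreal 32"
    using 16 abs_Im_le_cmod[of "contour_integral (linepath (-1) 1) h"] by (intro ennreal_leI) linarith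
  finally show ?thesis by simp
qed

text \<open>The bound is the same for all \<open>F\<close>, \<open>\<alpha>\<close> and
  \<open>\<eta>\<close>: the shift by \<open>- \<i> \<eta>\<close> only moves the argument deeper
  into the lower half plane, where the entry is at most the inverse distance to the real
  axis.\<close>

lemma kres_window:
  fixes F \<alpha> :: "complex^'d^'d"
  assumes F: "dissipative F" and \<alpha>: "\<alpha> \<in> hermitian_matrices" and \<eta>: "\<eta> > 0"
  shows "(\<integral>\<^sup>+t. ennreal (Im (kres F (\<alpha> + mat (complex_of_real t - \<i> * complex_of_real \<eta>)) $ i $ i)) *
    indicator {-1/2..1/2} t \<partial>lborel) \<le> 32"
proof (rule nevanlinna_window)
  show "(\<lambda>\<zeta>. kres F (\<alpha> + mat (\<zeta> - \<i> * complex_of_real \<eta>)) $ i $ i) holomorphic_on {\<zeta>. Im \<zeta> \<le> 0}"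
    using \<eta> by (intro holomorphic_on_subset[OF holomorphic_on_kres[OF F \<alpha>, of \<eta>]]) auto
  show "cmod (kres F (\<alpha> + mat (\<zeta> - \<i> * complex_of_real \<eta>)) $ i $ i) \<le> 1 / (- Im \<zeta>)" if "Im \<zeta> < 0" for \<zeta>
  proof -
    have "cmod (kres F (\<alpha> + mat (\<zeta> - \<i> * complex_of_real \<eta>)) $ i $ i) \<le> 1 / (- Im (\<zeta> - \<i> * complex_of_real \<eta>))"
      using that \<eta> by (intro cmod_kres_le[OF F \<alpha>]) simp
    also have "\<dots> \<le> 1 / (- Im \<zeta>)" using that \<eta> by (intro divide_left_mono) (auto intro: mult_pos_neg)
    finally show ?thesis .
  qed
  show "Im (kres F (\<alpha> + mat (complex_of_real t - \<i> * complex_of_real \<eta>)) $ i $ i) \<ge> 0" for t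
  proof -
    have "0 \<le> - Im (complex_of_real t - \<i> * complex_of_real \<eta>) *
      (norm (kres F (\<alpha> + mat (complex_of_real t - \<i> * complex_of_real \<eta>)) *v axis i 1))\<^sup>2"
      using \<eta> by simp
    also have "\<dots> \<le> Im (kres F (\<alpha> + mat (complex_of_real t - \<i> * complex_of_real \<eta>)) $ i $ i)"
      using \<eta> by (intro Im_kres_ge[OF F \<alpha>]) simp
    finally show ?thesis .
  qed
qed

section \<open>Real coordinates on Hermitian matrices\<close>

text \<open>The symmetric part of a real matrix becomes the real part, the antisymmetric part the
  imaginary part. This parametrizes the Hermitian matrices isometrically, so volumes and covers can
  be handled in \<open>real^'d^'d\<close>.\<close>

definition herm_of :: "real^'d^'d \<Rightarrow> complex^'d^'d" where
  "herm_of m = (\<chi> i j. Complex ((m $ i $ j + m $ j $ i) / 2) ((m $ i $ j - m $ j $ i) / 2))"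

lemma herm_of_hermitian: "herm_of m \<in> hermitian_matrices"
  by (simp add: herm_of_def hermitian_matrices_def complex_eq_iff field_simps)

lemma herm_of_add: "herm_of (m + n) = herm_of m + herm_of n"
  by (simp add: herm_of_def vec_eq_iff complex_eq_iff add_divide_distrib diff_divide_distrib)

lemma herm_of_diff: "herm_of (m - n) = herm_of m - herm_of n"
  by (simp add: herm_of_def vec_eq_iff complex_eq_iff add_divide_distrib diff_divide_distrib)

lemma herm_of_scale_one: "herm_of (t *\<^sub>R mat 1) = mat (complex_of_real t)"
  by (simp add: herm_of_def vec_eq_iff complex_eq_iff mat_def)

lemma norm_sq_matrix_entries:
  "(norm (M :: 'x::real_normed_vector^'m^'n))\<^sup>2 = (\<Sum>i\<in>UNIV. \<Sum>j\<in>UNIV. (norm (M $ i $ j))\<^sup>2)"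
  by (simp add: norm_vec_def L2_set_def sum_nonneg)

lemma norm_herm_of: "norm (herm_of m) = norm (m :: real^'d^'d)"
proof -
  note nsq = norm_sq_matrix_entries
  have "(norm (herm_of m))\<^sup>2 = (\<Sum>i\<in>UNIV. \<Sum>j\<in>UNIV. (m $ i $ j)\<^sup>2 / 2 + (m $ j $ i)\<^sup>2 / 2)"
    unfolding nsq
  proof (intro sum.cong refl)
    fix i j
    have "((a + b) / 2)\<^sup>2 + ((a - b) / 2)\<^sup>2 = a\<^sup>2 / 2 + b\<^sup>2 / 2" for a b :: real
      by (simp add: power2_eq_square field_simps)
    then show "(cmod (herm_of m $ i $ j))\<^sup>2 = (m $ i $ j)\<^sup>2 / 2 + (m $ j $ i)\<^sup>2 / 2"
      by (simp add: herm_of_def cmod_power2)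
  qed
  also have "\<dots> = (\<Sum>i\<in>UNIV. \<Sum>j\<in>UNIV. (m $ i $ j)\<^sup>2 / 2) + (\<Sum>i\<in>UNIV. \<Sum>j\<in>UNIV. (m $ j $ i)\<^sup>2 / 2)"
    by (simp add: sum.distrib)
  also have "(\<Sum>i\<in>UNIV. \<Sum>j\<in>UNIV. (m $ j $ i)\<^sup>2 / 2) = (\<Sum>i\<in>UNIV. \<Sum>j\<in>UNIV. (m $ i $ j)\<^sup>2 / 2)"
    by (rule sum.swap)
  also have "(\<Sum>i\<in>UNIV. \<Sum>j\<in>UNIV. (m $ i $ j)\<^sup>2 / 2) + (\<Sum>i\<in>UNIV. \<Sum>j\<in>UNIV. (m $ i $ j)\<^sup>2 / 2) = (norm m)\<^sup>2"
    by (simp only: nsq real_norm_def power2_abs sum_divide_distrib[symmetric] field_sum_of_halves)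
  finally have "(norm (herm_of m))\<^sup>2 = (norm m)\<^sup>2" .
  then show ?thesis by (rule power2_eq_imp_eq) simp_all
qed

text \<open>At \<open>(i, j)\<close> and \<open>(j, i)\<close> the preimage holds
  \<open>Re + Im\<close> and \<open>Re - Im\<close> of the same entry; half their sum and half their
  difference recover it.\<close>

lemma herm_of_surj:
  assumes "\<alpha> \<in> hermitian_matrices"
  shows "herm_of (\<chi> i j. Re (\<alpha> $ i $ j) + Im (\<alpha> $ i $ j)) = \<alpha>"
proof -
  have pair: "Complex ((Re a + Im a + (Re b + Im b)) / 2) ((Re a + Im a - (Re b + Im b)) / 2) = a"
    if "a = cnj b" for a b
    unfolding that by (simp add: complex_eq_iff)
  have "\<alpha> $ i $ j = cnj (\<alpha> $ j $ i)" for i j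
    using assms unfolding hermitian_matrices_def by fast
  from pair[OF this] show ?thesis unfolding herm_of_def vec_eq_iff vec_lambda_beta by (intro allI)
qed

lemma continuous_on_herm_of_entry: "continuous_on S (\<lambda>m. herm_of m $ i $ j)"
  unfolding herm_of_def by (simp, intro continuous_intros) simp_all

section \<open>Neighbourhoods of the exceptional parameters\<close>

text \<open>The integral is averaged over the translations by \<open>t *\<^sub>R e\<close> with
  \<open>t\<close> in an interval of length 1. After exchanging the integrals the hypothesis bounds
  each line integral; the radius grows by \<open>norm e\<close> to contain the translated
  balls.\<close>

lemma translation_average:
  fixes g :: "'a::euclidean_space \<Rightarrow> ennreal" and e :: 'a
  assumes g [measurable]: "g \<in> borel_measurable borel"
    and C: "\<And>m. (\<integral>\<^sup>+t. g (m + t *\<^sub>R e) * indicator {-1/2..1/2} t \<partial>lborel) \<le> C"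
  shows "(\<integral>\<^sup>+m. g m * indicator (ball 0 r) m \<partial>lborel) \<le> C * emeasure lborel (ball (0::'a) (r + norm e))"
proof -
  have [measurable]: "ball (0::'a) q \<in> sets borel" for q by simp
  let ?I = "\<integral>\<^sup>+m. g m * indicator (ball 0 r) m \<partial>lborel"
  let ?Q = "ball (0::'a) (r + norm e)"
  have shift: "?I \<le> (\<integral>\<^sup>+m. g (m + t *\<^sub>R e) * indicator ?Q m \<partial>lborel)" if t: "t \<in> {-1/2..1/2}" for t
  proof -
    have "?I = (\<integral>\<^sup>+m. g m * indicator (ball 0 r) m \<partial>distr lborel borel ((+) (t *\<^sub>R e)))"
      by (simp add: lborel_distr_plus)
    also have "\<dots> = (\<integral>\<^sup>+m. g (t *\<^sub>R e + m) * indicator (ball 0 r) (t *\<^sub>R e + m) \<partial>lborel)"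
      by (rule nn_integral_distr) measurable
    also have "\<dots> \<le> (\<integral>\<^sup>+m. g (m + t *\<^sub>R e) * indicator ?Q m \<partial>lborel)"
    proof (rule nn_integral_mono)
      fix m
      have "m \<in> ?Q" if "t *\<^sub>R e + m \<in> ball 0 r"
      proof -
        have "norm m \<le> norm (t *\<^sub>R e + m) + norm (t *\<^sub>R e)"
          using norm_triangle_ineq4[of "t *\<^sub>R e + m" "t *\<^sub>R e"] by simp
        moreover have "norm (t *\<^sub>R e) \<le> 1 * norm e"
          using t unfolding norm_scaleR by (intro mult_right_mono) (auto simp: abs_le_iff)
        ultimately show ?thesis using that by simp
      qed
      then show "g (t *\<^sub>R e + m) * indicator (ball 0 r) (t *\<^sub>R e + m) \<le> g (m + t *\<^sub>R e) * indicator ?Q m"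
        by (auto simp: indicator_def add.commute)
    qed
    finally show ?thesis .
  qed
  have "?I = (\<integral>\<^sup>+t. ?I * indicator {-1/2..1/2::real} t \<partial>lborel)"
    by (simp add: nn_integral_cmult)
  also have "\<dots> \<le> (\<integral>\<^sup>+t. (\<integral>\<^sup>+m. g (m + t *\<^sub>R e) * indicator ?Q m * indicator {-1/2..1/2} t \<partial>lborel) \<partial>lborel)"
  proof (rule nn_integral_mono)
    fix t :: real
    show "?I * indicator {-1/2..1/2} t \<le> (\<integral>\<^sup>+m. g (m + t *\<^sub>R e) * indicator ?Q m * indicator {-1/2..1/2} t \<partial>lborel)"
      using shift[of t] by (cases "t \<in> {-1/2..1/2}") simp_all
  qed
  also have "\<dots> = (\<integral>\<^sup>+m. (\<integral>\<^sup>+t. g (m + t *\<^sub>R e) * indicator ?Q m * indicator {-1/2..1/2} t \<partial>lborel) \<partial>lborel)"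
    by (rule lborel_pair.Fubini') measurable
  also have "\<dots> = (\<integral>\<^sup>+m. indicator ?Q m * (\<integral>\<^sup>+t. g (m + t *\<^sub>R e) * indicator {-1/2..1/2} t \<partial>lborel) \<partial>lborel)"
    by (intro nn_integral_cong) (simp add: nn_integral_cmult[symmetric] ac_simps)
  also have "\<dots> \<le> (\<integral>\<^sup>+m. C * indicator ?Q m \<partial>lborel)"
    using C by (intro nn_integral_mono) (auto simp: indicator_def)
  also have "\<dots> = C * emeasure lborel ?Q" by (simp add: nn_integral_cmult)
  finally show ?thesis .
qed

text \<open>Along each line in the direction of the identity every diagonal entry contributes at
  most 32, whatever \<open>x\<close> is. Hence integration against the finite \<open>\<nu>\<close>
  costs only its mass.\<close>

lemma kres_average:
  fixes F :: "real \<Rightarrow> complex^'d^'d" and \<nu> :: "real measure"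
  assumes F: "\<And>x. dissipative (F x)" and cont: "\<And>i j. continuous_on UNIV (\<lambda>x. F x $ i $ j)"
    and \<nu>: "sets \<nu> = sets borel" "finite_measure \<nu>" and \<eta>: "\<eta> > 0"
  defines "h x m \<equiv> (\<Sum>i\<in>UNIV. Im (kres (F x) (herm_of m + mat (- \<i> * complex_of_real \<eta>)) $ i $ i))"
  shows "(\<lambda>(x, m). h x m) \<in> borel_measurable (borel \<Otimes>\<^sub>M borel)"
    and "(\<integral>\<^sup>+m. (\<integral>\<^sup>+x. ennreal (h x m) \<partial>\<nu>) * indicator (ball 0 r) m \<partial>lborel) \<le>
      ennreal (32 * real CARD('d)) * emeasure \<nu> UNIV * emeasure lborel (ball (0::real^'d^'d) (r + norm (mat 1 :: real^'d^'d)))"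
proof -
  interpret finite_measure \<nu> by fact
  note [measurable_cong] = \<nu>(1)
  have sp: "space \<nu> = UNIV" using sets_eq_imp_space_eq[OF \<nu>(1)] by simp
  have cF: "continuous_on UNIV (\<lambda>p::real \<times> (real^'d^'d). F (fst p) $ i $ j)" for i j
    using continuous_on_compose2[OF cont[of i j] continuous_on_fst[OF continuous_on_id]] by simp
  have c\<beta>: "continuous_on UNIV (\<lambda>p::real \<times> (real^'d^'d). (herm_of (snd p) + mat (- \<i> * complex_of_real \<eta>)) $ i $ j)" for i j
    using continuous_on_add[OF continuous_on_compose2[OF continuous_on_herm_of_entry[of UNIV i j]
        continuous_on_snd[OF continuous_on_id] subset_UNIV] continuous_on_const]
    by (simp only: vector_add_component)
  have ck: "continuous_on UNIV (\<lambda>p::real \<times> (real^'d^'d). kres (F (fst p)) (herm_of (snd p) + mat (- \<i> * complex_of_real \<eta>)) $ i $ i)" for i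
    by (rule continuous_on_kres[OF cF c\<beta>]) (rule dissipative_kernel[OF F herm_of_hermitian, of "- \<i> * complex_of_real \<eta>"], use \<eta> in simp_all)
  have "continuous_on UNIV (\<lambda>p. h (fst p) (snd p))"
    unfolding h_def by (intro continuous_intros ck)
  from borel_measurable_continuous_onI[OF this]
  show h_meas: "(\<lambda>(x, m). h x m) \<in> borel_measurable (borel \<Otimes>\<^sub>M borel)"
    by (simp add: borel_prod case_prod_beta')
  have hx [measurable]: "(\<lambda>x. h x m) \<in> borel_measurable borel" for m
    using measurable_compose[OF measurable_Pair2'[of m borel borel] h_meas] by simp
  have hm [measurable]: "(\<lambda>p. h (snd p) (fst p)) \<in> borel_measurable (borel \<Otimes>\<^sub>M borel)"
    using measurable_compose[OF measurable_pair_swap' h_meas] by (simp add: case_prod_beta')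
  let ?g = "\<lambda>m. \<integral>\<^sup>+x. ennreal (h x m) \<partial>\<nu>"
  have gm: "?g \<in> borel_measurable borel"
  proof (rule borel_measurable_nn_integral[of "\<lambda>m x. ennreal (h x m)" borel])
    have st: "sets ((borel :: (real^'d^'d) measure) \<Otimes>\<^sub>M \<nu>) = sets (borel \<Otimes>\<^sub>M borel)"
      by (rule sets_pair_measure_cong[OF refl \<nu>(1)])
    have "(\<lambda>p. ennreal (h (snd p) (fst p))) \<in> borel_measurable (borel \<Otimes>\<^sub>M borel)"
      by measurable
    then show "(\<lambda>(m, x). ennreal (h x m)) \<in> borel_measurable (borel \<Otimes>\<^sub>M \<nu>)"
      unfolding measurable_cong_sets[OF st refl] case_prod_beta' .
  qed
  have "(\<integral>\<^sup>+t. ?g (m + t *\<^sub>R mat 1) * indicator {-1/2..1/2} t \<partial>lborel) \<le> ennreal (32 * real CARD('d)) * emeasure \<nu> UNIV" for m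
  proof -
    have hmt: "(\<lambda>p. h (fst p) (m + snd p *\<^sub>R mat 1)) \<in> borel_measurable (\<nu> \<Otimes>\<^sub>M lborel)"
    proof -
      have "(\<lambda>p::real \<times> real. (fst p, m + snd p *\<^sub>R mat 1)) \<in> measurable (borel \<Otimes>\<^sub>M borel) (borel \<Otimes>\<^sub>M borel)"
        by measurable
      from measurable_compose[OF this h_meas]
      have *: "(\<lambda>p::real \<times> real. h (fst p) (m + snd p *\<^sub>R mat 1)) \<in> borel_measurable (borel \<Otimes>\<^sub>M borel)" by simp
      have st: "sets (\<nu> \<Otimes>\<^sub>M lborel) = sets (borel \<Otimes>\<^sub>M borel :: (real \<times> real) measure)"
        by (rule sets_pair_measure_cong[OF \<nu>(1) sets_lborel])
      show ?thesis unfolding measurable_cong_sets[OF st refl] by (rule *)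
    qed
    interpret pair_sigma_finite \<nu> lborel by unfold_locales
    have "(\<integral>\<^sup>+t. ?g (m + t *\<^sub>R mat 1) * indicator {-1/2..1/2} t \<partial>lborel) =
      (\<integral>\<^sup>+t. (\<integral>\<^sup>+x. ennreal (h x (m + t *\<^sub>R mat 1)) * indicator {-1/2..1/2} t \<partial>\<nu>) \<partial>lborel)"
      by (intro nn_integral_cong nn_integral_multc[symmetric]) measurable
    also have "\<dots> = (\<integral>\<^sup>+x. (\<integral>\<^sup>+t. ennreal (h x (m + t *\<^sub>R mat 1)) * indicator {-1/2..1/2} t \<partial>lborel) \<partial>\<nu>)"
    proof (rule Fubini'[of "\<lambda>x t. ennreal (h x (m + t *\<^sub>R mat 1)) * indicator {-1/2..1/2} t"])
      show "(\<lambda>(x, t). ennreal (h x (m + t *\<^sub>R mat 1)) * indicator {-1/2..1/2} t) \<in> borel_measurable (\<nu> \<Otimes>\<^sub>M lborel)"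
        using hmt unfolding case_prod_beta' by measurable
    qed
    also have "\<dots> \<le> (\<integral>\<^sup>+x. ennreal (32 * real CARD('d)) \<partial>\<nu>)"
    proof (rule nn_integral_mono)
      fix x
      let ?k = "\<lambda>i t. Im (kres (F x) (herm_of m + mat (complex_of_real t - \<i> * complex_of_real \<eta>)) $ i $ i)"
      have k0: "?k i t \<ge> 0" for i t
      proof -
        have "0 \<le> - Im (complex_of_real t - \<i> * complex_of_real \<eta>) *
          (norm (kres (F x) (herm_of m + mat (complex_of_real t - \<i> * complex_of_real \<eta>)) *v axis i 1))\<^sup>2"
          using \<eta> by simp
        also have "\<dots> \<le> ?k i t" using \<eta> by (intro Im_kres_ge[OF F herm_of_hermitian]) simp
        finally show ?thesis .
      qed
      have km: "(\<lambda>t. ?k i t) \<in> borel_measurable borel" for i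
      proof -
        have "(\<lambda>\<zeta>. kres (F x) (herm_of m + mat (\<zeta> - \<i> * complex_of_real \<eta>)) $ i $ i) holomorphic_on {\<zeta>. Im \<zeta> \<le> \<eta>}"
          by (rule holomorphic_on_kres[OF F herm_of_hermitian])
        moreover have "complex_of_real ` UNIV \<subseteq> {\<zeta>. Im \<zeta> \<le> \<eta>}" using \<eta> by auto
        ultimately have "continuous_on UNIV (\<lambda>t. kres (F x) (herm_of m + mat (complex_of_real t - \<i> * complex_of_real \<eta>)) $ i $ i)"
          by (rule continuous_on_compose2[OF holomorphic_on_imp_continuous_on continuous_on_of_real[OF continuous_on_id]])
        then show ?thesis by (rule borel_measurable_continuous_onI[OF continuous_on_Im])
      qed
      have hk: "h x (m + t *\<^sub>R mat 1) = (\<Sum>i\<in>UNIV. ?k i t)" for t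
      proof -
        have "herm_of (m + t *\<^sub>R mat 1) + mat (- \<i> * complex_of_real \<eta>) =
          herm_of m + mat (complex_of_real t - \<i> * complex_of_real \<eta>)"
        proof -
          have madd: "mat a + mat b = (mat (a + b) :: complex^'d^'d)" for a b by (simp add: vec_eq_iff mat_def)
          show ?thesis by (simp only: herm_of_add herm_of_scale_one add.assoc madd) simp
        qed
        then show ?thesis unfolding h_def by simp
      qed
      have "(\<integral>\<^sup>+t. ennreal (h x (m + t *\<^sub>R mat 1)) * indicator {-1/2..1/2} t \<partial>lborel) =
        (\<integral>\<^sup>+t. (\<Sum>i\<in>UNIV. ennreal (?k i t) * indicator {-1/2..1/2} t) \<partial>lborel)"
        by (simp only: hk sum_ennreal[OF k0, symmetric] sum_distrib_right)
      also have "\<dots> = (\<Sum>i\<in>UNIV. (\<integral>\<^sup>+t. ennreal (?k i t) * indicator {-1/2..1/2} t \<partial>lborel))"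
      proof (rule nn_integral_sum)
        show "(\<lambda>t. ennreal (?k i t) * indicator {-1/2..1/2} t) \<in> borel_measurable lborel" for i
          using km[of i] by measurable
      qed
      also have "\<dots> \<le> (\<Sum>i\<in>(UNIV::'d set). 32)"
        by (intro sum_mono kres_window[OF F herm_of_hermitian \<eta>])
      also have "\<dots> = ennreal (32 * real CARD('d))"
        by (simp add: ennreal_mult ennreal_of_nat_eq_real_of_nat mult.commute)
      finally show "(\<integral>\<^sup>+t. ennreal (h x (m + t *\<^sub>R mat 1)) * indicator {-1/2..1/2} t \<partial>lborel) \<le> ennreal (32 * real CARD('d))" .
    qed
    also have "\<dots> = ennreal (32 * real CARD('d)) * emeasure \<nu> UNIV" by (simp add: sp)
    finally show ?thesis .
  qed
  from translation_average[OF gm this]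
  show "(\<integral>\<^sup>+m. ?g m * indicator (ball 0 r) m \<partial>lborel) \<le>
      ennreal (32 * real CARD('d)) * emeasure \<nu> UNIV * emeasure lborel (ball (0::real^'d^'d) (r + norm (mat 1 :: real^'d^'d)))" .
qed

text \<open>The neighbourhoods belonging to a fixed threshold index \<open>n0\<close> increase with \<open>n0\<close>, so a uniform
  bound on their volumes survives the union.\<close>

lemma neighbourhood_measure_le:
  fixes F :: "nat \<Rightarrow> real \<Rightarrow> complex^'d^'d" and \<nu> :: "real measure" and r :: real
  assumes F: "\<And>n x. dissipative (F n x)" and cont: "\<And>n i j. continuous_on UNIV (\<lambda>x. F n x $ i $ j)"
    and \<nu>: "sets \<nu> = sets borel" "finite_measure \<nu>" and \<delta>: "\<delta> > 0"
  defines "X \<equiv> {m \<in> ball 0 r. \<forall>K>0. \<exists>n0. \<forall>n\<ge>n0. \<delta> \<le> measure \<nu> {x. norm (kres (F n x) (herm_of m)) > K}}"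
  shows "\<exists>C. \<forall>\<eta>. 0 < \<eta> \<longrightarrow> \<eta> \<le> 1 \<longrightarrow> emeasure lborel (\<Union>m\<in>X. ball m \<eta>) \<le> ennreal (C * \<eta>)"
proof -
  interpret finite_measure \<nu> by fact
  note [measurable_cong] = \<nu>(1)
  have sp: "space \<nu> = UNIV" using sets_eq_imp_space_eq[OF \<nu>(1)] by simp
  define c where "c = 1 + 2 * norm (mat 1 :: complex^'d^'d)"
  have c: "c > 0" unfolding c_def using norm_mat_one_ge[where 'd='d] by linarith
  define V where "V = ennreal (32 * real CARD('d)) * emeasure \<nu> UNIV *
    emeasure lborel (ball (0::real^'d^'d) (r + 1 + norm (mat 1 :: real^'d^'d)))"
  have "V < \<infinity>"
    using emeasure_lborel_ball_finite[of "0::real^'d^'d" "r + 1 + norm (mat 1 :: real^'d^'d)"]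
    by (auto simp: V_def ennreal_mult_less_top emeasure_eq_measure)
  then obtain v where v: "v \<ge> 0" "V = ennreal v" by (metis ennreal_cases less_top infinity_ennreal_def)
  have meas: "{x. norm (kres (F n x) (herm_of m)) > K} \<in> sets \<nu>" for n m K
  proof -
    have "continuous_on UNIV (\<lambda>x. kres (F n x) (herm_of m) $ i $ j)" for i j
    proof (rule continuous_on_kres[OF cont])
      show "v = 0" if "(mat 1 + herm_of m ** F n p) *v v = 0" for p v
      proof (rule dissipative_kernel[OF F herm_of_hermitian])
        show "(mat 1 + (herm_of m + mat 0) ** F n p) *v v = 0" using that by simp
      qed simp
    qed auto
    then have "continuous_on UNIV (\<lambda>x. kres (F n x) (herm_of m))"
      by (subst vec_lambda_eta[symmetric], intro continuous_on_vec_lambda)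
         (subst vec_lambda_eta[symmetric], intro continuous_on_vec_lambda)
    then have "(\<lambda>x. norm (kres (F n x) (herm_of m))) \<in> borel_measurable borel"
      by (intro borel_measurable_continuous_onI continuous_intros)
    then have "{x \<in> space borel. K < norm (kres (F n x) (herm_of m))} \<in> sets borel" by measurable
    then show ?thesis using \<nu>(1) by simp
  qed
  have main: "emeasure lborel (\<Union>m\<in>X. ball m \<eta>) \<le> ennreal (v * c\<^sup>2 / \<delta> * \<eta>)" if \<eta>: "0 < \<eta>" "\<eta> \<le> 1" for \<eta>
  proof -
    \<comment> \<open>From the condition defining \<open>X\<close> only the threshold
      \<open>1 / \<eta>\<close> is kept, the size of resolvent that survives a perturbation of the
      parameter by \<open>\<eta>\<close>.\<close>
    define XN where "XN N = {m \<in> ball 0 r. \<forall>n\<ge>N. \<delta> \<le> measure \<nu> {x. norm (kres (F n x) (herm_of m)) > 1 / \<eta>}}" for N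
    define U where "U N = (\<Union>m\<in>XN N. ball m \<eta>)" for N :: nat
    have U_meas: "U N \<in> sets lborel" for N unfolding U_def by (simp add: open_UN borel_open)
    have "incseq U" unfolding U_def XN_def incseq_def by (intro allI impI UN_mono) auto
    have XX: "X \<subseteq> (\<Union>N. XN N)" unfolding X_def XN_def using \<eta> by (auto dest!: spec[of _ "1 / \<eta>"])
    have "(\<Union>m\<in>X. ball m \<eta>) \<subseteq> (\<Union>N. U N)" unfolding U_def using XX by blast
    moreover have UN: "emeasure lborel (U N) \<le> ennreal (v * c\<^sup>2 / \<delta> * \<eta>)" for N
    proof -
      let ?h = "\<lambda>x m. \<Sum>i\<in>UNIV. Im (kres (F N x) (herm_of m + mat (- \<i> * complex_of_real \<eta>)) $ i $ i)"
      \<comment> \<open>This is \<open>\<eta> * (1 / (c * \<eta>))\<^sup>2\<close>, the trace bound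
        fed with the lower bound for the shifted norm.\<close>
      let ?q = "1 / (c\<^sup>2 * \<eta>)"
      have q: "?q > 0" using c \<eta> by simp
      have low: "ennreal (\<delta> * ?q) \<le> (\<integral>\<^sup>+x. ennreal (?h x m') \<partial>\<nu>)" and m'r: "m' \<in> ball 0 (r + 1)" if "m' \<in> U N" for m'
      proof -
        obtain m where m: "m \<in> XN N" "dist m m' < \<eta>" using \<open>m' \<in> U N\<close> unfolding U_def by auto
        \<comment> \<open>Since \<open>\<eta> \<le> 1\<close>, enlarging the radius by 1 is enough
          for all \<open>\<eta>\<close>.\<close>
        have "norm m' \<le> norm m + dist m m'" by (metis dist_0_norm dist_triangle)
        then show "m' \<in> ball 0 (r + 1)" using m \<eta> unfolding XN_def by simp
        let ?S = "{x. norm (kres (F N x) (herm_of m)) > 1 / \<eta>}"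
        have "\<delta> \<le> measure \<nu> ?S" using m(1) unfolding XN_def by blast
        then have "ennreal (\<delta> * ?q) \<le> ennreal (measure \<nu> ?S * ?q)"
          using q by (intro ennreal_leI mult_right_mono) auto
        also have "\<dots> = (\<integral>\<^sup>+x. ennreal ?q * indicator ?S x \<partial>\<nu>)"
          by (subst mult.commute) (simp only: ennreal_mult'[OF less_imp_le[OF q]] emeasure_eq_measure
              nn_integral_cmult_indicator[OF meas[where n=N and m=m and K="1 / \<eta>"]])
        also have "\<dots> \<le> (\<integral>\<^sup>+x. ennreal (?h x m') \<partial>\<nu>)"
        proof (rule nn_integral_mono)
          fix x
          show "ennreal ?q * indicator ?S x \<le> ennreal (?h x m')"
          proof (cases "x \<in> ?S")
            case True
            let ?n = "norm (kres (F N x) (herm_of m' + mat (- \<i> * complex_of_real \<eta>)))"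
            have "norm (herm_of m' - herm_of m) \<le> \<eta>"
              using m(2) by (simp add: herm_of_diff[symmetric] norm_herm_of dist_norm norm_minus_commute)
            then have "1 / (c * \<eta>) \<le> ?n"
              using norm_kres_shift_ge[OF F herm_of_hermitian herm_of_hermitian \<eta>(1)] True unfolding c_def by blast
            then have "\<eta> * (1 / (c * \<eta>))\<^sup>2 \<le> \<eta> * ?n\<^sup>2"
              using \<eta> c by (intro mult_left_mono power_mono) auto
            also have "\<dots> \<le> ?h x m'"
              using \<eta> by (intro trace_Im_kres_ge[OF F herm_of_hermitian]) simp
            finally have "?q \<le> ?h x m'"
              using \<eta> c by (simp add: power2_eq_square field_simps)
            then show ?thesis using True by (simp add: ennreal_leI)
          qed simp
        qed
        finally show "ennreal (\<delta> * ?q) \<le> (\<integral>\<^sup>+x. ennreal (?h x m') \<partial>\<nu>)" .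
      qed
      \<comment> \<open>Chebyshev's inequality: on all of \<open>U N\<close> the averaged trace is
        at least \<open>\<delta> * ?q\<close>, of order \<open>1 / \<eta>\<close>, while its total
        integral is bounded by \<open>V\<close>.\<close>
      have "ennreal (\<delta> * ?q) * emeasure lborel (U N) = (\<integral>\<^sup>+m. ennreal (\<delta> * ?q) * indicator (U N) m \<partial>lborel)"
        using U_meas by (simp add: nn_integral_cmult)
      also have "\<dots> \<le> (\<integral>\<^sup>+m. (\<integral>\<^sup>+x. ennreal (?h x m) \<partial>\<nu>) * indicator (ball 0 (r + 1)) m \<partial>lborel)"
      proof (rule nn_integral_mono)
        fix m
        show "ennreal (\<delta> * ?q) * indicator (U N) m \<le> (\<integral>\<^sup>+x. ennreal (?h x m) \<partial>\<nu>) * indicator (ball 0 (r + 1)) m"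
          using low[of m] m'r[of m] by (cases "m \<in> U N") (simp_all add: indicator_def)
      qed
      also have "\<dots> \<le> V"
        unfolding V_def by (rule kres_average(2)[OF F cont \<nu> \<eta>(1)])
      finally have le: "ennreal (\<delta> * ?q) * emeasure lborel (U N) \<le> ennreal v" unfolding v .
      have dq: "\<delta> * ?q > 0" using \<delta> q by (intro mult_pos_pos)
      have "emeasure lborel (U N) \<noteq> \<infinity>"
      proof
        assume "emeasure lborel (U N) = \<infinity>"
        then have "ennreal (\<delta> * ?q) * emeasure lborel (U N) = \<infinity>" using dq \<delta> c \<eta> by (simp add: ennreal_mult_top)
        then show False using le by (simp add: top_unique)
      qed
      then obtain u where u: "u \<ge> 0" "emeasure lborel (U N) = ennreal u"
        by (metis ennreal_cases infinity_ennreal_def)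
      have "\<delta> * ?q * u \<le> v"
        using le dq u v by (simp add: ennreal_mult[symmetric] del: times_divide_eq_right)
      then have "u \<le> v * c\<^sup>2 / \<delta> * \<eta>"
        using \<delta> c \<eta> by (simp add: field_simps)
      then show ?thesis unfolding u by (rule ennreal_leI)
    qed
    ultimately have "emeasure lborel (\<Union>m\<in>X. ball m \<eta>) \<le> emeasure lborel (\<Union>N. U N)"
      using U_meas by (intro emeasure_mono) auto
    also have "\<dots> = (SUP N. emeasure lborel (U N))"
      using U_meas \<open>incseq U\<close> by (intro SUP_emeasure_incseq[symmetric]) auto
    also have "\<dots> \<le> ennreal (v * c\<^sup>2 / \<delta> * \<eta>)" by (rule SUP_least) (rule UN)
    finally show ?thesis .
  qed
  then show ?thesis by (intro exI[of _ "v * c\<^sup>2 / \<delta>"]) blast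
qed

section \<open>Hausdorff measure\<close>

text \<open>Vanishing of the outer measure spelled out by covers, so that countable unions and
  isometric images can be treated without infima.\<close>

definition hausdorff_null :: "real \<Rightarrow> 'a::metric_space set \<Rightarrow> bool" where
  "hausdorff_null s X \<longleftrightarrow> (\<forall>\<epsilon>>0. \<forall>\<delta>>0. \<exists>U::nat \<Rightarrow> 'a set. X \<subseteq> (\<Union>n. U n) \<and>
     (\<forall>n. bounded (U n) \<and> diameter (U n) \<le> \<delta>) \<and> (\<Sum>n. ennreal (diameter (U n) powr s)) \<le> ennreal \<epsilon>)"

lemma hausdorff_outer_measure_eq_0:
  assumes "hausdorff_null s X"
  shows "hausdorff_outer_measure s X = 0"
proof -
  have "(INF U\<in>{U::nat \<Rightarrow> 'a set. X \<subseteq> (\<Union>n. U n) \<and> (\<forall>n. bounded (U n) \<and> diameter (U n) \<le> \<delta>)}.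
      (\<Sum>n. ennreal (diameter (U n) powr s))) \<le> 0" if "\<delta> > 0" for \<delta>
  proof (rule ennreal_le_epsilon)
    fix \<epsilon> :: real assume "\<epsilon> > 0"
    then obtain U :: "nat \<Rightarrow> 'a set" where U: "X \<subseteq> (\<Union>n. U n)" "\<forall>n. bounded (U n) \<and> diameter (U n) \<le> \<delta>"
      "(\<Sum>n. ennreal (diameter (U n) powr s)) \<le> ennreal \<epsilon>"
      using assms \<open>\<delta> > 0\<close> unfolding hausdorff_null_def by meson
    then show "(INF U\<in>{U::nat \<Rightarrow> 'a set. X \<subseteq> (\<Union>n. U n) \<and> (\<forall>n. bounded (U n) \<and> diameter (U n) \<le> \<delta>)}.
      (\<Sum>n. ennreal (diameter (U n) powr s))) \<le> 0 + ennreal \<epsilon>"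
      by (intro INF_lower2[of U]) auto
  qed
  then show ?thesis
    unfolding hausdorff_outer_measure_def by (intro antisym SUP_least) auto
qed

text \<open>The \<open>k\<close>-th set is covered at cost
  \<open>\<epsilon> * (1 / 2) ^ Suc k\<close>, and the double sequence of covers is enumerated by
  \<open>prod_decode\<close>.\<close>

lemma hausdorff_null_UN:
  fixes X :: "nat \<Rightarrow> 'a::metric_space set"
  assumes X: "\<And>k. hausdorff_null s (X k)"
  shows "hausdorff_null s (\<Union>k. X k)"
  unfolding hausdorff_null_def
proof (intro allI impI)
  fix \<epsilon> \<delta> :: real assume \<epsilon>: "\<epsilon> > 0" and \<delta>: "\<delta> > 0"
  have "\<forall>k. \<exists>U::nat \<Rightarrow> 'a set. X k \<subseteq> (\<Union>n. U n) \<and> (\<forall>n. bounded (U n) \<and> diameter (U n) \<le> \<delta>) \<and>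
      (\<Sum>n. ennreal (diameter (U n) powr s)) \<le> ennreal (\<epsilon> * (1 / 2) ^ Suc k)"
    using X \<epsilon> \<delta> unfolding hausdorff_null_def by simp
  from choice[OF this] obtain U :: "nat \<Rightarrow> nat \<Rightarrow> 'a set" where U: "\<And>k. X k \<subseteq> (\<Union>n. U k n)"
    "\<And>k n. bounded (U k n)" "\<And>k n. diameter (U k n) \<le> \<delta>"
    "\<And>k. (\<Sum>n. ennreal (diameter (U k n) powr s)) \<le> ennreal (\<epsilon> * (1 / 2) ^ Suc k)" by blast
  define W where "W n = U (fst (prod_decode n)) (snd (prod_decode n))" for n
  have "(\<Union>k. X k) \<subseteq> (\<Union>n. W n)"
  proof
    fix x assume "x \<in> (\<Union>k. X k)"
    then obtain k n where "x \<in> U k n" using U(1) by blast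
    then have "x \<in> W (prod_encode (k, n))" by (simp add: W_def)
    then show "x \<in> (\<Union>n. W n)" by blast
  qed
  moreover have "\<forall>n. bounded (W n) \<and> diameter (W n) \<le> \<delta>" using U(2,3) by (simp add: W_def)
  moreover have "(\<Sum>n. ennreal (diameter (W n) powr s)) \<le> ennreal \<epsilon>"
  proof -
    have "(\<Sum>n. ennreal (diameter (W n) powr s)) = (\<integral>\<^sup>+n. ennreal (diameter (W n) powr s) \<partial>count_space UNIV)"
      by (simp add: nn_integral_count_space_nat)
    also have "\<dots> = (\<integral>\<^sup>+p. ennreal (diameter (U (fst p) (snd p)) powr s) \<partial>count_space UNIV)"
      unfolding W_def
      by (rule nn_integral_bij_count_space[of prod_decode UNIV UNIV "\<lambda>p. ennreal (diameter (U (fst p) (snd p)) powr s)"])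
         (rule bij_prod_decode)
    also have "\<dots> = (\<integral>\<^sup>+k. (\<integral>\<^sup>+n. ennreal (diameter (U k n) powr s) \<partial>count_space UNIV) \<partial>count_space UNIV)"
      using nn_integral_fst_count_space[of "\<lambda>p. ennreal (diameter (U (fst p) (snd p)) powr s)"] by simp
    also have "\<dots> = (\<Sum>k. \<Sum>n. ennreal (diameter (U k n) powr s))"
      by (simp add: nn_integral_count_space_nat)
    also have "\<dots> \<le> (\<Sum>k. ennreal (\<epsilon> * (1 / 2) ^ Suc k))"
      by (intro suminf_le U(4)) auto
    also have "\<dots> = ennreal \<epsilon>"
    proof (rule suminf_ennreal_eq)
      show "(\<lambda>k. \<epsilon> * (1 / 2) ^ Suc k) sums \<epsilon>" using sums_mult[OF power_half_series, of \<epsilon>] by simp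
    qed (use \<epsilon> in simp)
    finally show ?thesis .
  qed
  ultimately show "\<exists>W::nat \<Rightarrow> 'a set. (\<Union>k. X k) \<subseteq> (\<Union>n. W n) \<and> (\<forall>n. bounded (W n) \<and> diameter (W n) \<le> \<delta>) \<and>
      (\<Sum>n. ennreal (diameter (W n) powr s)) \<le> ennreal \<epsilon>" by blast
qed

lemma hausdorff_null_isometric_image:
  fixes f :: "'a::real_normed_vector \<Rightarrow> 'b::real_normed_vector"
  assumes X: "hausdorff_null s X" and s: "s \<ge> 0" and f: "\<And>x y. norm (f x - f y) = norm (x - y)"
  shows "hausdorff_null s (f ` X)"
  unfolding hausdorff_null_def
proof (intro allI impI)
  fix \<epsilon> \<delta> :: real assume "\<epsilon> > 0" "\<delta> > 0"
  then have "\<exists>U::nat \<Rightarrow> 'a set. X \<subseteq> (\<Union>n. U n) \<and> (\<forall>n. bounded (U n) \<and> diameter (U n) \<le> \<delta>) \<and>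
      (\<Sum>n. ennreal (diameter (U n) powr s)) \<le> ennreal \<epsilon>"
    using X unfolding hausdorff_null_def by simp
  then obtain U :: "nat \<Rightarrow> 'a set" where U: "X \<subseteq> (\<Union>n. U n)" "\<And>n. bounded (U n)" "\<And>n. diameter (U n) \<le> \<delta>"
    "(\<Sum>n. ennreal (diameter (U n) powr s)) \<le> ennreal \<epsilon>" by auto
  have b: "bounded (f ` U n)" for n
  proof -
    obtain x e where "\<And>y. y \<in> U n \<Longrightarrow> dist x y \<le> e" using U(2)[of n] unfolding bounded_def by auto
    then show ?thesis unfolding bounded_def
      by (intro exI[of _ "f x"] exI[of _ e]) (auto simp: dist_norm f)
  qed
  have d: "diameter (f ` U n) \<le> diameter (U n)" for n
  proof (rule diameter_le)
    show "f ` U n \<noteq> {} \<or> 0 \<le> diameter (U n)" using diameter_ge_0[OF U(2)] by simp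
    show "norm (x - y) \<le> diameter (U n)" if xy: "x \<in> f ` U n" "y \<in> f ` U n" for x y
    proof -
      obtain a c where "x = f a" "y = f c" "a \<in> U n" "c \<in> U n" using xy by auto
      then show ?thesis using diameter_bounded_bound[OF U(2), of a n c] by (simp add: f dist_norm)
    qed
  qed
  have "(\<Sum>n. ennreal (diameter (f ` U n) powr s)) \<le> (\<Sum>n. ennreal (diameter (U n) powr s))"
    using d s diameter_ge_0[OF b] by (intro suminf_le ennreal_leI powr_mono2) auto
  with U(4) have "(\<Sum>n. ennreal (diameter (f ` U n) powr s)) \<le> ennreal \<epsilon>" by (rule order_trans[rotated])
  moreover have "f ` X \<subseteq> (\<Union>n. f ` U n)" using U(1) by blast
  moreover have "\<forall>n. bounded (f ` U n) \<and> diameter (f ` U n) \<le> \<delta>"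
    using b d U(3) order_trans by blast
  ultimately show "\<exists>W::nat \<Rightarrow> 'b set. f ` X \<subseteq> (\<Union>n. W n) \<and> (\<forall>n. bounded (W n) \<and> diameter (W n) \<le> \<delta>) \<and>
      (\<Sum>n. ennreal (diameter (W n) powr s)) \<le> ennreal \<epsilon>"
    by (intro exI[of _ "\<lambda>n. f ` U n"]) simp
qed

text \<open>Take a largest subset of \<open>X\<close> with mutual distances at least
  \<open>2 * \<eta>\<close>. Its \<open>\<eta>\<close>-balls are disjoint inside the neighbourhood
  of \<open>X\<close>, which bounds its size; by maximality its \<open>2 * \<eta>\<close>-balls
  cover \<open>X\<close>.\<close>

lemma separated_cover:
  fixes X :: "'a::euclidean_space set"
  assumes \<eta>: "\<eta> > 0" and C: "emeasure lborel (\<Union>m\<in>X. ball m \<eta>) \<le> ennreal (C * \<eta>)"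
  obtains S where "finite S" "S \<subseteq> X" "X \<subseteq> (\<Union>m\<in>S. ball m (2 * \<eta>))"
    "real (card S) * (unit_ball_vol (real DIM('a)) * \<eta> ^ DIM('a)) \<le> max 0 (C * \<eta>)"
proof -
  let ?v = "unit_ball_vol (real DIM('a)) * \<eta> ^ DIM('a)"
  have v: "?v > 0" using \<eta> by simp
  define sep where "sep S \<longleftrightarrow> finite S \<and> S \<subseteq> X \<and> (\<forall>x\<in>S. \<forall>y\<in>S. x \<noteq> y \<longrightarrow> dist x y \<ge> 2 * \<eta>)" for S
  have card: "real (card S) * ?v \<le> max 0 (C * \<eta>)" if "sep S" for S
  proof -
    have S: "finite S" "S \<subseteq> X" using that by (auto simp: sep_def)
    have "disjoint_family_on (\<lambda>m. ball m \<eta>) S"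
      unfolding disjoint_family_on_def
    proof (intro ballI impI)
      fix m n assume "m \<in> S" "n \<in> S" "m \<noteq> n"
      then have "dist m n \<ge> 2 * \<eta>" using that by (auto simp: sep_def)
      then show "ball m \<eta> \<inter> ball n \<eta> = {}"
        using dist_triangle_less_add[of m _ \<eta> n \<eta>] by (fastforce simp: dist_commute)
    qed
    then have "(\<Sum>m\<in>S. emeasure lborel (ball m \<eta>)) = emeasure lborel (\<Union>m\<in>S. ball m \<eta>)"
      using S by (intro sum_emeasure) auto
    also have "\<dots> \<le> emeasure lborel (\<Union>m\<in>X. ball m \<eta>)"
      using S by (intro emeasure_mono) (auto simp: open_UN borel_open)
    also have "\<dots> \<le> ennreal (C * \<eta>)" by (rule C)
    also have "\<dots> \<le> ennreal (max 0 (C * \<eta>))" by (rule ennreal_leI) simp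
    also have "(\<Sum>m\<in>S. emeasure lborel (ball m \<eta>)) = ennreal (real (card S) * ?v)"
      using \<eta> by (simp add: emeasure_ball ennreal_mult' ennreal_of_nat_eq_real_of_nat)
    finally have "ennreal (real (card S) * ?v) \<le> ennreal (max 0 (C * \<eta>))" .
    then show ?thesis by (subst (asm) ennreal_le_iff) auto
  qed
  \<comment> \<open>A common bound on the cardinalities ensures that a largest separated set
    exists.\<close>
  have bound: "card S \<le> nat \<lceil>max 0 (C * \<eta>) / ?v\<rceil>" if "sep S" for S
    using card[OF that] v by (simp add: pos_le_divide_eq[symmetric] le_nat_iff le_ceiling_iff)
  have "sep {}" by (simp add: sep_def)
  then obtain S where S: "sep S" "\<And>S'. sep S' \<Longrightarrow> card S' \<le> card S"
    using ex_has_greatest_nat[of sep "{}" card "Suc (nat \<lceil>max 0 (C * \<eta>) / ?v\<rceil>)"] bound by (metis less_Suc_eq_le)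
  have "X \<subseteq> (\<Union>m\<in>S. ball m (2 * \<eta>))"
  proof
    fix x assume x: "x \<in> X"
    show "x \<in> (\<Union>m\<in>S. ball m (2 * \<eta>))"
    proof (rule ccontr)
      assume n: "x \<notin> (\<Union>m\<in>S. ball m (2 * \<eta>))"
      then have far: "dist m x \<ge> 2 * \<eta>" if "m \<in> S" for m using that by (auto simp: not_less)
      have "x \<notin> S" using n \<eta> by auto
      have "sep (insert x S)" using S(1) x far unfolding sep_def by (auto simp: dist_commute)
      from S(2)[OF this] show False using \<open>x \<notin> S\<close> S(1) by (simp add: sep_def)
    qed
  qed
  with S card[OF S(1)] that show thesis by (auto simp: sep_def)
qed

text \<open>In dimension \<open>D\<close> the volume bound gives a cover by
  \<open>O(\<eta> powr (1 - D))\<close> balls of diameter \<open>4 * \<eta>\<close>. Their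
  \<open>s\<close>-powers sum to at most \<open>B * \<eta> powr p\<close> with
  \<open>p = s - (D - 1) > 0\<close>, which tends to 0.\<close>

lemma hausdorff_null_if_neighbourhood_measure:
  fixes X :: "'a::euclidean_space set"
  assumes C: "\<And>\<eta>. 0 < \<eta> \<Longrightarrow> \<eta> \<le> 1 \<Longrightarrow> emeasure lborel (\<Union>m\<in>X. ball m \<eta>) \<le> ennreal (C * \<eta>)"
    and s: "s > 0" "s > real DIM('a) - 1"
  shows "hausdorff_null s X"
  unfolding hausdorff_null_def
proof (intro allI impI)
  fix \<epsilon> \<delta> :: real assume \<epsilon>: "\<epsilon> > 0" and \<delta>: "\<delta> > 0"
  let ?u = "unit_ball_vol (real DIM('a))"
  have u: "?u > 0" by simp
  define B where "B = max 0 C * 4 powr s / ?u"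
  define p where "p = s - (real DIM('a) - 1)"
  have p: "p > 0" using s by (simp add: p_def)
  have "((\<lambda>\<eta>. B * \<eta> powr p) \<longlongrightarrow> B * 0 powr p) (at_right 0)"
    using p by (intro tendsto_intros tendsto_powr2) (auto simp: eventually_at_right_less[THEN eventually_mono] less_imp_le)
  then have "((\<lambda>\<eta>. B * \<eta> powr p) \<longlongrightarrow> 0) (at_right 0)" by simp
  then have "eventually (\<lambda>\<eta>. B * \<eta> powr p < \<epsilon>) (at_right 0)" using \<epsilon> by (rule order_tendstoD)
  moreover have "eventually (\<lambda>\<eta>. \<eta> \<in> {0<..<min 1 (\<delta> / 4)}) (at_right (0::real))"
    using \<delta> by (intro eventually_at_right_real) simp
  ultimately obtain \<eta> where \<eta>': "B * \<eta> powr p < \<epsilon>" "\<eta> \<in> {0<..<min 1 (\<delta> / 4)}"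
    using eventually_happens'[OF trivial_limit_at_right_real eventually_conj] by blast
  then have \<eta>: "0 < \<eta>" "\<eta> \<le> 1" "4 * \<eta> \<le> \<delta>" by auto
  obtain S where S: "finite S" "X \<subseteq> (\<Union>m\<in>S. ball m (2 * \<eta>))" "real (card S) * (?u * \<eta> ^ DIM('a)) \<le> max 0 (C * \<eta>)"
    using separated_cover[OF \<eta>(1) C[OF \<eta>(1,2)]] by metis
  obtain f where f: "bij_betw f {..<card S} S"
    using ex_bij_betw_nat_finite[OF S(1)] by (auto simp: atLeast0LessThan)
  \<comment> \<open>The empty sets that fill up the sequence cost nothing: their diameter is 0 and
    \<open>0 powr s = 0\<close>.\<close>
  define U where "U n = (if n < card S then ball (f n) (2 * \<eta>) else {})" for n
  have "X \<subseteq> (\<Union>n. U n)"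
  proof
    fix x assume "x \<in> X"
    then obtain m where m: "m \<in> S" "x \<in> ball m (2 * \<eta>)" using S(2) by blast
    then obtain n where "n < card S" "m = f n" using f by (auto simp: bij_betw_def)
    then have "x \<in> U n" using m by (simp add: U_def)
    then show "x \<in> (\<Union>n. U n)" by blast
  qed
  moreover have "\<forall>n. bounded (U n) \<and> diameter (U n) \<le> \<delta>"
    using \<eta> \<delta> by (auto simp: U_def)
  moreover have "(\<Sum>n. ennreal (diameter (U n) powr s)) \<le> ennreal \<epsilon>"
  proof -
    have "(\<Sum>n. ennreal (diameter (U n) powr s)) = (\<Sum>n<card S. ennreal (diameter (U n) powr s))"
      by (rule suminf_finite) (auto simp: U_def)
    also have "\<dots> = (\<Sum>n<card S. ennreal ((4 * \<eta>) powr s))"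
      using \<eta> by (intro sum.cong) (auto simp: U_def)
    also have "\<dots> = ennreal (real (card S) * (4 * \<eta>) powr s)"
      by (simp add: ennreal_mult' ennreal_of_nat_eq_real_of_nat)
    also have "\<dots> \<le> ennreal \<epsilon>"
    proof (rule ennreal_leI)
      have "real (card S) \<le> max 0 C * \<eta> / (?u * \<eta> ^ DIM('a))"
      proof (subst pos_le_divide_eq)
        show "0 < ?u * \<eta> ^ DIM('a)" using u \<eta> by simp
        have "max 0 (C * \<eta>) = max 0 C * \<eta>" using \<eta> by (simp add: max_def mult_le_0_iff zero_le_mult_iff)
        then show "real (card S) * (?u * \<eta> ^ DIM('a)) \<le> max 0 C * \<eta>" using S(3) by simp
      qed
      then have "real (card S) * (4 * \<eta>) powr s \<le> max 0 C * \<eta> / (?u * \<eta> ^ DIM('a)) * (4 * \<eta>) powr s"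
        by (rule mult_right_mono) simp
      also have "\<dots> = B * \<eta> powr p"
      proof -
        have "\<eta> powr p = \<eta> powr s * \<eta> / \<eta> ^ DIM('a)"
          using \<eta> by (simp add: p_def powr_diff powr_add powr_realpow)
        then show ?thesis using \<eta> by (simp add: B_def powr_mult)
      qed
      also have "\<dots> \<le> \<epsilon>" using \<eta>'(1) by simp
      finally show "real (card S) * (4 * \<eta>) powr s \<le> \<epsilon>" .
    qed
    finally show ?thesis .
  qed
  ultimately show "\<exists>U::nat \<Rightarrow> 'a set. X \<subseteq> (\<Union>n. U n) \<and> (\<forall>n. bounded (U n) \<and> diameter (U n) \<le> \<delta>) \<and>
      (\<Sum>n. ennreal (diameter (U n) powr s)) \<le> ennreal \<epsilon>" by blast
qed

section \<open>Mutual singularity from small intervals\<close>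

text \<open>Cut the line into cells of length \<open>1/n\<close> and compare \<open>\<rho>\<close> with \<open>K\<close> times the Lebesgue measure of a
  small open neighbourhood of \<open>S\<close>.\<close>

lemma low_density_small:
  fixes \<rho> :: "real measure"
  assumes \<rho>: "sets \<rho> = sets borel" "finite_measure \<rho>" and S: "S \<in> sets borel" "emeasure lborel S = 0"
    and K: "K > 0" and \<kappa>: "\<kappa> > 0"
  shows "\<exists>n0. \<forall>n\<ge>n0. \<forall>T\<in>sets borel. T \<subseteq> S \<longrightarrow>
    (\<forall>x\<in>T. measure \<rho> (ball x (1 / real (Suc n))) \<le> K / real (Suc n)) \<longrightarrow> measure \<rho> T \<le> \<kappa>"
proof -
  interpret finite_measure \<rho> by fact
  note [measurable_cong] = \<rho>(1)
  have sp: "space \<rho> = UNIV" using sets_eq_imp_space_eq[OF \<rho>(1)] by simp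
  have "emeasure \<rho> S = (SUP C\<in>{C. C \<subseteq> S \<and> compact C}. emeasure \<rho> C)"
    by (rule inner_regular) (use \<rho> S in \<open>simp_all add: emeasure_eq_measure\<close>)
  note reg = this
  \<comment> \<open>Compactness gives \<open>C\<close> a positive distance from the complement of an
    open neighbourhood, so short cells that meet \<open>C\<close> stay inside it. The remainder of
    \<open>S\<close> uses up half of \<open>\<kappa>\<close>.\<close>
  have "\<exists>C. C \<subseteq> S \<and> compact C \<and> measure \<rho> S \<le> measure \<rho> C + \<kappa> / 2"
  proof (cases "measure \<rho> S \<le> \<kappa> / 2")
    case True
    then show ?thesis by (intro exI[of _ "{}"]) simp
  next
    case False
    then have "ennreal (measure \<rho> S - \<kappa> / 2) < emeasure \<rho> S"
      using \<kappa> by (simp add: emeasure_eq_measure ennreal_less_iff)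
    then obtain C where C: "C \<subseteq> S" "compact C" "ennreal (measure \<rho> S - \<kappa> / 2) < emeasure \<rho> C"
      unfolding reg less_SUP_iff by auto
    then have "measure \<rho> S - \<kappa> / 2 < measure \<rho> C"
      using False by (simp add: emeasure_eq_measure ennreal_less_iff)
    then show ?thesis using C(1,2) by (intro exI[of _ C]) simp
  qed
  then obtain C where C: "C \<subseteq> S" "compact C" "measure \<rho> S \<le> measure \<rho> C + \<kappa> / 2" by blast
  \<comment> \<open>Multiplied by the density bound \<open>K\<close>, this tolerance yields the
    other half of \<open>\<kappa>\<close>.\<close>
  obtain U where U: "open U" "S \<subseteq> U" "emeasure lborel (U - S) < ennreal (\<kappa> / (2 * K))"
    using outer_regular_lborel[OF S(1), of "\<kappa> / (2 * K)"] K \<kappa> by auto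
  have "emeasure lborel U \<le> emeasure lborel (U - S) + emeasure lborel S"
    using emeasure_subadditive[of "U - S" lborel S] S U(1) Un_absorb2[OF U(2)] by (simp add: Un_Diff_cancel2 borel_open)
  then have U': "emeasure lborel U \<le> ennreal (\<kappa> / (2 * K))" using U(3) S(2) by simp
  obtain d where d: "d > 0" "(\<Union>x\<in>C. ball x d) \<subseteq> U"
    using compact_subset_open_imp_ball_epsilon_subset[OF C(2) U(1)] C(1) U(2) by blast
  obtain n0 where n0: "1 / real (Suc n0) < d" using d(1) nat_approx_posE by blast
  show ?thesis
  proof (intro exI[of _ n0] allI impI ballI)
    fix n T assume n: "n \<ge> n0" and T: "T \<in> sets borel" "T \<subseteq> S"
      and low: "\<forall>x\<in>T. measure \<rho> (ball x (1 / real (Suc n))) \<le> K / real (Suc n)"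
    define e where "e = 1 / real (Suc n)"
    have e: "e > 0" by (simp add: e_def)
    have ed: "e < d"
    proof -
      have "e \<le> 1 / real (Suc n0)" unfolding e_def using n by (intro divide_left_mono) auto
      then show ?thesis using n0 by linarith
    qed
    define I where "I k = {of_int k * e ..< (of_int k + 1) * e}" for k :: int
    have mem_I: "x \<in> I \<lfloor>x / e\<rfloor>" for x
    proof -
      have "of_int \<lfloor>x / e\<rfloor> * e \<le> x / e * e" "x / e * e < (of_int \<lfloor>x / e\<rfloor> + 1) * e"
        using e floor_correct[of "x / e"] by (intro mult_right_mono mult_strict_right_mono; simp)+
      then show ?thesis using e by (simp add: I_def)
    qed
    have disj: "disjoint_family I"
      unfolding disjoint_family_on_def
    proof (intro ballI impI)
      fix k l :: int assume "k \<noteq> l"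
      have "k = \<lfloor>x / e\<rfloor>" if "x \<in> I k" for x k
        using that e by (intro floor_unique[symmetric]) (auto simp: I_def pos_le_divide_eq pos_divide_less_eq)
      then show "I k \<inter> I l = {}" using \<open>k \<noteq> l\<close> by blast
    qed
    have Ie: "emeasure lborel (I k) = ennreal e" for k
      using e by (simp add: I_def algebra_simps)
    let ?T = "T \<inter> C"
    have Cb: "C \<in> sets borel" using C(2) by (simp add: borel_compact)
    have cell: "emeasure \<rho> (?T \<inter> I k) \<le> ennreal K * emeasure lborel (U \<inter> I k)" for k
    proof (cases "?T \<inter> I k = {}")
      case False
      then obtain x where x: "x \<in> T" "x \<in> C" "x \<in> I k" by blast
      \<comment> \<open>A half-open cell of length \<open>e\<close> lies in the open ball of radius
        \<open>e\<close> about any of its points.\<close>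
      have sub: "I k \<subseteq> ball x e"
        using x(3) by (auto simp: I_def dist_real_def algebra_simps abs_less_iff)
      have "ball x e \<subseteq> U" using d(2) x(2) ed by fastforce
      then have UI: "U \<inter> I k = I k" using sub by blast
      have "emeasure \<rho> (?T \<inter> I k) \<le> emeasure \<rho> (ball x e)"
        using sub \<rho>(1) by (intro emeasure_mono) auto
      also have "\<dots> \<le> ennreal (K * e)"
        using low x(1) by (simp add: emeasure_eq_measure e_def ennreal_leI)
      also have "\<dots> = ennreal K * emeasure lborel (U \<inter> I k)"
        unfolding UI Ie using K e by (intro ennreal_mult) auto
      finally show ?thesis .
    qed simp
    have Imeas: "I k \<in> sets borel" for k by (simp add: I_def)
    have UNI: "(\<Union>k. A \<inter> I k) = A" for A using mem_I by blast
    have dA: "disjoint_family (\<lambda>k. A \<inter> I k)" for A using disj by (auto simp: disjoint_family_on_def)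
    have "emeasure \<rho> ?T = (\<integral>\<^sup>+k. emeasure \<rho> (?T \<inter> I k) \<partial>count_space UNIV)"
      using emeasure_UN_countable[of UNIV "\<lambda>k. ?T \<inter> I k" \<rho>] dA[of ?T] T(1) Cb Imeas \<rho>(1) unfolding UNI by simp
    also have "\<dots> \<le> (\<integral>\<^sup>+k. ennreal K * emeasure lborel (U \<inter> I k) \<partial>count_space UNIV)"
      by (intro nn_integral_mono cell)
    also have "\<dots> = ennreal K * (\<integral>\<^sup>+k. emeasure lborel (U \<inter> I k) \<partial>count_space UNIV)"
      by (rule nn_integral_cmult) simp
    also have "(\<integral>\<^sup>+k. emeasure lborel (U \<inter> I k) \<partial>count_space UNIV) = emeasure lborel U"
      using emeasure_UN_countable[of UNIV "\<lambda>k. U \<inter> I k" lborel] dA[of U] U(1) Imeas unfolding UNI by (simp add: borel_open)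
    also have "ennreal K * emeasure lborel U \<le> ennreal K * ennreal (\<kappa> / (2 * K))"
      by (intro mult_left_mono U') simp
    also have "\<dots> = ennreal (\<kappa> / 2)" using K \<kappa> by (simp add: ennreal_mult'[symmetric])
    finally have 1: "measure \<rho> ?T \<le> \<kappa> / 2" using \<kappa> by (simp add: emeasure_eq_measure)
    have "measure \<rho> T \<le> measure \<rho> (?T \<union> (S - C))"
      using T Cb S \<rho>(1) by (intro finite_measure_mono) auto
    also have "\<dots> \<le> measure \<rho> ?T + measure \<rho> (S - C)"
      using T Cb S \<rho>(1) by (intro measure_Un_le) auto
    also have "measure \<rho> (S - C) = measure \<rho> S - measure \<rho> C"
      using C(1) Cb S \<rho>(1) by (intro finite_measure_Diff) auto
    finally show "measure \<rho> T \<le> \<kappa>" using 1 C(3) by linarith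
  qed
qed

text \<open>For each \<open>k\<close> a late scale is chosen at which \<open>h n\<close> is small
  outside a set of small \<open>\<nu>\<close>-measure; the part of \<open>S\<close> where it is
  small has small \<open>\<rho>\<close>-measure by the low-density estimate. With errors
  \<open>(1/2) ^ k\<close>, Borel-Cantelli for both measures makes the limit superior of these parts
  the separating set.\<close>

lemma mutually_singular_if_small_intervals:
  fixes \<rho> \<nu> :: "real measure" and h :: "nat \<Rightarrow> real \<Rightarrow> real"
  assumes \<rho>: "sets \<rho> = sets borel" "finite_measure \<rho>" and \<nu>: "sets \<nu> = sets borel" "finite_measure \<nu>"
    and S: "S \<in> sets borel" "emeasure lborel S = 0" "measure \<nu> (- S) = 0"
    and h: "\<And>n. h n \<in> borel_measurable borel"
    and int: "\<And>n x. measure \<rho> (ball x (1 / real (Suc n))) \<le> 4 * h n x / real (Suc n)"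
    and small: "\<And>\<delta>. \<delta> > 0 \<Longrightarrow> \<exists>K>0. \<forall>n0. \<exists>n\<ge>n0. measure \<nu> {x. h n x > K} < \<delta>"
  shows "\<exists>N\<in>sets borel. measure \<rho> N = 0 \<and> measure \<nu> (- N) = 0"
proof -
  interpret r: finite_measure \<rho> by fact
  interpret n: finite_measure \<nu> by fact
  have sp: "space \<rho> = UNIV" "space \<nu> = UNIV"
    using sets_eq_imp_space_eq[OF \<rho>(1)] sets_eq_imp_space_eq[OF \<nu>(1)] by simp_all
  have hm: "{x. h n x > K} \<in> sets borel" "{x. h n x \<le> K} \<in> sets borel" for n K
    using h[of n] by measurable
  have "\<exists>T\<in>sets borel. measure \<rho> T \<le> (1/2) ^ k \<and> measure \<nu> (- T) \<le> (1/2) ^ k" for k :: nat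
  proof -
    have k: "(1/2::real) ^ k > 0" by simp
    obtain K where K: "K > 0" "\<And>n0. \<exists>n\<ge>n0. measure \<nu> {x. h n x > K} < (1/2) ^ k" using small[OF k] by blast
    have K4: "4 * K > 0" using K by simp
    obtain n0 where n0: "\<And>n T. n \<ge> n0 \<Longrightarrow> T \<in> sets borel \<Longrightarrow> T \<subseteq> S \<Longrightarrow>
      (\<forall>x\<in>T. measure \<rho> (ball x (1 / real (Suc n))) \<le> 4 * K / real (Suc n)) \<Longrightarrow> measure \<rho> T \<le> (1/2) ^ k"
      using low_density_small[OF \<rho> S(1,2) K4 k] by blast
    obtain n where n: "n \<ge> n0" "measure \<nu> {x. h n x > K} < (1/2) ^ k" using K(2) by blast
    let ?T = "S \<inter> {x. h n x \<le> K}"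
    have T: "?T \<in> sets borel" using S(1) hm by auto
    have "measure \<rho> ?T \<le> (1/2) ^ k"
    proof (rule n0[OF n(1) T])
      show "\<forall>x\<in>?T. measure \<rho> (ball x (1 / real (Suc n))) \<le> 4 * K / real (Suc n)"
      proof
        fix x assume "x \<in> ?T"
        then have "4 * h n x / real (Suc n) \<le> 4 * K / real (Suc n)" by (intro divide_right_mono) auto
        with int[of x n] show "measure \<rho> (ball x (1 / real (Suc n))) \<le> 4 * K / real (Suc n)" by linarith
      qed
    qed auto
    moreover have "measure \<nu> (- ?T) \<le> (1/2) ^ k"
    proof -
      have "measure \<nu> (- ?T) \<le> measure \<nu> (- S \<union> {x. h n x > K})"
        using S(1) hm \<nu>(1) by (intro n.finite_measure_mono) auto
      also have "\<dots> \<le> measure \<nu> (- S) + measure \<nu> {x. h n x > K}"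
        using S(1) hm \<nu>(1) by (intro measure_Un_le) auto
      finally show ?thesis using n(2) S(3) by simp
    qed
    ultimately show ?thesis using T by blast
  qed
  then obtain T where T: "\<And>k::nat. T k \<in> sets borel" "\<And>k. measure \<rho> (T k) \<le> (1/2) ^ k" "\<And>k. measure \<nu> (- T k) \<le> (1/2) ^ k"
    by metis
  have geo: "summable (\<lambda>k. (1/2::real) ^ k)" by (simp add: summable_geometric)
  have "summable (\<lambda>k. measure \<rho> (T k))" by (rule summable_comparison_test'[OF geo]) (use T(2) in simp)
  then have 1: "limsup T \<in> null_sets \<rho>"
    using T(1) \<rho>(1) by (intro borel_cantelli_limsup1) (auto simp: r.emeasure_eq_measure)
  have "summable (\<lambda>k. measure \<nu> (- T k))" by (rule summable_comparison_test'[OF geo]) (use T(3) in simp)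
  then have 2: "limsup (\<lambda>k. - T k) \<in> null_sets \<nu>"
    using T(1) \<nu>(1) by (intro borel_cantelli_limsup1) (auto simp: n.emeasure_eq_measure)
  \<comment> \<open>A point in only finitely many \<open>T k\<close> lies in all late
    complements.\<close>
  have sub: "- limsup T \<subseteq> limsup (\<lambda>k. - T k)"
  proof
    fix x assume "x \<in> - limsup T"
    then obtain m where m: "\<And>k. k \<ge> m \<Longrightarrow> x \<notin> T k" by (auto simp: limsup_INF_SUP)
    show "x \<in> limsup (\<lambda>k. - T k)"
      unfolding limsup_INF_SUP
    proof (intro INT_I)
      fix n
      have "x \<in> - T (max m n)" using m by simp
      then show "x \<in> (\<Union>k\<in>{n..}. - T k)" by (intro UN_I[of "max m n"]) auto
    qed
  qed
  have N: "limsup T \<in> sets borel" using 1 \<rho>(1) by (auto simp: null_sets_def)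
  then have "- limsup T \<in> null_sets \<nu>"
    using \<nu>(1) by (intro null_sets_subset[OF 2 _ sub]) auto
  then have "measure \<nu> (- limsup T) = 0" by (simp add: null_sets_def measure_def)
  moreover have "measure \<rho> (limsup T) = 0" using 1 by (simp add: null_sets_def measure_def)
  ultimately show ?thesis using N by blast
qed

section \<open>Boundary behaviour and spectral measures\<close>

context krein_perturbation
begin

lemma G\<alpha>_eq_sum: "G\<alpha> z e = (\<Sum>j\<in>UNIV. (e $ j) *\<^sub>C G\<alpha> z (axis j 1))"
proof -
  have sum: "G\<alpha> z (\<Sum>j\<in>I. f j) = (\<Sum>j\<in>I. G\<alpha> z (f j))" for f :: "'d \<Rightarrow> complex^'d" and I
    by (induction I rule: infinite_finite_induct)
       (auto simp: G\<alpha>_def matrix_vector_right_distrib G_add matrix_vector_mult_0_right)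
  have scale: "G\<alpha> z (c *s e) = c *\<^sub>C G\<alpha> z e" for c e
    by (simp only: G\<alpha>_def vector_scalar_commute G_scale)
  have "e = (\<Sum>j\<in>UNIV. (e $ j) *s axis j 1)" by (simp add: basis_expansion)
  then have "G\<alpha> z e = G\<alpha> z (\<Sum>j\<in>UNIV. (e $ j) *s axis j 1)" by (rule arg_cong)
  then show ?thesis by (simp only: sum scale)
qed

lemma G_eq_G\<alpha>:
  assumes z: "Im z \<noteq> 0"
  shows "G z e = G\<alpha> z (e + \<alpha> *v (F z *v e))"
  using N_eqI[OF z refl, of e] by (simp add: G\<alpha>_def)

text \<open>With \<open>z = Complex x \<epsilon>\<close>, the vector at \<open>\<i>\<close> is
  \<open>g\<close> of the perturbed operator applied to the vector at \<open>z\<close>, for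
  \<open>g t = (t - z) / (t - \<i>)\<close>. On the ball
  \<open>cmod (g t) \<le> 2 * \<epsilon>\<close>, as the denominator is at least 1 in modulus. Of
  the squared factor \<open>4 * \<epsilon>\<^sup>2\<close> one \<open>\<epsilon> = Im z\<close> goes
  into \<open>norm_G\<alpha>_le\<close>.\<close>

lemma window_measure_le:
  assumes Q: "is_spectral_pvm T\<alpha> Q" and \<epsilon>: "\<epsilon> > 0"
  shows "measure (pvm_vector_measure Q (G\<alpha> \<i> (axis j 1))) (ball x \<epsilon>) \<le> 4 * \<epsilon> * norm (F (Complex x \<epsilon>) ** N (Complex x \<epsilon>))"
proof -
  interpret Q: spectral_pvm Q T\<alpha>
    using Q self_adjoint_T\<alpha> by unfold_locales (auto simp: is_spectral_pvm_def)
  define z where "z = Complex x \<epsilon>"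
  have z: "Im z > 0" "Im z \<noteq> 0" "Im z = \<epsilon>" "Re z = x" using \<epsilon> by (simp_all add: z_def)
  have i: "Im \<i> \<noteq> 0" by simp
  define w where "w = G\<alpha> z (axis j 1)"
  define g where "g t = 1 - (z - \<i>) * rfun \<i> t" for t
  have g: "bounded_borel g" unfolding g_def
    by (intro bounded_borel_diff bounded_borel_mult bounded_borel_const bounded_borel_rfun i)
  have S: "ball x \<epsilon> \<in> sets borel" by simp
  have ind: "bounded_borel (indicator (ball x \<epsilon>))" by (rule bounded_borel_indicator[OF S])
  have R\<alpha>: "R\<alpha> \<i> w = Q.Phi (rfun \<i>) w"
    using resolvent_T\<alpha>[OF i] Q.resolvent_eq_Phi[OF i] by metis
  have "G\<alpha> \<i> (axis j 1) = w - (z - \<i>) *\<^sub>C R\<alpha> \<i> w"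
    using G\<alpha>_ident[OF z(2) i, of "axis j 1"] by (simp add: w_def algebra_simps)
  also have "\<dots> = Q.Phi g w"
    unfolding g_def R\<alpha> Q.Phi_diff[OF bounded_borel_const bounded_borel_mult[OF bounded_borel_const bounded_borel_rfun[OF i]]]
      Q.Phi_scale[OF bounded_borel_rfun[OF i]] Q.Phi_one ..
  finally have u: "G\<alpha> \<i> (axis j 1) = Q.Phi g w" .
  have "norm (Q (ball x \<epsilon>) (G\<alpha> \<i> (axis j 1))) = norm (Q.Phi (\<lambda>t. indicator (ball x \<epsilon>) t * g t) w)"
    unfolding u Q.Phi_mult[OF ind g] Q.Phi_indicator[OF S] ..
  also have "\<dots> \<le> 2 * \<epsilon> * norm w"
  proof (rule Q.Phi_bound[OF bounded_borel_mult[OF ind g]])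
    fix t
    show "cmod (indicator (ball x \<epsilon>) t * g t) \<le> 2 * \<epsilon>"
    proof (cases "t \<in> ball x \<epsilon>")
      case True
      have ne: "complex_of_real t - \<i> \<noteq> 0" by (rule of_real_diff_neq_0[OF i])
      then have gt: "g t = (complex_of_real t - z) / (complex_of_real t - \<i>)"
        by (simp add: g_def field_simps)
      have "cmod (complex_of_real t - z) \<le> \<bar>t - x\<bar> + \<epsilon>"
        using cmod_le[of "complex_of_real t - z"] z(3,4) \<epsilon> by simp
      moreover have "\<bar>t - x\<bar> < \<epsilon>" using True by (simp add: dist_real_def abs_minus_commute)
      moreover have "cmod (complex_of_real t - \<i>) \<ge> 1" using cmod_of_real_diff[of \<i> t] by simp
      ultimately have "cmod (g t) \<le> 2 * \<epsilon> / 1"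
        unfolding gt norm_divide using \<epsilon> by (intro frac_le) auto
      then show ?thesis using True by simp
    qed (use \<epsilon> in simp)
  qed
  finally have "(norm (Q (ball x \<epsilon>) (G\<alpha> \<i> (axis j 1))))\<^sup>2 \<le> (2 * \<epsilon> * norm w)\<^sup>2"
    by (intro power_mono) auto
  also have "\<dots> = 4 * \<epsilon> * (Im z * (norm w)\<^sup>2)" unfolding z(3) by (simp add: power2_eq_square)
  also have "\<dots> \<le> 4 * \<epsilon> * norm (F z ** N z)"
    unfolding w_def using \<epsilon> by (intro mult_left_mono norm_G\<alpha>_le z) auto
  finally show ?thesis using Q.measure_M[OF S] by (simp add: z_def)
qed

text \<open>\<open>G z e\<close> equals \<open>G\<alpha> z f\<close> for a suitable
  \<open>f\<close>, and \<open>G\<alpha> z f\<close> arises from \<open>G\<alpha> \<i> f\<close> by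
  a resolvent of \<open>T\<alpha>\<close>, which commutes with the spectral projections. So
  \<open>d\<close> vectors control all generators of the cyclic subspace.\<close>

lemma proj_G_eq_0:
  assumes Q: "is_spectral_pvm T\<alpha> Q" and S: "S \<in> sets borel"
    and 0: "\<And>j. Q S (G\<alpha> \<i> (axis j 1)) = 0" and z: "Im z \<noteq> 0"
  shows "Q S (G z e) = 0"
proof -
  interpret Q: spectral_pvm Q T\<alpha>
    using Q self_adjoint_T\<alpha> by unfold_locales (auto simp: is_spectral_pvm_def)
  have ind: "bounded_borel (indicator S)" by (rule bounded_borel_indicator[OF S])
  have r: "bounded_borel (rfun z)" by (rule bounded_borel_rfun[OF z])
  note lin = Q.proj_linear[OF S]
  define f where "f = e + \<alpha> *v (F z *v e)"
  have "Q S (G\<alpha> \<i> f) = (\<Sum>j\<in>UNIV. (f $ j) *\<^sub>C Q S (G\<alpha> \<i> (axis j 1)))"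
    by (subst G\<alpha>_eq_sum) (simp only: clinear_sum[OF lin] clinear_scale[OF lin])
  then have i0: "Q S (G\<alpha> \<i> f) = 0" by (simp add: 0)
  have i: "Im \<i> \<noteq> 0" by simp
  have "Q S (R\<alpha> z (G\<alpha> \<i> f)) = Q.Phi (indicator S) (Q.Phi (rfun z) (G\<alpha> \<i> f))"
    using resolvent_T\<alpha>[OF z] Q.resolvent_eq_Phi[OF z] Q.Phi_indicator[OF S] by metis
  also have "\<dots> = Q.Phi (\<lambda>t. indicator S t * rfun z t) (G\<alpha> \<i> f)" by (rule Q.Phi_mult[OF ind r, symmetric])
  also have "\<dots> = Q.Phi (\<lambda>t. rfun z t * indicator S t) (G\<alpha> \<i> f)" by (simp only: mult.commute)
  also have "\<dots> = Q.Phi (rfun z) (Q S (G\<alpha> \<i> f))" by (simp only: Q.Phi_mult[OF r ind] Q.Phi_indicator[OF S])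
  also have "\<dots> = 0" unfolding i0 by (rule clinear_zero[OF Q.clinear_Phi[OF r]])
  finally have R0: "Q S (R\<alpha> z (G\<alpha> \<i> f)) = 0" .
  have "G\<alpha> z f = G\<alpha> \<i> f - (\<i> - z) *\<^sub>C R\<alpha> z (G\<alpha> \<i> f)"
    using G\<alpha>_ident[OF i z, of f] by (simp add: algebra_simps)
  then have "Q S (G\<alpha> z f) = Q S (G\<alpha> \<i> f) - (\<i> - z) *\<^sub>C Q S (R\<alpha> z (G\<alpha> \<i> f))"
    by (simp only: clinear_diff[OF lin] clinear_scale[OF lin])
  then show ?thesis unfolding i0 R0 G_eq_G\<alpha>[OF z] f_def[symmetric] by simp
qed

end

text \<open>Each coordinate vector yields its own separating set. On their intersection the spectral
  projection kills the generators and, by cyclicity, the whole space; the complement is a finite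
  union of \<open>\<nu>\<close>-null sets.\<close>

lemma (in form_perturbation) mutually_singular_perturbed:
  assumes \<alpha>: "\<alpha> \<in> hermitian_matrices" and cyc: "cyclic_range A \<iota> B"
    and \<mu>: "scalar_spectral_measure (perturbed_operator A \<iota> B \<alpha>) \<mu>"
    and \<nu>: "sets \<nu> = sets borel" "finite_measure \<nu>" "mutually_singular \<nu> lborel"
    and small: "\<And>\<delta>. \<delta> > 0 \<Longrightarrow> \<exists>K>0. \<forall>n0. \<exists>n\<ge>n0.
      measure \<nu> {x. norm (kres (F (Complex x (1 / real (Suc n)))) \<alpha>) > K} < \<delta>"
  shows "mutually_singular \<mu> \<nu>"
proof -
  interpret kp: krein_perturbation "resolvent A" G Gs F \<alpha> by unfold_locales (rule \<alpha>)
  interpret n: finite_measure \<nu> by fact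
  have sp: "space \<nu> = UNIV" using sets_eq_imp_space_eq[OF \<nu>(1)] by simp
  obtain Q where Q: "is_spectral_pvm kp.T\<alpha> Q"
    and \<mu>Q: "\<And>S. S \<in> sets borel \<Longrightarrow> emeasure \<mu> S = 0 \<longleftrightarrow> (\<forall>x. Q S x = 0)"
    using \<mu> unfolding scalar_spectral_measure_def perturbed_operator_eq[OF \<alpha>] by blast
  interpret Q: spectral_pvm Q kp.T\<alpha>
    using Q kp.self_adjoint_T\<alpha> by unfold_locales (auto simp: is_spectral_pvm_def)
  obtain S0 where S0: "S0 \<in> sets borel" "emeasure \<nu> S0 = 0" "emeasure lborel (- S0) = 0"
    using \<nu>(1,3) unfolding mutually_singular_def by (auto simp: Compl_eq_Diff_UNIV)
  let ?h = "\<lambda>n x. norm (kres (F (Complex x (1 / real (Suc n)))) \<alpha>)"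
  have h: "?h n \<in> borel_measurable borel" for n
  proof (rule borel_measurable_continuous_onI)
    have "continuous_on UNIV (\<lambda>x. kres (F (Complex x (1 / real (Suc n)))) \<alpha> $ i $ j)" for i j
    proof (rule continuous_on_kres)
      show "continuous_on UNIV (\<lambda>x. F (Complex x (1 / real (Suc n))) $ i $ j)" for i j
        by (rule continuous_F) simp
      show "v = 0" if "(mat 1 + \<alpha> ** F (Complex p (1 / real (Suc n)))) *v v = 0" for p v
        using that by (intro kp.kernel_trivial[of "Complex p (1 / real (Suc n))" v]) auto
    qed (rule continuous_on_const)
    then have "continuous_on UNIV (\<lambda>x. \<chi> i j. kres (F (Complex x (1 / real (Suc n)))) \<alpha> $ i $ j)"
      by (intro continuous_on_vec_lambda)
    then show "continuous_on UNIV (?h n)" by (intro continuous_on_norm) simp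
  qed
  have "\<exists>N\<in>sets borel. measure (Q.M (kp.G\<alpha> \<i> (axis j 1))) N = 0 \<and> measure \<nu> (- N) = 0" for j
  proof (rule mutually_singular_if_small_intervals[of _ _ "- S0" ?h])
    show "sets (Q.M (kp.G\<alpha> \<i> (axis j 1))) = sets borel" by (rule Q.sets_pvm_vector_measure)
    show "finite_measure (Q.M (kp.G\<alpha> \<i> (axis j 1)))" by (rule Q.finite_M)
    show "measure (Q.M (kp.G\<alpha> \<i> (axis j 1))) (ball x (1 / real (Suc n))) \<le> 4 * ?h n x / real (Suc n)" for n x
      using kp.window_measure_le[OF Q, of "1 / real (Suc n)" j x] by (simp add: kres_def kp.N_def)
  qed (use \<nu>(1,2) S0 h small in \<open>auto simp: measure_def\<close>)
  then have "\<forall>j. \<exists>N. N \<in> sets borel \<and> measure (Q.M (kp.G\<alpha> \<i> (axis j 1))) N = 0 \<and> measure \<nu> (- N) = 0"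
    by (simp only: Bex_def) simp
  from choice[OF this] obtain N where N': "\<forall>j. N j \<in> sets borel \<and>
    measure (Q.M (kp.G\<alpha> \<i> (axis j 1))) (N j) = 0 \<and> measure \<nu> (- N j) = 0" ..
  have N: "N j \<in> sets borel" "measure (Q.M (kp.G\<alpha> \<i> (axis j 1))) (N j) = 0" "measure \<nu> (- N j) = 0" for j
    using N'[THEN spec, of j] by simp_all
  define S where "S = (\<Inter>j. N j)"
  have S: "S \<in> sets borel" unfolding S_def using N(1) by (intro sets.finite_INT) auto
  have j0: "Q S (kp.G\<alpha> \<i> (axis j 1)) = 0" for j
  proof -
    have "measure (Q.M (kp.G\<alpha> \<i> (axis j 1))) S \<le> measure (Q.M (kp.G\<alpha> \<i> (axis j 1))) (N j)"
      unfolding S_def using N(1)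
      by (intro finite_measure.finite_measure_mono) (auto simp: Q.sets_pvm_vector_measure intro: Q.finite_M)
    then show ?thesis using Q.measure_M[OF S, of "kp.G\<alpha> \<i> (axis j 1)"] N(2) by simp
  qed
  note lin = Q.proj_linear[OF S]
  let ?X = "{resolvent_B A \<iota> B z e | z e. z \<notin> \<real>}"
  have "Q S x = 0" for x
  proof (rule clinear_eq_on_dense[OF lin])
    show "norm (Q S y) \<le> 1 * norm y" for y using Q.norm_proj_le[OF S, of y] by simp
    show "closure (scaleC.span ?X) = UNIV" using cyc unfolding cyclic_range_def .
    have "scaleC.subspace {y. Q S y = 0}"
      by (simp add: scaleC.subspace_def clinear_zero[OF lin] clinear_add[OF lin] clinear_scale[OF lin])
    moreover have "?X \<subseteq> {y. Q S y = 0}"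
    proof
      fix y assume "y \<in> ?X"
      then obtain z e where z: "y = resolvent_B A \<iota> B z e" "Im z \<noteq> 0" by (auto simp: complex_is_Real_iff)
      then have "y = G z e" by (simp add: resolvent_B_eq G_eq)
      then show "y \<in> {y. Q S y = 0}" using kp.proj_G_eq_0[OF Q S j0 z(2)] by simp
    qed
    ultimately have "scaleC.span ?X \<subseteq> {y. Q S y = 0}" by (intro scaleC.span_minimal)
    then show "Q S y = 0" if "y \<in> scaleC.span ?X" for y using that by blast
  qed
  then have "emeasure \<mu> S = 0" using \<mu>Q[OF S] by blast
  moreover have "measure \<nu> (- S) = 0"
  proof -
    have "measure \<nu> (- S) = measure \<nu> (\<Union>j. - N j)" unfolding S_def by (simp add: Compl_INT)
    also have "\<dots> \<le> (\<Sum>j\<in>UNIV. measure \<nu> (- N j))"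
      using N(1) \<nu>(1) by (intro measure_UNION_le) auto
    finally show ?thesis using N(3) by (simp add: measure_le_0_iff)
  qed
  ultimately show ?thesis
    unfolding mutually_singular_def using S \<mu> \<nu>(1)
    by (intro bexI[of _ S]) (auto simp: scalar_spectral_measure_def sp n.emeasure_eq_measure Compl_eq_Diff_UNIV)
qed

section \<open>The exceptional set\<close>

lemma hausdorff_dimension_le:
  assumes d: "d \<ge> 0" and X: "\<And>s. s > d \<Longrightarrow> hausdorff_null s X"
  shows "hausdorff_dimension X \<le> ereal d"
proof (rule ereal_le_epsilon2)
  fix e :: real assume e: "e > 0"
  have "hausdorff_outer_measure (d + e) X = 0"
    using X[of "d + e"] e by (intro hausdorff_outer_measure_eq_0) simp
  then have "hausdorff_dimension X \<le> ereal (d + e)"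
    unfolding hausdorff_dimension_def using d e by (intro INF_lower) simp
  then show "hausdorff_dimension X \<le> ereal d + ereal e" by simp
qed

text \<open>The volume estimate concerns bounded sets of parameters, so the set is exhausted by
  balls of integer radius in real coordinates, and the isometry \<open>herm_of\<close> carries the
  covers to Hermitian matrices.\<close>

lemma (in form_perturbation) exceptional_set:
  assumes \<nu>: "sets \<nu> = sets borel" "finite_measure \<nu>" and \<delta>: "\<delta> > 0" and s: "s > real (CARD('d)\<^sup>2) - 1"
  shows "hausdorff_null s {\<alpha> \<in> hermitian_matrices. \<forall>K>0. \<exists>n0. \<forall>n\<ge>n0.
    \<delta> \<le> measure \<nu> {x. norm (kres (F (Complex x (1 / real (Suc n)))) \<alpha>) > K}}"
    (is "hausdorff_null s {\<alpha> \<in> _. ?bad \<alpha>}")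
proof -
  have s0: "s > 0" "s > real DIM(real^'d^'d) - 1"
  proof -
    show "s > real DIM(real^'d^'d) - 1" using s by (simp add: power2_eq_square)
    have "real (CARD('d)\<^sup>2) \<ge> 1" by (simp add: Suc_le_eq)
    then show "s > 0" using s by linarith
  qed
  define X where "X r = {m \<in> ball 0 (real r). ?bad (herm_of m)}" for r
  have "hausdorff_null s (X r)" for r
  proof -
    have "\<exists>C. \<forall>\<eta>. 0 < \<eta> \<longrightarrow> \<eta> \<le> 1 \<longrightarrow> emeasure lborel (\<Union>m\<in>X r. ball m \<eta>) \<le> ennreal (C * \<eta>)"
      unfolding X_def
      by (rule neighbourhood_measure_le[where F = "\<lambda>n x. F (Complex x (1 / real (Suc n)))"])
         (use \<nu> \<delta> in \<open>auto intro!: dissipative_F continuous_F\<close>)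
    then obtain C where "\<And>\<eta>. 0 < \<eta> \<Longrightarrow> \<eta> \<le> 1 \<Longrightarrow> emeasure lborel (\<Union>m\<in>X r. ball m \<eta>) \<le> ennreal (C * \<eta>)" by blast
    then show ?thesis by (rule hausdorff_null_if_neighbourhood_measure[OF _ s0])
  qed
  then have "hausdorff_null s (herm_of ` X r)" for r
    using s0(1) by (intro hausdorff_null_isometric_image) (auto simp: herm_of_diff[symmetric] norm_herm_of)
  then have "hausdorff_null s (\<Union>r. herm_of ` X r)" by (rule hausdorff_null_UN)
  moreover have "(\<Union>r. herm_of ` X r) = {\<alpha> \<in> hermitian_matrices. ?bad \<alpha>}"
  proof (intro equalityI subsetI)
    fix \<alpha> assume a: "\<alpha> \<in> {\<alpha> \<in> hermitian_matrices. ?bad \<alpha>}"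
    obtain m where m: "herm_of m = \<alpha>" using herm_of_surj a by blast
    obtain r where "norm m < real r" using reals_Archimedean2 by blast
    then have "m \<in> X r" using a unfolding X_def mem_Collect_eq m by simp
    then show "\<alpha> \<in> (\<Union>r. herm_of ` X r)" using m by blast
  qed (auto simp: X_def herm_of_hermitian)
  ultimately show ?thesis by simp
qed

theorem theorem0p1:
  fixes A :: "('h::complex_hilbert \<times> 'h) set"
    and \<iota> :: "'h \<Rightarrow> 'k::complex_banach"
    and B :: "complex^'d \<Rightarrow> 'k"
    and \<mu> :: "complex^'d^'d \<Rightarrow> real measure"
    and \<nu> :: "real measure"
  assumes "self_adjoint A"
    and "form_completion A \<iota>"
    and "Vector_Spaces.linear (*s) scaleC B" and "inj B"
    and "cyclic_range A \<iota> B"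
    and "\<forall>\<alpha>\<in>hermitian_matrices. scalar_spectral_measure (perturbed_operator A \<iota> B \<alpha>) (\<mu> \<alpha>)"
    and "sets \<nu> = sets borel" and "finite_measure \<nu>" and "mutually_singular \<nu> lborel"
  shows "\<exists>E \<subseteq> hermitian_matrices.
           hausdorff_dimension E \<le> ereal (real (CARD('d)\<^sup>2) - 1) \<and>
           (\<forall>\<alpha>\<in>hermitian_matrices - E. mutually_singular (\<mu> \<alpha>) \<nu>)"
proof -
  obtain P where P: "is_spectral_pvm A P" using spectral_theorem[OF assms(1)] by blast
  interpret form_perturbation P A \<iota> B
  proof (rule form_perturbation.intro)
    show "spectral_pvm P A" using P assms(1) by unfold_locales (auto simp: is_spectral_pvm_def)
    show "form_perturbation_axioms A \<iota> B" by (rule form_perturbation_axioms.intro) fact+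
  qed
  let ?m = "\<lambda>K n \<alpha>. measure \<nu> {x. norm (kres (F (Complex x (1 / real (Suc n)))) \<alpha>) > K}"
  \<comment> \<open>Outside \<open>E k\<close> some threshold \<open>K\<close> is exceeded only with
    \<open>\<nu>\<close>-measure below \<open>1 / real (Suc k)\<close> at arbitrarily late scales.
    As \<open>k\<close> varies these levels fall below every \<open>\<delta>\<close>, and a
    countable union keeps the Hausdorff measures zero.\<close>
  define E where "E k = {\<alpha> \<in> hermitian_matrices. \<forall>K>0. \<exists>n0. \<forall>n\<ge>n0. 1 / real (Suc k) \<le> ?m K n \<alpha>}" for k
  show ?thesis
  proof (intro exI[of _ "\<Union>k. E k"] conjI ballI)
    show "(\<Union>k. E k) \<subseteq> hermitian_matrices" by (auto simp: E_def)
    show "hausdorff_dimension (\<Union>k. E k) \<le> ereal (real (CARD('d)\<^sup>2) - 1)"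
    proof (rule hausdorff_dimension_le)
      show "0 \<le> real (CARD('d)\<^sup>2) - 1" by (simp add: Suc_le_eq)
      show "hausdorff_null s (\<Union>k. E k)" if "s > real (CARD('d)\<^sup>2) - 1" for s
        unfolding E_def by (intro hausdorff_null_UN exceptional_set assms that) simp
    qed
    fix \<alpha> assume \<alpha>: "\<alpha> \<in> hermitian_matrices - (\<Union>k. E k)"
    show "mutually_singular (\<mu> \<alpha>) \<nu>"
    proof (rule mutually_singular_perturbed)
      show "\<alpha> \<in> hermitian_matrices" using \<alpha> by blast
      then show "scalar_spectral_measure (perturbed_operator A \<iota> B \<alpha>) (\<mu> \<alpha>)" using assms(6) by blast
      fix \<delta> :: real assume "\<delta> > 0"
      then obtain k where k: "1 / real (Suc k) < \<delta>" using nat_approx_posE by blast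
      have "\<alpha> \<notin> E k" using \<alpha> by blast
      then have "\<not> (\<forall>K>0. \<exists>n0. \<forall>n\<ge>n0. 1 / real (Suc k) \<le> ?m K n \<alpha>)"
        using \<alpha> unfolding E_def by simp
      then obtain K where K: "K > 0" "\<not> (\<exists>n0. \<forall>n\<ge>n0. 1 / real (Suc k) \<le> ?m K n \<alpha>)" by auto
      show "\<exists>K>0. \<forall>n0. \<exists>n\<ge>n0. ?m K n \<alpha> < \<delta>"
      proof (intro exI[of _ K] conjI allI)
        fix n0
        obtain n where "n \<ge> n0" "\<not> 1 / real (Suc k) \<le> ?m K n \<alpha>" using K(2) by auto
        with k show "\<exists>n\<ge>n0. ?m K n \<alpha> < \<delta>" by (intro exI[of _ n] conjI) linarith+
      qed (rule K(1))
    qed (fact assms)+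
  qed
qed

end
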